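(* Let $s:C\times C\to\mathbb{R}$ be a kernel satisfying the Kernel Assumption, and let $[X^{(N)}]_{N=1}^\infty$ be a family of random hermitian matrices satisfying the Model Assumption with respect to $s$ (both assumptions are spelled out in the context). Let $\lambda^{(N)}_1\le\dots\le\lambda^{(N)}_N$ be the eigenvalues of $X^{(N)}/\sqrt N$ and let $L^{(N)}=N^{-1}\sum_{i=1}^N\delta_{\lambda_i^{(N)}}$ be the empirical distribution of eigenvalues. Let $\mu=\mu_s$ be the probability measure on $\mathbb{R}$ associated to $s$ (defined in the context). Then $L^{(N)}$ converges weakly in probability to $\mu$ as $N\to\infty$.
   Context: **Color space.** $\mathbb N$ is the set of positive integers. $C=[0,1]\times S^1$, where $S^1$ is the unit circle in $\mathbb{C}$; $P$ is the product of the uniform probability measures on $[0,1]$ and $S^1$. The spaces $L^p(C)$ and $L^p(C\times C)$ are taken with respect to $P$ and $P\times P$. **Kernel Assumption** on $s:C\times C\to\mathbb R$: (I) $s$ is nonnegative and symmetric: $s(c,c')=s(c',c)\ge 0$. (II) $s$ has a Fourier expansion $s(c,c')=\sum_{i,j\in\mathbb Z}s_{ij}(x,y)\xi^i\eta^j$ for $c=(x,\xi)$, $c'=(y,\eta)$, where all but finitely many of the coefficients $s_{ij}:[0,1]\times[0,1]\to\mathbb C$ vanish identically. (III) There is a finite partition $\mathcal I$ of $[0,1]$ into subintervals of positive length such that every $s_{ij}$ is constant on every set $I\times J$ with $I,J\in\mathcal I$. (IV) $\|s\|_{L^1(C\times C)}>0$. For $N\in\mathbb N$ and $K>0$ put $Q^{(N)}_K=\{i\in\{1,\dots,N\}: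 \min_{x\in\partial\mathcal I}|i-Nx|>K\}$, where $\partial\mathcal I\subset[0,1]$ is the finite set of all endpoints of intervals of $\mathcal I$. **Model Assumption.** For each $N\in\mathbb N$, $X^{(N)}=[X^{(N)}_{ij}]_{i,j=1}^N$ is an $N\times N$ random hermitian matrix such that: (I)(a) $EX^{(N)}_{ij}=0$ for all $N$ and all $i,j\in\{1,\dots,N\}$; (b) for all $k\in\mathbb N$, $\sup_{N}\max_{i,j=1}^N E|X^{(N)}_{ij}|^k<\infty$. (II) There exists $K>0$ such that for all $N\in\mathbb N$: (a) for all $i,j\in\mathbb Z$, if $\max(|i|,|j|)>K$ then $s_{ij}\equiv0$; (b) for all nonempty $A,B\subset\{(i,j)\in\{1,\dots,N\}^2: i\le j\}$ such that $\min_{(i,j)\in A}\min_{(k,\ell)\in B}\max(|i-k|,|j-\ell|)>K$, the $\sigma$-fields $\sigma(\{X^{(N)}_{ij}:(i,j)\in A\})$ and $\sigma(\{X^{(N)}_{k\ell}:(k,\ell)\in B\})$ are independent; (c) for all $i,j,k,\ell\in Q^{(N)}_K$ with $\min(j-i,\ell-k)>K$, $E X^{(N)}_{ij}\overline{X^{(N)}_{k\ell}}=s_{i-k,\ell-j}(i/N,j/N)$. **The measure $\mu_s$.** For each $N\in\mathbb N$ let $C^{(N)}=\{c^{(N)}_1,\dots,c^{(N)}_{N^2}\}\subset C$ be the set of pairs $(x,\xi)$ with $x\in[0,1)\cap\frac1N\mathbb Z$ and $\xi^N=1$, and $C^{(\infty)}=\bigcup_N C^{(N)}$. Let $\{\tilde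 Y_e\}$, indexed by the subsets $e\subset C^{(\infty)}$ with $|e|\in\{1,2\}$, be an i.i.d. family of standard normal random variables. Let $\tilde X^{(N)}$ be the $N^2\times N^2$ real symmetric random matrix with entries $\tilde X^{(N)}_{ij}=2^{\delta_{ij}/2}\sqrt{s(c_i^{(N)},c_j^{(N)})}\,\tilde Y_{\{c_i^{(N)},c_j^{(N)}\}}$, and let $\tilde L^{(N)}$ be the empirical distribution of the eigenvalues of $\tilde X^{(N)}/N$. It is known that $\tilde L^{(N)}$ tends weakly in probability as $N\to\infty$ to a (deterministic) limit with bounded support; this limit is denoted $\mu_s$. *)

theory Defs
  imports "HOL-Probability.Probability" "Jordan_Normal_Form.Char_Poly"
begin

section \<open>Color space and kernels\<close>

type_synonym color = "real \<times> complex"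

definition color_space :: "color set" where
  "color_space = {0..1} \<times> sphere 0 1"

text \<open>The uniform probability measure on the circle is the image of the one on the unit interval.
  The carrier of \<^term>\<open>color_measure\<close> is exactly \<^term>\<open>color_space\<close>, so values
  of a kernel outside \<^term>\<open>color_space \<times> color_space\<close> never matter.\<close>

definition color_measure :: "color measure" where
  "color_measure =
     restrict_space lborel {0..1} \<Otimes>\<^sub>M
     distr (restrict_space lborel {0..1}) (restrict_space borel (sphere 0 1))
       (\<lambda>t. cis (2 * pi * t))"

definition fourier_support :: "(int \<Rightarrow> int \<Rightarrow> real \<Rightarrow> real \<Rightarrow> complex) \<Rightarrow> (int \<times> int) set" where
  "fourier_support sc = {(i, j). \<exists>x\<in>{0..1}. \<exists>y\<in>{0..1}. sc i j x y \<noteq> 0}"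

definition interval_partition :: "real set set \<Rightarrow> bool" where
  "interval_partition \<I> \<longleftrightarrow>
     finite \<I> \<and> partition_on {0..1} \<I> \<and> (\<forall>I\<in>\<I>. is_interval I \<and> Inf I < Sup I)"

definition endpoints :: "real set set \<Rightarrow> real set" where
  "endpoints \<I> = Inf ` \<I> \<union> Sup ` \<I>"

text \<open>The Fourier coefficients \<open>sc i j\<close> are determined on the unit square by \<open>s\<close>; they and
  the partition are carried along because the assumptions on the matrices refer to them.\<close>

definition kernel_assumption ::
  "(color \<Rightarrow> color \<Rightarrow> real) \<Rightarrow> (int \<Rightarrow> int \<Rightarrow> real \<Rightarrow> real \<Rightarrow> complex) \<Rightarrow> real set set \<Rightarrow> bool" where
  "kernel_assumption s sc \<I> \<longleftrightarrow>
     (\<forall>c\<in>color_space. \<forall>c'\<in>color_space. s c c' = s c' c \<and> s c c' \<ge> 0) \<and>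
     finite (fourier_support sc) \<and>
     (\<forall>(x, \<xi>)\<in>color_space. \<forall>(y, \<eta>)\<in>color_space.
        complex_of_real (s (x, \<xi>) (y, \<eta>)) =
          (\<Sum>(i, j)\<in>fourier_support sc. sc i j x y * \<xi> powi i * \<eta> powi j)) \<and>
     interval_partition \<I> \<and>
     (\<forall>i j. \<forall>I\<in>\<I>. \<forall>J\<in>\<I>. (\<lambda>(x, y). sc i j x y) constant_on (I \<times> J)) \<and>
     (LINT (c, c') | (color_measure \<Otimes>\<^sub>M color_measure). \<bar>s c c'\<bar>) > 0"


section \<open>The matrix model\<close>

definition Q_set :: "real set set \<Rightarrow> nat \<Rightarrow> real \<Rightarrow> nat set" where
  "Q_set \<I> N K = {i\<in>{1..N}. Min ((\<lambda>x. \<bar>real i - real N * x\<bar>) ` endpoints \<I>) > K}"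

definition generated_sigma ::
  "'a measure \<Rightarrow> (nat \<Rightarrow> nat \<Rightarrow> 'a \<Rightarrow> complex) \<Rightarrow> (nat \<times> nat) set \<Rightarrow> 'a set set" where
  "generated_sigma M Y A =
     sigma_sets (space M) {Y i j -` S \<inter> space M | i j S. (i, j) \<in> A \<and> S \<in> sets borel}"

text \<open>\<open>X N i j\<close> is the entry in row \<open>i\<close> and column \<open>j\<close> of the \<open>N\<close>-th matrix, with both
  indices running over \<open>{1..N}\<close>. The matrices of different sizes may live on different
  probability spaces \<open>M N\<close>.

  Moments are taken as nonnegative integrals, so that the moment bound includes
  integrability.\<close>

definition model_assumption ::
  "(int \<Rightarrow> int \<Rightarrow> real \<Rightarrow> real \<Rightarrow> complex) \<Rightarrow> real set set \<Rightarrow> (nat \<Rightarrow> 'a measure) \<Rightarrow>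
   (nat \<Rightarrow> nat \<Rightarrow> nat \<Rightarrow> 'a \<Rightarrow> complex) \<Rightarrow> bool" where
  "model_assumption sc \<I> M X \<longleftrightarrow>
     (\<forall>N\<ge>1. prob_space (M N) \<and>
        (\<forall>i\<in>{1..N}. \<forall>j\<in>{1..N}. X N i j \<in> borel_measurable (M N) \<and>
           (\<forall>\<omega>\<in>space (M N). X N j i \<omega> = cnj (X N i j \<omega>)))) \<and>
     (\<forall>N\<ge>1. \<forall>i\<in>{1..N}. \<forall>j\<in>{1..N}. (LINT \<omega>|M N. X N i j \<omega>) = 0) \<and>
     (\<forall>k\<ge>1. (SUP N\<in>{1..}. SUP i\<in>{1..N}. SUP j\<in>{1..N}.
        \<integral>\<^sup>+ \<omega>. ennreal (norm (X N i j \<omega>) ^ k) \<partial>M N) < \<infinity>) \<and>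
     (\<exists>K::real. K > 0 \<and> (\<forall>N\<ge>1.
        (\<forall>i j. real_of_int (max \<bar>i\<bar> \<bar>j\<bar>) > K \<longrightarrow> (\<forall>x\<in>{0..1}. \<forall>y\<in>{0..1}. sc i j x y = 0)) \<and>
        (\<forall>A B. A \<noteq> {} \<and> B \<noteq> {} \<and>
           A \<subseteq> {(i, j). i \<in> {1..N} \<and> j \<in> {1..N} \<and> i \<le> j} \<and>
           B \<subseteq> {(i, j). i \<in> {1..N} \<and> j \<in> {1..N} \<and> i \<le> j} \<and>
           (\<forall>(i, j)\<in>A. \<forall>(k, l)\<in>B. max \<bar>real i - real k\<bar> \<bar>real j - real l\<bar> > K) \<longrightarrow>
           prob_space.indep_set (M N) (generated_sigma (M N) (X N) A)
             (generated_sigma (M N) (X N) B)) \<and>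
        (\<forall>i\<in>Q_set \<I> N K. \<forall>j\<in>Q_set \<I> N K. \<forall>k\<in>Q_set \<I> N K. \<forall>l\<in>Q_set \<I> N K.
           min (real j - real i) (real l - real k) > K \<longrightarrow>
           (LINT \<omega>|M N. X N i j \<omega> * cnj (X N k l \<omega>)) =
             sc (int i - int k) (int l - int j) (real i / real N) (real j / real N))))"

text \<open>Rows and columns of matrices in the library are numbered from \<open>0\<close>.\<close>

definition model_matrix :: "(nat \<Rightarrow> nat \<Rightarrow> nat \<Rightarrow> 'a \<Rightarrow> complex) \<Rightarrow> nat \<Rightarrow> 'a \<Rightarrow> complex mat" where
  "model_matrix X N \<omega> = Matrix.mat N N (\<lambda>(i, j). X N (Suc i) (Suc j) \<omega>)"


section \<open>Empirical distributions of eigenvalues\<close>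

text \<open>Eigenvalues are counted with algebraic multiplicity. This is used for hermitian matrices
  only, whose eigenvalues are real, so that \<^const>\<open>Re\<close> merely changes the type.\<close>

definition empirical_distribution :: "complex mat \<Rightarrow> real measure" where
  "empirical_distribution A =
     distr (measure_pmf (pmf_of_multiset (proots (char_poly A)))) borel Re"

definition weakly_in_probability ::
  "(nat \<Rightarrow> 'a measure) \<Rightarrow> (nat \<Rightarrow> 'a \<Rightarrow> real measure) \<Rightarrow> real measure \<Rightarrow> bool" where
  "weakly_in_probability M L \<mu> \<longleftrightarrow>
     (\<forall>f::real \<Rightarrow> real. continuous_on UNIV f \<and> bounded (range f) \<longrightarrow>
        (\<forall>\<epsilon>>0. (\<lambda>N. measure (M N)
             {\<omega> \<in> space (M N). \<bar>(LINT x|L N \<omega>. f x) - (LINT x|\<mu>. f x)\<bar> > \<epsilon>})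
           \<longlonglongrightarrow> 0))"


section \<open>The limit measure of a kernel\<close>

definition color_points :: "nat \<Rightarrow> color set" where
  "color_points N = {(x, \<xi>). x \<in> {0..<1} \<and> (\<exists>m::int. x = real_of_int m / real N) \<and> \<xi> ^ N = 1}"

definition all_color_points :: "color set" where
  "all_color_points = (\<Union>N\<in>{1..}. color_points N)"

text \<open>A concrete enumeration of \<^term>\<open>color_points N\<close>, with indices in \<open>{..<N\<^sup>2}\<close>. Another
  enumeration conjugates the matrix below by a permutation and leaves its spectrum unchanged.\<close>

definition color_point :: "nat \<Rightarrow> nat \<Rightarrow> color" where
  "color_point N k = (real (k div N) / real N, cis (2 * pi * real (k mod N) / real N))"

lemma bij_betw_color_point:
  assumes "N \<ge> 1"
  shows "bij_betw (color_point N) {..<N\<^sup>2} (color_points N)"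
proof -
  have N: "N > 0" using assms by simp
  have 1: "bij_betw (\<lambda>k. (k div N, k mod N)) {..<N\<^sup>2} ({..<N} \<times> {..<N})"
  proof (rule bij_betwI[where g = "\<lambda>(a, b). a * N + b"])
    show "(\<lambda>k. (k div N, k mod N)) \<in> {..<N\<^sup>2} \<rightarrow> {..<N} \<times> {..<N}"
      using N by (auto simp: power2_eq_square less_mult_imp_div_less)
    show "(\<lambda>(a, b). a * N + b) \<in> {..<N} \<times> {..<N} \<rightarrow> {..<N\<^sup>2}"
    proof clarsimp
      fix a b assume "a < N" "b < N"
      then have "a * N + b < Suc a * N" by simp
      also have "\<dots> \<le> N * N" using \<open>a < N\<close> by (intro mult_le_mono1) simp
      finally show "a * N + b < N\<^sup>2" by (simp add: power2_eq_square)
    qed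
  qed (use N in auto)
  have 2: "bij_betw (\<lambda>a. real a / real N) {..<N}
             {x. x \<in> {0..<1} \<and> (\<exists>m::int. x = real_of_int m / real N)}"
  proof (rule bij_betw_imageI)
    show "inj_on (\<lambda>a. real a / real N) {..<N}"
      using N by (auto simp: inj_on_def)
    show "(\<lambda>a. real a / real N) ` {..<N} =
            {x. x \<in> {0..<1} \<and> (\<exists>m::int. x = real_of_int m / real N)}"
    proof (intro equalityI subsetI)
      fix x assume "x \<in> (\<lambda>a. real a / real N) ` {..<N}"
      then obtain a where "a < N" "x = real a / real N" by auto
      then show "x \<in> {x. x \<in> {0..<1} \<and> (\<exists>m::int. x = real_of_int m / real N)}"
        by (auto intro!: exI[of _ "int a"])
    next
      fix x assume "x \<in> {x. x \<in> {0..<1} \<and> (\<exists>m::int. x = real_of_int m / real N)}"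
      then obtain m :: int where m: "0 \<le> x" "x < 1" "x = real_of_int m / real N" by auto
      then have "0 \<le> m" "m < int N" using N by (auto simp: field_simps)
      with m show "x \<in> (\<lambda>a. real a / real N) ` {..<N}"
        by (intro image_eqI[of _ _ "nat m"]) auto
    qed
  qed
  have 3: "bij_betw (\<lambda>b. cis (2 * pi * real b / real N)) {..<N} {\<xi>. \<xi> ^ N = 1}"
    using Complex.bij_betw_roots_unity[OF N] .
  have "bij_betw (map_prod (\<lambda>a. real a / real N) (\<lambda>b. cis (2 * pi * real b / real N)))
          ({..<N} \<times> {..<N})
          ({x. x \<in> {0..<1} \<and> (\<exists>m::int. x = real_of_int m / real N)} \<times> {\<xi>. \<xi> ^ N = 1})"
    by (rule bij_betw_map_prod[OF 2 3])
  note bij_betw_trans[OF 1 this]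
  moreover have "map_prod (\<lambda>a. real a / real N) (\<lambda>b. cis (2 * pi * real b / real N)) \<circ>
      (\<lambda>k. (k div N, k mod N)) = color_point N"
    by (simp add: fun_eq_iff color_point_def)
  moreover have "{x. x \<in> {0..<1} \<and> (\<exists>m::int. x = real_of_int m / real N)} \<times> {\<xi>. \<xi> ^ N = 1} =
      color_points N"
    by (auto simp: color_points_def)
  ultimately show ?thesis by simp
qed

definition noise_index :: "color set set" where
  "noise_index = {e. e \<subseteq> all_color_points \<and> card e \<in> {1, 2}}"

text \<open>The canonical realization of an i.i.d. family of standard normal variables: under
  \<^term>\<open>noise_measure\<close> the coordinates \<open>Y e\<close> with \<open>e \<in> noise_index\<close> form such a family.\<close>

definition noise_measure :: "(color set \<Rightarrow> real) measure" where
  "noise_measure = (\<Pi>\<^sub>M e\<in>noise_index. density lborel (\<lambda>x. ennreal (std_normal_density x)))"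

definition color_matrix ::
  "(color \<Rightarrow> color \<Rightarrow> real) \<Rightarrow> nat \<Rightarrow> (color set \<Rightarrow> real) \<Rightarrow> real mat" where
  "color_matrix s N Y = Matrix.mat (N\<^sup>2) (N\<^sup>2) (\<lambda>(i, j).
     (if i = j then sqrt 2 else 1) * sqrt (s (color_point N i) (color_point N j)) *
     Y {color_point N i, color_point N j})"

text \<open>Weak limits in probability are unique, so this is the limit of the empirical distributions
  of the eigenvalues of the matrices \<^term>\<open>color_matrix s N\<close>, divided by \<open>N\<close>.\<close>

definition kernel_measure :: "(color \<Rightarrow> color \<Rightarrow> real) \<Rightarrow> real measure" where
  "kernel_measure s = (THE \<mu>. real_distribution \<mu> \<and>
     weakly_in_probability (\<lambda>N. noise_measure)
       (\<lambda>N Y. empirical_distribution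
          (map_mat complex_of_real ((1 / real N) \<cdot>\<^sub>m color_matrix s N Y))) \<mu>)"

end

theory Submission
  imports Defs "Jordan_Normal_Form.Schur_Decomposition"
begin

text \<open>Both families are matrices of size \<open>n\<close>, scaled by \<open>1 / sqrt n\<close>, with centred entries whose
  dependence is confined to pairs of entries with neighbouring (or transposed neighbouring) indices.
  For such a band ensemble the normalized traces of powers concentrate around a sum over noncrossing
  pairings of the edges of a closed walk: every other dependence pattern of the edges costs a factor
  \<open>n\<close> in the number of walks, and so does any dependence between two walks in the variance.
  Cutting a noncrossing pairing at the partner of the first edge turns the sum into a quadratic
  recursion that only involves the covariances.

  For the model the unknowns of this recursion form an approximately Toeplitz matrix near each macroscopic
  position, and its diagonals converge to coefficients \<open>d\<^sub>p(x)\<close>. For the color matrix the covariance is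
  diagonal, so the unknowns are functions on the color points, and they converge to
  \<open>\<Sum>\<^sub>p d\<^sub>p(x) \<xi>\<^sup>p\<close> with the same coefficients: the Fourier expansion of \<open>s\<close> carries one recursion into
  the other. Hence both families have the same limiting moments. These grow at most geometrically, so they determine
  the limit, which is therefore the measure \<open>\<mu>\<^sub>s\<close>.\<close>

section \<open>Counting labelings\<close>

text \<open>The obstacle is that the joint law of neighbouring entries is arbitrary: known are only
  independence of distant entries, uniform moments, and covariances away from the diagonal and from
  the endpoints of \<open>\<I>\<close>. Hence the estimates become counts. A closed walk of
  \<open>m\<close> edges matched in pairs without defect has \<open>1 + m / 2\<close> free vertices,
  which is the scale of the trace. A triple or a defect leaves at most \<open>(m + 1) / 2\<close>,
  so expectations are off by \<open>n ^ (- 1 / 2)\<close>; a linked pair of walks has at most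
  \<open>m + 1\<close> instead of \<open>m + 2\<close>, so variances are \<open>O(1 / n)\<close> and
  Chebyshev's inequality applies. Unknown covariances affect boundedly many terms of each average in
  the recursion. For the color matrix the circle variable runs over roots of unity, where characters
  are exactly orthogonal for large \<open>N\<close>, and only the interval variable leaves a Riemann
  sum. As \<open>kernel_measure\<close> is a definite description, existence and uniqueness of the
  weak limit must be proved for the color matrices too; the candidate comes by tightness from
  sampled spectra.\<close>

definition conn :: "(nat \<times> nat) set \<Rightarrow> (nat \<times> nat) set" where
  "conn H = (H \<union> H\<inverse>)\<^sup>*"

lemma conn_refl [simp]: "(x, x) \<in> conn H"
  by (simp add: conn_def)

lemma conn_trans: "(x, y) \<in> conn H \<Longrightarrow> (y, z) \<in> conn H \<Longrightarrow> (x, z) \<in> conn H"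
  by (simp add: conn_def)

lemma conn_sym: "(x, y) \<in> conn H \<Longrightarrow> (y, x) \<in> conn H"
proof -
  assume "(x, y) \<in> conn H"
  then have "(y, x) \<in> ((H \<union> H\<inverse>)\<inverse>)\<^sup>*"
    unfolding conn_def by (rule rtrancl_converseI)
  moreover have "(H \<union> H\<inverse>)\<inverse> = H \<union> H\<inverse>" by auto
  ultimately show ?thesis by (simp add: conn_def)
qed

lemma conn_base: "(x, y) \<in> H \<Longrightarrow> (x, y) \<in> conn H"
  by (auto simp: conn_def)

text \<open>A chain that uses the new pair several times can be shortened to one that uses it at
  most once, in one of its two directions.\<close>

lemma conn_insertD:
  assumes "(x, y) \<in> conn (insert (u, v) H)"
  shows "(x, y) \<in> conn H \<or> (x, u) \<in> conn H \<and> (v, y) \<in> conn H \<or> (x, v) \<in> conn H \<and> (u, y) \<in> conn H"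
  using assms unfolding conn_def[of "insert (u, v) H"]
proof (induction rule: rtrancl_induct)
  case (step y z)
  then have "(y, z) \<in> H \<union> H\<inverse> \<or> (y = u \<and> z = v) \<or> (y = v \<and> z = u)" by auto
  then show ?case
  proof (elim disjE)
    assume "(y, z) \<in> H \<union> H\<inverse>"
    then have "(y, z) \<in> conn H" by (auto simp: conn_def)
    then show ?thesis using step.IH by (meson conn_trans)
  next
    assume "y = u \<and> z = v"
    then show ?thesis using step.IH by (metis conn_refl conn_trans)
  next
    assume "y = v \<and> z = u"
    then show ?thesis using step.IH by (metis conn_refl conn_trans)
  qed
qed simp

text \<open>Deleting one pair from a relation splits at most one component, so each deleted pair
  costs at most one further representative. The new representatives are ends of deleted pairs, which
  later keeps them inside \<open>P\<close>.\<close>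

lemma exists_small_transversal:
  assumes "finite R" "finite T" "\<forall>p\<in>P. \<exists>t\<in>T. (p, t) \<in> conn (H \<union> R)"
  shows "\<exists>T'. finite T' \<and> T' \<subseteq> T \<union> fst ` R \<union> snd ` R \<and> card T' \<le> card T + card R \<and>
    (\<forall>p\<in>P. \<exists>t\<in>T'. (p, t) \<in> conn H)"
  using assms
proof (induction R arbitrary: T rule: finite_induct)
  case empty
  then show ?case by (intro exI[of _ T]) auto
next
  case (insert e R)
  obtain u v where e: "e = (u, v)" by (cases e)
  let ?H = "H \<union> R"
  \<comment> \<open>If \<open>u\<close> still reaches \<open>T\<close>, only the component of
    \<open>v\<close> can have lost its representative. If not, no chain reached \<open>T\<close> by
    crossing from \<open>v\<close> to \<open>u\<close>, and \<open>u\<close> is the end to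
    add.\<close>
  define w where "w = (if \<exists>t\<in>T. (u, t) \<in> conn ?H then v else u)"
  have "\<forall>p\<in>P. \<exists>t\<in>insert w T. (p, t) \<in> conn ?H"
  proof
    fix p assume "p \<in> P"
    then obtain t where t: "t \<in> T" "(p, t) \<in> conn (insert (u, v) ?H)"
      using insert.prems e by auto
    from conn_insertD[OF t(2)] show "\<exists>t\<in>insert w T. (p, t) \<in> conn ?H"
      using t(1) unfolding w_def by (smt (verit) conn_trans insert_iff)
  qed
  from insert.IH[OF _ this] insert.prems obtain T' where T': "finite T'"
    "T' \<subseteq> insert w T \<union> fst ` R \<union> snd ` R" "card T' \<le> card (insert w T) + card R"
    "\<forall>p\<in>P. \<exists>t\<in>T'. (p, t) \<in> conn H" by auto
  have "card (insert w T) \<le> card T + 1"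
    using insert.prems by (simp add: card_insert_if)
  moreover have "w \<in> {u, v}" by (simp add: w_def)
  ultimately show ?case using T' insert.hyps e
    by (intro exI[of _ T']) auto
qed

section \<open>Labelings with prescribed neighbour relations\<close>

definition band_radius :: "nat \<Rightarrow> nat" where "band_radius p = 2 * p ^ 2"

definition ball_of :: "'v set \<Rightarrow> ('v \<Rightarrow> 'v \<Rightarrow> bool) \<Rightarrow> nat \<Rightarrow> 'v \<Rightarrow> 'v set" where
  "ball_of V nb r v = ((\<lambda>A. \<Union>w\<in>A. {x\<in>V. nb w x}) ^^ r) {v}"

lemma ball_of_Suc: "ball_of V nb (Suc r) v = (\<Union>w\<in>ball_of V nb r v. {x\<in>V. nb w x})"
  by (simp add: ball_of_def)

lemma ball_of_subset: "v \<in> V \<Longrightarrow> ball_of V nb r v \<subseteq> V"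
  by (induction r) (auto simp: ball_of_Suc, simp add: ball_of_def)

lemma ball_of_mono:
  assumes "\<And>v. v \<in> V \<Longrightarrow> nb v v" "v \<in> V" "r \<le> r'"
  shows "ball_of V nb r v \<subseteq> ball_of V nb r' v"
  using assms(3)
proof (induction rule: dec_induct)
  case (step n)
  have "ball_of V nb n v \<subseteq> ball_of V nb (Suc n) v"
    using ball_of_subset[OF assms(2)] assms(1) by (fastforce simp: ball_of_Suc)
  with step show ?case by blast
qed simp

lemma card_ball_of_le:
  assumes "finite V" "v \<in> V" "\<And>v. v \<in> V \<Longrightarrow> card {w\<in>V. nb v w} \<le> D"
  shows "card (ball_of V nb r v) \<le> D ^ r"
proof (induction r)
  case (Suc r)
  have "card (ball_of V nb (Suc r) v) \<le> (\<Sum>w\<in>ball_of V nb r v. card {x\<in>V. nb w x})"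
    unfolding ball_of_Suc
    by (rule card_UN_le) (meson assms ball_of_subset finite_subset)
  also have "\<dots> \<le> (\<Sum>w\<in>ball_of V nb r v. D)"
    using ball_of_subset[OF assms(2)] by (intro sum_mono assms(3)) auto
  also have "\<dots> \<le> D ^ r * D" using Suc by simp
  finally show ?case by (simp add: mult.commute)
qed (simp add: ball_of_def)

definition labelings :: "'v set \<Rightarrow> ('v \<Rightarrow> 'v \<Rightarrow> bool) \<Rightarrow> nat set \<Rightarrow> (nat \<times> nat) set \<Rightarrow> (nat \<Rightarrow> 'v) set" where
  "labelings V nb P H = {\<phi>\<in>PiE P (\<lambda>_. V). \<forall>(p, q)\<in>H. nb (\<phi> p) (\<phi> q)}"

text \<open>Each link of a chain moves the label by one neighbour step, and a chain needs at most as
  many links as there are ordered pairs of positions; \<open>band_radius\<close> leaves room for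
  twice that. What matters is that the radius does not depend on \<open>V\<close>.\<close>

lemma conn_ball_of:
  assumes refl: "\<And>v. v \<in> V \<Longrightarrow> nb v v" and sym: "\<And>v w. v \<in> V \<Longrightarrow> w \<in> V \<Longrightarrow> nb v w \<Longrightarrow> nb w v"
    and "finite P" "H \<subseteq> P \<times> P" "\<phi> \<in> labelings V nb P H" "t \<in> P" "(t, p) \<in> conn H"
  shows "\<phi> p \<in> ball_of V nb (band_radius (card P)) (\<phi> t)"
proof -
  have V: "\<phi> p \<in> V" if "p \<in> P" for p
    using assms(5) that by (auto simp: labelings_def)
  have fin: "finite H" using assms(3,4) by (meson finite_SigmaI finite_subset)
  have "(t, p) \<in> (\<Union>n\<in>{n. n \<le> card (H \<union> H\<inverse>)}. (H \<union> H\<inverse>) ^^ n)"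
    using assms(7) rtrancl_finite_eq_relpow[of "H \<union> H\<inverse>"] fin by (simp add: conn_def)
  then obtain k where k: "k \<le> card (H \<union> H\<inverse>)" "(t, p) \<in> (H \<union> H\<inverse>) ^^ k" by auto
  have "card (H \<union> H\<inverse>) \<le> card (P \<times> P)"
    using assms(3,4) by (intro card_mono) auto
  then have kr: "k \<le> band_radius (card P)"
    using k(1) by (simp add: card_cartesian_product band_radius_def power2_eq_square)
  have "\<phi> p \<in> ball_of V nb k (\<phi> t)"
    using k(2)
  proof (induction k arbitrary: p)
    case 0
    then show ?case by (simp add: ball_of_def)
  next
    case (Suc k)
    then obtain q where q: "(t, q) \<in> (H \<union> H\<inverse>) ^^ k" "(q, p) \<in> H \<union> H\<inverse>" by auto
    then have "q \<in> P" "p \<in> P" using assms(4) by auto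
    have "nb (\<phi> q) (\<phi> p)"
      using q(2) assms(5) sym[OF V[OF \<open>p \<in> P\<close>] V[OF \<open>q \<in> P\<close>]] by (auto simp: labelings_def)
    then show ?case using Suc.IH[OF q(1)] V[OF \<open>p \<in> P\<close>] by (auto simp: ball_of_Suc)
  qed
  moreover have "ball_of V nb k (\<phi> t) \<subseteq> ball_of V nb (band_radius (card P)) (\<phi> t)"
    by (rule ball_of_mono) (use refl V[OF assms(6)] kr in auto)
  ultimately show ?thesis by blast
qed

text \<open>Up to a bounded factor, a labeling is determined by its values on one position of each
  connected component of the constraints.\<close>

lemma card_labelings_le_transversal:
  assumes fin: "finite V" and refl: "\<And>v. v \<in> V \<Longrightarrow> nb v v"
    and sym: "\<And>v w. v \<in> V \<Longrightarrow> w \<in> V \<Longrightarrow> nb v w \<Longrightarrow> nb w v"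
    and deg: "\<And>v. v \<in> V \<Longrightarrow> card {w\<in>V. nb v w} \<le> D"
    and "finite P" "H \<subseteq> P \<times> P" "T \<subseteq> P" "\<forall>p\<in>P. \<exists>t\<in>T. (p, t) \<in> conn H"
  shows "card (labelings V nb P H) \<le> card V ^ card T * (D ^ band_radius (card P)) ^ card P"
proof -
  obtain r where r: "\<And>p. p \<in> P \<Longrightarrow> r p \<in> T \<and> (p, r p) \<in> conn H" using assms(8) by metis
  define F where "F \<psi> = PiE P (\<lambda>p. ball_of V nb (band_radius (card P)) (\<psi> (r p)))" for \<psi>
  have finT: "finite T" using assms finite_subset by blast
  have "labelings V nb P H \<subseteq> (\<Union>\<psi>\<in>PiE T (\<lambda>_. V). F \<psi>)"
  proof
    fix \<phi> assume phi: "\<phi> \<in> labelings V nb P H"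
    have "\<phi> p \<in> ball_of V nb (band_radius (card P)) (restrict \<phi> T (r p))" if "p \<in> P" for p
      using conn_ball_of[OF refl sym assms(5,6) phi, of "r p" p] r[OF that] conn_sym assms(7) by auto
    moreover have "\<phi> \<in> extensional P"
      using phi by (auto simp: labelings_def PiE_def)
    ultimately have "\<phi> \<in> F (restrict \<phi> T)"
      unfolding F_def by (simp add: PiE_iff)
    moreover have "restrict \<phi> T \<in> PiE T (\<lambda>_. V)"
      using phi assms(7) by (auto simp: labelings_def PiE_def)
    ultimately show "\<phi> \<in> (\<Union>\<psi>\<in>PiE T (\<lambda>_. V). F \<psi>)" by blast
  qed
  moreover have finF: "finite (F \<psi>)" if "\<psi> \<in> PiE T (\<lambda>_. V)" for \<psi>
    unfolding F_def
    by (intro finite_PiE assms(5) finite_subset[OF ball_of_subset fin]) (use r that in auto)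
  ultimately have "card (labelings V nb P H) \<le> card (\<Union>\<psi>\<in>PiE T (\<lambda>_. V). F \<psi>)"
    by (intro card_mono finite_UN_I finite_PiE finT fin) auto
  also have "\<dots> \<le> (\<Sum>\<psi>\<in>PiE T (\<lambda>_. V). card (F \<psi>))"
    by (intro card_UN_le finite_PiE finT fin)
  also have "\<dots> \<le> (\<Sum>\<psi>\<in>PiE T (\<lambda>_. V). (D ^ band_radius (card P)) ^ card P)"
  proof (rule sum_mono)
    fix \<psi> assume psi: "\<psi> \<in> PiE T (\<lambda>_. V)"
    have "card (F \<psi>) = (\<Prod>p\<in>P. card (ball_of V nb (band_radius (card P)) (\<psi> (r p))))"
      unfolding F_def by (rule card_PiE[OF assms(5)])
    also have "\<dots> \<le> (\<Prod>p\<in>P. D ^ band_radius (card P))"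
      using psi r by (intro prod_mono conjI card_ball_of_le fin deg) auto
    finally show "card (F \<psi>) \<le> (D ^ band_radius (card P)) ^ card P" by simp
  qed
  also have "\<dots> = card V ^ card T * (D ^ band_radius (card P)) ^ card P"
    using finT by (simp add: card_PiE)
  finally show ?thesis .
qed

section \<open>Gluing the ends of edges, and classes of close edges\<close>

definition edge_pairs :: "nat set \<Rightarrow> (nat \<times> nat) set" where
  "edge_pairs R = (\<lambda>a. (a, Suc a)) ` R"

text \<open>If gluing the ends of \<open>r\<close> edges makes the constraints connect all
  positions, then the constraints alone leave at most \<open>1 + r\<close> components, and each
  component is one free choice in \<open>V\<close>.\<close>

lemma card_labelings_le:
  assumes fin: "finite V" "V \<noteq> {}" and refl: "\<And>v. v \<in> V \<Longrightarrow> nb v v"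
    and sym: "\<And>v w. v \<in> V \<Longrightarrow> w \<in> V \<Longrightarrow> nb v w \<Longrightarrow> nb w v"
    and deg: "\<And>v. v \<in> V \<Longrightarrow> card {w\<in>V. nb v w} \<le> D"
    and P: "finite P" "H \<subseteq> P \<times> P" "p0 \<in> P" "edge_pairs R \<subseteq> P \<times> P" "finite R"
      "\<forall>p\<in>P. (p, p0) \<in> conn (H \<union> edge_pairs R)"
    and r: "card R \<le> r"
  shows "card (labelings V nb P H) \<le> card V ^ (1 + r) * (D ^ band_radius (card P)) ^ card P"
proof -
  have "finite (edge_pairs R)" "card (edge_pairs R) \<le> card R"
    using P(5) by (auto simp: edge_pairs_def card_image_le)
  moreover have "\<forall>p\<in>P. \<exists>t\<in>{p0}. (p, t) \<in> conn (H \<union> edge_pairs R)" using P(6) by simp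
  ultimately obtain T where T: "T \<subseteq> {p0} \<union> fst ` edge_pairs R \<union> snd ` edge_pairs R"
     "card T \<le> card {p0} + card (edge_pairs R)" "\<forall>p\<in>P. \<exists>t\<in>T. (p, t) \<in> conn H"
    using exists_small_transversal[of "edge_pairs R" "{p0}" P H] by auto
  have "fst ` edge_pairs R \<subseteq> P" "snd ` edge_pairs R \<subseteq> P" using P(4) by auto
  then have "T \<subseteq> P" using T(1) P(3) by blast
  have "card T \<le> 1 + r" using T(2) r \<open>card (edge_pairs R) \<le> card R\<close> by simp
  have "card V \<ge> 1" using fin by (simp add: Suc_leI card_gt_0_iff)
  have "card (labelings V nb P H) \<le> card V ^ card T * (D ^ band_radius (card P)) ^ card P"
    by (rule card_labelings_le_transversal[OF fin(1) refl sym deg P(1,2) \<open>T \<subseteq> P\<close> T(3)])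
  also have "\<dots> \<le> card V ^ (1 + r) * (D ^ band_radius (card P)) ^ card P"
    by (intro mult_right_mono power_increasing \<open>card T \<le> 1 + r\<close> \<open>card V \<ge> 1\<close>) simp
  finally show ?thesis .
qed

text \<open>The first alternative matches the edges in parallel, the second antiparallel. Both count
  as dependence, because transposed entries of a hermitian matrix determine each other.\<close>

definition edge_close :: "(nat \<times> nat) set \<Rightarrow> nat \<Rightarrow> nat \<Rightarrow> bool" where
  "edge_close H a b \<longleftrightarrow> (a, b) \<in> H \<and> (Suc a, Suc b) \<in> H \<or> (a, Suc b) \<in> H \<and> (Suc a, b) \<in> H"

lemma edge_close_sym: "sym H \<Longrightarrow> edge_close H a b \<Longrightarrow> edge_close H b a"
  unfolding edge_close_def by (auto dest: symD)

definition isolation_free :: "(nat \<times> nat) set \<Rightarrow> nat set \<Rightarrow> bool" where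
  "isolation_free H E \<longleftrightarrow> (\<forall>a\<in>E. \<exists>b\<in>E. b \<noteq> a \<and> edge_close H a b)"

definition has_triple :: "(nat \<times> nat) set \<Rightarrow> nat set \<Rightarrow> bool" where
  "has_triple H E \<longleftrightarrow> (\<exists>a\<in>E. \<exists>b\<in>E. \<exists>c\<in>E. a \<noteq> b \<and> a \<noteq> c \<and> b \<noteq> c \<and> edge_close H a b \<and> edge_close H a c)"

definition edge_rel :: "(nat \<times> nat) set \<Rightarrow> nat set \<Rightarrow> (nat \<times> nat) set" where
  "edge_rel H E = {(a, b). a \<in> E \<and> b \<in> E \<and> edge_close H a b}"

text \<open>Every class of the transitive closure of closeness has at least two edges, so one
  representative per class is at most half of the edges. A triple forces a class with three edges
  and makes the inequality strict.\<close>

lemma exists_edge_representatives: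
  assumes "finite E" "sym H" "isolation_free H E"
  shows "\<exists>R\<subseteq>E. 2 * card R + (if has_triple H E then 1 else 0) \<le> card E \<and>
    (\<forall>a\<in>E. \<exists>r\<in>R. (a, r) \<in> (edge_rel H E)\<^sup>*)"
proof -
  define Q where "Q = {(a, b). a \<in> E \<and> b \<in> E \<and> (a, b) \<in> (edge_rel H E)\<^sup>*}"
  have sym: "sym ((edge_rel H E)\<^sup>*)"
    using edge_close_sym[OF assms(2)] by (intro sym_rtrancl) (auto simp: sym_def edge_rel_def)
  have eq: "equiv E Q"
    unfolding Q_def using sym
    by (auto intro!: equivI refl_onI symI transI dest: symD)
  define \<C> where "\<C> = E // Q"
  have fin: "finite \<C>" unfolding \<C>_def
    using assms(1) by (simp add: finite_quotient Q_def subset_iff)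
  have cl: "C \<subseteq> E \<and> finite C \<and> 2 \<le> card C" if CC: "C \<in> \<C>" for C
  proof -
    obtain a where a: "a \<in> E" "C = Q `` {a}"
      using CC by (auto simp: \<C>_def elim: quotientE)
    obtain b where b: "b \<in> E" "b \<noteq> a" "edge_close H a b"
      using assms(3) a by (auto simp: isolation_free_def)
    have "{a, b} \<subseteq> C" using a b by (auto simp: Q_def edge_rel_def)
    moreover have "C \<subseteq> E" using a by (auto simp: Q_def)
    ultimately show ?thesis using b assms(1)
      by (metis card_2_iff card_mono finite_subset)
  qed
  have sum: "card E = (\<Sum>C\<in>\<C>. card C)"
  proof -
    have "card (\<Union>\<C>) = (\<Sum>C\<in>\<C>. card C)"
      using quotient_disj[OF eq] cl by (intro card_Union_disjoint) (auto simp: \<C>_def disjoint_def pairwise_def disjnt_def)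
    then show ?thesis using Union_quotient[OF eq] by (simp add: \<C>_def)
  qed
  have card: "2 * card \<C> + (if has_triple H E then 1 else 0) \<le> card E"
  proof (cases "has_triple H E")
    case True
    then obtain a b c where abc: "a \<in> E" "b \<in> E" "c \<in> E" "a \<noteq> b" "a \<noteq> c" "b \<noteq> c"
      "edge_close H a b" "edge_close H a c" by (auto simp: has_triple_def)
    have C: "Q `` {a} \<in> \<C>" using abc by (auto simp: \<C>_def quotient_def)
    have "{a, b, c} \<subseteq> Q `` {a}" using abc by (auto simp: Q_def edge_rel_def)
    then have "card {a, b, c} \<le> card (Q `` {a})" using cl[OF C] by (intro card_mono) auto
    then have "2 < card (Q `` {a})" using abc by simp
    then have "(\<Sum>C\<in>\<C>. 2) < (\<Sum>C\<in>\<C>. card C)"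
      using cl C by (intro sum_strict_mono_ex1 fin) auto
    then show ?thesis using sum by simp
  next
    case False
    have "(\<Sum>C\<in>\<C>. 2) \<le> (\<Sum>C\<in>\<C>. card C)" using cl by (intro sum_mono) auto
    then show ?thesis using sum False by simp
  qed
  define R where "R = (\<lambda>C. SOME x. x \<in> C) ` \<C>"
  have R: "(SOME x. x \<in> C) \<in> C" if "C \<in> \<C>" for C
    using cl[OF that] by (metis card.empty not_numeral_le_zero some_in_eq)
  have "card R \<le> card \<C>" unfolding R_def by (rule card_image_le[OF fin])
  moreover have "R \<subseteq> E" using R cl by (auto simp: R_def)
  moreover have "\<exists>r\<in>R. (a, r) \<in> (edge_rel H E)\<^sup>*" if "a \<in> E" for a
  proof -
    have C: "Q `` {a} \<in> \<C>" using that by (auto simp: \<C>_def quotient_def)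
    from R[OF C] have "(a, SOME x. x \<in> Q `` {a}) \<in> (edge_rel H E)\<^sup>*" by (auto simp: Q_def)
    then show ?thesis using C unfolding R_def by blast
  qed
  ultimately show ?thesis using card by (intro exI[of _ R]) auto
qed

text \<open>Two close edges and the two constraints between their ends form a four-cycle, so
  connecting the ends of one edge connects the ends of the other.\<close>

lemma conn_edge_close:
  assumes "H \<subseteq> C" "edge_close H a b" "(b, Suc b) \<in> conn C"
  shows "(a, Suc a) \<in> conn C"
  using assms unfolding edge_close_def
  by (meson conn_base conn_sym conn_trans subset_iff)

lemma conn_edge_rel_rtrancl:
  assumes "H \<subseteq> C" "(a, b) \<in> (edge_rel H E)\<^sup>*" "(b, Suc b) \<in> conn C"
  shows "(a, Suc a) \<in> conn C"
  using assms(2,3)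
  by (induction rule: converse_rtrancl_induct) (auto simp: edge_rel_def intro: conn_edge_close[OF assms(1)])

lemma conn_representatives:
  assumes "\<forall>a\<in>E. \<exists>r\<in>R. (a, r) \<in> (edge_rel H E)\<^sup>*" "a \<in> E"
  shows "(a, Suc a) \<in> conn (H \<union> edge_pairs R)"
proof -
  obtain r where r: "r \<in> R" "(a, r) \<in> (edge_rel H E)\<^sup>*" using assms by auto
  have "(r, Suc r) \<in> conn (H \<union> edge_pairs R)" using r(1) by (intro conn_base) (auto simp: edge_pairs_def)
  then show ?thesis using conn_edge_rel_rtrancl[OF _ r(2), of "H \<union> edge_pairs R"] by auto
qed

lemma conn_interval:
  assumes "\<And>a. u \<le> a \<Longrightarrow> a < v \<Longrightarrow> (a, Suc a) \<in> conn C" "u \<le> p" "p \<le> v"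
  shows "(p, u) \<in> conn C"
  using assms(2,3)
proof (induction p rule: dec_induct)
  case (step n)
  then have "(n, u) \<in> conn C" "(n, Suc n) \<in> conn C" using assms(1) by auto
  then show ?case by (meson conn_sym conn_trans)
qed simp

text \<open>The type of a labeling. The number of types depends only on the number of positions, so
  it suffices to bound the labelings of a single type.\<close>

definition rel_of :: "('v \<Rightarrow> 'v \<Rightarrow> bool) \<Rightarrow> nat set \<Rightarrow> (nat \<Rightarrow> 'v) \<Rightarrow> (nat \<times> nat) set" where
  "rel_of nb P \<phi> = {(p, q). p \<in> P \<and> q \<in> P \<and> nb (\<phi> p) (\<phi> q)}"

text \<open>A defect is a pair of edges matched in parallel, or a pair crossing an antiparallel one: a
  pairing of the edges of a closed walk without defects is noncrossing and antiparallel.\<close>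

definition has_defect :: "(nat \<times> nat) set \<Rightarrow> nat \<Rightarrow> bool" where
  "has_defect H m \<longleftrightarrow>
     (\<exists>p q. p < q \<and> q < m \<and> (p, q) \<in> H \<and> (Suc p, Suc q) \<in> H) \<or>
     (\<exists>a p b q. a < p \<and> p < b \<and> b < q \<and> q < m \<and> (Suc a, b) \<in> H \<and> edge_close H p q)"

text \<open>Types with an isolated edge are left out because the expectation and the noncrossing sum
  both vanish on them. The pair \<open>(0, m)\<close> is what closedness of the walk contributes to
  its type.\<close>

definition degenerate :: "nat \<Rightarrow> (nat \<times> nat) set \<Rightarrow> bool" where
  "degenerate m H \<longleftrightarrow> isolation_free H {..<m} \<and>
     (has_triple H {..<m} \<or> (0, m) \<in> H \<and> has_defect H m)"

text \<open>With a triple, one representative per class of close edges is already cheap enough.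
  Otherwise the two edges \<open>p\<close> and \<open>q\<close> of a defect get no representative at
  all: the other edges connect three arcs of the walk, closedness joins the outer two, and the
  defect itself ties the middle arc to the first.\<close>

lemma degenerate_connecting_set:
  assumes "sym H" "degenerate m H"
  shows "\<exists>R\<subseteq>{..<m}. 2 * card R + 1 \<le> m \<and> (\<forall>p\<le>m. (p, 0) \<in> conn (H \<union> edge_pairs R))"
proof (cases "has_triple H {..<m}")
  case True
  with assms exists_edge_representatives[of "{..<m}" H] obtain R where R: "R \<subseteq> {..<m}"
    "2 * card R + 1 \<le> m" "\<forall>a\<in>{..<m}. \<exists>r\<in>R. (a, r) \<in> (edge_rel H {..<m})\<^sup>*"
    by (auto simp: degenerate_def)
  have "(p, 0) \<in> conn (H \<union> edge_pairs R)" if "p \<le> m" for p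
    by (rule conn_interval[where v = m]) (use that conn_representatives[OF R(3)] in auto)
  then show ?thesis using R by blast
next
  case False
  from assms False have iso: "isolation_free H {..<m}" and H0: "(0, m) \<in> H" and "has_defect H m"
    by (auto simp: degenerate_def)
  \<comment> \<open>The constraint \<open>(u, v)\<close> joins the arc up to \<open>p\<close> to the
    arc between the two edges. For a parallel match it joins the first ends of the edges; for a
    crossing it comes from the antiparallel pair that is crossed.\<close>
  from this(3) obtain p q u v where pq: "p < q" "q < m" "edge_close H p q"
    and uv: "u \<le> p" "p < v" "v \<le> q" "(u, v) \<in> H"
    unfolding has_defect_def
  proof (elim disjE exE conjE)
    fix p q assume "p < q" "q < m" "(p, q) \<in> H" "(Suc p, Suc q) \<in> H"
    then show thesis by (intro that[of p q p q]) (auto simp: edge_close_def)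
  next
    fix a p b q assume "a < p" "p < b" "b < q" "q < m" "(Suc a, b) \<in> H" "edge_close H p q"
    then show thesis by (intro that[of p q "Suc a" b]) auto
  qed
  define E where "E = {..<m} - {p, q}"
  have "card E + 2 = m" using pq by (simp add: E_def card_Diff_subset)
  have "isolation_free H E"
    unfolding isolation_free_def
  proof
    fix a assume a: "a \<in> E"
    then obtain b where b: "b < m" "b \<noteq> a" "edge_close H a b"
      using iso by (auto simp: isolation_free_def E_def)
    \<comment> \<open>A further partner of \<open>p\<close> or of \<open>q\<close> would make a
      triple, so dropping both edges isolates none of the others.\<close>
    have "b \<noteq> p"
    proof
      assume "b = p"
      then have "edge_close H p a" using edge_close_sym[OF assms(1)] b by auto
      then have "has_triple H {..<m}" unfolding has_triple_def
        using pq a b \<open>b = p\<close> by (intro bexI[of _ p] bexI[of _ a] bexI[of _ q]) (auto simp: E_def)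
      with False show False by simp
    qed
    moreover have "b \<noteq> q"
    proof
      assume "b = q"
      then have "edge_close H q a" "edge_close H q p" using edge_close_sym[OF assms(1)] b pq by auto
      then have "has_triple H {..<m}" unfolding has_triple_def
        using pq a b \<open>b = q\<close> by (intro bexI[of _ q] bexI[of _ a] bexI[of _ p]) (auto simp: E_def)
      with False show False by simp
    qed
    ultimately show "\<exists>b\<in>E. b \<noteq> a \<and> edge_close H a b" using b by (auto simp: E_def)
  qed
  from exists_edge_representatives[OF _ assms(1) this] obtain R where R: "R \<subseteq> E"
    "2 * card R \<le> card E" "\<forall>a\<in>E. \<exists>r\<in>R. (a, r) \<in> (edge_rel H E)\<^sup>*"
    by (auto simp: E_def dest: add_leD1)
  define C where "C = H \<union> edge_pairs R"
  have HC: "(x, y) \<in> conn C" if "(x, y) \<in> H" for x y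
    using that by (intro conn_base) (auto simp: C_def)
  have EC: "(a, Suc a) \<in> conn C" if "a < m" "a \<noteq> p" "a \<noteq> q" for a
    unfolding C_def by (rule conn_representatives[OF R(3)]) (use that in \<open>auto simp: E_def\<close>)
  have 1: "(x, 0) \<in> conn C" if "x \<le> p" for x
    by (rule conn_interval[where v = p]) (use that pq in \<open>auto intro!: EC\<close>)
  have 2: "(x, Suc q) \<in> conn C" if "q < x" "x \<le> m" for x
    by (rule conn_interval[where v = m]) (use that pq in \<open>auto intro!: EC\<close>)
  have 3: "(x, Suc p) \<in> conn C" if "p < x" "x \<le> q" for x
    by (rule conn_interval[where v = q]) (use that pq in \<open>auto intro!: EC\<close>)
  have "(m, 0) \<in> conn C" by (rule conn_sym[OF HC[OF H0]])
  then have 4: "(x, 0) \<in> conn C" if "q < x" "x \<le> m" for x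
    by (rule conn_trans[OF 2[OF that] conn_trans[OF conn_sym[OF 2[OF pq(2) order_refl]]]])
  have "(v, 0) \<in> conn C" by (rule conn_trans[OF conn_sym[OF HC[OF uv(4)]] 1[OF uv(1)]])
  then have 5: "(x, 0) \<in> conn C" if "p < x" "x \<le> q" for x
    by (rule conn_trans[OF 3[OF that] conn_trans[OF conn_sym[OF 3[OF uv(2,3)]]]])
  have "\<forall>x\<le>m. (x, 0) \<in> conn C" using 1 4 5 by (meson not_le)
  then show ?thesis using R \<open>card E + 2 = m\<close> unfolding C_def
    by (intro exI[of _ R]) (auto simp: E_def)
qed

text \<open>Two closed walks of \<open>m\<close> steps are laid out one after the other on the positions \<open>{..2 * m + 1}\<close>;
  the missing position \<open>m\<close> is the jump from the end of the first to the start of the second.\<close>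

definition two_walk_edges :: "nat \<Rightarrow> nat set" where
  "two_walk_edges m = {..<m} \<union> {Suc m..<Suc (2 * m)}"

text \<open>Pairs of walks whose type is not linked have covariance zero, by
  \<open>cov_walks_nonzero_imp_linked\<close>.\<close>

definition linked :: "nat \<Rightarrow> (nat \<times> nat) set \<Rightarrow> bool" where
  "linked m H \<longleftrightarrow> isolation_free H (two_walk_edges m) \<and>
     (\<exists>a\<in>{..<m}. \<exists>b\<in>{Suc m..<Suc (2 * m)}. edge_close H a b)"

text \<open>Classes of close edges have at least two members, so \<open>m\<close> representatives
  serve the \<open>2 * m\<close> edges and connect each walk within itself. The close pair across
  the gap then joins the two walks, so the second walk does not add a component of its own.\<close>

lemma linked_connecting_set:
  assumes "sym H" "linked m H"
  shows "\<exists>R\<subseteq>two_walk_edges m. card R \<le> m \<and>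
    (\<forall>p\<le>Suc (2 * m). (p, 0) \<in> conn (H \<union> edge_pairs R))"
proof -
  from assms obtain a b where ab: "a < m" "Suc m \<le> b" "b < Suc (2 * m)" "edge_close H a b"
    by (auto simp: linked_def)
  have fin: "finite (two_walk_edges m)" by (simp add: two_walk_edges_def)
  have "card (two_walk_edges m) = 2 * m"
    unfolding two_walk_edges_def by (subst card_Un_disjoint) auto
  with exists_edge_representatives[OF fin assms(1)] assms(2) obtain R where R: "R \<subseteq> two_walk_edges m"
    "2 * card R \<le> 2 * m"
    "\<forall>a\<in>two_walk_edges m. \<exists>r\<in>R. (a, r) \<in> (edge_rel H (two_walk_edges m))\<^sup>*"
    by (auto simp: linked_def dest: add_leD1)
  define C where "C = H \<union> edge_pairs R"
  have EC: "(x, Suc x) \<in> conn C" if "x \<in> two_walk_edges m" for x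
    unfolding C_def by (rule conn_representatives[OF R(3) that])
  have 1: "(x, 0) \<in> conn C" if "x \<le> m" for x
  proof (rule conn_interval[OF _ le0 that])
    fix a assume "a < m"
    then have "a \<in> two_walk_edges m" unfolding two_walk_edges_def by simp
    then show "(a, Suc a) \<in> conn C" by (rule EC)
  qed
  have 2: "(x, Suc m) \<in> conn C" if "Suc m \<le> x" "x \<le> Suc (2 * m)" for x
  proof (rule conn_interval[OF _ that])
    fix a assume "Suc m \<le> a" "a < Suc (2 * m)"
    then have "a \<in> two_walk_edges m" unfolding two_walk_edges_def by (simp only: Un_iff atLeastLessThan_iff simp_thms)
    then show "(a, Suc a) \<in> conn C" by (rule EC)
  qed
  obtain y where y: "(a, y) \<in> H" "Suc m \<le> y" "y \<le> Suc (2 * m)"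
  proof (cases "(a, b) \<in> H")
    case True
    then show thesis using ab by (intro that[of b]) auto
  next
    case False
    then show thesis using ab by (intro that[of "Suc b"]) (auto simp: edge_close_def)
  qed
  have "(a, y) \<in> conn C" using y by (intro conn_base) (auto simp: C_def)
  then have "(Suc m, 0) \<in> conn C"
    using conn_trans[OF conn_trans[OF conn_sym[OF 2[OF y(2,3)]] conn_sym] 1[of a]] ab(1) by simp
  then have "(x, 0) \<in> conn C" if "x \<le> Suc (2 * m)" for x
    using that 1[of x] conn_trans[OF 2[of x]] by (cases "x \<le> m") auto
  then show ?thesis using R unfolding C_def by auto
qed

text \<open>The power of two bounds the number of types of \<open>p\<close> positions. The other
  factor bounds the labelings of one type once the label of one position per component is
  fixed.\<close>

definition walk_const :: "nat \<Rightarrow> nat \<Rightarrow> nat" where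
  "walk_const D p = 2 ^ (p * p) * (D ^ band_radius p) ^ p"

section \<open>The numbers of degenerate walks and of linked pairs of walks\<close>

locale band_set =
  fixes V :: "'v set" and nb :: "'v \<Rightarrow> 'v \<Rightarrow> bool" and D :: nat
  assumes finite_V: "finite V" and V_ne: "V \<noteq> {}"
    and nb_refl: "\<And>v. v \<in> V \<Longrightarrow> nb v v"
    and nb_sym: "\<And>v w. v \<in> V \<Longrightarrow> w \<in> V \<Longrightarrow> nb v w \<Longrightarrow> nb w v"
    and degree: "\<And>v. v \<in> V \<Longrightarrow> card {w\<in>V. nb v w} \<le> D"
begin

lemma sym_rel_of: "\<phi> ` P \<subseteq> V \<Longrightarrow> sym (rel_of nb P \<phi>)"
  using nb_sym by (auto simp: sym_def rel_of_def image_subset_iff)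

lemma card_types_le:
  assumes P: "finite P" "base \<in> P"
    and conn: "\<And>H. sym H \<Longrightarrow> Bad H \<Longrightarrow> \<exists>R. finite R \<and> edge_pairs R \<subseteq> P \<times> P \<and> card R \<le> r \<and>
        (\<forall>p\<in>P. (p, base) \<in> conn (H \<union> edge_pairs R))"
  shows "card {\<phi>\<in>PiE P (\<lambda>_. V). Bad (rel_of nb P \<phi>)} \<le> walk_const D (card P) * card V ^ (1 + r)"
proof -
  let ?F = "\<lambda>H. {\<phi>\<in>PiE P (\<lambda>_. V). Bad H \<and> rel_of nb P \<phi> = H}"
  let ?c = "card V ^ (1 + r) * (D ^ band_radius (card P)) ^ card P"
  have fin: "finite (PiE P (\<lambda>_. V))" by (intro finite_PiE P finite_V)
  have "card {\<phi>\<in>PiE P (\<lambda>_. V). Bad (rel_of nb P \<phi>)} \<le> card (\<Union>H\<in>Pow (P \<times> P). ?F H)"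
    by (intro card_mono finite_UN_I) (use P fin in \<open>auto simp: rel_of_def\<close>)
  also have "\<dots> \<le> (\<Sum>H\<in>Pow (P \<times> P). card (?F H))"
    using P by (intro card_UN_le) auto
  also have "\<dots> \<le> (\<Sum>H\<in>Pow (P \<times> P). ?c)"
  proof (rule sum_mono)
    fix H assume "H \<in> Pow (P \<times> P)"
    then have H: "H \<subseteq> P \<times> P" by auto
    show "card (?F H) \<le> ?c"
    proof (cases "?F H = {}")
      case False
      then obtain \<phi> where phi: "\<phi> \<in> PiE P (\<lambda>_. V)" "Bad H" "rel_of nb P \<phi> = H" by auto
      have "sym H" using phi sym_rel_of[of \<phi> P] by auto
      from conn[OF this phi(2)] obtain R where R: "finite R" "edge_pairs R \<subseteq> P \<times> P" "card R \<le> r"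
        "\<forall>p\<in>P. (p, base) \<in> conn (H \<union> edge_pairs R)" by auto
      have "card (?F H) \<le> card (labelings V nb P H)"
      proof (rule card_mono)
        show "finite (labelings V nb P H)" using fin by (simp add: labelings_def)
        show "?F H \<subseteq> labelings V nb P H" by (auto simp: labelings_def rel_of_def)
      qed
      also have "\<dots> \<le> ?c"
        by (rule card_labelings_le[OF finite_V V_ne nb_refl nb_sym degree P(1) H P(2) R(2,1,4,3)])
      finally show ?thesis .
    next
      case True
      then show ?thesis by (simp only: card.empty)
    qed
  qed
  also have "\<dots> = walk_const D (card P) * card V ^ (1 + r)"
    using P by (simp add: card_Pow card_cartesian_product walk_const_def)
  finally show ?thesis .
qed

text \<open>At most \<open>(m - 1) div 2\<close> representatives are needed, hence at most
  \<open>(m + 1) / 2\<close> free labels. The square root keeps the bound uniform in the parity of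
  \<open>m\<close>.\<close>

lemma card_degenerate_le:
  "real (card {\<phi>\<in>PiE {..m} (\<lambda>_. V). degenerate m (rel_of nb {..m} \<phi>)}) \<le>
     real (walk_const D (Suc m)) * sqrt (card V) ^ (m + 1)"
\<comment> \<open>For \<open>m = 0\<close> the count by representatives would allow one free label
  where the claim allows half of one, but a walk without edges is never degenerate.\<close>
proof (cases "m = 0")
  case True
  then show ?thesis by (simp add: degenerate_def has_triple_def has_defect_def)
next
  case False
  define r where "r = (m - 1) div 2"
  have "card {\<phi>\<in>PiE {..m} (\<lambda>_. V). degenerate m (rel_of nb {..m} \<phi>)} \<le>
      walk_const D (card {..m}) * card V ^ (1 + r)"
  proof (rule card_types_le[where base = 0 and Bad = "degenerate m"])
    fix H :: "(nat \<times> nat) set" assume "sym H" "degenerate m H"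
    from degenerate_connecting_set[OF this] obtain R where R: "R\<subseteq>{..<m}" "2 * card R + 1 \<le> m"
      "\<forall>p\<le>m. (p, 0) \<in> conn (H \<union> edge_pairs R)" by auto
    then show "\<exists>R. finite R \<and> edge_pairs R \<subseteq> {..m} \<times> {..m} \<and> card R \<le> r \<and>
        (\<forall>p\<in>{..m}. (p, 0) \<in> conn (H \<union> edge_pairs R))"
      by (intro exI[of _ R]) (auto simp: r_def edge_pairs_def intro: finite_subset)
  qed auto
  then have "real (card {\<phi>\<in>PiE {..m} (\<lambda>_. V). degenerate m (rel_of nb {..m} \<phi>)}) \<le>
      real (walk_const D (Suc m) * card V ^ (1 + r))"
    by (simp only: of_nat_le_iff card_atMost)
  also have "\<dots> = real (walk_const D (Suc m)) * sqrt (card V) ^ (2 * (1 + r))"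
    by (simp only: power_mult) simp
  also have "\<dots> \<le> real (walk_const D (Suc m)) * sqrt (card V) ^ (m + 1)"
  proof (intro mult_left_mono power_increasing)
    show "2 * (1 + r) \<le> m + 1" using False by (simp add: r_def)
    show "1 \<le> sqrt (real (card V))"
      using finite_V V_ne by (simp add: Suc_leI card_gt_0_iff)
  qed auto
  finally show ?thesis .
qed

lemma card_linked_le:
  "card {\<phi>\<in>PiE {..Suc (2 * m)} (\<lambda>_. V). linked m (rel_of nb {..Suc (2 * m)} \<phi>)} \<le>
     walk_const D (2 * m + 2) * card V ^ (m + 1)"
proof -
  have "card {\<phi>\<in>PiE {..Suc (2 * m)} (\<lambda>_. V). linked m (rel_of nb {..Suc (2 * m)} \<phi>)} \<le>
      walk_const D (card {..Suc (2 * m)}) * card V ^ (1 + m)"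
  proof (rule card_types_le[where base = 0 and Bad = "linked m"])
    fix H :: "(nat \<times> nat) set" assume "sym H" "linked m H"
    from linked_connecting_set[OF this] obtain R where R: "R\<subseteq>two_walk_edges m" "card R \<le> m"
      "\<forall>p\<le>Suc (2 * m). (p, 0) \<in> conn (H \<union> edge_pairs R)" by auto
    then show "\<exists>R. finite R \<and> edge_pairs R \<subseteq> {..Suc (2 * m)} \<times> {..Suc (2 * m)} \<and> card R \<le> m \<and>
        (\<forall>p\<in>{..Suc (2 * m)}. (p, 0) \<in> conn (H \<union> edge_pairs R))"
      by (intro exI[of _ R]) (auto simp: two_walk_edges_def edge_pairs_def intro: finite_subset)
  qed auto
  then show ?thesis by simp
qed

end

section \<open>Moments of band ensembles\<close>

text \<open>The product is at most a power of its largest factor; the \<open>1\<close> covers the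
  empty product.\<close>

lemma prod_le_one_plus_sum_power:
  fixes x :: "nat \<Rightarrow> real"
  assumes "finite S" "\<And>a. a \<in> S \<Longrightarrow> 0 \<le> x a"
  shows "(\<Prod>a\<in>S. x a) \<le> 1 + (\<Sum>a\<in>S. x a ^ card S)"
proof (cases "S = {}")
  case False
  define m where "m = Max (x ` S)"
  have "m \<in> x ` S" unfolding m_def using assms(1) False by (intro Max_in) auto
  then obtain b where b: "b \<in> S" "x b = m" by auto
  have "(\<Prod>a\<in>S. x a) \<le> (\<Prod>a\<in>S. m)"
    using assms by (intro prod_mono) (auto simp: m_def)
  also have "\<dots> = x b ^ card S" using b by simp
  also have "\<dots> \<le> (\<Sum>a\<in>S. x a ^ card S)"
    using assms b(1) by (intro member_le_sum) auto
  finally show ?thesis by simp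
qed simp

text \<open>The recursion of \<open>W\<close> with every covariance replaced by \<open>c\<close>: a
  Catalan number times \<open>c ^ (m div 2)\<close> for even \<open>m\<close>, and \<open>0\<close>
  for odd \<open>m\<close>.\<close>

fun nc_bound :: "real \<Rightarrow> nat \<Rightarrow> real" where
  "nc_bound c 0 = 1"
| "nc_bound c (Suc m) = (\<Sum>k<m. c * nc_bound c k * nc_bound c (m - 1 - k))"

lemma nc_bound_nonneg: "0 \<le> c \<Longrightarrow> 0 \<le> nc_bound c m"
  by (induction c m rule: nc_bound.induct) (auto intro!: sum_nonneg mult_nonneg_nonneg)

text \<open>Bounds the mean norm of a product of \<open>k\<close> entries, whatever their
  dependence, through \<open>prod_le_one_plus_sum_power\<close>.\<close>

definition moment_const :: "(nat \<Rightarrow> real) \<Rightarrow> nat \<Rightarrow> real" where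
  "moment_const B k = 1 + real k * B k"

text \<open>An edge is named by the position \<open>a\<close> of its first vertex in a walk \<open>\<phi>\<close>, so a set of edges is a set
  of positions.\<close>

locale band_ensemble = band_set V nb D + prob_space M
  for V :: "'v set" and nb :: "'v \<Rightarrow> 'v \<Rightarrow> bool" and D :: nat and M :: "'a measure" +
  fixes X :: "'v \<Rightarrow> 'v \<Rightarrow> 'a \<Rightarrow> complex" and B :: "nat \<Rightarrow> real"
  assumes X_measurable: "\<And>i j. i \<in> V \<Longrightarrow> j \<in> V \<Longrightarrow> X i j \<in> borel_measurable M"
    and X_integrable: "\<And>i j k. i \<in> V \<Longrightarrow> j \<in> V \<Longrightarrow> integrable M (\<lambda>\<omega>. norm (X i j \<omega>) ^ k)"
    and X_moment: "\<And>i j k. i \<in> V \<Longrightarrow> j \<in> V \<Longrightarrow> (LINT \<omega>|M. norm (X i j \<omega>) ^ k) \<le> B k"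
    and X_mean: "\<And>i j. i \<in> V \<Longrightarrow> j \<in> V \<Longrightarrow> (LINT \<omega>|M. X i j \<omega>) = 0"
    and X_factor: "\<And>\<phi> S T. finite S \<Longrightarrow> finite T \<Longrightarrow> (\<forall>a\<in>S \<union> T. \<phi> a \<in> V \<and> \<phi> (Suc a) \<in> V) \<Longrightarrow>
      (\<forall>a\<in>S. \<forall>b\<in>T. \<not> (nb (\<phi> a) (\<phi> b) \<and> nb (\<phi> (Suc a)) (\<phi> (Suc b)) \<or>
         nb (\<phi> a) (\<phi> (Suc b)) \<and> nb (\<phi> (Suc a)) (\<phi> b))) \<Longrightarrow>
      (LINT \<omega>|M. (\<Prod>a\<in>S \<union> T. X (\<phi> a) (\<phi> (Suc a)) \<omega>)) =
        (LINT \<omega>|M. (\<Prod>a\<in>S. X (\<phi> a) (\<phi> (Suc a)) \<omega>)) *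
        (LINT \<omega>|M. (\<Prod>a\<in>T. X (\<phi> a) (\<phi> (Suc a)) \<omega>))"
begin

definition antiparallel :: "(nat \<Rightarrow> 'v) \<Rightarrow> nat \<Rightarrow> nat \<Rightarrow> bool" where
  "antiparallel \<phi> a b \<longleftrightarrow> nb (\<phi> a) (\<phi> (Suc b)) \<and> nb (\<phi> (Suc a)) (\<phi> b)"

definition close :: "(nat \<Rightarrow> 'v) \<Rightarrow> nat \<Rightarrow> nat \<Rightarrow> bool" where
  "close \<phi> a b \<longleftrightarrow> nb (\<phi> a) (\<phi> b) \<and> nb (\<phi> (Suc a)) (\<phi> (Suc b)) \<or> antiparallel \<phi> a b"

definition Y :: "(nat \<Rightarrow> 'v) \<Rightarrow> nat set \<Rightarrow> 'a \<Rightarrow> complex" where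
  "Y \<phi> S \<omega> = (\<Prod>a\<in>S. X (\<phi> a) (\<phi> (Suc a)) \<omega>)"

definition EY :: "(nat \<Rightarrow> 'v) \<Rightarrow> nat set \<Rightarrow> complex" where
  "EY \<phi> S = (LINT \<omega>|M. Y \<phi> S \<omega>)"

definition labels_in :: "(nat \<Rightarrow> 'v) \<Rightarrow> nat set \<Rightarrow> bool" where
  "labels_in \<phi> S \<longleftrightarrow> (\<forall>a\<in>S. \<phi> a \<in> V \<and> \<phi> (Suc a) \<in> V)"

lemma labels_in_subset: "labels_in \<phi> S \<Longrightarrow> T \<subseteq> S \<Longrightarrow> labels_in \<phi> T"
  by (auto simp: labels_in_def)

lemma close_sym: "labels_in \<phi> {a, b} \<Longrightarrow> close \<phi> a b \<Longrightarrow> close \<phi> b a"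
  unfolding close_def antiparallel_def labels_in_def using nb_sym by auto

lemma EY_factor:
  assumes "finite S" "finite T" "labels_in \<phi> (S \<union> T)" "\<And>a b. a \<in> S \<Longrightarrow> b \<in> T \<Longrightarrow> \<not> close \<phi> a b"
  shows "EY \<phi> (S \<union> T) = EY \<phi> S * EY \<phi> T"
  using X_factor[of S T \<phi>] assms
  unfolding EY_def Y_def labels_in_def close_def antiparallel_def by blast

lemma EY_empty [simp]: "EY \<phi> {} = 1"
  by (simp add: EY_def Y_def prob_space)

lemma EY_singleton: "labels_in \<phi> {a} \<Longrightarrow> EY \<phi> {a} = 0"
  by (simp add: EY_def Y_def labels_in_def X_mean)

text \<open>An edge that is close to no other splits off as a factor, and that factor is a mean,
  hence zero.\<close>

lemma EY_isolated:
  assumes "finite S" "labels_in \<phi> S" "a \<in> S" "\<And>b. b \<in> S \<Longrightarrow> b \<noteq> a \<Longrightarrow> \<not> close \<phi> a b"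
  shows "EY \<phi> S = 0"
proof -
  have S: "S = {a} \<union> (S - {a})" using assms by auto
  have "EY \<phi> ({a} \<union> (S - {a})) = EY \<phi> {a} * EY \<phi> (S - {a})"
    using assms by (intro EY_factor) (auto elim!: labels_in_subset)
  then show ?thesis using EY_singleton[of \<phi> a] labels_in_subset[OF assms(2), of "{a}"] assms(3) S by simp
qed

lemma Y_measurable: "labels_in \<phi> S \<Longrightarrow> Y \<phi> S \<in> borel_measurable M"
  unfolding Y_def[abs_def] labels_in_def by (intro borel_measurable_prod X_measurable) auto

lemma norm_Y_le:
  "finite S \<Longrightarrow> norm (Y \<phi> S \<omega>) \<le> 1 + (\<Sum>a\<in>S. norm (X (\<phi> a) (\<phi> (Suc a)) \<omega>) ^ card S)"
  unfolding Y_def prod_norm[symmetric] by (rule prod_le_one_plus_sum_power) auto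

lemma Y_bound_integrable:
  "labels_in \<phi> S \<Longrightarrow> finite S \<Longrightarrow>
     integrable M (\<lambda>\<omega>. 1 + (\<Sum>a\<in>S. norm (X (\<phi> a) (\<phi> (Suc a)) \<omega>) ^ card S))"
  unfolding labels_in_def by (intro Bochner_Integration.integrable_add Bochner_Integration.integrable_sum X_integrable) auto

lemma Y_integrable: "labels_in \<phi> S \<Longrightarrow> finite S \<Longrightarrow> integrable M (Y \<phi> S)"
  by (rule Bochner_Integration.integrable_bound[OF Y_bound_integrable Y_measurable])
     (auto intro!: AE_I2 order_trans[OF norm_Y_le])

lemma norm_EY_le:
  assumes "labels_in \<phi> S" "finite S"
  shows "norm (EY \<phi> S) \<le> moment_const B (card S)"
proof -
  have "norm (EY \<phi> S) \<le> (LINT \<omega>|M. 1 + (\<Sum>a\<in>S. norm (X (\<phi> a) (\<phi> (Suc a)) \<omega>) ^ card S))"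
    unfolding EY_def
    by (intro order_trans[OF integral_norm_bound] integral_mono norm_Y_le
        integrable_norm Y_integrable Y_bound_integrable assms)
  also have "\<dots> = 1 + (\<Sum>a\<in>S. LINT \<omega>|M. norm (X (\<phi> a) (\<phi> (Suc a)) \<omega>) ^ card S)"
    using assms by (subst Bochner_Integration.integral_add)
      (auto simp: prob_space labels_in_def intro!: X_integrable Bochner_Integration.integral_sum)
  also have "\<dots> \<le> 1 + (\<Sum>a\<in>S. B (card S))"
    using assms by (intro add_left_mono sum_mono X_moment) (auto simp: labels_in_def)
  finally show ?thesis by (simp add: moment_const_def)
qed

text \<open>The indices follow a walk: the edge from \<open>i\<close> to \<open>j\<close> and a
  later edge from \<open>l\<close> to \<open>k\<close>. The covariance is cut off to antiparallel
  neighbours, so entries close only in parallel count as uncorrelated; a parallel match in a closed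
  walk is a defect and belongs to the error term.\<close>

definition cov :: "'v \<Rightarrow> 'v \<Rightarrow> 'v \<Rightarrow> 'v \<Rightarrow> complex" where
  "cov i j l k = (if nb i k \<and> nb j l then LINT \<omega>|M. X i j \<omega> * X l k \<omega> else 0)"

text \<open>The sum over noncrossing pairings of the edges \<open>a, \<dots>, a + m - 1\<close>; the first edge is paired with
  edge \<open>Suc a + c\<close>.\<close>

fun W :: "(nat \<Rightarrow> 'v) \<Rightarrow> nat \<Rightarrow> nat \<Rightarrow> complex" where
  "W \<phi> a 0 = 1"
| "W \<phi> a (Suc m) = (\<Sum>c<m. cov (\<phi> a) (\<phi> (Suc a)) (\<phi> (Suc a + c)) (\<phi> (Suc (Suc a + c))) *
      W \<phi> (Suc a) c * W \<phi> (Suc (Suc a + c)) (m - 1 - c))"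

declare W.simps(2) [simp del]

lemma EY_pair:
  assumes "a \<noteq> b"
  shows "EY \<phi> {a, b} = (LINT \<omega>|M. X (\<phi> a) (\<phi> (Suc a)) \<omega> * X (\<phi> b) (\<phi> (Suc b)) \<omega>)"
  using assms by (simp add: EY_def Y_def)

lemma norm_cov_le:
  assumes "i \<in> V" "j \<in> V" "l \<in> V" "k \<in> V"
  shows "norm (cov i j l k) \<le> moment_const B 2"
proof -
  \<comment> \<open>The two entries are the edges \<open>0\<close> and \<open>2\<close> of the walk
    \<open>i\<close>, \<open>j\<close>, \<open>l\<close>, \<open>k\<close>, so the general bound for
    products of edges applies.\<close>
  define \<phi> where "\<phi> = (\<lambda>p::nat. if p = 0 then i else if p = 1 then j else if p = 2 then l else k)"
  have "norm (EY \<phi> {0, 2}) \<le> moment_const B (card {0, 2::nat})"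
    using assms by (intro norm_EY_le) (auto simp: labels_in_def \<phi>_def)
  moreover have "card {0, 2::nat} = 2" by simp
  ultimately have le: "norm (EY \<phi> {0, 2}) \<le> moment_const B 2" by metis
  have "EY \<phi> {0, 2} = (LINT \<omega>|M. X i j \<omega> * X l k \<omega>)"
    by (subst EY_pair) (auto simp: \<phi>_def)
  then show ?thesis using le order_trans[OF norm_ge_zero le] by (simp add: cov_def)
qed

lemma W_shift: "W \<phi> (a + b) m = W (\<lambda>p. \<phi> (p + b)) a m"
proof (induction m arbitrary: a rule: less_induct)
  case (less m)
  show ?case
  proof (cases m)
    case (Suc m')
    have "W \<phi> (Suc (a + b)) c = W (\<lambda>p. \<phi> (p + b)) (Suc a) c" if "c < m'" for c
      using less[of c "Suc a"] that Suc by simp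
    moreover have "W \<phi> (Suc (Suc (a + b) + c)) (m' - 1 - c) =
        W (\<lambda>p. \<phi> (p + b)) (Suc (Suc a + c)) (m' - 1 - c)" if "c < m'" for c
      using less[of "m' - 1 - c" "Suc (Suc a + c)"] that Suc by (simp add: ac_simps)
    ultimately show ?thesis unfolding Suc W.simps by (intro sum.cong) (auto simp: ac_simps)
  qed simp
qed

lemma W_cong: "(\<And>p. a \<le> p \<Longrightarrow> p \<le> a + m \<Longrightarrow> \<phi> p = \<psi> p) \<Longrightarrow> W \<phi> a m = W \<psi> a m"
proof (induction m arbitrary: a rule: less_induct)
  case (less m)
  show ?case
  proof (cases m)
    case (Suc m')
    have "W \<phi> (Suc a) c = W \<psi> (Suc a) c" if "c < m'" for c
      by (rule less.IH) (use that Suc less.prems in auto)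
    moreover have "W \<phi> (Suc (Suc a + c)) (m' - 1 - c) = W \<psi> (Suc (Suc a + c)) (m' - 1 - c)"
      if "c < m'" for c
      by (rule less.IH) (use that Suc less.prems in auto)
    moreover have "\<phi> p = \<psi> p" if "a \<le> p" "p \<le> a + Suc m'" for p
      using less.prems that Suc by auto
    ultimately show ?thesis unfolding Suc W.simps by (intro sum.cong) auto
  qed simp
qed

lemma norm_W_le:
  "(\<And>p. a \<le> p \<Longrightarrow> p \<le> a + m \<Longrightarrow> \<phi> p \<in> V) \<Longrightarrow> norm (W \<phi> a m) \<le> nc_bound (moment_const B 2) m"
proof (induction m arbitrary: a rule: less_induct)
  case (less m)
  show ?case
  proof (cases m)
    case (Suc m')
    let ?c = "moment_const B 2"
    obtain v where "v \<in> V" using V_ne by auto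
    then have c0: "0 \<le> ?c" using order_trans[OF norm_ge_zero norm_cov_le] by blast
    have "norm (W \<phi> a m) \<le> (\<Sum>c<m'. norm (cov (\<phi> a) (\<phi> (Suc a)) (\<phi> (Suc a + c)) (\<phi> (Suc (Suc a + c)))) *
        norm (W \<phi> (Suc a) c) * norm (W \<phi> (Suc (Suc a + c)) (m' - 1 - c)))"
      unfolding Suc W.simps by (rule order_trans[OF norm_sum]) (simp add: norm_mult)
    also have "\<dots> \<le> (\<Sum>c<m'. ?c * nc_bound ?c c * nc_bound ?c (m' - 1 - c))"
    proof (intro sum_mono mult_mono)
      fix c assume c: "c \<in> {..<m'}"
      show "norm (cov (\<phi> a) (\<phi> (Suc a)) (\<phi> (Suc a + c)) (\<phi> (Suc (Suc a + c)))) \<le> ?c"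
        using c less.prems Suc by (intro norm_cov_le) auto
      show "norm (W \<phi> (Suc a) c) \<le> nc_bound ?c c"
        using c less.prems Suc by (intro less.IH) auto
      show "norm (W \<phi> (Suc (Suc a + c)) (m' - 1 - c)) \<le> nc_bound ?c (m' - 1 - c)"
        using c less.prems Suc by (intro less.IH) auto
    qed (auto intro!: nc_bound_nonneg mult_nonneg_nonneg c0)
    finally show ?thesis using Suc by simp
  qed simp
qed

text \<open>Meant for the contrapositive: an isolated edge makes \<open>W\<close> vanish, in
  agreement with \<open>EY_isolated\<close>.\<close>

lemma W_nonzero_imp_partner:
  assumes "\<And>p. a \<le> p \<Longrightarrow> p \<le> a + m \<Longrightarrow> \<phi> p \<in> V" "W \<phi> a m \<noteq> 0" "p \<in> {a..<a + m}"
  shows "\<exists>q\<in>{a..<a + m}. q \<noteq> p \<and> close \<phi> p q"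
  using assms
proof (induction m arbitrary: a rule: less_induct)
  case (less m)
  then obtain m' where m: "m = Suc m'" by (cases m) auto
  from less.prems(2) obtain c where c: "c < m'"
    "cov (\<phi> a) (\<phi> (Suc a)) (\<phi> (Suc a + c)) (\<phi> (Suc (Suc a + c))) \<noteq> 0"
    "W \<phi> (Suc a) c \<noteq> 0" "W \<phi> (Suc (Suc a + c)) (m' - 1 - c) \<noteq> 0"
    unfolding m W.simps by (metis (no_types, lifting) lessThan_iff mult_eq_0_iff sum.neutral)
  define b where "b = Suc a + c"
  have ab: "close \<phi> a b" using c(2) by (auto simp: cov_def close_def antiparallel_def b_def split: if_splits)
  have ba: "close \<phi> b a"
    by (rule close_sym[OF _ ab]) (use less.prems(1) c(1) m in \<open>auto simp: labels_in_def b_def\<close>)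
  consider "p = a" | "p = b" | "p \<in> {Suc a..<Suc a + c}" | "p \<in> {Suc (Suc a + c)..<Suc (Suc a + c) + (m' - 1 - c)}"
    using less.prems(3) c(1) m by (fastforce simp: b_def)
  then show ?case
  proof cases
    case 1
    then show ?thesis using ab c(1) m by (intro bexI[of _ b]) (auto simp: b_def)
  next
    case 2
    then show ?thesis using ba c(1) m by (intro bexI[of _ a]) (auto simp: b_def)
  next
    case 3
    have "\<exists>q\<in>{Suc a..<Suc a + c}. q \<noteq> p \<and> close \<phi> p q"
      by (rule less.IH[OF _ _ c(3) 3]) (use less.prems(1) c(1) m in auto)
    then show ?thesis using c(1) m by fastforce
  next
    case 4
    have "\<exists>q\<in>{Suc (Suc a + c)..<Suc (Suc a + c) + (m' - 1 - c)}. q \<noteq> p \<and> close \<phi> p q"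
      by (rule less.IH[OF _ _ c(4) 4]) (use less.prems(1) c(1) m in auto)
    then show ?thesis using c(1) m by fastforce
  qed
qed

text \<open>Closeness is then a perfect matching of the edges of the segment, antiparallel and
  noncrossing.\<close>

definition good_segment :: "(nat \<Rightarrow> 'v) \<Rightarrow> nat \<Rightarrow> nat \<Rightarrow> bool" where
  "good_segment \<phi> a m \<longleftrightarrow>
     (\<forall>p\<in>{a..<a + m}. \<exists>q\<in>{a..<a + m}. q \<noteq> p \<and> antiparallel \<phi> p q \<and>
        (\<forall>q'\<in>{a..<a + m}. q' \<noteq> p \<longrightarrow> close \<phi> p q' \<longrightarrow> q' = q)) \<and>
     (\<forall>p q p' q'. a \<le> p \<longrightarrow> p < q \<longrightarrow> q < p' \<longrightarrow> p' < q' \<longrightarrow> q' < a + m \<longrightarrow> close \<phi> p p' \<longrightarrow> \<not> close \<phi> q q')"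

text \<open>The partner of the first edge cuts the segment into an inner and an outer part. No edge
  of one part is close to the other part or to the pair, so the expectation factors exactly as one
  term of the recursion of \<open>W\<close>.\<close>

lemma EY_good_segment:
  assumes "\<And>p. a \<le> p \<Longrightarrow> p \<le> a + m \<Longrightarrow> \<phi> p \<in> V" "good_segment \<phi> a m"
  shows "EY \<phi> {a..<a + m} = W \<phi> a m"
  using assms
proof (induction m arbitrary: a rule: less_induct)
  case (less m)
  show ?case
  proof (cases m)
    case (Suc m')
    let ?S = "{a..<a + m}"
    have lab: "labels_in \<phi> ?S" using less.prems(1) by (auto simp: labels_in_def)
    have sym: "close \<phi> q p" if "p \<in> ?S" "q \<in> ?S" "close \<phi> p q" for p q
      by (rule close_sym[OF labels_in_subset[OF lab] that(3)]) (use that in auto)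
    have uniq: "q' = q" if "p \<in> ?S" "q \<in> ?S" "q' \<in> ?S" "q \<noteq> p" "q' \<noteq> p" "close \<phi> p q" "close \<phi> p q'" for p q q'
      using less.prems(2) that unfolding good_segment_def by metis
    have nocross: "\<not> close \<phi> q q'" if "a \<le> p" "p < q" "q < p'" "p' < q'" "q' < a + m" "close \<phi> p p'" for p q p' q'
      using less.prems(2) that unfolding good_segment_def by blast
    have partner: "\<exists>q\<in>?S. q \<noteq> p \<and> antiparallel \<phi> p q" if "p \<in> ?S" for p
      using less.prems(2) that unfolding good_segment_def by blast
    obtain b where b: "b \<in> ?S" "b \<noteq> a" "antiparallel \<phi> a b"
      using partner[of a] Suc by auto
    have cab: "close \<phi> a b" using b by (simp add: close_def)
    have cba: "close \<phi> b a" using sym[OF _ b(1) cab] Suc by auto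
    have aS: "a \<in> ?S" using Suc by simp
    define c where "c = b - Suc a"
    have c: "b = Suc a + c" "c < m'" using b Suc by (auto simp: c_def)
    let ?I = "{Suc a..<Suc a + c}" and ?O = "{Suc b..<Suc b + (m' - 1 - c)}"
    have S: "?S = {a, b} \<union> (?I \<union> ?O)" using c Suc by auto
    have not_a: "\<not> close \<phi> a p" "\<not> close \<phi> b p" if "p \<in> ?I \<union> ?O" for p
    proof -
      have p: "p \<in> ?S" "p \<noteq> a" "p \<noteq> b" using that c Suc by auto
      show "\<not> close \<phi> a p" using uniq[OF aS b(1) p(1) b(2) p(2) cab] p by auto
      show "\<not> close \<phi> b p" using uniq[OF b(1) aS p(1) b(2)[symmetric] p(3) cba] p by auto
    qed
    \<comment> \<open>Close edges inside and outside the pair would cross it.\<close>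
    have IO: "\<not> close \<phi> p q" if "p \<in> ?I" "q \<in> ?O" for p q
      using nocross[of a p b q] that cab c Suc by auto
    have "EY \<phi> ?S = EY \<phi> {a, b} * EY \<phi> (?I \<union> ?O)"
      unfolding S
    proof (rule EY_factor)
      show "labels_in \<phi> ({a, b} \<union> (?I \<union> ?O))" using lab S by simp
    qed (use not_a in auto)
    also have "EY \<phi> (?I \<union> ?O) = EY \<phi> ?I * EY \<phi> ?O"
      using IO labels_in_subset[OF lab] S by (intro EY_factor) auto
    also have "EY \<phi> {a, b} = cov (\<phi> a) (\<phi> (Suc a)) (\<phi> b) (\<phi> (Suc b))"
      using b by (simp add: EY_pair cov_def antiparallel_def)
    also have "EY \<phi> ?I = W \<phi> (Suc a) c"
    proof (rule less.IH)
      show "good_segment \<phi> (Suc a) c"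
        unfolding good_segment_def
      proof (intro conjI ballI)
        fix p assume p: "p \<in> ?I"
        then have pS: "p \<in> ?S" using S by blast
        obtain q where q: "q \<in> ?S" "q \<noteq> p" "antiparallel \<phi> p q" using partner[OF pS] by auto
        have cpq: "close \<phi> p q" using q by (simp add: close_def)
        have "q \<noteq> a" "q \<noteq> b" using not_a[of p] sym[OF pS q(1) cpq] p by auto
        moreover have "q \<notin> ?O" using IO[OF p] cpq by auto
        ultimately have "q \<in> ?I" using q(1) S by blast
        then show "\<exists>q\<in>?I. q \<noteq> p \<and> antiparallel \<phi> p q \<and> (\<forall>q'\<in>?I. q' \<noteq> p \<longrightarrow> close \<phi> p q' \<longrightarrow> q' = q)"
          using q cpq uniq[OF pS q(1) _ q(2) _ cpq] S by (intro bexI[of _ q]) auto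
      next
        show "\<forall>p q p' q'. Suc a \<le> p \<longrightarrow> p < q \<longrightarrow> q < p' \<longrightarrow> p' < q' \<longrightarrow> q' < Suc a + c \<longrightarrow>
            close \<phi> p p' \<longrightarrow> \<not> close \<phi> q q'"
        proof (intro allI impI)
          fix p q p' q' assume "Suc a \<le> p" "p < q" "q < p'" "p' < q'" "q' < Suc a + c" "close \<phi> p p'"
          then show "\<not> close \<phi> q q'" using c Suc by (intro nocross[of p q p' q']) auto
        qed
      qed
    qed (use c Suc less.prems(1) in auto)
    also have "EY \<phi> ?O = W \<phi> (Suc b) (m' - 1 - c)"
    proof (rule less.IH)
      show "good_segment \<phi> (Suc b) (m' - 1 - c)"
        unfolding good_segment_def
      proof (intro conjI ballI)
        fix p assume p: "p \<in> ?O"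
        then have pS: "p \<in> ?S" using S by blast
        obtain q where q: "q \<in> ?S" "q \<noteq> p" "antiparallel \<phi> p q" using partner[OF pS] by auto
        have cpq: "close \<phi> p q" using q by (simp add: close_def)
        have "q \<noteq> a" "q \<noteq> b" using not_a[of p] sym[OF pS q(1) cpq] p by auto
        moreover have "q \<notin> ?I" using IO[OF _ p] sym[OF pS q(1) cpq] by auto
        ultimately have "q \<in> ?O" using q(1) S by blast
        then show "\<exists>q\<in>?O. q \<noteq> p \<and> antiparallel \<phi> p q \<and> (\<forall>q'\<in>?O. q' \<noteq> p \<longrightarrow> close \<phi> p q' \<longrightarrow> q' = q)"
          using q cpq uniq[OF pS q(1) _ q(2) _ cpq] S by (intro bexI[of _ q]) auto
      next
        show "\<forall>p q p' q'. Suc b \<le> p \<longrightarrow> p < q \<longrightarrow> q < p' \<longrightarrow> p' < q' \<longrightarrow> q' < Suc b + (m' - 1 - c) \<longrightarrow>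
            close \<phi> p p' \<longrightarrow> \<not> close \<phi> q q'"
        proof (intro allI impI)
          fix p q p' q' assume "Suc b \<le> p" "p < q" "q < p'" "p' < q'" "q' < Suc b + (m' - 1 - c)" "close \<phi> p p'"
          then show "\<not> close \<phi> q q'" using c Suc by (intro nocross[of p q p' q']) auto
        qed
      qed
    qed (use c Suc less.prems(1) in auto)
    finally have EY: "EY \<phi> ?S = cov (\<phi> a) (\<phi> (Suc a)) (\<phi> b) (\<phi> (Suc b)) *
        (W \<phi> (Suc a) c * W \<phi> (Suc b) (m' - 1 - c))" .
    \<comment> \<open>All other terms of the recursion vanish: a nonzero covariance would give the
      first edge a second close edge.\<close>
    have zero: "cov (\<phi> a) (\<phi> (Suc a)) (\<phi> (Suc a + c')) (\<phi> (Suc (Suc a + c'))) = 0"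
      if c': "c' \<in> {..<m'} - {c}" for c'
    proof (rule ccontr)
      assume "cov (\<phi> a) (\<phi> (Suc a)) (\<phi> (Suc a + c')) (\<phi> (Suc (Suc a + c'))) \<noteq> 0"
      then have "close \<phi> a (Suc a + c')"
        by (auto simp: cov_def close_def antiparallel_def split: if_splits)
      then have "Suc a + c' = b" using uniq[OF aS b(1) _ b(2) _ cab, of "Suc a + c'"] c' Suc by auto
      then show False using c' c by auto
    qed
    have "W \<phi> a m = (\<Sum>c'\<in>{c}. cov (\<phi> a) (\<phi> (Suc a)) (\<phi> (Suc a + c')) (\<phi> (Suc (Suc a + c'))) *
      W \<phi> (Suc a) c' * W \<phi> (Suc (Suc a + c')) (m' - 1 - c'))"
      unfolding Suc W.simps
      by (rule sum.mono_neutral_right) (use c zero in auto)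
    then show ?thesis using EY c by simp
  qed simp
qed

end

section \<open>Closed walks: expectation and variance of traces\<close>

context band_ensemble
begin

definition path_lists :: "nat \<Rightarrow> 'v list set" where
  "path_lists m = {xs. set xs \<subseteq> V \<and> length xs = Suc m}"

definition closed_walks :: "nat \<Rightarrow> 'v list set" where
  "closed_walks m = {xs\<in>path_lists m. xs ! 0 = xs ! m}"

lemma finite_path_lists: "finite (path_lists m)"
  unfolding path_lists_def by (rule finite_lists_length_eq[OF finite_V])

lemma finite_closed_walks: "finite (closed_walks m)"
  using finite_path_lists by (simp add: closed_walks_def)

lemma nth_path_list: "xs \<in> path_lists m \<Longrightarrow> p \<le> m \<Longrightarrow> xs ! p \<in> V"
  by (auto simp: path_lists_def intro: nth_mem)

lemma edge_close_rel_of: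
  assumes "{p, Suc p, q, Suc q} \<subseteq> P"
  shows "edge_close (rel_of nb P \<phi>) p q \<longleftrightarrow> close \<phi> p q"
  using assms by (auto simp: edge_close_def rel_of_def close_def antiparallel_def)

text \<open>Closedness puts \<open>(0, m)\<close> into the type, so a nondegenerate type without
  isolated edges has neither a triple nor a defect. The absence of triples makes partners unique,
  and the absence of defects makes them antiparallel and noncrossing.\<close>

lemma good_segment_if_nondegenerate:
  assumes V: "\<And>p. p \<le> m \<Longrightarrow> \<phi> p \<in> V" and closed: "\<phi> 0 = \<phi> m"
    and iso: "isolation_free (rel_of nb {..m} \<phi>) {..<m}" and nd: "\<not> degenerate m (rel_of nb {..m} \<phi>)"
  shows "good_segment \<phi> 0 m"
proof -
  let ?H = "rel_of nb {..m} \<phi>"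
  have ec: "edge_close ?H p q \<longleftrightarrow> close \<phi> p q" if "p < m" "q < m" for p q
    using that by (intro edge_close_rel_of) auto
  have sym: "close \<phi> q p" if "p < m" "q < m" "close \<phi> p q" for p q
    using that V by (intro close_sym[of \<phi> p q]) (auto simp: labels_in_def)
  have "(0, m) \<in> ?H" using V closed by (auto simp: rel_of_def nb_refl)
  then have nt: "\<not> has_triple ?H {..<m}" and ndf: "\<not> has_defect ?H m"
    using iso nd by (auto simp: degenerate_def)
  have uniq: "q = q'" if "p < m" "q < m" "q' < m" "q \<noteq> p" "q' \<noteq> p" "close \<phi> p q" "close \<phi> p q'" for p q q'
    using nt that ec unfolding has_triple_def by (metis lessThan_iff)
  have nopar: "\<not> (nb (\<phi> p) (\<phi> q) \<and> nb (\<phi> (Suc p)) (\<phi> (Suc q)))" if "p < q" "q < m" for p q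
    using ndf that unfolding has_defect_def by (auto simp: rel_of_def)
  have anti: "antiparallel \<phi> p q" if "p < m" "q < m" "q \<noteq> p" "close \<phi> p q" for p q
  proof (rule ccontr)
    assume "\<not> antiparallel \<phi> p q"
    then have *: "nb (\<phi> p) (\<phi> q)" "nb (\<phi> (Suc p)) (\<phi> (Suc q))" using that by (auto simp: close_def)
    then have "nb (\<phi> q) (\<phi> p)" "nb (\<phi> (Suc q)) (\<phi> (Suc p))" using nb_sym V that by auto
    then show False using * nopar[of p q] nopar[of q p] that by (metis nat_neq_iff)
  qed
  have cross: "\<not> close \<phi> q q'" if "p < q" "q < p'" "p' < q'" "q' < m" "close \<phi> p p'" for p q p' q'
  proof
    assume c: "close \<phi> q q'"
    have "antiparallel \<phi> p p'" using that by (intro anti) auto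
    then have "(Suc p, p') \<in> ?H" using that by (auto simp: rel_of_def antiparallel_def)
    moreover have "edge_close ?H q q'" using c ec that by auto
    ultimately have "has_defect ?H m" unfolding has_defect_def using that by blast
    with ndf show False by simp
  qed
  show ?thesis unfolding good_segment_def
  proof (intro conjI ballI)
    fix p assume p: "p \<in> {0..<0 + m}"
    then have "p < m" by simp
    with iso obtain q where "q < m" "q \<noteq> p" "edge_close ?H p q"
      unfolding isolation_free_def by blast
    then have q: "q < m" "q \<noteq> p" "close \<phi> p q" using ec[OF \<open>p < m\<close>] by auto
    then show "\<exists>q\<in>{0..<0 + m}. q \<noteq> p \<and> antiparallel \<phi> p q \<and>
        (\<forall>q'\<in>{0..<0 + m}. q' \<noteq> p \<longrightarrow> close \<phi> p q' \<longrightarrow> q' = q)"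
    proof (intro bexI[of _ q] conjI ballI impI)
      fix q' assume "q' \<in> {0..<0 + m}" "q' \<noteq> p" "close \<phi> p q'"
      then show "q' = q" using uniq[OF \<open>p < m\<close> q(1) _ q(2) _ q(3), of q'] by simp
    qed (use anti[OF \<open>p < m\<close> q(1,2,3)] q in auto)
  qed (use cross in auto)
qed

text \<open>Either all edges have partners and the walk is a good segment, or some edge is isolated
  and both sides are zero.\<close>

lemma EY_eq_W_if_nondegenerate:
  assumes V: "\<And>p. p \<le> m \<Longrightarrow> \<phi> p \<in> V" and closed: "\<phi> 0 = \<phi> m"
    and nd: "\<not> degenerate m (rel_of nb {..m} \<phi>)"
  shows "EY \<phi> {..<m} = W \<phi> 0 m"
proof (cases "isolation_free (rel_of nb {..m} \<phi>) {..<m}")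
  case True
  then show ?thesis using EY_good_segment[OF _ good_segment_if_nondegenerate[OF V closed True nd]] V
    by (simp add: atLeast0LessThan)
next
  case False
  obtain p where p: "p < m" "\<And>q. q < m \<Longrightarrow> q \<noteq> p \<Longrightarrow> \<not> close \<phi> p q"
  proof -
    obtain p where p: "p < m" "\<And>q. q < m \<Longrightarrow> q \<noteq> p \<Longrightarrow> \<not> edge_close (rel_of nb {..m} \<phi>) p q"
      using False unfolding isolation_free_def by blast
    have "edge_close (rel_of nb {..m} \<phi>) p q \<longleftrightarrow> close \<phi> p q" if "q < m" for q
      using that p by (intro edge_close_rel_of) auto
    with p show thesis by (intro that[of p]) auto
  qed
  have "EY \<phi> {..<m} = 0"
    using p V by (intro EY_isolated[of _ _ p]) (auto simp: labels_in_def)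
  moreover have "W \<phi> 0 m = 0"
    using W_nonzero_imp_partner[of 0 m \<phi> p] p V by (auto simp: atLeast0LessThan)
  ultimately show ?thesis by simp
qed

lemma card_degenerate_walks_le:
  "real (card {xs\<in>closed_walks m. degenerate m (rel_of nb {..m} ((!) xs))}) \<le>
     real (walk_const D (Suc m)) * sqrt (card V) ^ (m + 1)"
proof -
  let ?f = "\<lambda>xs. restrict ((!) xs) {..m}"
  have "card {xs\<in>closed_walks m. degenerate m (rel_of nb {..m} ((!) xs))} \<le>
      card {\<phi>\<in>PiE {..m} (\<lambda>_. V). degenerate m (rel_of nb {..m} \<phi>)}"
  proof (rule card_inj_on_le)
    show "inj_on ?f {xs\<in>closed_walks m. degenerate m (rel_of nb {..m} ((!) xs))}"
    proof (rule inj_onI)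
      fix xs ys assume "xs \<in> {xs\<in>closed_walks m. degenerate m (rel_of nb {..m} ((!) xs))}"
        "ys \<in> {xs\<in>closed_walks m. degenerate m (rel_of nb {..m} ((!) xs))}" and eq: "?f xs = ?f ys"
      then have len: "length xs = Suc m" "length ys = Suc m" by (auto simp: closed_walks_def path_lists_def)
      have "xs ! p = ys ! p" if "p \<le> m" for p using fun_cong[OF eq, of p] that by simp
      then show "xs = ys" using len by (intro nth_equalityI) auto
    qed
    show "?f ` {xs\<in>closed_walks m. degenerate m (rel_of nb {..m} ((!) xs))} \<subseteq>
        {\<phi>\<in>PiE {..m} (\<lambda>_. V). degenerate m (rel_of nb {..m} \<phi>)}"
    proof clarify
      fix xs assume xs: "xs \<in> closed_walks m" "degenerate m (rel_of nb {..m} ((!) xs))"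
      have "rel_of nb {..m} (?f xs) = rel_of nb {..m} ((!) xs)" by (auto simp: rel_of_def)
      then show "?f xs \<in> {..m} \<rightarrow>\<^sub>E V \<and> degenerate m (rel_of nb {..m} (?f xs))"
        using xs nth_path_list by (auto simp: closed_walks_def)
    qed
    show "finite {\<phi>\<in>PiE {..m} (\<lambda>_. V). degenerate m (rel_of nb {..m} \<phi>)}"
      by (intro finite_Collect_conjI disjI1) (simp add: finite_PiE finite_V)
  qed
  then show ?thesis using card_degenerate_le[of m] by linarith
qed

text \<open>The two sums differ only on degenerate walks, whose number is under control; there both
  terms are merely bounded.\<close>

lemma sum_EY_approx_sum_W:
  "norm ((\<Sum>xs\<in>closed_walks m. EY ((!) xs) {..<m}) - (\<Sum>xs\<in>closed_walks m. W ((!) xs) 0 m)) \<le>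
     (moment_const B m + nc_bound (moment_const B 2) m) *
       (real (walk_const D (Suc m)) * sqrt (card V) ^ (m + 1))"
proof -
  let ?S = "{xs\<in>closed_walks m. degenerate m (rel_of nb {..m} ((!) xs))}"
  let ?c = "moment_const B m + nc_bound (moment_const B 2) m"
  have V: "xs ! p \<in> V" if "xs \<in> closed_walks m" "p \<le> m" for xs p
    using that nth_path_list by (auto simp: closed_walks_def)
  have bd: "norm (EY ((!) xs) {..<m} - W ((!) xs) 0 m) \<le> ?c" if "xs \<in> closed_walks m" for xs
  proof -
    have "norm (EY ((!) xs) {..<m}) \<le> moment_const B (card {..<m})"
      using V[OF that] by (intro norm_EY_le) (auto simp: labels_in_def)
    moreover have "norm (W ((!) xs) 0 m) \<le> nc_bound (moment_const B 2) m"
      using V[OF that] by (intro norm_W_le) auto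
    ultimately show ?thesis using norm_triangle_ineq4[of "EY ((!) xs) {..<m}" "W ((!) xs) 0 m"] by simp
  qed
  \<comment> \<open>No sign is assumed for \<open>B\<close>. Evaluating the bound at a constant walk
    shows that \<open>?c\<close> dominates a norm and is nonnegative.\<close>
  obtain v where "v \<in> V" using V_ne by auto
  then have "replicate (Suc m) v \<in> closed_walks m" by (auto simp: closed_walks_def path_lists_def nth_Cons')
  then have c0: "0 \<le> ?c" using bd norm_ge_zero order_trans by blast
  have "(\<Sum>xs\<in>closed_walks m. EY ((!) xs) {..<m}) - (\<Sum>xs\<in>closed_walks m. W ((!) xs) 0 m) =
      (\<Sum>xs\<in>closed_walks m. EY ((!) xs) {..<m} - W ((!) xs) 0 m)"
    by (simp add: sum_subtractf)
  also have "\<dots> = (\<Sum>xs\<in>?S. EY ((!) xs) {..<m} - W ((!) xs) 0 m)"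
  proof (rule sum.mono_neutral_right[OF finite_closed_walks])
    show "\<forall>xs\<in>closed_walks m - ?S. EY ((!) xs) {..<m} - W ((!) xs) 0 m = 0"
    proof
      fix xs assume xs: "xs \<in> closed_walks m - ?S"
      then have "EY ((!) xs) {..<m} = W ((!) xs) 0 m"
        using V[of xs] by (intro EY_eq_W_if_nondegenerate) (auto simp: closed_walks_def)
      then show "EY ((!) xs) {..<m} - W ((!) xs) 0 m = 0" by simp
    qed
  qed auto
  also have "norm \<dots> \<le> (\<Sum>xs\<in>?S. ?c)" by (intro sum_norm_le bd) simp
  also have "\<dots> = ?c * real (card ?S)" by simp
  also have "\<dots> \<le> ?c * (real (walk_const D (Suc m)) * sqrt (card V) ^ (m + 1))"
    by (intro mult_left_mono card_degenerate_walks_le c0)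
  finally show ?thesis .
qed

lemma Y_cong:
  "(\<And>a. a \<in> S \<Longrightarrow> \<phi> a = \<psi> a \<and> \<phi> (Suc a) = \<psi> (Suc a)) \<Longrightarrow> Y \<phi> S = Y \<psi> S"
  unfolding Y_def by (intro ext prod.cong) auto

lemma Y_shift: "Y \<phi> {Suc m..<Suc (2 * m)} = Y (\<lambda>p. \<phi> (p + Suc m)) {..<m}"
  unfolding Y_def
  by (intro ext prod.reindex_bij_witness[of _ "\<lambda>a. a + Suc m" "\<lambda>a. a - Suc m"]) auto

text \<open>Placing both walks on one line of positions makes the product of their edges an ordinary
  product over a set of edges, to which the factorization rule applies. The jump at position
  \<open>m\<close> is not an edge.\<close>

lemma concatenated_walks:
  assumes xs: "xs \<in> path_lists m" and ys: "ys \<in> path_lists m"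
  shows "Y ((!) xs) {..<m} = Y ((!) (xs @ ys)) {..<m}"
    and "Y ((!) ys) {..<m} = Y ((!) (xs @ ys)) {Suc m..<Suc (2 * m)}"
    and "Y ((!) xs) {..<m} \<omega> * Y ((!) ys) {..<m} \<omega> = Y ((!) (xs @ ys)) ({..<m} \<union> {Suc m..<Suc (2 * m)}) \<omega>"
    and "S \<subseteq> {..<m} \<union> {Suc m..<Suc (2 * m)} \<Longrightarrow> labels_in ((!) (xs @ ys)) S"
proof -
  have len: "length xs = Suc m" "length ys = Suc m" using xs ys by (auto simp: path_lists_def)
  have V: "(xs @ ys) ! p \<in> V" if "p \<le> Suc (2 * m)" for p
    using nth_path_list[OF xs, of p] nth_path_list[OF ys, of "p - Suc m"] that len by (auto simp: nth_append)
  show 1: "Y ((!) xs) {..<m} = Y ((!) (xs @ ys)) {..<m}"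
    by (rule Y_cong) (auto simp: nth_append len)
  show 2: "Y ((!) ys) {..<m} = Y ((!) (xs @ ys)) {Suc m..<Suc (2 * m)}"
    unfolding Y_shift by (rule Y_cong) (auto simp: nth_append len)
  show "Y ((!) xs) {..<m} \<omega> * Y ((!) ys) {..<m} \<omega> = Y ((!) (xs @ ys)) ({..<m} \<union> {Suc m..<Suc (2 * m)}) \<omega>"
    unfolding 1 2 unfolding Y_def by (rule prod.union_disjoint[symmetric]) auto
  show "labels_in ((!) (xs @ ys)) S" if "S \<subseteq> {..<m} \<union> {Suc m..<Suc (2 * m)}"
    unfolding labels_in_def
  proof (intro ballI conjI V)
    fix a assume "a \<in> S"
    then have "a < m \<or> a < Suc (2 * m)" using that by auto
    then show "a \<le> Suc (2 * m)" "Suc a \<le> Suc (2 * m)" by auto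
  qed
qed

text \<open>Without close edges across the walks the expectation factors. An edge isolated in the
  union is isolated in its own walk too, so then both the joint expectation and the product of
  expectations are zero.\<close>

lemma cov_walks_nonzero_imp_linked:
  assumes xs: "xs \<in> path_lists m" and ys: "ys \<in> path_lists m"
    and ne: "(LINT \<omega>|M. Y ((!) xs) {..<m} \<omega> * Y ((!) ys) {..<m} \<omega>) \<noteq> EY ((!) xs) {..<m} * EY ((!) ys) {..<m}"
  shows "linked m (rel_of nb {..Suc (2 * m)} ((!) (xs @ ys)))"
proof -
  let ?\<phi> = "(!) (xs @ ys)"
  let ?A = "{..<m}" and ?B = "{Suc m..<Suc (2 * m)}"
  let ?H = "rel_of nb {..Suc (2 * m)} ?\<phi>"
  note cw = concatenated_walks[OF xs ys]
  have lab: "labels_in ?\<phi> S" if "S \<subseteq> ?A \<union> ?B" for S by (rule cw(4)[OF that])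
  have U: "(LINT \<omega>|M. Y ((!) xs) {..<m} \<omega> * Y ((!) ys) {..<m} \<omega>) = EY ?\<phi> (?A \<union> ?B)"
    unfolding EY_def cw(3) ..
  have ne': "EY ?\<phi> (?A \<union> ?B) \<noteq> EY ?\<phi> ?A * EY ?\<phi> ?B"
    using ne unfolding U unfolding EY_def cw(1,2) .
  have ec: "edge_close ?H p q \<longleftrightarrow> close ?\<phi> p q" if "p \<in> ?A \<union> ?B" "q \<in> ?A \<union> ?B" for p q
    using that by (intro edge_close_rel_of) auto
  have "\<exists>a\<in>?A. \<exists>b\<in>?B. close ?\<phi> a b"
  proof (rule ccontr)
    assume "\<not> ?thesis"
    then have "EY ?\<phi> (?A \<union> ?B) = EY ?\<phi> ?A * EY ?\<phi> ?B"
      by (intro EY_factor lab) auto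
    with ne' show False by simp
  qed
  then have "\<exists>a\<in>?A. \<exists>b\<in>?B. edge_close ?H a b" using ec by blast
  moreover have "isolation_free ?H (?A \<union> ?B)"
  proof (rule ccontr)
    assume "\<not> ?thesis"
    then obtain p where p: "p \<in> ?A \<union> ?B" "\<And>q. q \<in> ?A \<union> ?B \<Longrightarrow> q \<noteq> p \<Longrightarrow> \<not> close ?\<phi> p q"
      unfolding isolation_free_def using ec by blast
    have 1: "EY ?\<phi> (?A \<union> ?B) = 0"
      by (rule EY_isolated[OF _ _ p]) (auto intro!: lab)
    have "EY ?\<phi> ?A = 0 \<or> EY ?\<phi> ?B = 0"
    proof (cases "p \<in> ?A")
      case True
      then have "EY ?\<phi> ?A = 0" using p(2) by (intro EY_isolated[of _ _ p] lab) auto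
      then show ?thesis ..
    next
      case False
      then have "EY ?\<phi> ?B = 0" using p by (intro EY_isolated[of _ _ p] lab) auto
      then show ?thesis ..
    qed
    then show False using 1 ne' by auto
  qed
  ultimately show ?thesis by (simp add: linked_def two_walk_edges_def)
qed

lemma card_linked_walks_le:
  "card {(xs, ys). xs \<in> path_lists m \<and> ys \<in> path_lists m \<and> linked m (rel_of nb {..Suc (2 * m)} ((!) (xs @ ys)))}
     \<le> walk_const D (2 * m + 2) * card V ^ (m + 1)" (is "card ?S \<le> _")
proof -
  let ?f = "\<lambda>(xs, ys). restrict ((!) (xs @ ys)) {..Suc (2 * m)}"
  have "card ?S \<le> card {\<phi>\<in>PiE {..Suc (2 * m)} (\<lambda>_. V). linked m (rel_of nb {..Suc (2 * m)} \<phi>)}"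
  proof (rule card_inj_on_le)
    show "inj_on ?f ?S"
    proof (rule inj_onI)
      fix p q assume pq: "p \<in> ?S" "q \<in> ?S" "?f p = ?f q"
      obtain xs ys zs ws where p: "p = (xs, ys)" and q: "q = (zs, ws)" by (cases p, cases q)
      have len: "length xs = Suc m" "length ys = Suc m" "length zs = Suc m" "length ws = Suc m"
        using pq p q by (auto simp: path_lists_def)
      have "(xs @ ys) ! r = (zs @ ws) ! r" if "r \<le> Suc (2 * m)" for r
        using fun_cong[OF pq(3), of r] that p q by simp
      then have "xs @ ys = zs @ ws" using len by (intro nth_equalityI) auto
      then show "p = q" using len p q by simp
    qed
    show "?f ` ?S \<subseteq> {\<phi>\<in>PiE {..Suc (2 * m)} (\<lambda>_. V). linked m (rel_of nb {..Suc (2 * m)} \<phi>)}"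
    proof (rule image_subsetI)
      fix z assume "z \<in> ?S"
      then obtain xs ys where z: "z = (xs, ys)" and *: "xs \<in> path_lists m" "ys \<in> path_lists m"
        "linked m (rel_of nb {..Suc (2 * m)} ((!) (xs @ ys)))" by auto
      have "rel_of nb {..Suc (2 * m)} (?f z) = rel_of nb {..Suc (2 * m)} ((!) (xs @ ys))"
        by (auto simp: rel_of_def z)
      moreover have "(xs @ ys) ! p \<in> V" if "p \<le> Suc (2 * m)" for p
        using nth_path_list[OF *(1), of p] nth_path_list[OF *(2), of "p - Suc m"] that *(1,2)
        by (auto simp: nth_append path_lists_def)
      ultimately show "?f z \<in> {\<phi>\<in>PiE {..Suc (2 * m)} (\<lambda>_. V). linked m (rel_of nb {..Suc (2 * m)} \<phi>)}"
        using * by (auto simp: z)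
    qed
    show "finite {\<phi>\<in>PiE {..Suc (2 * m)} (\<lambda>_. V). linked m (rel_of nb {..Suc (2 * m)} \<phi>)}"
      by (intro finite_Collect_conjI disjI1) (simp add: finite_PiE finite_V)
  qed
  then show ?thesis using card_linked_le[of m] by linarith
qed

definition walk_trace :: "nat \<Rightarrow> 'a \<Rightarrow> complex" where
  "walk_trace m \<omega> = (\<Sum>xs\<in>closed_walks m. Y ((!) xs) {..<m} \<omega>)"

lemma labels_closed_walk: "xs \<in> closed_walks m \<Longrightarrow> labels_in ((!) xs) {..<m}"
  using nth_path_list by (auto simp: closed_walks_def labels_in_def)

lemma walk_trace_measurable: "walk_trace m \<in> borel_measurable M"
  unfolding walk_trace_def[abs_def] by (intro borel_measurable_sum Y_measurable labels_closed_walk)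

lemma integrable_walk_trace: "integrable M (walk_trace m)"
  unfolding walk_trace_def[abs_def]
  by (intro Bochner_Integration.integrable_sum Y_integrable labels_closed_walk) auto

lemma expectation_walk_trace: "(LINT \<omega>|M. walk_trace m \<omega>) = (\<Sum>xs\<in>closed_walks m. EY ((!) xs) {..<m})"
  unfolding walk_trace_def EY_def
  by (intro Bochner_Integration.integral_sum Y_integrable labels_closed_walk) auto

lemma Y_mult_integrable_bound:
  assumes xs: "xs \<in> closed_walks m" and ys: "ys \<in> closed_walks m"
  shows "integrable M (\<lambda>\<omega>. Y ((!) xs) {..<m} \<omega> * Y ((!) ys) {..<m} \<omega>)"
    and "norm (LINT \<omega>|M. Y ((!) xs) {..<m} \<omega> * Y ((!) ys) {..<m} \<omega>) \<le> moment_const B (2 * m)"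
proof -
  let ?\<phi> = "(!) (xs @ ys)"
  let ?A = "{..<m}" and ?B = "{Suc m..<Suc (2 * m)}"
  have pl: "xs \<in> path_lists m" "ys \<in> path_lists m" using assms by (auto simp: closed_walks_def)
  note cw = concatenated_walks[OF pl]
  have lab: "labels_in ?\<phi> (?A \<union> ?B)" by (rule cw(4)) simp
  show "integrable M (\<lambda>\<omega>. Y ((!) xs) {..<m} \<omega> * Y ((!) ys) {..<m} \<omega>)"
    unfolding cw(3) by (intro Y_integrable lab) auto
  have "card (?A \<union> ?B) = 2 * m" by (subst card_Un_disjoint) auto
  then show "norm (LINT \<omega>|M. Y ((!) xs) {..<m} \<omega> * Y ((!) ys) {..<m} \<omega>) \<le> moment_const B (2 * m)"
    unfolding cw(3) using norm_EY_le[OF lab] by (simp add: EY_def)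
qed

text \<open>The difference is a double sum of covariances of walks, restricted to linked pairs. The
  square carries no conjugation; it becomes a true variance only for hermitian matrices, whose
  traces of powers are real.\<close>

lemma norm_variance_walk_trace_le:
  "norm ((LINT \<omega>|M. walk_trace m \<omega> * walk_trace m \<omega>) - (LINT \<omega>|M. walk_trace m \<omega>)\<^sup>2) \<le>
     (moment_const B (2 * m) + (moment_const B m)\<^sup>2) *
       real (walk_const D (2 * m + 2) * card V ^ (m + 1))"
proof -
  let ?E = "\<lambda>(xs, ys). LINT \<omega>|M. Y ((!) xs) {..<m} \<omega> * Y ((!) ys) {..<m} \<omega>"
  let ?F = "\<lambda>(xs, ys). EY ((!) xs) {..<m} * EY ((!) ys) {..<m}"
  let ?P = "closed_walks m \<times> closed_walks m"
  let ?L = "{(xs, ys). xs \<in> path_lists m \<and> ys \<in> path_lists m \<and> linked m (rel_of nb {..Suc (2 * m)} ((!) (xs @ ys)))}"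
  let ?c = "moment_const B (2 * m) + (moment_const B m)\<^sup>2"
  have EYle: "norm (EY ((!) xs) {..<m}) \<le> moment_const B m" if "xs \<in> closed_walks m" for xs
    using norm_EY_le[OF labels_closed_walk[OF that]] by simp
  have bd: "norm (?E z - ?F z) \<le> ?c" if "z \<in> ?P" for z
  proof -
    obtain xs ys where z: "z = (xs, ys)" by (cases z)
    have "norm (?F z) \<le> moment_const B m * moment_const B m"
      using that z EYle order_trans[OF norm_ge_zero EYle] by (auto simp: norm_mult intro!: mult_mono)
    then show ?thesis using norm_triangle_ineq4[of "?E z" "?F z"] Y_mult_integrable_bound(2)[of xs m ys] that z
      by (auto simp: power2_eq_square)
  qed
  obtain v where "v \<in> V" using V_ne by auto
  then have "(replicate (Suc m) v, replicate (Suc m) v) \<in> ?P"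
    by (auto simp: closed_walks_def path_lists_def nth_Cons')
  then have c0: "0 \<le> ?c" using order_trans[OF norm_ge_zero bd] by blast
  have "(LINT \<omega>|M. walk_trace m \<omega> * walk_trace m \<omega>) =
      (LINT \<omega>|M. (\<Sum>xs\<in>closed_walks m. \<Sum>ys\<in>closed_walks m. Y ((!) xs) {..<m} \<omega> * Y ((!) ys) {..<m} \<omega>))"
    unfolding walk_trace_def by (simp add: sum_product)
  also have "\<dots> = (\<Sum>xs\<in>closed_walks m. \<Sum>ys\<in>closed_walks m. LINT \<omega>|M. Y ((!) xs) {..<m} \<omega> * Y ((!) ys) {..<m} \<omega>)"
    by (simp add: Bochner_Integration.integral_sum Bochner_Integration.integrable_sum Y_mult_integrable_bound(1))
  also have "\<dots> = (\<Sum>z\<in>?P. ?E z)" by (simp add: sum.cartesian_product)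
  finally have 1: "(LINT \<omega>|M. walk_trace m \<omega> * walk_trace m \<omega>) = (\<Sum>z\<in>?P. ?E z)" .
  have 2: "(LINT \<omega>|M. walk_trace m \<omega>)\<^sup>2 = (\<Sum>z\<in>?P. ?F z)"
    unfolding expectation_walk_trace power2_eq_square by (simp add: sum_product sum.cartesian_product)
  have "(LINT \<omega>|M. walk_trace m \<omega> * walk_trace m \<omega>) - (LINT \<omega>|M. walk_trace m \<omega>)\<^sup>2 = (\<Sum>z\<in>?P. ?E z - ?F z)"
    unfolding 1 2 by (rule sum_subtractf[symmetric])
  moreover have "\<dots> = (\<Sum>z\<in>?P \<inter> ?L. ?E z - ?F z)"
  proof (rule sum.mono_neutral_right)
    show "\<forall>z\<in>?P - ?P \<inter> ?L. ?E z - ?F z = 0"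
    proof
      fix z assume z: "z \<in> ?P - ?P \<inter> ?L"
      obtain xs ys where xy: "z = (xs, ys)" by (cases z)
      then have "xs \<in> path_lists m" "ys \<in> path_lists m" using z by (auto simp: closed_walks_def)
      then show "?E z - ?F z = 0" using cov_walks_nonzero_imp_linked[of xs m ys] z xy by auto
    qed
  qed (auto simp: finite_closed_walks)
  ultimately have eq: "(LINT \<omega>|M. walk_trace m \<omega> * walk_trace m \<omega>) - (LINT \<omega>|M. walk_trace m \<omega>)\<^sup>2 =
      (\<Sum>z\<in>?P \<inter> ?L. ?E z - ?F z)" by (rule trans)
  have "norm (\<Sum>z\<in>?P \<inter> ?L. ?E z - ?F z) \<le> (\<Sum>z\<in>?P \<inter> ?L. ?c)"
    by (rule sum_norm_le) (rule bd, erule IntD1)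
  also have "\<dots> = ?c * real (card (?P \<inter> ?L))"
    unfolding sum_constant by (rule mult.commute)
  also have "\<dots> \<le> ?c * real (card ?L)"
  proof (intro mult_left_mono c0)
    have "?L \<subseteq> path_lists m \<times> path_lists m" by auto
    then have "finite ?L" by (rule finite_subset) (simp add: finite_path_lists)
    then show "real (card (?P \<inter> ?L)) \<le> real (card ?L)" unfolding of_nat_le_iff by (rule card_mono) (rule Int_lower2)
  qed
  also have "\<dots> \<le> ?c * real (walk_const D (2 * m + 2) * card V ^ (m + 1))"
    by (intro mult_left_mono c0) (simp only: of_nat_le_iff card_linked_walks_le)
  finally show ?thesis unfolding eq .
qed

end

section \<open>Path sums with fixed ends and their recursion\<close>

context band_ensemble
begin

definition paths :: "nat \<Rightarrow> 'v \<Rightarrow> 'v \<Rightarrow> 'v list set" where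
  "paths m i k = {xs\<in>path_lists m. xs ! 0 = i \<and> xs ! m = k}"

definition path_sum :: "nat \<Rightarrow> 'v \<Rightarrow> 'v \<Rightarrow> complex" where
  "path_sum m i k = (\<Sum>xs\<in>paths m i k. W ((!) xs) 0 m)"

lemma sum_path_lists:
  "(\<Sum>xs\<in>path_lists m. F xs) = (\<Sum>i\<in>V. \<Sum>k\<in>V. \<Sum>xs\<in>paths m i k. F xs)" for F :: "'v list \<Rightarrow> complex"
proof -
  have "(\<Sum>xs\<in>path_lists m. F xs) = (\<Sum>z\<in>V \<times> V. \<Sum>xs | xs \<in> path_lists m \<and> (xs ! 0, xs ! m) = z. F xs)"
    by (rule sum.group[symmetric]) (auto simp: finite_path_lists finite_V intro: nth_path_list)
  also have "\<dots> = (\<Sum>(i, k)\<in>V \<times> V. \<Sum>xs\<in>paths m i k. F xs)"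
    by (intro sum.cong) (auto simp: paths_def)
  finally show ?thesis by (simp add: sum.cartesian_product)
qed

lemma sum_closed_walks: "(\<Sum>xs\<in>closed_walks m. F xs) = (\<Sum>i\<in>V. \<Sum>xs\<in>paths m i i. F xs)" for F :: "'v list \<Rightarrow> complex"
proof -
  have "(\<Sum>xs\<in>closed_walks m. F xs) = (\<Sum>i\<in>V. \<Sum>xs | xs \<in> closed_walks m \<and> xs ! 0 = i. F xs)"
    by (rule sum.group[symmetric]) (auto simp: closed_walks_def finite_path_lists finite_V intro: nth_path_list)
  also have "\<dots> = (\<Sum>i\<in>V. \<Sum>xs\<in>paths m i i. F xs)"
    by (intro sum.cong) (auto simp: paths_def closed_walks_def)
  finally show ?thesis .
qed

lemma sum_W_closed_walks: "(\<Sum>xs\<in>closed_walks m. W ((!) xs) 0 m) = (\<Sum>i\<in>V. path_sum m i i)"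
  unfolding path_sum_def by (rule sum_closed_walks)

lemma paths_0: "i \<in> V \<Longrightarrow> paths 0 i k = (if i = k then {[i]} else {})"
  by (auto simp: paths_def path_lists_def length_Suc_conv)

lemma path_sum_0: "i \<in> V \<Longrightarrow> path_sum 0 i k = (if i = k then 1 else 0)"
  by (simp add: path_sum_def paths_0)

lemma W_nth_append:
  assumes "length ys = Suc c" "length zs = Suc (m - 1 - c)" "c < m"
  shows "W ((!) (x # ys @ zs)) (Suc 0) c = W ((!) ys) 0 c"
    and "W ((!) (x # ys @ zs)) (Suc (Suc c)) (m - 1 - c) = W ((!) zs) 0 (m - 1 - c)"
proof -
  have "W ((!) (x # ys @ zs)) (Suc 0) c = W (\<lambda>p. (x # ys @ zs) ! (p + Suc 0)) 0 c"
    using W_shift[of "(!) (x # ys @ zs)" 0 "Suc 0" c] by simp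
  also have "\<dots> = W ((!) ys) 0 c"
    by (rule W_cong) (use assms in \<open>auto simp: nth_append\<close>)
  finally show "W ((!) (x # ys @ zs)) (Suc 0) c = W ((!) ys) 0 c" .
  have "W ((!) (x # ys @ zs)) (Suc (Suc c)) (m - 1 - c) = W (\<lambda>p. (x # ys @ zs) ! (p + Suc (Suc c))) 0 (m - 1 - c)"
    using W_shift[of "(!) (x # ys @ zs)" 0 "Suc (Suc c)" "m - 1 - c"] by simp
  also have "\<dots> = W ((!) zs) 0 (m - 1 - c)"
    by (rule W_cong) (use assms in \<open>auto simp: nth_append\<close>)
  finally show "W ((!) (x # ys @ zs)) (Suc (Suc c)) (m - 1 - c) = W ((!) zs) 0 (m - 1 - c)" .
qed

text \<open>The first edge leads from \<open>i\<close> to \<open>j\<close> and its partner from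
  \<open>l\<close> to \<open>k'\<close>. Removing both leaves a path of \<open>c\<close> steps from
  \<open>j\<close> to \<open>l\<close> and one of \<open>m - 1 - c\<close> steps from
  \<open>k'\<close> to \<open>k\<close>, and these two are independent choices.\<close>

lemma path_sum_Suc:
  assumes i: "i \<in> V" and k: "k \<in> V"
  shows "path_sum (Suc m) i k =
    (\<Sum>c<m. \<Sum>j\<in>V. \<Sum>l\<in>V. \<Sum>k'\<in>V. cov i j l k' * path_sum c j l * path_sum (m - 1 - c) k' k)"
proof -
  define f where "f c xs = cov (xs ! 0) (xs ! 1) (xs ! Suc c) (xs ! Suc (Suc c)) *
      W ((!) xs) (Suc 0) c * W ((!) xs) (Suc (Suc c)) (m - 1 - c)" for c xs
  have "path_sum (Suc m) i k = (\<Sum>xs\<in>paths (Suc m) i k. \<Sum>c<m. f c xs)"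
    unfolding path_sum_def f_def by (simp add: W.simps(2))
  also have "\<dots> = (\<Sum>c<m. \<Sum>xs\<in>paths (Suc m) i k. f c xs)"
    by (rule sum.swap)
  also have "\<dots> = (\<Sum>c<m. \<Sum>j\<in>V. \<Sum>l\<in>V. \<Sum>k'\<in>V. cov i j l k' * path_sum c j l * path_sum (m - 1 - c) k' k)"
  proof (rule sum.cong[OF refl])
    fix c assume "c \<in> {..<m}"
    then have c: "c < m" by simp
    let ?m' = "m - 1 - c"
    define Z where "Z = {zs\<in>path_lists ?m'. zs ! ?m' = k}"
    define g where "g ys zs = cov i (ys ! 0) (ys ! c) (zs ! 0) * W ((!) ys) 0 c * W ((!) zs) 0 ?m'" for ys zs
    \<comment> \<open>A path is \<open>i # ys @ zs\<close>, where both removed edges sit at the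
      seams: one enters \<open>ys\<close> and the other leads from the end of \<open>ys\<close> to
      the start of \<open>zs\<close>.\<close>
    have "(\<Sum>xs\<in>paths (Suc m) i k. f c xs) = (\<Sum>(ys, zs)\<in>path_lists c \<times> Z. g ys zs)"
    proof (rule sum.reindex_bij_witness[of _ "\<lambda>(ys, zs). i # ys @ zs" "\<lambda>xs. (take (Suc c) (tl xs), drop (Suc c) (tl xs))"])
      fix xs assume xs: "xs \<in> paths (Suc m) i k"
      then obtain ws where ws: "xs = i # ws" "length ws = Suc m" "set ws \<subseteq> V" "ws ! m = k"
        by (auto simp: paths_def path_lists_def length_Suc_conv)
      show "(case (take (Suc c) (tl xs), drop (Suc c) (tl xs)) of (ys, zs) \<Rightarrow> i # ys @ zs) = xs"
        using ws by simp
      have "take (Suc c) ws \<in> path_lists c" using ws c by (auto simp: path_lists_def dest: in_set_takeD)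
      moreover have "drop (Suc c) ws \<in> Z" using ws c
        by (auto simp: path_lists_def Z_def dest: in_set_dropD)
      ultimately show "(take (Suc c) (tl xs), drop (Suc c) (tl xs)) \<in> path_lists c \<times> Z" using ws by simp
    next
      fix z assume "z \<in> path_lists c \<times> Z"
      then obtain ys zs where z: "z = (ys, zs)" "ys \<in> path_lists c" "zs \<in> Z" by auto
      then have len: "length ys = Suc c" "length zs = Suc ?m'" by (auto simp: path_lists_def Z_def)
      show "(take (Suc c) (tl (case z of (ys, zs) \<Rightarrow> i # ys @ zs)), drop (Suc c) (tl (case z of (ys, zs) \<Rightarrow> i # ys @ zs))) = z"
        using z len by simp
      have "(ys @ zs) ! m = zs ! ?m'" using len c by (simp add: nth_append)
      then show "(case z of (ys, zs) \<Rightarrow> i # ys @ zs) \<in> paths (Suc m) i k"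
        using z len c i by (auto simp: paths_def path_lists_def Z_def)
    next
      fix xs assume xs: "xs \<in> paths (Suc m) i k"
      then obtain ws where ws: "xs = i # ws" "length ws = Suc m"
        by (auto simp: paths_def path_lists_def length_Suc_conv)
      define ys zs where "ys = take (Suc c) ws" and "zs = drop (Suc c) ws"
      have len: "length ys = Suc c" "length zs = Suc ?m'" "xs = i # ys @ zs"
        using ws c by (auto simp: ys_def zs_def)
      have "f c xs = g ys zs"
        unfolding f_def g_def len(3) W_nth_append[OF len(1,2) c] using len(1,2) by (simp add: nth_append)
      then show "(case (take (Suc c) (tl xs), drop (Suc c) (tl xs)) of (ys, zs) \<Rightarrow> g ys zs) = f c xs"
        using ws by (simp add: ys_def zs_def)
    qed
    also have "\<dots> = (\<Sum>ys\<in>path_lists c. \<Sum>zs\<in>Z. g ys zs)"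
      by (rule sum.cartesian_product[symmetric])
    also have "\<dots> = (\<Sum>j\<in>V. \<Sum>l\<in>V. \<Sum>ys\<in>paths c j l. \<Sum>zs\<in>Z. g ys zs)"
      by (rule sum_path_lists)
    also have "\<dots> = (\<Sum>j\<in>V. \<Sum>l\<in>V. \<Sum>k'\<in>V. cov i j l k' * path_sum c j l * path_sum ?m' k' k)"
    proof (intro sum.cong refl)
      fix j l
      have Zsum: "(\<Sum>zs\<in>Z. g ys zs) = (\<Sum>k'\<in>V. cov i j l k' * W ((!) ys) 0 c * path_sum ?m' k' k)"
        if "ys \<in> paths c j l" for ys
      proof -
        have "(\<Sum>zs\<in>Z. g ys zs) = (\<Sum>k'\<in>V. \<Sum>zs | zs \<in> Z \<and> zs ! 0 = k'. g ys zs)"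
          by (rule sum.group[symmetric]) (auto simp: Z_def finite_path_lists finite_V intro: nth_path_list)
        also have "\<dots> = (\<Sum>k'\<in>V. cov i j l k' * W ((!) ys) 0 c * path_sum ?m' k' k)"
        proof (rule sum.cong[OF refl])
          fix k'
          have "(\<Sum>zs | zs \<in> Z \<and> zs ! 0 = k'. g ys zs) = (\<Sum>zs\<in>paths ?m' k' k. cov i j l k' * W ((!) ys) 0 c * W ((!) zs) 0 ?m')"
            using that by (intro sum.cong) (auto simp: Z_def paths_def g_def)
          then show "(\<Sum>zs | zs \<in> Z \<and> zs ! 0 = k'. g ys zs) = cov i j l k' * W ((!) ys) 0 c * path_sum ?m' k' k"
            by (simp add: path_sum_def sum_distrib_left)
        qed
        finally show ?thesis .
      qed
      have "(\<Sum>ys\<in>paths c j l. \<Sum>zs\<in>Z. g ys zs) =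
          (\<Sum>ys\<in>paths c j l. \<Sum>k'\<in>V. cov i j l k' * W ((!) ys) 0 c * path_sum ?m' k' k)"
        by (rule sum.cong[OF refl Zsum])
      also have "\<dots> = (\<Sum>k'\<in>V. \<Sum>ys\<in>paths c j l. cov i j l k' * W ((!) ys) 0 c * path_sum ?m' k' k)"
        by (rule sum.swap)
      also have "\<dots> = (\<Sum>k'\<in>V. cov i j l k' * path_sum c j l * path_sum ?m' k' k)"
        unfolding path_sum_def[of c] by (simp add: sum_distrib_left sum_distrib_right)
      finally show "(\<Sum>ys\<in>paths c j l. \<Sum>zs\<in>Z. g ys zs) =
          (\<Sum>k'\<in>V. cov i j l k' * path_sum c j l * path_sum ?m' k' k)" .
    qed
    finally show "(\<Sum>xs\<in>paths (Suc m) i k. f c xs) =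
        (\<Sum>j\<in>V. \<Sum>l\<in>V. \<Sum>k'\<in>V. cov i j l k' * path_sum c j l * path_sum ?m' k' k)" .
  qed
  finally show ?thesis .
qed

lemma sum_paths_Suc:
  assumes "i \<in> V" "k \<in> V"
  shows "(\<Sum>xs\<in>paths (Suc m) i k. Y ((!) xs) {..<Suc m} \<omega>) =
    (\<Sum>j\<in>V. (\<Sum>xs\<in>paths m i j. Y ((!) xs) {..<m} \<omega>) * X j k \<omega>)"
proof -
  let ?S = "{xs\<in>path_lists m. xs ! 0 = i}"
  have Yk: "Y ((!) (xs @ [k])) {..<Suc m} \<omega> = Y ((!) xs) {..<m} \<omega> * X (xs ! m) k \<omega>"
    if "xs \<in> path_lists m" for xs
  proof -
    have len: "length xs = Suc m" using that by (simp add: path_lists_def)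
    have "Y ((!) (xs @ [k])) {..<m} = Y ((!) xs) {..<m}"
      by (rule Y_cong) (auto simp: nth_append len)
    then show ?thesis using len by (simp add: Y_def nth_append)
  qed
  have "(\<Sum>xs\<in>paths (Suc m) i k. Y ((!) xs) {..<Suc m} \<omega>) = (\<Sum>xs\<in>?S. Y ((!) xs) {..<m} \<omega> * X (xs ! m) k \<omega>)"
  proof (rule sum.reindex_bij_witness[of _ "\<lambda>xs. xs @ [k]" "butlast"])
    fix xs assume xs: "xs \<in> paths (Suc m) i k"
    then have len: "length xs = Suc (Suc m)" and k: "xs ! Suc m = k" "xs ! 0 = i" "set xs \<subseteq> V"
      by (auto simp: paths_def path_lists_def)
    then have "last xs = k" by (metis diff_Suc_1 last_conv_nth length_0_conv nat.distinct(1))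
    then show eq: "butlast xs @ [k] = xs"
      using len by (metis append_butlast_last_id length_0_conv nat.distinct(1))
    show S: "butlast xs \<in> ?S"
      using k len by (auto simp: path_lists_def nth_butlast dest: in_set_butlastD)
    have "butlast xs \<in> path_lists m" using S by simp
    from Yk[OF this] show "Y ((!) (butlast xs)) {..<m} \<omega> * X (butlast xs ! m) k \<omega> = Y ((!) xs) {..<Suc m} \<omega>"
      unfolding eq by simp
  next
    fix xs assume "xs \<in> ?S"
    then show "butlast (xs @ [k]) = xs" "xs @ [k] \<in> paths (Suc m) i k"
      using assms by (auto simp: paths_def path_lists_def nth_append)
  qed
  also have "\<dots> = (\<Sum>j\<in>V. \<Sum>xs | xs \<in> ?S \<and> xs ! m = j. Y ((!) xs) {..<m} \<omega> * X (xs ! m) k \<omega>)"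
    by (rule sum.group[symmetric]) (auto simp: finite_path_lists finite_V intro: nth_path_list)
  also have "\<dots> = (\<Sum>j\<in>V. \<Sum>xs\<in>paths m i j. Y ((!) xs) {..<m} \<omega> * X j k \<omega>)"
    by (intro sum.cong) (auto simp: paths_def)
  finally show ?thesis by (simp add: sum_distrib_right)
qed

end

lemma (in band_ensemble) walk_trace_eq_trace_power:
  fixes A :: "complex mat"
  assumes A: "A \<in> carrier_mat n n" and f: "bij_betw f {..<n} V"
    and entries: "\<And>i j. i < n \<Longrightarrow> j < n \<Longrightarrow> A $$ (i, j) = X (f i) (f j) \<omega>"
  shows "walk_trace m \<omega> = (\<Sum>i<n. (A ^\<^sub>m m) $$ (i, i))"
proof -
  have fV: "f i \<in> V" if "i < n" for i using f that by (auto simp: bij_betw_def)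
  have inj: "f i = f j \<longleftrightarrow> i = j" if "i < n" "j < n" for i j
    using f that by (auto simp: bij_betw_def inj_on_def)
  have pow: "(A ^\<^sub>m m) $$ (i, k) = (\<Sum>xs\<in>paths m (f i) (f k). Y ((!) xs) {..<m} \<omega>)"
    if "i < n" "k < n" for i k
    using that
  proof (induction m arbitrary: k)
    case 0
    then show ?case using A inj fV by (simp add: paths_0 Y_def)
  next
    case (Suc m)
    have Am: "A ^\<^sub>m m \<in> carrier_mat n n" using A by simp
    have "(A ^\<^sub>m Suc m) $$ (i, k) = (\<Sum>j<n. (A ^\<^sub>m m) $$ (i, j) * A $$ (j, k))"
      using A Am Suc.prems by (simp add: scalar_prod_def atLeast0LessThan)
    also have "\<dots> = (\<Sum>j<n. (\<Sum>xs\<in>paths m (f i) (f j). Y ((!) xs) {..<m} \<omega>) * X (f j) (f k) \<omega>)"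
      using Suc by (intro sum.cong) (auto simp: entries)
    also have "\<dots> = (\<Sum>j\<in>V. (\<Sum>xs\<in>paths m (f i) j. Y ((!) xs) {..<m} \<omega>) * X j (f k) \<omega>)"
      by (rule sum.reindex_bij_betw[OF f])
    finally show ?case using sum_paths_Suc[OF fV fV] Suc.prems by simp
  qed
  have "walk_trace m \<omega> = (\<Sum>i\<in>V. \<Sum>xs\<in>paths m i i. Y ((!) xs) {..<m} \<omega>)"
    unfolding walk_trace_def by (rule sum_closed_walks)
  also have "\<dots> = (\<Sum>i<n. \<Sum>xs\<in>paths m (f i) (f i). Y ((!) xs) {..<m} \<omega>)"
    by (rule sum.reindex_bij_betw[OF f, symmetric])
  finally show ?thesis by (simp add: pow)
qed

section \<open>Spectral moments and weak convergence\<close>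

lemma trace_mult_comm:
  fixes A B :: "'a::comm_semiring_0 mat"
  assumes "A \<in> carrier_mat n m" "B \<in> carrier_mat m n"
  shows "(\<Sum>i<n. (A * B) $$ (i, i)) = (\<Sum>j<m. (B * A) $$ (j, j))"
proof -
  have "(\<Sum>i<n. (A * B) $$ (i, i)) = (\<Sum>i<n. \<Sum>j<m. A $$ (i, j) * B $$ (j, i))"
    using assms by (intro sum.cong) (auto simp: scalar_prod_def atLeast0LessThan)
  also have "\<dots> = (\<Sum>j<m. \<Sum>i<n. B $$ (j, i) * A $$ (i, j))"
    by (subst sum.swap) (simp add: mult.commute)
  also have "\<dots> = (\<Sum>j<m. (B * A) $$ (j, j))"
    using assms by (intro sum.cong) (auto simp: scalar_prod_def atLeast0LessThan)
  finally show ?thesis .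
qed

lemma upper_triangular_power:
  fixes B :: "'a::comm_semiring_1 mat"
  assumes B: "B \<in> carrier_mat n n" "upper_triangular B"
  shows "upper_triangular (B ^\<^sub>m m) \<and> (\<forall>i<n. (B ^\<^sub>m m) $$ (i, i) = (B $$ (i, i)) ^ m)"
proof (induction m)
  case 0
  then show ?case using B by auto
next
  case (Suc m)
  have C: "B ^\<^sub>m m \<in> carrier_mat n n" using B by simp
  have z: "(B ^\<^sub>m m) $$ (i, k) = 0" if "k < i" "i < n" for i k
    using Suc C that by auto
  have z': "B $$ (i, k) = 0" if "k < i" "i < n" for i k
    using B that by auto
  have entry: "(B ^\<^sub>m Suc m) $$ (i, j) = (\<Sum>k<n. (B ^\<^sub>m m) $$ (i, k) * B $$ (k, j))"
    if "i < n" "j < n" for i j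
    using that B C by (simp add: scalar_prod_def atLeast0LessThan)
  have "(B ^\<^sub>m Suc m) $$ (i, j) = 0" if "j < i" "i < n" for i j
  proof -
    have "(B ^\<^sub>m m) $$ (i, k) * B $$ (k, j) = 0" if "k < n" for k
      using z[of k i] z'[of j k] \<open>j < i\<close> \<open>i < n\<close> that by (cases "k < i") auto
    then show ?thesis using entry[of i j] that by simp
  qed
  moreover have "(B ^\<^sub>m Suc m) $$ (i, i) = (B $$ (i, i)) ^ Suc m" if "i < n" for i
  proof -
    have "(\<Sum>k<n. (B ^\<^sub>m m) $$ (i, k) * B $$ (k, i)) = (\<Sum>k\<in>{i}. (B ^\<^sub>m m) $$ (i, k) * B $$ (k, i))"
    proof (rule sum.mono_neutral_right)
      show "\<forall>k\<in>{..<n} - {i}. (B ^\<^sub>m m) $$ (i, k) * B $$ (k, i) = 0"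
      proof
        fix k assume "k \<in> {..<n} - {i}"
        then show "(B ^\<^sub>m m) $$ (i, k) * B $$ (k, i) = 0"
          using z[of k i] z'[of i k] \<open>i < n\<close> by (cases "k < i") auto
      qed
    qed (use that in auto)
    then show ?thesis using entry[of i i] that Suc by (simp add: mult.commute)
  qed
  ultimately show ?case using B by (auto simp: upper_triangular_def)
qed

text \<open>Schur triangularization puts the roots of the characteristic polynomial, with
  multiplicity, on the diagonal, and powers of a triangular matrix have the powers of its
  diagonal.\<close>

lemma trace_power_eq_sum_roots:
  fixes A :: "complex mat"
  assumes A: "A \<in> carrier_mat n n" and as: "char_poly A = (\<Prod>a\<leftarrow>as. [:- a, 1:])"
  shows "(\<Sum>i<n. (A ^\<^sub>m m) $$ (i, i)) = (\<Sum>a\<leftarrow>as. a ^ m)"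
proof -
  obtain B P Q where BPQ: "schur_decomposition A as = (B, P, Q)" by (metis prod_cases3)
  from schur_decomposition[OF A as BPQ] have w: "similar_mat_wit A B P Q"
    and ut: "upper_triangular B" and diag: "diag_mat B = as" by auto
  note c = similar_mat_witD2[OF A w]
  have B: "B \<in> carrier_mat n n" and P: "P \<in> carrier_mat n n" and Q: "Q \<in> carrier_mat n n"
    and QP: "Q * P = 1\<^sub>m n" using c by auto
  have Bm: "B ^\<^sub>m m \<in> carrier_mat n n" using B by simp
  have "(\<Sum>i<n. (A ^\<^sub>m m) $$ (i, i)) = (\<Sum>i<n. ((P * B ^\<^sub>m m) * Q) $$ (i, i))"
    using similar_mat_wit_pow_id[OF w, of m] by simp
  also have "\<dots> = (\<Sum>i<n. (Q * (P * B ^\<^sub>m m)) $$ (i, i))"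
    by (rule trace_mult_comm) (use P Q Bm in auto)
  also have "Q * (P * B ^\<^sub>m m) = B ^\<^sub>m m"
    using assoc_mult_mat[OF Q P Bm, symmetric] unfolding QP left_mult_one_mat[OF Bm] .
  also have "(\<Sum>i<n. (B ^\<^sub>m m) $$ (i, i)) = (\<Sum>i<n. (B $$ (i, i)) ^ m)"
    using upper_triangular_power[OF B ut, of m] by (intro sum.cong) auto
  also have "\<dots> = (\<Sum>a\<leftarrow>as. a ^ m)"
    unfolding diag[symmetric] diag_mat_def using B
    by (simp add: sum_list_distinct_conv_sum_set atLeast0LessThan o_def)
  finally show ?thesis .
qed

lemma proots_prod_linear: "proots (\<Prod>a\<leftarrow>as. [:- a, 1:]) = mset (as :: 'a::idom list)"
proof (induction as)
  case (Cons a as)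
  have "(\<Prod>a\<leftarrow>as. [:- a, 1:]) \<noteq> 0" by (auto simp: prod_list_zero_iff)
  then have "proots ([:- a, 1:] * (\<Prod>a\<leftarrow>as. [:- a, 1:])) = {#a#} + mset as"
    by (subst proots_mult) (use Cons in auto)
  then show ?case by simp
qed simp

definition hermitian_mat :: "complex mat \<Rightarrow> bool" where
  "hermitian_mat A \<longleftrightarrow> dim_row A = dim_col A \<and> (\<forall>i<dim_row A. \<forall>j<dim_row A. A $$ (j, i) = cnj (A $$ (i, j)))"

lemma hermitian_root_real:
  assumes A: "A \<in> carrier_mat n n" "hermitian_mat A" and r: "poly (char_poly A) a = 0"
  shows "a \<in> \<real>"
proof -
  from r A(1) have "eigenvalue A a" by (simp add: eigenvalue_root_char_poly)
  then obtain v where v: "v \<in> carrier_vec n" "v \<noteq> 0\<^sub>v n" "A *\<^sub>v v = a \<cdot>\<^sub>v v"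
    using A(1) by (auto simp: eigenvalue_def eigenvector_def)
  \<comment> \<open>\<open>S\<close> is the squared norm of the eigenvector and \<open>T\<close> is
    the quadratic form of \<open>A\<close> at it. Hermitian symmetry makes \<open>T\<close> real,
    and \<open>T\<close> equals \<open>a * S\<close>.\<close>
  define S where "S = (\<Sum>i<n. cnj (v $ i) * v $ i)"
  define T where "T = (\<Sum>i<n. \<Sum>j<n. cnj (v $ i) * (A $$ (i, j) * v $ j))"
  have row: "(\<Sum>j<n. A $$ (i, j) * v $ j) = a * v $ i" if "i < n" for i
  proof -
    have "(A *\<^sub>v v) $ i = (\<Sum>j<n. A $$ (i, j) * v $ j)"
      using A(1) v(1) that by (simp add: scalar_prod_def atLeast0LessThan)
    moreover have "(a \<cdot>\<^sub>v v) $ i = a * v $ i" using v(1) that by simp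
    ultimately show ?thesis using v(3) by simp
  qed
  have herm: "cnj (A $$ (i, j)) = A $$ (j, i)" if "i < n" "j < n" for i j
    using A that by (metis carrier_matD(1) hermitian_mat_def)
  have "T = (\<Sum>i<n. cnj (v $ i) * (a * v $ i))"
    unfolding T_def using row by (intro sum.cong) (auto simp flip: sum_distrib_left)
  then have T1: "T = a * S" by (simp add: S_def sum_distrib_left ac_simps)
  have "cnj T = (\<Sum>i<n. \<Sum>j<n. v $ i * (cnj (A $$ (i, j)) * cnj (v $ j)))"
    by (simp add: T_def)
  also have "\<dots> = (\<Sum>i<n. \<Sum>j<n. cnj (v $ j) * (A $$ (j, i) * v $ i))"
    by (intro sum.cong refl) (use herm in auto)
  also have "\<dots> = T" unfolding T_def by (rule sum.swap)
  finally have T2: "cnj T = T" .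
  have Sr: "S = of_real (\<Sum>i<n. (norm (v $ i))\<^sup>2)"
    unfolding S_def of_real_sum by (intro sum.cong refl) (subst complex_norm_square, rule mult.commute)
  have "S \<noteq> 0"
  proof
    assume "S = 0"
    then have "(\<Sum>i<n. (norm (v $ i))\<^sup>2) = 0" unfolding Sr by (simp only: of_real_eq_0_iff)
    then have "\<forall>i<n. v $ i = 0" by (simp add: sum_nonneg_eq_0_iff)
    then have "v = 0\<^sub>v n" using v(1) by (intro eq_vecI) auto
    with v(2) show False by simp
  qed
  have "cnj a * S = a * S" using T2 unfolding T1 complex_cnj_mult by (simp add: Sr)
  then have "cnj a = a" using \<open>S \<noteq> 0\<close> by simp
  then show ?thesis by (simp add: Reals_cnj_iff)
qed

section \<open>Averages over finite lists of reals\<close>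

definition avg :: "real list \<Rightarrow> (real \<Rightarrow> real) \<Rightarrow> real" where
  "avg ls f = (\<Sum>x\<leftarrow>ls. f x) / real (length ls)"

lemma sum_count_mset:
  fixes f :: "'b \<Rightarrow> real"
  assumes "finite X" "set xs \<subseteq> X"
  shows "(\<Sum>x\<in>X. f x * real (count (mset xs) x)) = (\<Sum>x\<leftarrow>xs. f x)"
  using assms(2)
proof (induction xs)
  case (Cons a xs)
  have "(\<Sum>x\<in>X. f x * real (count (mset (a # xs)) x)) =
      (\<Sum>x\<in>X. f x * real (count (mset xs) x) + (if a = x then f x else 0))"
    by (intro sum.cong) (auto simp: algebra_simps)
  also have "\<dots> = (\<Sum>x\<leftarrow>xs. f x) + f a"
    using Cons assms(1) by (simp add: sum.distrib)
  finally show ?case by simp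
qed simp

lemma integral_pmf_of_multiset:
  fixes f :: "'b \<Rightarrow> real"
  assumes "xs \<noteq> []"
  shows "(LINT x|measure_pmf (pmf_of_multiset (mset xs)). f x) = (\<Sum>x\<leftarrow>xs. f x) / real (length xs)"
proof -
  have "(LINT x|measure_pmf (pmf_of_multiset (mset xs)). f x) =
      (\<Sum>x\<in>set xs. f x * pmf (pmf_of_multiset (mset xs)) x)"
    using assms by (intro integral_measure_pmf_real) auto
  also have "\<dots> = (\<Sum>x\<in>set xs. f x * real (count (mset xs) x)) / real (length xs)"
    using assms by (simp add: sum_divide_distrib)
  finally show ?thesis by (simp only: sum_count_mset[OF finite_set subset_refl])
qed

definition list_distribution :: "real list \<Rightarrow> real measure" where
  "list_distribution ls = distr (measure_pmf (pmf_of_multiset (mset ls))) borel id"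

lemma real_distribution_list_distribution: "real_distribution (list_distribution ls)"
  unfolding list_distribution_def by (rule prob_space.real_distribution_distr) (simp_all add: prob_space_measure_pmf)

lemma integral_list_distribution:
  assumes "ls \<noteq> []" "f \<in> borel_measurable borel"
  shows "(LINT x|list_distribution ls. f x) = avg ls f"
  unfolding list_distribution_def using assms
  by (subst integral_distr) (auto simp: integral_pmf_of_multiset avg_def)

text \<open>The order of the roots is an arbitrary choice that \<open>avg\<close> does not
  see.\<close>

definition spectrum_list :: "complex mat \<Rightarrow> real list" where
  "spectrum_list A =
     map Re (SOME as. char_poly A = (\<Prod>a\<leftarrow>as. [:- a, 1:]) \<and> length as = dim_row A)"

lemma spectrum_list:
  assumes A: "A \<in> carrier_mat n n" "n > 0"
  shows "length (spectrum_list A) = n" "spectrum_list A \<noteq> []"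
    and "f \<in> borel_measurable borel \<Longrightarrow> (LINT x|empirical_distribution A. f x) = avg (spectrum_list A) f"
    and "hermitian_mat A \<Longrightarrow> avg (spectrum_list A) (\<lambda>x. x ^ m) = Re (\<Sum>i<n. (A ^\<^sub>m m) $$ (i, i)) / real n"
    and "hermitian_mat A \<Longrightarrow> (\<Sum>i<n. (A ^\<^sub>m m) $$ (i, i)) \<in> \<real>"
proof -
  define as where "as = (SOME as. char_poly A = (\<Prod>a\<leftarrow>as. [:- a, 1:]) \<and> length as = dim_row A)"
  have "\<exists>as. char_poly A = (\<Prod>a\<leftarrow>as. [:- a, 1:]) \<and> length as = dim_row A"
    using char_poly_factorized[OF A(1)] A(1) by auto
  from someI_ex[OF this] have as: "char_poly A = (\<Prod>a\<leftarrow>as. [:- a, 1:])" "length as = n"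
    using A(1) by (auto simp: as_def)
  have sl: "spectrum_list A = map Re as" by (simp add: spectrum_list_def as_def)
  show "length (spectrum_list A) = n" "spectrum_list A \<noteq> []" using as A(2) sl by auto
  show "(LINT x|empirical_distribution A. f x) = avg (spectrum_list A) f" if "f \<in> borel_measurable borel"
  proof -
    have "as \<noteq> []" using as A(2) by auto
    have "(LINT x|empirical_distribution A. f x) =
        (LINT a|measure_pmf (pmf_of_multiset (mset as)). f (Re a))"
      unfolding empirical_distribution_def as(1) proots_prod_linear using that
      by (subst integral_distr) auto
    also have "\<dots> = avg (spectrum_list A) f"
      using integral_pmf_of_multiset[OF \<open>as \<noteq> []\<close>, of "\<lambda>a. f (Re a)"] by (simp add: avg_def sl o_def)
    finally show ?thesis .
  qed
  assume h: "hermitian_mat A"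
  have real: "a \<in> \<real>" if "a \<in> set as" for a
  proof (rule hermitian_root_real[OF A(1) h])
    have "a \<in># proots (char_poly A)" using that as(1) proots_prod_linear by (metis set_mset_mset)
    then show "poly (char_poly A) a = 0"
      by (metis count_eq_zero_iff count_proots order_root proots_0 count_empty)
  qed
  have tr: "(\<Sum>i<n. (A ^\<^sub>m m) $$ (i, i)) = of_real (\<Sum>a\<leftarrow>as. Re a ^ m)"
  proof -
    have "(\<Sum>a\<leftarrow>as. a ^ m) = (\<Sum>a\<leftarrow>as. of_real (Re a ^ m))"
      using real by (intro arg_cong[where f = sum_list] map_cong) (auto elim!: Reals_cases)
    also have "\<dots> = of_real (\<Sum>a\<leftarrow>as. Re a ^ m)" by (induction as) auto
    finally show ?thesis using trace_power_eq_sum_roots[OF A(1) as(1), of m] by simp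
  qed
  show "avg (spectrum_list A) (\<lambda>x. x ^ m) = Re (\<Sum>i<n. (A ^\<^sub>m m) $$ (i, i)) / real n"
    unfolding tr using as by (simp add: avg_def sl o_def)
  show "(\<Sum>i<n. (A ^\<^sub>m m) $$ (i, i)) \<in> \<real>" unfolding tr by simp
qed

lemma avg_add: "avg ls (\<lambda>x. f x + g x) = avg ls f + avg ls g"
  by (simp add: avg_def sum_list_addf add_divide_distrib)

lemma avg_cmult: "avg ls (\<lambda>x. c * f x) = c * avg ls f"
  by (simp add: avg_def sum_list_const_mult)

lemma avg_const: "ls \<noteq> [] \<Longrightarrow> avg ls (\<lambda>x. c) = c"
  by (simp add: avg_def sum_list_triv)

lemma avg_mono: "(\<And>x. f x \<le> g x) \<Longrightarrow> avg ls f \<le> avg ls g"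
  unfolding avg_def by (intro divide_right_mono sum_list_mono) auto

lemma abs_avg_le: "\<bar>avg ls f\<bar> \<le> avg ls (\<lambda>x. \<bar>f x\<bar>)"
  unfolding avg_def by (simp add: divide_right_mono sum_list_abs[of "map f ls", simplified o_def map_map])

lemma avg_diff: "avg ls (\<lambda>x. f x - g x) = avg ls f - avg ls g"
  by (simp add: avg_def sum_list_subtractf diff_divide_distrib)

lemma avg_sum: "finite I \<Longrightarrow> avg ls (\<lambda>x. \<Sum>i\<in>I. f i x) = (\<Sum>i\<in>I. avg ls (f i))"
  by (induction I rule: finite_induct) (simp_all add: avg_add, simp add: avg_def)

lemma polynomial_approximation:
  fixes f :: "real \<Rightarrow> real"
  assumes "continuous_on UNIV f" "e > 0"
  shows "\<exists>a d. \<forall>x\<in>{-b..b}. \<bar>f x - (\<Sum>i\<le>d. a i * x ^ i)\<bar> < e"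
proof -
  obtain g where g: "polynomial_function g" "\<forall>x\<in>{-b..b}. norm (f x - g x) < e"
    using Stone_Weierstrass_polynomial_function[of "{-b..b}" f e] assms continuous_on_subset by blast
  then obtain a d where "g = (\<lambda>x. \<Sum>i\<le>d. a i * x ^ i)"
    using real_polynomial_function_eq real_polynomial_function_iff_sum by metis
  with g show ?thesis by auto
qed

text \<open>A quantitative moment method. A polynomial approximates \<open>f\<close> on a fixed
  interval larger than the growth rate \<open>C\<close>, and a high even moment controls the error
  outside it. Comparing two lists, rather than a list and a measure, avoids unbounded test functions
  on a limit that is only known through bounded ones.\<close>

lemma moments_determine_averages:
  fixes f :: "real \<Rightarrow> real"
  assumes mu: "\<And>m. \<bar>\<mu> m\<bar> \<le> 2 * C ^ m" and C: "C \<ge> 1"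
    and f: "continuous_on UNIV f" "bounded (range f)" and e: "e > 0"
  shows "\<exists>K \<delta>. \<delta> > 0 \<and> (\<forall>ls ls'. ls \<noteq> [] \<longrightarrow> ls' \<noteq> [] \<longrightarrow>
    (\<forall>m\<le>K. \<bar>avg ls (\<lambda>x. x ^ m) - \<mu> m\<bar> \<le> \<delta>) \<longrightarrow> (\<forall>m\<le>K. \<bar>avg ls' (\<lambda>x. x ^ m) - \<mu> m\<bar> \<le> \<delta>) \<longrightarrow>
    \<bar>avg ls f - avg ls' f\<bar> \<le> e)"
proof -
  \<comment> \<open>Any value above \<open>C\<close> serves: the mass beyond \<open>b\<close>,
    weighted by powers, is suppressed by \<open>(C / b) ^ (2 * k)\<close>.\<close>
  define b where "b = C + 1"
  have b: "b > 1" "0 < b" "C < b" using C by (auto simp: b_def)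
  obtain F where F: "\<And>x. \<bar>f x\<bar> \<le> F" using f(2) by (auto simp: bounded_iff)
  have F0: "0 \<le> F" using F[of 0] by linarith
  obtain a d where ad: "\<And>x. x \<in> {-b..b} \<Longrightarrow> \<bar>f x - (\<Sum>i\<le>d. a i * x ^ i)\<bar> < e / 8"
    using polynomial_approximation[OF f(1) divide_pos_pos[OF e, of 8], of b] by fastforce
  define p where "p x = (\<Sum>i\<le>d. a i * x ^ i)" for x :: real
  define A where "A = (\<Sum>i\<le>d. \<bar>a i\<bar>)"
  have A0: "0 \<le> A" by (auto simp: A_def sum_nonneg)
  define G where "G = F + A"
  have G0: "0 \<le> G" using A0 F0 by (simp add: G_def)
  have "(\<lambda>k. 3 * G * b ^ d * ((C / b)\<^sup>2) ^ k) \<longlonglongrightarrow> 3 * G * b ^ d * 0"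
    using b C by (intro tendsto_mult tendsto_const LIMSEQ_realpow_zero) (auto simp: power_less_one_iff)
  then have "eventually (\<lambda>k. 3 * G * b ^ d * ((C / b)\<^sup>2) ^ k < e / 8) sequentially"
    using e by (intro order_tendstoD(2)) auto
  then have "eventually (\<lambda>k. 3 * G * b ^ d * ((C / b)\<^sup>2) ^ k < e / 8 \<and> k \<ge> d) sequentially"
    using eventually_ge_at_top by (rule eventually_conj)
  then obtain k where k: "3 * G * b ^ d * ((C / b)\<^sup>2) ^ k < e / 8" "d \<le> k"
    using eventually_happens'[OF sequentially_bot] by blast
  define \<delta> where "\<delta> = min 1 (e / (8 * (A + 1)))"
  have \<delta>: "0 < \<delta>" "\<delta> \<le> 1" "A * \<delta> \<le> e / 8"
  proof -
    show "0 < \<delta>" "\<delta> \<le> 1" using e A0 by (auto simp: \<delta>_def)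
    have "A * \<delta> \<le> A * (e / (8 * (A + 1)))" using A0 by (intro mult_left_mono) (auto simp: \<delta>_def)
    also have "\<dots> = (A / (A + 1)) * (e / 8)" using A0 by (simp add: field_simps)
    also have "\<dots> \<le> 1 * (e / 8)" using A0 e by (intro mult_right_mono) auto
    finally show "A * \<delta> \<le> e / 8" by simp
  qed
  \<comment> \<open>Outside the interval both \<open>f\<close> and \<open>p\<close> are of order
    \<open>\<bar>x\<bar> ^ d\<close>, and this is at most \<open>b ^ d * (x / b) ^ (2 * k)\<close>
    because \<open>b \<le> \<bar>x\<bar>\<close> and \<open>d \<le> 2 * k\<close>.\<close>
  have pt: "\<bar>f x - p x\<bar> \<le> e / 8 + G * b ^ d / b ^ (2 * k) * x ^ (2 * k)" for x
  proof (cases "x \<in> {-b..b}")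
    case True
    have "0 \<le> G * b ^ d / b ^ (2 * k) * x ^ (2 * k)"
      using G0 b by (intro mult_nonneg_nonneg divide_nonneg_nonneg zero_le_power zero_le_even_power) auto
    then show ?thesis using ad[OF True] unfolding p_def by linarith
  next
    case False
    then have x: "b \<le> \<bar>x\<bar>" by auto
    then have x1: "1 \<le> \<bar>x\<bar>" using b by linarith
    have "\<bar>p x\<bar> \<le> (\<Sum>i\<le>d. \<bar>a i\<bar> * \<bar>x\<bar> ^ i)"
      unfolding p_def by (rule order_trans[OF sum_abs]) (simp add: abs_mult power_abs)
    also have "\<dots> \<le> (\<Sum>i\<le>d. \<bar>a i\<bar> * \<bar>x\<bar> ^ d)"
      using x1 by (intro sum_mono mult_left_mono power_increasing) auto
    also have "\<dots> = A * \<bar>x\<bar> ^ d" by (simp add: A_def sum_distrib_right)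
    finally have p: "\<bar>p x\<bar> \<le> A * \<bar>x\<bar> ^ d" .
    have "\<bar>f x\<bar> \<le> F * \<bar>x\<bar> ^ d"
      using mult_left_mono[OF one_le_power[OF x1, of d] F0] F[of x] by linarith
    then have "\<bar>f x - p x\<bar> \<le> G * \<bar>x\<bar> ^ d" using p by (simp add: G_def algebra_simps)
    also have "\<dots> \<le> G * (b ^ d / b ^ (2 * k) * x ^ (2 * k))"
    proof (intro mult_left_mono G0)
      have split: "y ^ (2 * k) = y ^ d * y ^ (2 * k - d)" for y :: real
        using k(2) power_add[of y d "2 * k - d"] by simp
      have "b ^ (2 * k) * \<bar>x\<bar> ^ d = b ^ d * \<bar>x\<bar> ^ d * b ^ (2 * k - d)"
        unfolding split[of b] by (simp only: ac_simps)
      also have "\<dots> \<le> b ^ d * \<bar>x\<bar> ^ d * \<bar>x\<bar> ^ (2 * k - d)"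
        using x b by (intro mult_left_mono power_mono) auto
      also have "\<dots> = b ^ d * \<bar>x\<bar> ^ (2 * k)"
        unfolding split[of "\<bar>x\<bar>"] by (simp only: ac_simps)
      also have "\<bar>x\<bar> ^ (2 * k) = x ^ (2 * k)" by (rule power_even_abs) simp
      finally show "\<bar>x\<bar> ^ d \<le> b ^ d / b ^ (2 * k) * x ^ (2 * k)"
        using b(2) by (simp add: pos_le_divide_eq mult.commute)
    qed
    finally show ?thesis using e by (simp add: mult.assoc)
  qed
  have one: "\<bar>avg ls f - avg ls p\<bar> \<le> e / 4"
    if ls: "ls \<noteq> []" "\<forall>m\<le>max d (2 * k). \<bar>avg ls (\<lambda>x. x ^ m) - \<mu> m\<bar> \<le> \<delta>" for ls
  proof -
    \<comment> \<open>The factor \<open>3\<close> below is \<open>2\<close> from the moment bound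
      plus \<open>1\<close> for the deviation, since
      \<open>\<delta> \<le> 1 \<le> C ^ (2 * k)\<close>.\<close>
    have C2k: "1 \<le> C ^ (2 * k)" using C by (rule one_le_power)
    have "\<bar>avg ls (\<lambda>x. x ^ (2 * k)) - \<mu> (2 * k)\<bar> \<le> \<delta>" using ls by auto
    then have m: "avg ls (\<lambda>x. x ^ (2 * k)) \<le> 3 * C ^ (2 * k)" using mu[of "2 * k"] \<delta>(2) C2k by linarith
    have "\<bar>avg ls f - avg ls p\<bar> \<le> avg ls (\<lambda>x. \<bar>f x - p x\<bar>)"
      using abs_avg_le[of ls "\<lambda>x. f x - p x"] by (simp add: avg_diff)
    also have "\<dots> \<le> avg ls (\<lambda>x. e / 8 + G * b ^ d / b ^ (2 * k) * x ^ (2 * k))"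
      by (intro avg_mono pt)
    also have "\<dots> = e / 8 + G * b ^ d / b ^ (2 * k) * avg ls (\<lambda>x. x ^ (2 * k))"
      unfolding avg_add avg_cmult avg_const[OF ls(1)] ..
    also have "\<dots> \<le> e / 8 + G * b ^ d / b ^ (2 * k) * (3 * C ^ (2 * k))"
      using G0 b m by (intro add_left_mono mult_left_mono) auto
    also have "G * b ^ d / b ^ (2 * k) * (3 * C ^ (2 * k)) = 3 * G * b ^ d * ((C / b)\<^sup>2) ^ k"
      by (simp add: power_divide power_mult)
    finally show ?thesis using k(1) by linarith
  qed
  have "\<bar>avg ls f - avg ls' f\<bar> \<le> e"
    if ls: "ls \<noteq> []" "\<forall>m\<le>max d (2 * k). \<bar>avg ls (\<lambda>x. x ^ m) - \<mu> m\<bar> \<le> \<delta>"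
      and ls': "ls' \<noteq> []" "\<forall>m\<le>max d (2 * k). \<bar>avg ls' (\<lambda>x. x ^ m) - \<mu> m\<bar> \<le> \<delta>" for ls ls'
  proof -
    have avgp: "avg ls p = (\<Sum>i\<le>d. a i * avg ls (\<lambda>x. x ^ i))" for ls
      unfolding p_def by (simp add: avg_sum avg_cmult)
    have "\<bar>avg ls p - avg ls' p\<bar> \<le> (\<Sum>i\<le>d. \<bar>a i * (avg ls (\<lambda>x. x ^ i) - avg ls' (\<lambda>x. x ^ i))\<bar>)"
      unfolding avgp sum_subtractf[symmetric] right_diff_distrib[symmetric] by (rule sum_abs)
    also have "\<dots> \<le> (\<Sum>i\<le>d. \<bar>a i\<bar> * (2 * \<delta>))"
      unfolding abs_mult
    proof (intro sum_mono mult_left_mono)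
      fix i assume "i \<in> {..d}"
      then have "i \<le> max d (2 * k)" by auto
      then have "\<bar>avg ls (\<lambda>x. x ^ i) - \<mu> i\<bar> \<le> \<delta>" "\<bar>avg ls' (\<lambda>x. x ^ i) - \<mu> i\<bar> \<le> \<delta>"
        using ls ls' by auto
      then show "\<bar>avg ls (\<lambda>x. x ^ i) - avg ls' (\<lambda>x. x ^ i)\<bar> \<le> 2 * \<delta>" by linarith
    qed auto
    also have "\<dots> = 2 * (A * \<delta>)" by (simp add: A_def flip: sum_distrib_right)
    finally show ?thesis using one[OF ls] one[OF ls'] \<delta>(3) by linarith
  qed
  then show ?thesis using \<delta>(1) by (intro exI[of _ "max d (2 * k)"] exI[of _ \<delta>]) blast
qed

text \<open>Chebyshev's inequality, with the half-open interval that the definition of tightness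
  uses.\<close>

lemma measure_list_distribution_ge:
  assumes ls: "ls \<noteq> []" and R: "R > 0"
  shows "measure (list_distribution ls) {-R<..R} \<ge> 1 - avg ls (\<lambda>x. x\<^sup>2) / R\<^sup>2"
proof -
  interpret real_distribution "list_distribution ls" by (rule real_distribution_list_distribution)
  have "measure (list_distribution ls) {-R<..R} = (LINT x|list_distribution ls. indicat_real {-R<..R} x)"
    by simp
  also have "\<dots> = avg ls (indicat_real {-R<..R})"
    by (rule integral_list_distribution[OF ls]) simp
  also have "\<dots> \<ge> avg ls (\<lambda>x. 1 - (1 / R\<^sup>2) * x\<^sup>2)"
  proof (rule avg_mono)
    fix x
    show "1 - (1 / R\<^sup>2) * x\<^sup>2 \<le> indicat_real {-R<..R} x"
    proof (cases "x \<in> {-R<..R}")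
      case False
      then have "R \<le> \<bar>x\<bar>" by auto
      then have "R\<^sup>2 \<le> x\<^sup>2" using R by (metis abs_le_square_iff abs_of_pos)
      then show ?thesis using False R by (simp add: field_simps)
    qed simp
  qed
  also have "avg ls (\<lambda>x. 1 - (1 / R\<^sup>2) * x\<^sup>2) = 1 - avg ls (\<lambda>x. x\<^sup>2) / R\<^sup>2"
    unfolding avg_diff avg_const[OF ls] avg_cmult by simp
  finally show ?thesis .
qed

text \<open>Convergent second moments are bounded, which gives tightness and hence a weakly
  convergent subsequence. Any such limit point is good enough as a candidate.\<close>

lemma exists_limit_measure:
  assumes ne: "\<And>j. ls j \<noteq> []" and lim: "\<And>m. (\<lambda>j. avg (ls j) (\<lambda>x. x ^ m)) \<longlonglongrightarrow> \<mu> m"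
  shows "\<exists>\<nu> r. real_distribution \<nu> \<and> strict_mono (r :: nat \<Rightarrow> nat) \<and>
    (\<forall>f. continuous_on UNIV f \<longrightarrow> bounded (range f) \<longrightarrow> (\<lambda>j. avg (ls (r j)) f) \<longlonglongrightarrow> (LINT x|\<nu>. f x))"
proof -
  let ?L = "\<lambda>j. list_distribution (ls j)"
  have "Bseq (\<lambda>j. avg (ls j) (\<lambda>x. x ^ 2))" using lim convergentI convergent_imp_Bseq by blast
  then obtain S where S: "S > 0" "\<And>j. avg (ls j) (\<lambda>x. x\<^sup>2) \<le> S"
    by (auto elim!: BseqE) (meson abs_le_D1)
  have "tight ?L"
    unfolding tight_def
  proof (intro conjI allI impI)
    fix e :: real assume e: "e > 0"
    define R where "R = sqrt (S / e) + 1"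
    have "0 \<le> sqrt (S / e)" using S e by simp
    then have R: "R > 0" "R > sqrt (S / e)" unfolding R_def by linarith+
    have "S / e < R\<^sup>2" 
      using power_strict_mono[OF R(2) \<open>0 \<le> sqrt (S / e)\<close>, of 2] S e by simp
    then have "S / R\<^sup>2 < e" using e R by (simp add: field_simps)
    show "\<exists>a b. a < b \<and> (\<forall>n. 1 - e < measure (?L n) {a<..b})"
    proof (intro exI conjI allI)
      show "- R < R" using R by simp
      fix n
      have "avg (ls n) (\<lambda>x. x\<^sup>2) / R\<^sup>2 \<le> S / R\<^sup>2" by (intro divide_right_mono S) simp
      then show "1 - e < measure (?L n) {-R<..R}"
        using measure_list_distribution_ge[OF ne R(1), of n] \<open>S / R\<^sup>2 < e\<close> by linarith
    qed
  qed (rule real_distribution_list_distribution)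
  from tight_imp_convergent_subsubsequence[OF this, of id] obtain r \<nu>
    where r: "strict_mono r" "real_distribution \<nu>" "weak_conv_m (?L \<circ> id \<circ> r) \<nu>"
    by (auto simp: strict_mono_def)
  have "(\<lambda>j. avg (ls (r j)) f) \<longlonglongrightarrow> (LINT x|\<nu>. f x)"
    if f: "continuous_on UNIV f" "bounded (range f)" for f
  proof -
    obtain B where B: "\<And>x. norm (f x) \<le> B" using f(2) by (auto simp: bounded_iff)
    have "weak_conv_m (\<lambda>j. ?L (r j)) \<nu>" using r(3) by (simp add: o_def)
    then have "(\<lambda>j. integral\<^sup>L (?L (r j)) f) \<longlonglongrightarrow> integral\<^sup>L \<nu> f"
    proof (rule weak_conv_imp_integral_bdd_continuous_conv[rotated 2])
      show "isCont f x" for x using f(1) by (simp add: continuous_on_eq_continuous_at)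
    qed (use real_distribution_list_distribution r(2) B in auto)
    then show ?thesis
      using integral_list_distribution[OF ne borel_measurable_continuous_onI[OF f(1)]] by simp
  qed
  with r show ?thesis by blast
qed

text \<open>The average of \<open>f\<close> is a pointwise limit of averages of polynomials, the
  \<open>n\<close>-th one approximating \<open>f\<close> on the interval from \<open>-n\<close> to
  \<open>n\<close>; each list is finite and eventually lies inside. So measurability of the moments
  suffices, without measurability of single eigenvalues.\<close>

lemma borel_measurable_avg:
  fixes f :: "real \<Rightarrow> real"
  assumes meas: "\<And>m. (\<lambda>\<omega>. avg (L \<omega>) (\<lambda>x. x ^ m)) \<in> borel_measurable M"
    and ne: "\<And>\<omega>. \<omega> \<in> space M \<Longrightarrow> L \<omega> \<noteq> []" and f: "continuous_on UNIV f"
  shows "(\<lambda>\<omega>. avg (L \<omega>) f) \<in> borel_measurable M"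
proof -
  have "\<forall>n::nat. \<exists>p::nat \<times> (nat \<Rightarrow> real). \<forall>x\<in>{-real n..real n}. \<bar>f x - (\<Sum>i\<le>fst p. snd p i * x ^ i)\<bar> < 1 / real (Suc n)"
    using polynomial_approximation[OF f, of "1 / real (Suc _)" "real _"] by fastforce
  then obtain p where p: "\<And>n x. x \<in> {-real n..real n} \<Longrightarrow>
      \<bar>f x - (\<Sum>i\<le>fst (p n). snd (p n) i * x ^ i)\<bar> < 1 / real (Suc n)"
    by metis
  define g where "g n \<omega> = avg (L \<omega>) (\<lambda>x. \<Sum>i\<le>fst (p n). snd (p n) i * x ^ i)" for n \<omega>
  show ?thesis
  proof (rule borel_measurable_LIMSEQ_real)
    show "g n \<in> borel_measurable M" for n
      unfolding g_def[abs_def] avg_sum[OF finite_atMost] avg_cmult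
      by (intro borel_measurable_sum borel_measurable_times borel_measurable_const meas)
    fix \<omega> assume \<omega>: "\<omega> \<in> space M"
    obtain n0 :: nat where n0: "Max (abs ` set (L \<omega>)) \<le> real n0" using real_arch_simple by blast
    have n0': "\<bar>x\<bar> \<le> real n0" if "x \<in> set (L \<omega>)" for x
      by (rule order_trans[OF Max_ge n0]) (use that in auto)
    have "\<bar>g n \<omega> - avg (L \<omega>) f\<bar> \<le> 1 / real (Suc n)" if n: "n \<ge> n0" for n
    proof -
      let ?q = "\<lambda>x. \<Sum>i\<le>fst (p n). snd (p n) i * x ^ i"
      have "\<bar>g n \<omega> - avg (L \<omega>) f\<bar> \<le> avg (L \<omega>) (\<lambda>x. \<bar>?q x - f x\<bar>)"
        unfolding g_def avg_diff[symmetric] by (rule abs_avg_le)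
      also have "\<dots> \<le> (\<Sum>x\<leftarrow>L \<omega>. 1 / real (Suc n)) / real (length (L \<omega>))"
        unfolding avg_def
      proof (intro divide_right_mono sum_list_mono)
        fix x assume "x \<in> set (L \<omega>)"
        then have "\<bar>x\<bar> \<le> real n" using n0' n by (meson of_nat_mono order_trans)
        then have "x \<in> {-real n..real n}" by auto
        from p[OF this] show "\<bar>?q x - f x\<bar> \<le> 1 / real (Suc n)" by linarith
      qed auto
      also have "\<dots> = 1 / real (Suc n)" using ne[OF \<omega>] by (simp add: sum_list_triv)
      finally show ?thesis .
    qed
    then have "eventually (\<lambda>n. norm (g n \<omega> - avg (L \<omega>) f) \<le> 1 / real (Suc n)) sequentially"
      by (intro eventually_sequentiallyI[of n0]) auto
    then have "(\<lambda>n. g n \<omega> - avg (L \<omega>) f) \<longlonglongrightarrow> 0"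
      by (rule Lim_null_comparison) (rule LIMSEQ_Suc[OF lim_1_over_n])
    then show "(\<lambda>n. g n \<omega>) \<longlonglongrightarrow> avg (L \<omega>) f" by (simp add: LIM_zero_iff)
  qed
qed

text \<open>A union bound. As the spaces \<open>M N\<close> are unrelated, the outcome is sought in
  a single space whose exceptional probabilities add up to less than \<open>1\<close>.\<close>

lemma ex_point_outside_small_sets:
  fixes S :: "'i \<Rightarrow> nat \<Rightarrow> 'a set"
  assumes I: "finite I" and prob: "\<And>N. N \<ge> 1 \<Longrightarrow> prob_space (M N)"
    and S: "\<And>i N. i \<in> I \<Longrightarrow> N \<ge> 1 \<Longrightarrow> S i N \<in> sets (M N)"
    and lim: "\<And>i. i \<in> I \<Longrightarrow> (\<lambda>N. measure (M N) (S i N)) \<longlonglongrightarrow> 0"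
  shows "\<exists>N\<ge>1. \<exists>\<omega>\<in>space (M N). \<forall>i\<in>I. \<omega> \<notin> S i N"
proof -
  have "(\<lambda>N. \<Sum>i\<in>I. measure (M N) (S i N)) \<longlonglongrightarrow> (\<Sum>i\<in>I. 0)"
    by (intro tendsto_sum lim)
  then have "eventually (\<lambda>N. (\<Sum>i\<in>I. measure (M N) (S i N)) < 1) sequentially"
    by (intro order_tendstoD(2)) auto
  then have "eventually (\<lambda>N. (\<Sum>i\<in>I. measure (M N) (S i N)) < 1 \<and> N \<ge> 1) sequentially"
    using eventually_ge_at_top by (rule eventually_conj)
  then obtain N where N: "(\<Sum>i\<in>I. measure (M N) (S i N)) < 1" "N \<ge> 1"
    using eventually_happens'[OF sequentially_bot] by blast
  interpret prob_space "M N" by (rule prob[OF N(2)])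
  have "measure (M N) (\<Union>i\<in>I. S i N) \<le> (\<Sum>i\<in>I. measure (M N) (S i N))"
    using I S N by (intro finite_measure_subadditive_finite) auto
  then have "(\<Union>i\<in>I. S i N) \<noteq> space (M N)" using N(1) prob_space by auto
  moreover have "(\<Union>i\<in>I. S i N) \<subseteq> space (M N)" using sets.sets_into_space[OF S[OF _ N(2)]] by auto
  ultimately show ?thesis using N(2) by (intro exI[of _ N]) auto
qed

section \<open>From convergence of moments in probability to the weak limit\<close>

locale spectral_moments =
  fixes M :: "nat \<Rightarrow> 'a measure" and A :: "nat \<Rightarrow> 'a \<Rightarrow> complex mat" and n :: "nat \<Rightarrow> nat" and \<mu> :: "nat \<Rightarrow> real"
  assumes prob: "\<And>N. N \<ge> 1 \<Longrightarrow> prob_space (M N)"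
    and carrier: "\<And>N \<omega>. N \<ge> 1 \<Longrightarrow> \<omega> \<in> space (M N) \<Longrightarrow> A N \<omega> \<in> carrier_mat (n N) (n N)"
    and pos: "\<And>N. N \<ge> 1 \<Longrightarrow> n N > 0"
    and measurable_moment: "\<And>N m. N \<ge> 1 \<Longrightarrow> (\<lambda>\<omega>. avg (spectrum_list (A N \<omega>)) (\<lambda>x. x ^ m)) \<in> borel_measurable (M N)"
    and moments: "\<And>m \<epsilon>. \<epsilon> > 0 \<Longrightarrow>
      (\<lambda>N. measure (M N) {\<omega> \<in> space (M N). \<bar>avg (spectrum_list (A N \<omega>)) (\<lambda>x. x ^ m) - \<mu> m\<bar> > \<epsilon>}) \<longlonglongrightarrow> 0"
begin

abbreviation T :: "nat \<Rightarrow> 'a \<Rightarrow> (real \<Rightarrow> real) \<Rightarrow> real" where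
  "T N \<omega> \<equiv> avg (spectrum_list (A N \<omega>))"

definition bad :: "real \<Rightarrow> nat \<Rightarrow> nat \<Rightarrow> 'a set" where
  "bad \<epsilon> m N = {\<omega> \<in> space (M N). \<bar>T N \<omega> (\<lambda>x. x ^ m) - \<mu> m\<bar> > \<epsilon>}"

lemma bad_sets: "N \<ge> 1 \<Longrightarrow> bad \<epsilon> m N \<in> sets (M N)"
  unfolding bad_def using measurable_moment[of N m] by measurable

lemma spectrum_ne: "N \<ge> 1 \<Longrightarrow> \<omega> \<in> space (M N) \<Longrightarrow> spectrum_list (A N \<omega>) \<noteq> []"
  using spectrum_list(2)[OF carrier pos] by blast

lemma integral_eq_avg:
  assumes "N \<ge> 1" "\<omega> \<in> space (M N)" "continuous_on UNIV f"
  shows "(LINT x|empirical_distribution (A N \<omega>). f x) = T N \<omega> f"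
  using spectrum_list(3)[OF carrier pos] assms borel_measurable_continuous_onI by blast

text \<open>The deterministic measures obtained by fixing suitable outcomes provide candidates for the weak
  limit.\<close>

lemma exists_list_sequence:
  "\<exists>ls. (\<forall>j. ls j \<noteq> []) \<and> (\<forall>m. (\<lambda>j. avg (ls j) (\<lambda>x. x ^ m)) \<longlonglongrightarrow> \<mu> m)"
proof -
  have "\<exists>l. l \<noteq> [] \<and> (\<forall>m\<le>j. \<bar>avg l (\<lambda>x. x ^ m) - \<mu> m\<bar> \<le> 1 / real (Suc j))" for j
  proof -
    have "\<exists>N\<ge>1. \<exists>\<omega>\<in>space (M N). \<forall>m\<in>{..j}. \<omega> \<notin> bad (1 / real (Suc j)) m N"
    proof (rule ex_point_outside_small_sets)
      show "(\<lambda>N. measure (M N) (bad (1 / real (Suc j)) m N)) \<longlonglongrightarrow> 0" for m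
        unfolding bad_def by (rule moments) simp
    qed (auto simp: prob bad_sets)
    then obtain N \<omega> where N: "N \<ge> 1" "\<omega> \<in> space (M N)" "\<forall>m\<in>{..j}. \<omega> \<notin> bad (1 / real (Suc j)) m N" by blast
    then show ?thesis using spectrum_ne[OF N(1,2)]
      by (intro exI[of _ "spectrum_list (A N \<omega>)"]) (auto simp: bad_def not_less)
  qed
  then obtain ls where ls: "\<And>j. ls j \<noteq> []"
    "\<And>j m. m \<le> j \<Longrightarrow> \<bar>avg (ls j) (\<lambda>x. x ^ m) - \<mu> m\<bar> \<le> 1 / real (Suc j)" by metis
  have "(\<lambda>j. avg (ls j) (\<lambda>x. x ^ m)) \<longlonglongrightarrow> \<mu> m" for m
  proof -
    have "eventually (\<lambda>j. norm (avg (ls j) (\<lambda>x. x ^ m) - \<mu> m) \<le> 1 / real (Suc j)) sequentially"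
      using ls(2) by (intro eventually_sequentiallyI[of m]) auto
    then have "(\<lambda>j. avg (ls j) (\<lambda>x. x ^ m) - \<mu> m) \<longlonglongrightarrow> 0"
      by (rule Lim_null_comparison) (rule LIMSEQ_Suc[OF lim_1_over_n])
    then show ?thesis by (simp add: LIM_zero_iff)
  qed
  with ls(1) show ?thesis by blast
qed

text \<open>One fixed list \<open>ls j\<close> serves as intermediary: its average of
  \<open>f\<close> is close to the integral, and any spectrum with nearly correct low moments has
  nearly the same average as that list. What remains is the probability that one of finitely many
  moments deviates.\<close>

lemma weakly_in_probability_limit:
  assumes mu: "\<And>m. \<bar>\<mu> m\<bar> \<le> 2 * C ^ m" "C \<ge> 1"
    and ls: "\<And>j. ls j \<noteq> []" "\<And>m. (\<lambda>j. avg (ls j) (\<lambda>x. x ^ m)) \<longlonglongrightarrow> \<mu> m"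
    and lim: "\<And>f. continuous_on UNIV f \<Longrightarrow> bounded (range f) \<Longrightarrow> (\<lambda>j. avg (ls j) f) \<longlonglongrightarrow> (LINT x|\<nu>. f x)"
  shows "weakly_in_probability M (\<lambda>N \<omega>. empirical_distribution (A N \<omega>)) \<nu>"
  unfolding weakly_in_probability_def
proof (intro allI impI, elim conjE)
  fix f :: "real \<Rightarrow> real" and \<epsilon> :: real
  assume f: "continuous_on UNIV f" "bounded (range f)" and e: "\<epsilon> > 0"
  obtain K \<delta> where K: "\<delta> > 0" "\<And>l l'. l \<noteq> [] \<Longrightarrow> l' \<noteq> [] \<Longrightarrow>
      (\<forall>m\<le>K. \<bar>avg l (\<lambda>x. x ^ m) - \<mu> m\<bar> \<le> \<delta>) \<Longrightarrow> (\<forall>m\<le>K. \<bar>avg l' (\<lambda>x. x ^ m) - \<mu> m\<bar> \<le> \<delta>) \<Longrightarrow>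
      \<bar>avg l f - avg l' f\<bar> \<le> \<epsilon> / 2"
    using moments_determine_averages[OF mu f half_gt_zero[OF e]] by blast
  have "eventually (\<lambda>j. \<forall>m\<in>{..K}. dist (avg (ls j) (\<lambda>x. x ^ m)) (\<mu> m) < \<delta>) sequentially"
    by (intro eventually_ball_finite ballI tendstoD[OF ls(2)] K(1)) simp
  moreover have "eventually (\<lambda>j. dist (avg (ls j) f) (LINT x|\<nu>. f x) < \<epsilon> / 2) sequentially"
    by (intro tendstoD[OF lim[OF f]] half_gt_zero e)
  ultimately have "eventually (\<lambda>j. (\<forall>m\<in>{..K}. dist (avg (ls j) (\<lambda>x. x ^ m)) (\<mu> m) < \<delta>) \<and>
      dist (avg (ls j) f) (LINT x|\<nu>. f x) < \<epsilon> / 2) sequentially" by (rule eventually_conj)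
  then obtain j where j': "\<forall>m\<in>{..K}. dist (avg (ls j) (\<lambda>x. x ^ m)) (\<mu> m) < \<delta>"
    "dist (avg (ls j) f) (LINT x|\<nu>. f x) < \<epsilon> / 2"
    using eventually_happens'[OF sequentially_bot] by blast
  then have j: "\<forall>m\<le>K. \<bar>avg (ls j) (\<lambda>x. x ^ m) - \<mu> m\<bar> \<le> \<delta>"
    "\<bar>avg (ls j) f - (LINT x|\<nu>. f x)\<bar> < \<epsilon> / 2"
    by (auto simp: dist_real_def less_imp_le)
  let ?D = "\<lambda>N. {\<omega> \<in> space (M N). \<bar>(LINT x|empirical_distribution (A N \<omega>). f x) - (LINT x|\<nu>. f x)\<bar> > \<epsilon>}"
  have le: "norm (measure (M N) (?D N)) \<le> (\<Sum>m\<le>K. measure (M N) (bad \<delta> m N))" if N: "N \<ge> 1" for N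
  proof (cases "?D N \<in> sets (M N)")
    case True
    interpret prob_space "M N" by (rule prob[OF N])
    have "?D N \<subseteq> (\<Union>m\<in>{..K}. bad \<delta> m N)"
    proof
      fix \<omega> assume \<omega>: "\<omega> \<in> ?D N"
      then have sp: "\<omega> \<in> space (M N)" by simp
      have "\<not> (\<forall>m\<le>K. \<bar>T N \<omega> (\<lambda>x. x ^ m) - \<mu> m\<bar> \<le> \<delta>)"
      proof
        assume "\<forall>m\<le>K. \<bar>T N \<omega> (\<lambda>x. x ^ m) - \<mu> m\<bar> \<le> \<delta>"
        from K(2)[OF spectrum_ne[OF N sp] ls(1) this j(1)] have "\<bar>T N \<omega> f - avg (ls j) f\<bar> \<le> \<epsilon> / 2" .
        moreover have "\<bar>T N \<omega> f - (LINT x|\<nu>. f x)\<bar> > \<epsilon>" using \<omega> integral_eq_avg[OF N sp f(1)] by simp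
        ultimately show False using j(2) by linarith
      qed
      then show "\<omega> \<in> (\<Union>m\<in>{..K}. bad \<delta> m N)" using sp by (auto simp: bad_def not_le)
    qed
    then have "measure (M N) (?D N) \<le> measure (M N) (\<Union>m\<in>{..K}. bad \<delta> m N)"
      by (intro finite_measure_mono sets.finite_UN) (auto intro: bad_sets[OF N])
    also have "\<dots> \<le> (\<Sum>m\<le>K. measure (M N) (bad \<delta> m N))"
      by (intro finite_measure_subadditive_finite) (auto intro: bad_sets[OF N])
    finally show ?thesis by simp
  next
    \<comment> \<open>A set outside the sigma-algebra has measure \<open>0\<close> by
      convention.\<close>
    case False
    then show ?thesis by (simp add: measure_notin_sets sum_nonneg)
  qed
  show "(\<lambda>N. measure (M N) (?D N)) \<longlonglongrightarrow> 0"
  proof (rule Lim_null_comparison)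
    show "eventually (\<lambda>N. norm (measure (M N) (?D N)) \<le> (\<Sum>m\<le>K. measure (M N) (bad \<delta> m N))) sequentially"
      by (rule eventually_sequentiallyI[of 1]) (rule le)
    have "(\<lambda>N. \<Sum>m\<le>K. measure (M N) (bad \<delta> m N)) \<longlonglongrightarrow> (\<Sum>m\<le>K. 0)"
      unfolding bad_def by (intro tendsto_sum moments K(1))
    then show "(\<lambda>N. \<Sum>m\<le>K. measure (M N) (bad \<delta> m N)) \<longlonglongrightarrow> 0" by simp
  qed
qed

text \<open>A single outcome that is close to both limits bounds the distance of their integrals.
  Cosines and sines as test functions then identify the characteristic functions.\<close>

lemma weak_limit_unique:
  assumes w1: "weakly_in_probability M (\<lambda>N \<omega>. empirical_distribution (A N \<omega>)) \<nu>1"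
    and w2: "weakly_in_probability M (\<lambda>N \<omega>. empirical_distribution (A N \<omega>)) \<nu>2"
    and r1: "real_distribution \<nu>1" and r2: "real_distribution \<nu>2"
  shows "\<nu>1 = \<nu>2"
proof -
  have eq: "(LINT x|\<nu>1. f x) = (LINT x|\<nu>2. f x)" if f: "continuous_on UNIV f" "bounded (range f)" for f :: "real \<Rightarrow> real"
  proof (rule ccontr)
    assume ne: "(LINT x|\<nu>1. f x) \<noteq> (LINT x|\<nu>2. f x)"
    \<comment> \<open>A third of the gap: an outcome within \<open>e\<close> of both integrals
      brings them within \<open>2 * e\<close> of each other.\<close>
    define e where "e = \<bar>(LINT x|\<nu>1. f x) - (LINT x|\<nu>2. f x)\<bar> / 3"
    have e: "e > 0" using ne by (simp add: e_def)
    define S where "S b N = {\<omega> \<in> space (M N). \<bar>(LINT x|empirical_distribution (A N \<omega>). f x) -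
        (LINT x|(if b then \<nu>1 else \<nu>2). f x)\<bar> > e}" for b :: bool and N
    have "\<exists>N\<ge>1. \<exists>\<omega>\<in>space (M N). \<forall>b\<in>UNIV. \<omega> \<notin> S b N"
    proof (rule ex_point_outside_small_sets)
      show "(\<lambda>N. measure (M N) (S b N)) \<longlonglongrightarrow> 0" for b
        using w1 w2 f e unfolding weakly_in_probability_def S_def by (cases b) auto
      fix b and N :: nat assume N: "N \<ge> 1"
      \<comment> \<open>Measurability is essential here: a nonmeasurable exceptional set would have
        measure \<open>0\<close> by convention, and its smallness would say nothing.\<close>
      have "(\<lambda>\<omega>. T N \<omega> f) \<in> borel_measurable (M N)"
        by (rule borel_measurable_avg[OF measurable_moment[OF N] spectrum_ne[OF N] f(1)])
      then have "{\<omega> \<in> space (M N). \<bar>T N \<omega> f - (LINT x|(if b then \<nu>1 else \<nu>2). f x)\<bar> > e} \<in> sets (M N)"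
        by measurable
      also have "{\<omega> \<in> space (M N). \<bar>T N \<omega> f - (LINT x|(if b then \<nu>1 else \<nu>2). f x)\<bar> > e} = S b N"
        unfolding S_def using integral_eq_avg[OF N _ f(1)] by auto
      finally show "S b N \<in> sets (M N)" .
    qed (auto simp: prob)
    then obtain N \<omega> where "\<omega> \<in> space (M N)" "\<omega> \<notin> S True N" "\<omega> \<notin> S False N" by blast
    then have "\<bar>(LINT x|\<nu>1. f x) - (LINT x|\<nu>2. f x)\<bar> \<le> 2 * e" by (auto simp: S_def)
    then show False using e by (simp add: e_def)
  qed
  interpret d1: real_distribution \<nu>1 by (rule r1)
  interpret d2: real_distribution \<nu>2 by (rule r2)
  have "char \<nu>1 = char \<nu>2"
  proof
    fix t
    have c: "(LINT x|\<nu>1. cos (t * x)) = (LINT x|\<nu>2. cos (t * x))"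
      by (rule eq) (auto intro!: continuous_intros boundedI[where B = 1])
    have s: "(LINT x|\<nu>1. sin (t * x)) = (LINT x|\<nu>2. sin (t * x))"
      by (rule eq) (auto intro!: continuous_intros boundedI[where B = 1])
    have "Re (iexp (t * x)) = cos (t * x)" "Im (iexp (t * x)) = sin (t * x)" for x
      by (simp_all add: Re_exp Im_exp)
    then show "char \<nu>1 t = char \<nu>2 t"
      unfolding char_def
      by (intro complex_eqI)
        (use c s in \<open>simp_all flip: integral_Re[OF d1.integrable_iexp] integral_Re[OF d2.integrable_iexp]
            integral_Im[OF d1.integrable_iexp] integral_Im[OF d2.integrable_iexp]\<close>)
  qed
  then show ?thesis by (rule Levy_uniqueness[OF r1 r2])
qed

end

text \<open>The candidate limit is sampled from the second family. It is a weak limit of both, since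
  only the moments enter, and uniqueness for the second family evaluates the definite
  description.\<close>

lemma common_weak_limit:
  assumes 1: "spectral_moments M A n \<mu>" and 2: "spectral_moments M' A' n' \<mu>"
    and mu: "\<And>m. \<bar>\<mu> m\<bar> \<le> 2 * C ^ m" "C \<ge> 1"
  shows "weakly_in_probability M (\<lambda>N \<omega>. empirical_distribution (A N \<omega>))
    (THE \<nu>. real_distribution \<nu> \<and> weakly_in_probability M' (\<lambda>N \<omega>. empirical_distribution (A' N \<omega>)) \<nu>)"
proof -
  interpret a: spectral_moments M A n \<mu> by (rule 1)
  interpret b: spectral_moments M' A' n' \<mu> by (rule 2)
  obtain ls where ls: "\<And>j. ls j \<noteq> []" "\<And>m. (\<lambda>j. avg (ls j) (\<lambda>x. x ^ m)) \<longlonglongrightarrow> \<mu> m"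
    using b.exists_list_sequence by blast
  obtain \<nu> r where \<nu>: "real_distribution \<nu>" and r: "strict_mono r"
    and lim: "\<And>f. continuous_on UNIV f \<Longrightarrow> bounded (range f) \<Longrightarrow> (\<lambda>j. avg (ls (r j)) f) \<longlonglongrightarrow> (LINT x|\<nu>. f x)"
    using exists_limit_measure[OF ls] by blast
  have ls': "(\<lambda>j. avg (ls (r j)) (\<lambda>x. x ^ m)) \<longlonglongrightarrow> \<mu> m" for m
    using LIMSEQ_subseq_LIMSEQ[OF ls(2) r] by (simp add: o_def)
  have w: "weakly_in_probability M (\<lambda>N \<omega>. empirical_distribution (A N \<omega>)) \<nu>"
    by (rule a.weakly_in_probability_limit[OF mu ls(1) ls' lim])
  have w': "weakly_in_probability M' (\<lambda>N \<omega>. empirical_distribution (A' N \<omega>)) \<nu>"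
    by (rule b.weakly_in_probability_limit[OF mu ls(1) ls' lim])
  have "(THE \<nu>. real_distribution \<nu> \<and> weakly_in_probability M' (\<lambda>N \<omega>. empirical_distribution (A' N \<omega>)) \<nu>) = \<nu>"
    using \<nu> w' b.weak_limit_unique by (intro the_equality) auto
  with w show ?thesis by simp
qed

section \<open>Spectral moments of band matrices\<close>

lemma smult_power_mat:
  fixes A :: "'a::comm_semiring_1 mat"
  assumes A: "A \<in> carrier_mat n n"
  shows "(c \<cdot>\<^sub>m A) ^\<^sub>m m = c ^ m \<cdot>\<^sub>m (A ^\<^sub>m m)"
proof (induction m)
  case 0
  then show ?case using A by auto
next
  case (Suc m)
  have Am: "A ^\<^sub>m m \<in> carrier_mat n n" using A by simp
  have "(c \<cdot>\<^sub>m A) ^\<^sub>m Suc m = (c ^ m \<cdot>\<^sub>m (A ^\<^sub>m m)) * (c \<cdot>\<^sub>m A)" using Suc by simp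
  also have "\<dots> = c ^ m \<cdot>\<^sub>m (c \<cdot>\<^sub>m (A ^\<^sub>m m * A))"
    using mult_smult_assoc_mat[OF Am, of "c \<cdot>\<^sub>m A" n "c ^ m"] mult_smult_distrib[OF Am A, of c] A by simp
  also have "\<dots> = c ^ Suc m \<cdot>\<^sub>m (A ^\<^sub>m Suc m)"
    by (rule eq_matI) (auto simp: ac_simps)
  finally show ?case .
qed

lemma (in band_ensemble) integrable_walk_trace_square:
  "integrable M (\<lambda>\<omega>. walk_trace m \<omega> * walk_trace m \<omega>)"
  unfolding walk_trace_def sum_product
  by (intro Bochner_Integration.integrable_sum Y_mult_integrable_bound(1))

definition moment_error :: "nat \<Rightarrow> (nat \<Rightarrow> real) \<Rightarrow> nat \<Rightarrow> real" where
  "moment_error D B m = (moment_const B m + nc_bound (moment_const B 2) m) * real (walk_const D (Suc m))"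

definition variance_error :: "nat \<Rightarrow> (nat \<Rightarrow> real) \<Rightarrow> nat \<Rightarrow> real" where
  "variance_error D B m = (moment_const B (2 * m) + (moment_const B m)\<^sup>2) * real (walk_const D (2 * m + 2))"

text \<open>The main term of the \<open>m\<close>-th spectral moment: the average over the starting
  vertex, with one factor \<open>1 / sqrt n\<close> for each of the \<open>m\<close>
  entries.\<close>

definition (in band_ensemble) path_mean :: "nat \<Rightarrow> complex" where
  "path_mean m = (\<Sum>i\<in>V. path_sum m i i) / (of_nat (card V) * of_real (sqrt (real (card V)) ^ m))"

locale band_matrix = band_ensemble V nb D M X B
  for V :: "'v set" and nb D and M :: "'a measure" and X B +
  fixes A :: "'a \<Rightarrow> complex mat" and f :: "nat \<Rightarrow> 'v" and n :: nat
  assumes f: "bij_betw f {..<n} V"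
    and A: "\<And>\<omega>. \<omega> \<in> space M \<Longrightarrow> A \<omega> = mat n n (\<lambda>(i, j). X (f i) (f j) \<omega> / of_real (sqrt (real n)))"
    and X_herm: "\<And>\<omega> i j. \<omega> \<in> space M \<Longrightarrow> i \<in> V \<Longrightarrow> j \<in> V \<Longrightarrow> X j i \<omega> = cnj (X i j \<omega>)"
begin

lemma card_V: "card V = n"
  using bij_betw_same_card[OF f] by simp

lemma n_pos: "n > 0"
  using card_V finite_V V_ne by (simp add: card_gt_0_iff flip: card_V)

definition scale :: "nat \<Rightarrow> real" where
  "scale m = real n * sqrt (real n) ^ m"

lemma scale_pos: "scale m > 0"
  using n_pos by (simp add: scale_def)

lemma A_carrier: "\<omega> \<in> space M \<Longrightarrow> A \<omega> \<in> carrier_mat n n"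
  by (simp add: A)

lemma A_hermitian: "\<omega> \<in> space M \<Longrightarrow> hermitian_mat (A \<omega>)"
proof -
  assume w: "\<omega> \<in> space M"
  have fV: "f i \<in> V" if "i < n" for i using f that by (auto simp: bij_betw_def)
  have "A \<omega> $$ (j, i) = cnj (A \<omega> $$ (i, j))" if "i < n" "j < n" for i j
    using X_herm[OF w fV[OF that(1)] fV[OF that(2)]] that by (simp add: A[OF w])
  then show ?thesis unfolding hermitian_mat_def carrier_matD[OF A_carrier[OF w]] by blast
qed

lemma trace_A:
  assumes w: "\<omega> \<in> space M"
  shows "(\<Sum>i<n. (A \<omega> ^\<^sub>m m) $$ (i, i)) = walk_trace m \<omega> / of_real (sqrt (real n) ^ m)"
proof -
  define A0 where "A0 = mat n n (\<lambda>(i, j). X (f i) (f j) \<omega>)"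
  define c where "c = 1 / complex_of_real (sqrt (real n))"
  have A0: "A0 \<in> carrier_mat n n" by (simp add: A0_def)
  have A0m: "A0 ^\<^sub>m m \<in> carrier_mat n n" using A0 by simp
  have "A \<omega> = c \<cdot>\<^sub>m A0"
    unfolding A[OF w] A0_def c_def by (rule eq_matI) auto
  then have "A \<omega> ^\<^sub>m m = c ^ m \<cdot>\<^sub>m (A0 ^\<^sub>m m)" by (simp add: smult_power_mat[OF A0])
  then have "(\<Sum>i<n. (A \<omega> ^\<^sub>m m) $$ (i, i)) = (\<Sum>i<n. c ^ m * (A0 ^\<^sub>m m) $$ (i, i))"
    using index_smult_mat(1)[of _ "A0 ^\<^sub>m m" _ "c ^ m"] unfolding carrier_matD[OF A0m] by (intro sum.cong) auto
  also have "\<dots> = c ^ m * walk_trace m \<omega>"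
    using walk_trace_eq_trace_power[OF A0 f, of \<omega> m] by (simp add: A0_def flip: sum_distrib_left)
  finally show ?thesis by (simp add: c_def power_divide)
qed

abbreviation T :: "nat \<Rightarrow> 'a \<Rightarrow> real" where
  "T m \<omega> \<equiv> avg (spectrum_list (A \<omega>)) (\<lambda>x. x ^ m)"

lemma T_eq: "\<omega> \<in> space M \<Longrightarrow> of_real (T m \<omega>) = walk_trace m \<omega> / of_real (scale m)"
proof -
  assume w: "\<omega> \<in> space M"
  note s = spectrum_list[OF A_carrier[OF w] n_pos]
  have "of_real (T m \<omega>) = (\<Sum>i<n. (A \<omega> ^\<^sub>m m) $$ (i, i)) / of_nat n"
    using s(4,5)[OF A_hermitian[OF w], of m] by (simp add: complex_is_Real_iff complex_eq_iff)
  then show ?thesis unfolding trace_A[OF w] by (simp add: scale_def)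
qed

lemma T_eq_Re: "\<omega> \<in> space M \<Longrightarrow> T m \<omega> = Re (walk_trace m \<omega>) / scale m"
  using arg_cong[OF T_eq, of \<omega> Re m] by simp

lemma T_square: "\<omega> \<in> space M \<Longrightarrow> (T m \<omega>)\<^sup>2 = Re (walk_trace m \<omega> * walk_trace m \<omega>) / (scale m)\<^sup>2"
proof -
  assume w: "\<omega> \<in> space M"
  have "walk_trace m \<omega> = of_real (T m \<omega> * scale m)"
    using T_eq[OF w, of m] scale_pos[of m] by (simp add: field_simps)
  then have "walk_trace m \<omega> * walk_trace m \<omega> = of_real ((T m \<omega> * scale m)\<^sup>2)"
    by (simp add: power2_eq_square)
  then have "Re (walk_trace m \<omega> * walk_trace m \<omega>) = (T m \<omega> * scale m)\<^sup>2" by simp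
  then show ?thesis using scale_pos[of m] by (simp add: power_mult_distrib)
qed

lemma T_measurable: "T m \<in> borel_measurable M"
proof -
  have "(\<lambda>\<omega>. Re (walk_trace m \<omega>) / scale m) \<in> borel_measurable M"
    using walk_trace_measurable[of m] by measurable
  then show ?thesis by (subst measurable_cong[OF T_eq_Re]) auto
qed

lemma integrable_T: "integrable M (T m)"
proof -
  have "integrable M (\<lambda>\<omega>. Re (walk_trace m \<omega>) / scale m)"
    by (intro integrable_divide integrable_Re integrable_walk_trace)
  then show ?thesis by (subst Bochner_Integration.integrable_cong[OF refl T_eq_Re])
qed

lemma integrable_T_square: "integrable M (\<lambda>\<omega>. (T m \<omega>)\<^sup>2)"
proof -
  have "integrable M (\<lambda>\<omega>. Re (walk_trace m \<omega> * walk_trace m \<omega>) / (scale m)\<^sup>2)"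
    by (intro integrable_divide integrable_Re integrable_walk_trace_square)
  then show ?thesis by (subst Bochner_Integration.integrable_cong[OF refl T_square])
qed

lemma expectation_T: "of_real (LINT \<omega>|M. T m \<omega>) = (LINT \<omega>|M. walk_trace m \<omega>) / of_real (scale m)"
proof -
  have "complex_of_real (LINT \<omega>|M. T m \<omega>) = (LINT \<omega>|M. of_real (T m \<omega>))"
    by (rule integral_complex_of_real[symmetric])
  also have "\<dots> = (LINT \<omega>|M. walk_trace m \<omega> / of_real (scale m))"
    by (rule Bochner_Integration.integral_cong[OF refl T_eq])
  finally show ?thesis by simp
qed

lemma expectation_T_square:
  "of_real (LINT \<omega>|M. (T m \<omega>)\<^sup>2) = (LINT \<omega>|M. walk_trace m \<omega> * walk_trace m \<omega>) / (of_real (scale m))\<^sup>2"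
proof -
  have "complex_of_real (LINT \<omega>|M. (T m \<omega>)\<^sup>2) = (LINT \<omega>|M. of_real ((T m \<omega>)\<^sup>2))"
    by (rule integral_complex_of_real[symmetric])
  also have "\<dots> = (LINT \<omega>|M. walk_trace m \<omega> * walk_trace m \<omega> / (of_real (scale m))\<^sup>2)"
    by (rule Bochner_Integration.integral_cong[OF refl]) (simp add: T_eq power2_eq_square)
  finally show ?thesis by simp
qed

text \<open>Degenerate walks contribute at most of order \<open>sqrt n ^ (m + 1)\<close>, while the
  normalization is \<open>sqrt n ^ (m + 2)\<close>.\<close>

lemma expectation_T_approx:
  "norm (of_real (LINT \<omega>|M. T m \<omega>) - path_mean m) \<le> moment_error D B m / sqrt (real n)"
proof -
  let ?s = "sqrt (real n)"
  have s: "?s > 0" "?s * ?s = real n" using n_pos by auto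
  have pm: "path_mean m = (\<Sum>xs\<in>closed_walks m. W ((!) xs) 0 m) / of_real (scale m)"
    by (simp add: path_mean_def sum_W_closed_walks card_V scale_def)
  have "norm (of_real (LINT \<omega>|M. T m \<omega>) - path_mean m) =
      norm ((\<Sum>xs\<in>closed_walks m. EY ((!) xs) {..<m}) - (\<Sum>xs\<in>closed_walks m. W ((!) xs) 0 m)) / scale m"
    unfolding expectation_T pm expectation_walk_trace diff_divide_distrib[symmetric] norm_divide
    using scale_pos[of m] by simp
  also have "\<dots> \<le> (moment_error D B m * ?s ^ (m + 1)) / scale m"
    using sum_EY_approx_sum_W[of m] scale_pos[of m] unfolding card_V moment_error_def
    by (intro divide_right_mono) (auto simp: mult.assoc)
  also have "?s ^ (m + 1) = scale m / ?s"
    using s by (simp add: scale_def nonzero_eq_divide_eq)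
  finally show ?thesis using scale_pos[of m] by simp
qed

text \<open>Linked pairs contribute of order \<open>n ^ (m + 1)\<close> against the squared
  normalization \<open>n ^ (m + 2)\<close>.\<close>

lemma variance_T_le:
  "\<bar>(LINT \<omega>|M. (T m \<omega>)\<^sup>2) - (LINT \<omega>|M. T m \<omega>)\<^sup>2\<bar> \<le> variance_error D B m / real n"
proof -
  have "\<bar>(LINT \<omega>|M. (T m \<omega>)\<^sup>2) - (LINT \<omega>|M. T m \<omega>)\<^sup>2\<bar> =
      norm (complex_of_real ((LINT \<omega>|M. (T m \<omega>)\<^sup>2) - (LINT \<omega>|M. T m \<omega>)\<^sup>2))"
    by (simp only: norm_of_real)
  also have "\<dots> = norm ((LINT \<omega>|M. walk_trace m \<omega> * walk_trace m \<omega>) - (LINT \<omega>|M. walk_trace m \<omega>)\<^sup>2) / (scale m)\<^sup>2"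
    unfolding of_real_diff of_real_power expectation_T_square expectation_T power_divide
      diff_divide_distrib[symmetric] norm_divide
    using scale_pos[of m] by (simp add: norm_power)
  also have "\<dots> \<le> (variance_error D B m * real n ^ (m + 1)) / (scale m)\<^sup>2"
    using norm_variance_walk_trace_le[of m] unfolding card_V variance_error_def
    by (intro divide_right_mono) (auto simp: mult.assoc)
  also have "(scale m)\<^sup>2 = real n ^ (m + 1) * real n"
  proof -
    have "(sqrt (real n) ^ m)\<^sup>2 = (sqrt (real n) * sqrt (real n)) ^ m"
      unfolding power2_eq_square by (rule power_mult_distrib[symmetric])
    then show ?thesis by (simp add: scale_def power_mult_distrib power2_eq_square)
  qed
  finally show ?thesis using n_pos by simp
qed

text \<open>Chebyshev's inequality around an arbitrary center \<open>u\<close>, so that the variance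
  and the distance of the mean from its limit enter together.\<close>

lemma measure_deviation_le:
  assumes e: "\<epsilon> > 0"
  shows "measure M {\<omega> \<in> space M. \<bar>T m \<omega> - u\<bar> > \<epsilon>} \<le>
    (variance_error D B m / real n + ((LINT \<omega>|M. T m \<omega>) - u)\<^sup>2) / \<epsilon>\<^sup>2"
proof -
  have sq: "(T m \<omega> - u)\<^sup>2 = (T m \<omega>)\<^sup>2 - 2 * u * T m \<omega> + u\<^sup>2" for \<omega>
    by (simp add: power2_eq_square algebra_simps)
  have int: "integrable M (\<lambda>\<omega>. (T m \<omega> - u)\<^sup>2)"
    unfolding sq by (intro Bochner_Integration.integrable_add Bochner_Integration.integrable_diff
        integrable_T_square integrable_mult_right integrable_T integrable_const)
  have "(LINT \<omega>|M. (T m \<omega> - u)\<^sup>2) = (LINT \<omega>|M. (T m \<omega>)\<^sup>2) - 2 * u * (LINT \<omega>|M. T m \<omega>) + u\<^sup>2"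
    unfolding sq by (subst Bochner_Integration.integral_add)
      (auto simp: integrable_T_square integrable_T prob_space intro!: Bochner_Integration.integrable_diff
        Bochner_Integration.integral_diff)
  also have "\<dots> = ((LINT \<omega>|M. (T m \<omega>)\<^sup>2) - (LINT \<omega>|M. T m \<omega>)\<^sup>2) + ((LINT \<omega>|M. T m \<omega>) - u)\<^sup>2"
    by (simp add: power2_eq_square algebra_simps)
  finally have E: "(LINT \<omega>|M. (T m \<omega> - u)\<^sup>2) \<le> variance_error D B m / real n + ((LINT \<omega>|M. T m \<omega>) - u)\<^sup>2"
    using variance_T_le[of m] by linarith
  have meas: "{\<omega> \<in> space M. \<epsilon>\<^sup>2 \<le> (T m \<omega> - u)\<^sup>2} \<in> sets M"
    using T_measurable[of m] by measurable
  have "measure M {\<omega> \<in> space M. \<bar>T m \<omega> - u\<bar> > \<epsilon>} \<le> measure M {\<omega> \<in> space M. \<epsilon>\<^sup>2 \<le> (T m \<omega> - u)\<^sup>2}"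
  proof (rule finite_measure_mono[OF _ meas], rule subsetI)
    fix \<omega> assume "\<omega> \<in> {\<omega> \<in> space M. \<bar>T m \<omega> - u\<bar> > \<epsilon>}"
    then show "\<omega> \<in> {\<omega> \<in> space M. \<epsilon>\<^sup>2 \<le> (T m \<omega> - u)\<^sup>2}"
      using e by (auto simp flip: abs_le_square_iff)
  qed
  also have "\<dots> \<le> (LINT \<omega>|M. (T m \<omega> - u)\<^sup>2) / \<epsilon>\<^sup>2"
    using e by (intro integral_Markov_inequality_measure[OF int, of "{}"]) auto
  also have "\<dots> \<le> (variance_error D B m / real n + ((LINT \<omega>|M. T m \<omega>) - u)\<^sup>2) / \<epsilon>\<^sup>2"
    by (intro divide_right_mono E) simp
  finally show ?thesis .
qed

end

text \<open>The degree \<open>D\<close> and the moment bounds \<open>B\<close> are the same for all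
  \<open>N\<close>, so both error terms vanish as the size grows.\<close>

lemma spectral_moments_band_matrices:
  fixes M :: "nat \<Rightarrow> 'a measure"
  assumes bm: "\<And>N. N \<ge> 1 \<Longrightarrow> band_matrix (V N) (nb N) D (M N) (X N) B (A N) (f N) (n N)"
    and n: "filterlim n at_top sequentially"
    and lim: "\<And>m. (\<lambda>N. band_ensemble.path_mean (V N) (nb N) (M N) (X N) m) \<longlonglongrightarrow> z m"
  shows "spectral_moments M A n (\<lambda>m. Re (z m))"
proof (rule spectral_moments.intro)
  fix N :: nat assume N: "N \<ge> 1"
  interpret band_matrix "V N" "nb N" D "M N" "X N" B "A N" "f N" "n N" by (rule bm[OF N])
  show "prob_space (M N)" by (rule prob_space_axioms)
  show "A N \<omega> \<in> carrier_mat (n N) (n N)" if "\<omega> \<in> space (M N)" for \<omega> by (rule A_carrier[OF that])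
  show "n N > 0" by (rule n_pos)
  show "(\<lambda>\<omega>. avg (spectrum_list (A N \<omega>)) (\<lambda>x. x ^ m)) \<in> borel_measurable (M N)" for m by (rule T_measurable)
next
  fix m :: nat and \<epsilon> :: real assume e: "\<epsilon> > 0"
  define ET where "ET N = (LINT \<omega>|M N. avg (spectrum_list (A N \<omega>)) (\<lambda>x. x ^ m))" for N
  have nr: "filterlim (\<lambda>N. real (n N)) at_top sequentially"
    by (rule filterlim_compose[OF filterlim_real_sequentially n])
  have "filterlim (\<lambda>N. sqrt (real (n N))) at_top sequentially"
    by (rule filterlim_compose[OF sqrt_at_top nr])
  then have err: "(\<lambda>N. moment_error D B m / sqrt (real (n N))) \<longlonglongrightarrow> 0"
    by (intro tendsto_divide_0[OF tendsto_const] filterlim_at_top_imp_at_infinity)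
  have "(\<lambda>N. complex_of_real (ET N) - band_ensemble.path_mean (V N) (nb N) (M N) (X N) m) \<longlonglongrightarrow> 0"
  proof (rule Lim_null_comparison[OF _ err])
    show "\<forall>\<^sub>F N in sequentially. norm (complex_of_real (ET N) - band_ensemble.path_mean (V N) (nb N) (M N) (X N) m)
        \<le> moment_error D B m / sqrt (real (n N))"
      by (rule eventually_sequentiallyI[of 1])
        (unfold ET_def, rule band_matrix.expectation_T_approx[OF bm])
  qed
  from tendsto_add[OF this lim[of m]] have "(\<lambda>N. complex_of_real (ET N)) \<longlonglongrightarrow> z m" by simp
  from tendsto_Re[OF this] have ET: "ET \<longlonglongrightarrow> Re (z m)" by simp
  have bound: "(\<lambda>N. (variance_error D B m / real (n N) + (ET N - Re (z m))\<^sup>2) / \<epsilon>\<^sup>2) \<longlonglongrightarrow> (0 + (Re (z m) - Re (z m))\<^sup>2) / \<epsilon>\<^sup>2"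
    using e by (intro tendsto_intros ET tendsto_divide_0[OF tendsto_const] filterlim_at_top_imp_at_infinity nr) auto
  show "(\<lambda>N. measure (M N) {\<omega> \<in> space (M N). \<bar>avg (spectrum_list (A N \<omega>)) (\<lambda>x. x ^ m) - Re (z m)\<bar> > \<epsilon>}) \<longlonglongrightarrow> 0"
  proof (rule Lim_null_comparison)
    show "\<forall>\<^sub>F N in sequentially. norm (measure (M N) {\<omega> \<in> space (M N). \<bar>avg (spectrum_list (A N \<omega>)) (\<lambda>x. x ^ m) - Re (z m)\<bar> > \<epsilon>})
        \<le> (variance_error D B m / real (n N) + (ET N - Re (z m))\<^sup>2) / \<epsilon>\<^sup>2"
      using band_matrix.measure_deviation_le[OF bm e]
      by (intro eventually_sequentiallyI[of 1]) (simp add: ET_def)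
  qed (use bound in simp)
qed

section \<open>The limiting recursion\<close>

lemma sum_roots_of_unity:
  assumes N: "N \<ge> 1"
  shows "(\<Sum>v<N. cis (2 * pi * real v / real N) powi k) = (if int N dvd k then of_nat N else 0)"
proof -
  define z where "z = cis (2 * pi * real_of_int k / real N)"
  have "cis (2 * pi * real v / real N) powi k = z ^ v" for v
    by (simp add: z_def Complex.DeMoivre cis_power_int) (simp add: field_simps)
  then have eq: "(\<Sum>v<N. cis (2 * pi * real v / real N) powi k) = (\<Sum>v<N. z ^ v)" by simp
  show ?thesis
  proof (cases "int N dvd k")
    case True
    then obtain l where l: "k = int N * l" by auto
    have "2 * pi * real_of_int k / real N = 2 * pi * real_of_int l" using N by (simp add: l)
    then have "z = cis (2 * pi * real_of_int l)" by (simp only: z_def)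
    also have "\<dots> = 1" by (rule cis_multiple_2pi) simp
    finally have "z = 1" .
    then show ?thesis using True by (simp add: eq)
  next
    case False
    have zN: "z ^ N = 1"
    proof -
      have "z ^ N = cis (2 * pi * real_of_int k)" using N by (simp add: z_def Complex.DeMoivre)
      also have "\<dots> = 1" by (rule cis_multiple_2pi) simp
      finally show ?thesis .
    qed
    have "z \<noteq> 1"
    proof
      assume "z = 1"
      then have "Re z = 1" by simp
      then have "cos (2 * pi * real_of_int k / real N) = 1" by (simp only: z_def cis.sel)
      then obtain l :: int where "2 * pi * real_of_int k / real N = real_of_int l * 2 * pi"
        unfolding cos_one_2pi_int by blast
      then have "real_of_int k = real_of_int (l * int N)" using N by (simp add: field_simps)
      then have "k = l * int N" by (simp only: of_int_eq_iff)
      with False show False by simp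
    qed
    then show ?thesis using False zN by (simp add: eq geometric_sum)
  qed
qed

text \<open>Rounding at the ends of the interval costs at most \<open>1\<close>. The second unit
  pays for the point \<open>0\<close> or \<open>N\<close> that one of the two grids lacks: the color
  points use \<open>{..<N}\<close> and the matrix indices \<open>{1..N}\<close>.\<close>

lemma card_grid_interval:
  fixes \<alpha> \<beta> :: real
  assumes le: "\<alpha> \<le> \<beta>" and J: "{\<alpha><..<\<beta>} \<subseteq> J" "J \<subseteq> {\<alpha>..\<beta>}" "J \<subseteq> {0..1}" and N: "N \<ge> 1" and R: "R = {..<N} \<or> R = {1..N}"
  shows "\<bar>real (card {j\<in>R. real j / real N \<in> J}) - real N * (\<beta> - \<alpha>)\<bar> \<le> 2"
proof -
  define S where "S = {j::int. real_of_int j / real N \<in> J}"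
  have S01: "S \<subseteq> {0..int N}"
  proof
    fix j assume "j \<in> S"
    then have "real_of_int j / real N \<in> {0..1}" using J(3) by (auto simp: S_def)
    then show "j \<in> {0..int N}" using N by (auto simp: field_simps)
  qed
  then have finS: "finite S" by (rule finite_subset) simp
  have low: "{\<lfloor>real N * \<alpha>\<rfloor> + 1..\<lceil>real N * \<beta>\<rceil> - 1} \<subseteq> S"
  proof
    fix j assume "j \<in> {\<lfloor>real N * \<alpha>\<rfloor> + 1..\<lceil>real N * \<beta>\<rceil> - 1}"
    then have "real N * \<alpha> < real_of_int j" "real_of_int j < real N * \<beta>" by (auto simp: floor_less_iff less_ceiling_iff)
      linarith+
    then have "real_of_int j / real N \<in> {\<alpha><..<\<beta>}" using N by (auto simp: field_simps)
    then show "j \<in> S" using J(1) by (auto simp: S_def)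
  qed
  have up: "S \<subseteq> {\<lceil>real N * \<alpha>\<rceil>..\<lfloor>real N * \<beta>\<rfloor>}"
  proof
    fix j assume "j \<in> S"
    then have "real_of_int j / real N \<in> {\<alpha>..\<beta>}" using J(2) by (auto simp: S_def)
    then have "real N * \<alpha> \<le> real_of_int j" "real_of_int j \<le> real N * \<beta>" using N by (auto simp: field_simps)
    then show "j \<in> {\<lceil>real N * \<alpha>\<rceil>..\<lfloor>real N * \<beta>\<rfloor>}" by (auto simp: ceiling_le_iff le_floor_iff)
  qed
  have l: "real N * (\<beta> - \<alpha>) - 1 \<le> real (card S)"
  proof -
    have "nat (\<lceil>real N * \<beta>\<rceil> - 1 - \<lfloor>real N * \<alpha>\<rfloor>) \<le> card S"
      using card_mono[OF finS low] by simp
    then have "\<lceil>real N * \<beta>\<rceil> - 1 - \<lfloor>real N * \<alpha>\<rfloor> \<le> int (card S)" by linarith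
    then have "real_of_int \<lceil>real N * \<beta>\<rceil> - 1 - real_of_int \<lfloor>real N * \<alpha>\<rfloor> \<le> real (card S)" by linarith
    moreover have "real N * \<beta> \<le> real_of_int \<lceil>real N * \<beta>\<rceil>" "real_of_int \<lfloor>real N * \<alpha>\<rfloor> \<le> real N * \<alpha>" by linarith+
    ultimately show ?thesis unfolding right_diff_distrib by linarith
  qed
  have u: "real (card S) \<le> real N * (\<beta> - \<alpha>) + 1" if Sne: "S \<noteq> {}"
  proof -
    have c: "card S \<le> card {\<lceil>real N * \<alpha>\<rceil>..\<lfloor>real N * \<beta>\<rfloor>}" by (rule card_mono[OF _ up]) simp
    have "card S > 0" using Sne finS by (simp add: card_gt_0_iff)
    then have "int (card S) \<le> \<lfloor>real N * \<beta>\<rfloor> + 1 - \<lceil>real N * \<alpha>\<rceil>" using c by simp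
    then have "real (card S) \<le> real_of_int \<lfloor>real N * \<beta>\<rfloor> + 1 - real_of_int \<lceil>real N * \<alpha>\<rceil>" by linarith
    moreover have "real_of_int \<lfloor>real N * \<beta>\<rfloor> \<le> real N * \<beta>" "real N * \<alpha> \<le> real_of_int \<lceil>real N * \<alpha>\<rceil>" by linarith+
    ultimately show ?thesis unfolding right_diff_distrib by linarith
  qed
  let ?T = "{j\<in>R. real j / real N \<in> J}"
  have im: "int ` ?T \<subseteq> S" by (auto simp: S_def)
  have ct: "card (int ` ?T) = card ?T" by (rule card_image) (auto simp: inj_on_def)
  have T1: "card ?T \<le> card S" using card_mono[OF finS im] ct by simp
  have "S \<subseteq> int ` ?T \<union> (if R = {..<N} then {int N} else {0})"
  proof
    fix j assume j: "j \<in> S"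
    then have j01: "0 \<le> j" "j \<le> int N" using S01 by auto
    obtain i where i: "j = int i" using j01(1) nonneg_int_cases by blast
    then have rj: "real i / real N \<in> J" "i \<le> N" using j j01 by (auto simp: S_def)
    show "j \<in> int ` ?T \<union> (if R = {..<N} then {int N} else {0})"
    proof (cases "i \<in> R")
      case True
      then have "j \<in> int ` ?T" unfolding i using rj by blast
      then show ?thesis by simp
    next
      case False
      then show ?thesis using R rj(2) by (auto simp: i)
    qed
  qed
  then have "card S \<le> card (int ` ?T \<union> (if R = {..<N} then {int N} else {0}))"
    using R by (intro card_mono) auto
  also have "\<dots> \<le> card ?T + 1"
    by (rule order_trans[OF card_Un_le]) (simp add: ct)
  finally have T2: "card S \<le> card ?T + 1" .
  show ?thesis
  proof (cases "S = {}")
    case True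
    then have "card ?T = 0" using T1 by simp
    moreover have "0 \<le> real N * (\<beta> - \<alpha>)" using le by simp
    ultimately show ?thesis using l True by auto
  next
    case False
    from u[OF this] l T1 T2 show ?thesis by linarith
  qed
qed

definition freqs :: "nat \<Rightarrow> int set" where
  "freqs L = {-int L..int L}"

lemma finite_freqs [simp]: "finite (freqs L)"
  by (simp add: freqs_def)

text \<open>Fourier inversion on the roots of unity: two frequencies in \<open>freqs L\<close>
  differ by at most \<open>2 * L < N\<close>, so the characters are orthogonal on the grid.\<close>

lemma sum_torus_coefficient:
  fixes c :: "int \<Rightarrow> int \<Rightarrow> complex"
  assumes N: "N > 2 * L" and ab: "a \<in> freqs L" "b \<in> freqs L"
  defines "w \<equiv> \<lambda>v. cis (2 * pi * real v / real N)"
  shows "(\<Sum>u<N. \<Sum>v<N. (\<Sum>i\<in>freqs L. \<Sum>j\<in>freqs L. c i j * w u powi i * w v powi j) * w u powi (-a) * w v powi (-b))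
    = of_nat N * of_nat N * c a b"
proof -
  have N1: "N \<ge> 1" using N by simp
  have orth: "(\<Sum>v<N. w v powi i * w v powi (-a)) = (if i = a then of_nat N else 0)"
    if "i \<in> freqs L" "a \<in> freqs L" for i a
  proof -
    have "(\<Sum>v<N. w v powi i * w v powi (-a)) = (\<Sum>v<N. w v powi (i - a))"
      by (intro sum.cong refl) (simp add: w_def power_int_add[symmetric])
    also have "\<dots> = (if int N dvd (i - a) then of_nat N else 0)"
      unfolding w_def by (rule sum_roots_of_unity[OF N1])
    also have "int N dvd (i - a) \<longleftrightarrow> i = a"
    proof
      assume d: "int N dvd (i - a)"
      show "i = a"
      proof (rule ccontr)
        assume "i \<noteq> a"
        then have "int N \<le> \<bar>i - a\<bar>" using zdvd_imp_le[of "int N" "\<bar>i - a\<bar>"] d by simp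
        then show False using that N by (auto simp: freqs_def)
      qed
    qed simp
    finally show ?thesis .
  qed
  have "(\<Sum>u<N. \<Sum>v<N. (\<Sum>i\<in>freqs L. \<Sum>j\<in>freqs L. c i j * w u powi i * w v powi j) * w u powi (-a) * w v powi (-b))
      = (\<Sum>u<N. \<Sum>v<N. \<Sum>i\<in>freqs L. \<Sum>j\<in>freqs L. c i j * (w u powi i * w u powi (-a)) * (w v powi j * w v powi (-b)))"
    unfolding sum_distrib_right by (intro sum.cong refl) (simp only: ac_simps)
  also have "\<dots> = (\<Sum>u<N. \<Sum>i\<in>freqs L. \<Sum>v<N. \<Sum>j\<in>freqs L. c i j * (w u powi i * w u powi (-a)) * (w v powi j * w v powi (-b)))"
    by (intro sum.cong refl) (rule sum.swap)
  also have "\<dots> = (\<Sum>u<N. \<Sum>i\<in>freqs L. \<Sum>j\<in>freqs L. \<Sum>v<N. c i j * (w u powi i * w u powi (-a)) * (w v powi j * w v powi (-b)))"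
    by (intro sum.cong refl) (rule sum.swap)
  also have "\<dots> = (\<Sum>u<N. \<Sum>i\<in>freqs L. \<Sum>j\<in>freqs L. c i j * (w u powi i * w u powi (-a)) * (if j = b then of_nat N else 0))"
    by (intro sum.cong refl) (simp add: orth ab flip: sum_distrib_left)
  also have "\<dots> = (\<Sum>u<N. \<Sum>i\<in>freqs L. (w u powi i * w u powi (-a)) * (c i b * of_nat N))"
    by (intro sum.cong refl) (simp add: if_distrib[where f = "\<lambda>x. _ * x"] ab cong: if_cong)
  also have "\<dots> = (\<Sum>i\<in>freqs L. \<Sum>u<N. (w u powi i * w u powi (-a)) * (c i b * of_nat N))"
    by (rule sum.swap)
  also have "\<dots> = (\<Sum>i\<in>freqs L. (if i = a then of_nat N else 0) * (c i b * of_nat N))"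
    by (intro sum.cong refl) (simp add: orth ab flip: sum_distrib_right)
  also have "\<dots> = of_nat N * of_nat N * c a b"
    by (simp add: if_distrib[where f = "\<lambda>x. x * _"] ab cong: if_cong)
  finally show ?thesis .
qed

section \<open>Step kernels and the coefficients of the limit\<close>

locale step_kernel =
  fixes s :: "color \<Rightarrow> color \<Rightarrow> real" and sc :: "int \<Rightarrow> int \<Rightarrow> real \<Rightarrow> real \<Rightarrow> complex"
    and \<I> :: "real set set" and L :: nat
  assumes kernel: "kernel_assumption s sc \<I>"
    and band: "\<And>i j x y. x \<in> {0..1} \<Longrightarrow> y \<in> {0..1} \<Longrightarrow> i \<notin> freqs L \<or> j \<notin> freqs L \<Longrightarrow> sc i j x y = 0"
begin

definition pt :: "real set \<Rightarrow> real" where "pt J = (SOME x. x \<in> J)"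
definition wt :: "real set \<Rightarrow> real" where "wt J = Sup J - Inf J"

lemma finite_I: "finite \<I>" and part: "partition_on {0..1} \<I>"
  and interval: "J \<in> \<I> \<Longrightarrow> is_interval J" and Inf_less_Sup: "J \<in> \<I> \<Longrightarrow> Inf J < Sup J"
  using kernel by (auto simp: kernel_assumption_def interval_partition_def)

lemma I_union: "\<Union>\<I> = {0..1}" and I_ne: "J \<in> \<I> \<Longrightarrow> J \<noteq> {}"
  and I_disjoint: "J \<in> \<I> \<Longrightarrow> J' \<in> \<I> \<Longrightarrow> x \<in> J \<Longrightarrow> x \<in> J' \<Longrightarrow> J = J'"
  using part by (auto simp: partition_on_def disjoint_def)

lemma I_sub: "J \<in> \<I> \<Longrightarrow> J \<subseteq> {0..1}"
  using I_union by auto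

lemma pt_in: "J \<in> \<I> \<Longrightarrow> pt J \<in> J"
  using I_ne[of J] unfolding pt_def by (simp add: some_in_eq)

lemma pt01: "J \<in> \<I> \<Longrightarrow> pt J \<in> {0..1}"
  using pt_in I_sub by blast

lemma wt_nonneg: "J \<in> \<I> \<Longrightarrow> 0 \<le> wt J"
  using Inf_less_Sup[of J] by (simp add: wt_def)

lemma interval_bounds:
  assumes "J \<in> \<I>"
  shows "{Inf J<..<Sup J} \<subseteq> J" "J \<subseteq> {Inf J..Sup J}"
proof -
  have b: "bdd_above J" "bdd_below J" using I_sub[OF assms] by (auto intro: bdd_above_mono bdd_below_mono)
  show "J \<subseteq> {Inf J..Sup J}" using b by (auto intro: cInf_lower cSup_upper)
  show "{Inf J<..<Sup J} \<subseteq> J"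
  proof
    fix x assume "x \<in> {Inf J<..<Sup J}"
    then obtain a b where "a \<in> J" "b \<in> J" "a < x" "x < b"
      using cInf_lessD[OF I_ne[OF assms]] less_cSupD[OF I_ne[OF assms]] by (metis greaterThanLessThan_iff)
    then show "x \<in> J" using interval[OF assms] by (meson is_interval_1 less_imp_le)
  qed
qed

definition step_fun :: "(real \<Rightarrow> complex) \<Rightarrow> bool" where
  "step_fun g \<longleftrightarrow> (\<forall>J\<in>\<I>. \<forall>x\<in>J. \<forall>y\<in>J. g x = g y)"

lemma step_fun_pt: "step_fun g \<Longrightarrow> J \<in> \<I> \<Longrightarrow> x \<in> J \<Longrightarrow> g x = g (pt J)"
  unfolding step_fun_def using pt_in by blast

text \<open>The integral over the unit interval of a step function.\<close>

definition step_mean :: "(real \<Rightarrow> complex) \<Rightarrow> complex" where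
  "step_mean g = (\<Sum>J\<in>\<I>. of_real (wt J) * g (pt J))"

text \<open>On each piece the function is constant and the number of grid points is off by at most
  \<open>2\<close>.\<close>

lemma riemann_sum_step_fun:
  assumes g: "step_fun g" and B: "\<And>x. x \<in> {0..1} \<Longrightarrow> norm (g x) \<le> B" and N: "N \<ge> 1"
    and R: "R = {..<N} \<or> R = {1..N}"
  shows "norm ((\<Sum>j\<in>R. g (real j / real N)) / of_nat N - step_mean g) \<le> 2 * real (card \<I>) * B / real N"
proof -
  let ?c = "\<lambda>J. real (card {j\<in>R. real j / real N \<in> J})"
  have finR: "finite R" using R by auto
  have R01: "real j / real N \<in> {0..1}" if "j \<in> R" for j using that R N by auto
  have inter: "\<exists>J\<in>\<I>. x \<in> J" if "x \<in> {0..1}" for x using I_union that by blast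
  define loc where "loc x = (SOME J. J \<in> \<I> \<and> x \<in> J)" for x :: real
  have loc: "loc x \<in> \<I> \<and> x \<in> loc x" if "x \<in> {0..1}" for x
    unfolding loc_def by (rule someI_ex) (use inter[OF that] in blast)
  have loc_eq: "loc x = J \<longleftrightarrow> x \<in> J" if "x \<in> {0..1}" "J \<in> \<I>" for x J
    using loc[OF that(1)] I_disjoint that by blast
  have "(\<Sum>j\<in>R. g (real j / real N)) = (\<Sum>J\<in>\<I>. \<Sum>j | j \<in> R \<and> loc (real j / real N) = J. g (real j / real N))"
    by (rule sum.group[symmetric]) (use finR finite_I loc R01 in auto)
  also have "\<dots> = (\<Sum>J\<in>\<I>. of_real (?c J) * g (pt J))"
  proof (rule sum.cong[OF refl])
    fix J assume J: "J \<in> \<I>"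
    have "(\<Sum>j | j \<in> R \<and> loc (real j / real N) = J. g (real j / real N)) = (\<Sum>j | j \<in> R \<and> real j / real N \<in> J. g (pt J))"
      using loc_eq[OF R01 J] step_fun_pt[OF g J] by (intro sum.cong) auto
    then show "(\<Sum>j | j \<in> R \<and> loc (real j / real N) = J. g (real j / real N)) = of_real (?c J) * g (pt J)" by simp
  qed
  finally have "(\<Sum>j\<in>R. g (real j / real N)) / of_nat N - step_mean g =
      (\<Sum>J\<in>\<I>. of_real (?c J - real N * wt J) * g (pt J)) / of_nat N"
    using N by (simp add: step_mean_def sum_divide_distrib sum_subtractf[symmetric] field_simps)
  also have "norm \<dots> \<le> (\<Sum>J\<in>\<I>. 2 * B) / real N"
    unfolding norm_divide norm_of_nat
  proof (intro divide_right_mono sum_norm_le)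
    fix J assume J: "J \<in> \<I>"
    have "\<bar>?c J - real N * wt J\<bar> \<le> 2"
      unfolding wt_def using Inf_less_Sup[OF J]
      by (intro card_grid_interval[OF _ interval_bounds[OF J] I_sub[OF J] N R]) simp
    then show "norm (of_real (?c J - real N * wt J) * g (pt J)) \<le> 2 * B"
      unfolding norm_mult norm_of_real by (intro mult_mono B pt01 J) auto
  qed simp
  finally show ?thesis by (simp add: mult.commute mult.left_commute)
qed

lemma sc_const:
  assumes "I \<in> \<I>" "J \<in> \<I>" "x \<in> I" "x' \<in> I" "y \<in> J" "y' \<in> J"
  shows "sc i j x y = sc i j x' y'"
proof -
  have "(\<lambda>(x, y). sc i j x y) constant_on (I \<times> J)"
    using kernel assms(1,2) by (auto simp: kernel_assumption_def)
  then obtain c where "\<And>z. z \<in> I \<times> J \<Longrightarrow> (\<lambda>(x, y). sc i j x y) z = c"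
    by (auto simp: constant_on_def)
  from this[of "(x, y)"] this[of "(x', y')"] assms show ?thesis by simp
qed

lemma step_fun_sc_right: "x \<in> {0..1} \<Longrightarrow> step_fun (sc i j x)"
  using I_union sc_const unfolding step_fun_def by (metis UnionE)

lemma step_fun_sc_left: "y \<in> {0..1} \<Longrightarrow> step_fun (\<lambda>x. sc i j x y)"
  using I_union sc_const unfolding step_fun_def by (metis UnionE)

lemma s_expansion:
  assumes "x \<in> {0..1}" "y \<in> {0..1}" "norm \<xi> = 1" "norm \<eta> = 1"
  shows "of_real (s (x, \<xi>) (y, \<eta>)) = (\<Sum>i\<in>freqs L. \<Sum>j\<in>freqs L. sc i j x y * \<xi> powi i * \<eta> powi j)"
proof -
  have c: "(x, \<xi>) \<in> color_space" "(y, \<eta>) \<in> color_space" using assms by (auto simp: color_space_def)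
  have "\<forall>(x, \<xi>)\<in>color_space. \<forall>(y, \<eta>)\<in>color_space.
        complex_of_real (s (x, \<xi>) (y, \<eta>)) =
          (\<Sum>(i, j)\<in>fourier_support sc. sc i j x y * \<xi> powi i * \<eta> powi j)"
    using kernel by (simp add: kernel_assumption_def)
  then have "complex_of_real (s (x, \<xi>) (y, \<eta>)) =
      (\<Sum>(i, j)\<in>fourier_support sc. sc i j x y * \<xi> powi i * \<eta> powi j)"
    using c by fast
  also have "\<dots> = (\<Sum>(i, j)\<in>freqs L \<times> freqs L. sc i j x y * \<xi> powi i * \<eta> powi j)"
  proof (rule sum.mono_neutral_left)
    show "fourier_support sc \<subseteq> freqs L \<times> freqs L"
      using band by (fastforce simp: fourier_support_def)
    show "\<forall>z\<in>freqs L \<times> freqs L - fourier_support sc. (case z of (i, j) \<Rightarrow> sc i j x y * \<xi> powi i * \<eta> powi j) = 0"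
    proof
      fix z assume z: "z \<in> freqs L \<times> freqs L - fourier_support sc"
      obtain i j where ij: "z = (i, j)" by (cases z)
      have "sc i j x y = 0" using z assms(1,2) unfolding ij fourier_support_def by blast
      then show "(case z of (i, j) \<Rightarrow> sc i j x y * \<xi> powi i * \<eta> powi j) = 0" by (simp add: ij)
    qed
  qed simp
  finally show ?thesis by (simp add: sum.cartesian_product)
qed

lemma s_sym: "c \<in> color_space \<Longrightarrow> c' \<in> color_space \<Longrightarrow> s c c' = s c' c"
  and s_nonneg: "c \<in> color_space \<Longrightarrow> c' \<in> color_space \<Longrightarrow> 0 \<le> s c c'"
  using kernel by (auto simp: kernel_assumption_def)

text \<open>The coefficients are recovered from values of \<open>s\<close> at roots of unity, so the
  symmetry of \<open>s\<close> passes to them. It is needed for covariances of entries below the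
  diagonal.\<close>

lemma sc_sym:
  assumes x: "x \<in> {0..1}" and y: "y \<in> {0..1}"
  shows "sc i j x y = sc j i y x"
proof (cases "i \<in> freqs L \<and> j \<in> freqs L")
  case True
  \<comment> \<open>The smallest grid on which all frequencies up to \<open>L\<close> in absolute
    value are separated.\<close>
  define N where "N = 2 * L + 1"
  define w where "w v = cis (2 * pi * real v / real N)" for v
  have N: "N > 2 * L" by (simp add: N_def)
  have "of_nat N * of_nat N * sc i j x y = (\<Sum>u<N. \<Sum>v<N. of_real (s (x, w u) (y, w v)) * w u powi (-i) * w v powi (-j))"
    using sum_torus_coefficient[OF N, of i j "\<lambda>i j. sc i j x y"] True
    by (simp add: s_expansion[OF x y] w_def)
  also have "\<dots> = (\<Sum>v<N. \<Sum>u<N. of_real (s (y, w v) (x, w u)) * w v powi (-j) * w u powi (-i))"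
    using x y by (subst sum.swap, intro sum.cong refl)
      (simp add: s_sym[of "(x, _)" "(y, _)"] color_space_def w_def)
  also have "\<dots> = of_nat N * of_nat N * sc j i y x"
    using sum_torus_coefficient[OF N, of j i "\<lambda>i j. sc i j y x"] True
    by (simp add: s_expansion[OF y x] w_def)
  finally have "of_nat N * of_nat N * sc i j x y = of_nat N * of_nat N * sc j i y x" .
  moreover have "complex_of_nat N \<noteq> 0" unfolding of_nat_eq_0_iff by (simp add: N_def)
  ultimately show ?thesis by simp
qed (use band x y in auto)

text \<open>A crude substitute for the supremum: the coefficients take finitely many values on the
  unit square, one for each frequency and each pair of pieces.\<close>

definition sc_bound :: real where
  "sc_bound = (\<Sum>i\<in>freqs L. \<Sum>j\<in>freqs L. \<Sum>I\<in>\<I>. \<Sum>J\<in>\<I>. norm (sc i j (pt I) (pt J)))"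

lemma sc_bound_nonneg: "0 \<le> sc_bound"
  unfolding sc_bound_def by (intro sum_nonneg) auto

lemma norm_sc_le:
  assumes "x \<in> {0..1}" "y \<in> {0..1}"
  shows "norm (sc i j x y) \<le> sc_bound"
proof (cases "i \<in> freqs L \<and> j \<in> freqs L")
  case True
  obtain I J where IJ: "I \<in> \<I>" "J \<in> \<I>" "x \<in> I" "y \<in> J" using I_union assms by (metis UnionE)
  have "norm (sc i j x y) = norm (sc i j (pt I) (pt J))" using sc_const[OF IJ(1,2)] IJ pt_in by metis
  also have "\<dots> \<le> (\<Sum>J\<in>\<I>. norm (sc i j (pt I) (pt J)))"
    using IJ finite_I by (intro member_le_sum) auto
  also have "\<dots> \<le> (\<Sum>I\<in>\<I>. \<Sum>J\<in>\<I>. norm (sc i j (pt I) (pt J)))"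
    using IJ finite_I by (intro member_le_sum[where f = "\<lambda>I. \<Sum>J\<in>\<I>. norm (sc i j (pt I) (pt J))"]) (auto intro: sum_nonneg)
  also have "\<dots> \<le> (\<Sum>j\<in>freqs L. \<Sum>I\<in>\<I>. \<Sum>J\<in>\<I>. norm (sc i j (pt I) (pt J)))"
    using True by (intro member_le_sum[where f = "\<lambda>j. \<Sum>I\<in>\<I>. \<Sum>J\<in>\<I>. norm (sc i j (pt I) (pt J))"]) (auto intro!: sum_nonneg)
  also have "\<dots> \<le> sc_bound" unfolding sc_bound_def
    using True by (intro member_le_sum[where f = "\<lambda>i. \<Sum>j\<in>freqs L. \<Sum>I\<in>\<I>. \<Sum>J\<in>\<I>. norm (sc i j (pt I) (pt J))"]) (auto intro!: sum_nonneg)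
  finally show ?thesis .
qed (use band assms sc_bound_nonneg in auto)

text \<open>\<open>dcoef m p x\<close> is the limit of the entries of the \<open>m\<close>-th noncrossing path sum at distance \<open>p\<close> from
  the diagonal, near the macroscopic position \<open>x\<close>.\<close>

definition eta :: "(int \<Rightarrow> real \<Rightarrow> complex) \<Rightarrow> int \<Rightarrow> real \<Rightarrow> complex" where
  "eta f q x = step_mean (\<lambda>y. \<Sum>r\<in>freqs L. sc q (-r) x y * f r y)"

fun dcoef :: "nat \<Rightarrow> int \<Rightarrow> real \<Rightarrow> complex" where
  "dcoef 0 = (\<lambda>p x. if p = 0 then 1 else 0)"
| "dcoef (Suc m) = (\<lambda>p x. \<Sum>c<m. \<Sum>q\<in>freqs L. eta (dcoef c) q x * dcoef (m - 1 - c) (p - q) x)"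

declare dcoef.simps(2) [simp del]

lemma step_fun_eta: "step_fun (eta f q)"
proof -
  have "eta f q x = eta f q y" if "I \<in> \<I>" "x \<in> I" "y \<in> I" for I x y
    unfolding eta_def step_mean_def using sc_const[OF that(1) _ that(2,3)] pt_in
    by (intro sum.cong refl arg_cong2[where f = times]) metis
  then show ?thesis unfolding step_fun_def by blast
qed

lemma step_fun_dcoef: "step_fun (dcoef m p)"
proof (induction m arbitrary: p rule: less_induct)
  case (less m)
  show ?case
  proof (cases m)
    case (Suc m')
    have "dcoef (Suc m') p x = dcoef (Suc m') p y" if I: "I \<in> \<I>" "x \<in> I" "y \<in> I" for I x y
      unfolding dcoef.simps(2)
    proof (intro sum.cong refl arg_cong2[where f = times])
      fix c q assume "c \<in> {..<m'}"
      then have "step_fun (dcoef (m' - 1 - c) (p - q))" using Suc by (intro less.IH) auto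
      then show "dcoef (m' - 1 - c) (p - q) x = dcoef (m' - 1 - c) (p - q) y"
        using I unfolding step_fun_def by blast
      show "eta (dcoef c) q x = eta (dcoef c) q y" using step_fun_eta I unfolding step_fun_def by blast
    qed
    then show ?thesis unfolding Suc step_fun_def by blast
  qed (simp add: step_fun_def)
qed

text \<open>Every level of the recursion shifts the frequency by at most \<open>L\<close> and
  shortens the remaining path by at least one step.\<close>

lemma dcoef_eq_0: "x \<in> {0..1} \<Longrightarrow> p \<notin> freqs (L * m) \<Longrightarrow> dcoef m p x = 0"
proof (induction m arbitrary: p rule: less_induct)
  case (less m)
  show ?case
  proof (cases m)
    case 0
    then show ?thesis using less.prems by (auto simp: freqs_def)
  next
    case (Suc m')
    show ?thesis unfolding Suc dcoef.simps(2)
    proof (intro sum.neutral ballI)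
      fix c q assume c: "c \<in> {..<m'}" and q: "q \<in> freqs L"
      have "L * (m' - 1 - c) + L \<le> L * m"
        using c Suc mult_le_mono2[of "m' - 1 - c + 1" m L] by (simp add: algebra_simps)
      then have "int (L * (m' - 1 - c)) + int L \<le> int (L * m)" by (simp only: of_nat_add[symmetric] of_nat_le_iff)
      then have "p - q \<notin> freqs (L * (m' - 1 - c))"
        using less.prems(2) q unfolding freqs_def atLeastAtMost_iff by linarith
      then have "dcoef (m' - 1 - c) (p - q) x = 0" using c Suc less.prems(1) by (intro less.IH) auto
      then show "eta (dcoef c) q x * dcoef (m' - 1 - c) (p - q) x = 0" by simp
    qed
  qed
qed

definition dcoef_bound :: "nat \<Rightarrow> real" where
  "dcoef_bound m = (\<Sum>p\<in>freqs (L * m). \<Sum>J\<in>\<I>. norm (dcoef m p (pt J)))"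

lemma dcoef_bound_nonneg: "0 \<le> dcoef_bound m"
  unfolding dcoef_bound_def by (intro sum_nonneg) auto

lemma norm_dcoef_le:
  assumes "x \<in> {0..1}"
  shows "norm (dcoef m p x) \<le> dcoef_bound m"
proof (cases "p \<in> freqs (L * m)")
  case True
  obtain J where J: "J \<in> \<I>" "x \<in> J" using I_union assms by blast
  have "norm (dcoef m p x) = norm (dcoef m p (pt J))" using step_fun_pt[OF step_fun_dcoef J] by simp
  also have "\<dots> \<le> (\<Sum>J\<in>\<I>. norm (dcoef m p (pt J)))" using J finite_I by (intro member_le_sum) auto
  also have "\<dots> \<le> dcoef_bound m" unfolding dcoef_bound_def
    using True by (intro member_le_sum[where f = "\<lambda>p. \<Sum>J\<in>\<I>. norm (dcoef m p (pt J))"]) (auto intro: sum_nonneg)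
  finally show ?thesis .
qed (use dcoef_eq_0[OF assms] dcoef_bound_nonneg in auto)

text \<open>\<open>eta (dcoef m) q x\<close> is the \<open>q\<close>-th Fourier coefficient of the
  integral operator with kernel \<open>s\<close>, applied to the function with coefficients
  \<open>dcoef m\<close>: integration over the second circle pairs the frequency \<open>-r\<close>
  of the kernel with the frequency \<open>r\<close>.\<close>

definition eta_integrand :: "nat \<Rightarrow> int \<Rightarrow> real \<Rightarrow> real \<Rightarrow> complex" where
  "eta_integrand m q x y = (\<Sum>r\<in>freqs L. sc q (-r) x y * dcoef m r y)"

lemma eta_eq: "eta (dcoef m) q x = step_mean (eta_integrand m q x)"
  by (simp add: eta_def eta_integrand_def[abs_def])

lemma step_fun_eta_integrand: "x \<in> {0..1} \<Longrightarrow> step_fun (eta_integrand m q x)"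
  using step_fun_sc_right[of x] step_fun_dcoef[of m] unfolding step_fun_def eta_integrand_def
  by (intro ballI sum.cong refl arg_cong2[where f = times]) blast+

definition integrand_bound :: "nat \<Rightarrow> real" where
  "integrand_bound m = real (card (freqs L)) * (sc_bound * dcoef_bound m)"

lemma integrand_bound_nonneg: "0 \<le> integrand_bound m"
  unfolding integrand_bound_def using sc_bound_nonneg dcoef_bound_nonneg by simp

lemma norm_eta_integrand_le:
  assumes "x \<in> {0..1}" "y \<in> {0..1}"
  shows "norm (eta_integrand m q x y) \<le> integrand_bound m"
proof -
  have "norm (eta_integrand m q x y) \<le> (\<Sum>r\<in>freqs L. sc_bound * dcoef_bound m)"
    unfolding eta_integrand_def
    by (intro sum_norm_le order_trans[OF norm_mult_ineq] mult_mono norm_sc_le norm_dcoef_le assms sc_bound_nonneg) simp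
  then show ?thesis by (simp add: integrand_bound_def)
qed

lemma norm_eta_le:
  assumes "x \<in> {0..1}"
  shows "norm (eta (dcoef m) q x) \<le> (\<Sum>J\<in>\<I>. wt J) * integrand_bound m"
  unfolding eta_eq step_mean_def sum_distrib_right
  using wt_nonneg norm_eta_integrand_le[OF assms pt01]
  by (intro sum_norm_le) (simp add: norm_mult mult_left_mono)

end

section \<open>Convergence of the recursion of the model\<close>

lemma eventually_divide_le:
  fixes a :: real
  assumes "e > 0"
  shows "eventually (\<lambda>N. a / real N \<le> e) sequentially"
proof -
  have "(\<lambda>N. a / real N) \<longlonglongrightarrow> 0" by (rule lim_const_over_n)
  then have "eventually (\<lambda>N. a / real N < e) sequentially" using assms by (rule order_tendstoD(2))
  then show ?thesis by (rule eventually_mono) simp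
qed

lemma card_nat_near:
  assumes "0 \<le> R"
  shows "finite {i::nat. \<bar>real i - a\<bar> \<le> R}" "real (card {i::nat. \<bar>real i - a\<bar> \<le> R}) \<le> 2 * R + 1"
proof -
  let ?S = "{i::nat. \<bar>real i - a\<bar> \<le> R}"
  have sub: "int ` ?S \<subseteq> {\<lceil>a - R\<rceil>..\<lfloor>a + R\<rfloor>}"
    by (auto simp: ceiling_le_iff le_floor_iff abs_le_iff)
  have inj: "inj_on int ?S" by (simp add: inj_on_def)
  have fin: "finite (int ` ?S)" by (rule finite_subset[OF sub]) simp
  then show "finite ?S" by (rule finite_imageD[OF _ inj])
  have "card (int ` ?S) \<le> card {\<lceil>a - R\<rceil>..\<lfloor>a + R\<rfloor>}" by (rule card_mono[OF _ sub]) simp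
  then have "card ?S \<le> nat (\<lfloor>a + R\<rfloor> - \<lceil>a - R\<rceil> + 1)"
    unfolding card_image[OF inj] by simp
  then have "real (card ?S) \<le> max 0 (real_of_int (\<lfloor>a + R\<rfloor> - \<lceil>a - R\<rceil> + 1))" by linarith
  also have "\<dots> \<le> 2 * R + 1" using assms by linarith
  finally show "real (card ?S) \<le> 2 * R + 1" .
qed

context step_kernel
begin

lemma finite_endpoints: "finite (endpoints \<I>)"
  using finite_I by (simp add: endpoints_def)

lemma endpoints_01: "0 \<in> endpoints \<I>" "1 \<in> endpoints \<I>"
proof -
  have "(0::real) \<in> \<Union>\<I>" "(1::real) \<in> \<Union>\<I>" using I_union by auto
  then obtain I J where IJ: "I \<in> \<I>" "0 \<in> I" "J \<in> \<I>" "1 \<in> J" by blast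
  have "Inf I = 0" using I_sub[OF IJ(1)] IJ(2) by (intro cInf_eq_minimum) auto
  moreover have "Sup J = 1" using I_sub[OF IJ(3)] IJ(4) by (intro cSup_eq_maximum) auto
  ultimately show "0 \<in> endpoints \<I>" "1 \<in> endpoints \<I>"
    using IJ unfolding endpoints_def by (metis UnI1 UnI2 image_eqI)+
qed

lemma Q_set_iff: "i \<in> Q_set \<I> N R \<longleftrightarrow> i \<in> {1..N} \<and> (\<forall>x\<in>endpoints \<I>. \<bar>real i - real N * x\<bar> > R)"
proof -
  have "(\<lambda>x. \<bar>real i - real N * x\<bar>) ` endpoints \<I> \<noteq> {}" using endpoints_01 by auto
  then show ?thesis unfolding Q_set_def using finite_endpoints by (auto simp: Min_gr_iff)
qed

lemma Q_set_antimono: "R' \<le> R \<Longrightarrow> i \<in> Q_set \<I> N R \<Longrightarrow> i \<in> Q_set \<I> N R'"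
  unfolding Q_set_iff by fastforce

text \<open>Since \<open>0\<close> and \<open>1\<close> are endpoints, an index in
  \<open>Q_set \<I> N R\<close> is more than \<open>R\<close> away from both ends of the range, and
  short shifts stay inside it.\<close>

lemma Q_set_shift:
  assumes i: "i \<in> Q_set \<I> N R" and k: "\<bar>int i - k\<bar> \<le> int d" "real d \<le> R"
  shows "nat k \<in> Q_set \<I> N (R - real d)" "int (nat k) = k" "nat k \<in> {1..N}"
proof -
  have e: "\<bar>real i - real N * x\<bar> > R" if "x \<in> endpoints \<I>" for x using i that by (simp add: Q_set_iff)
  have i1: "1 \<le> i" "i \<le> N" using i by (auto simp: Q_set_iff)
  have k': "\<bar>real i - real_of_int k\<bar> \<le> real d" using k(1) by linarith
  have "real i > R" "real N - real i > R" using e[OF endpoints_01(1)] e[OF endpoints_01(2)] i1 by auto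
  then have "real_of_int k > 0" "real_of_int k < real N" using k' k(2) by linarith+
  then have kN: "k \<ge> 1" "k \<le> int N" by linarith+
  then show kk: "int (nat k) = k" "nat k \<in> {1..N}" by auto
  have "\<bar>real (nat k) - real N * x\<bar> > R - real d" if "x \<in> endpoints \<I>" for x
    using e[OF that] k' kk(1) by (smt (verit) of_int_of_nat_eq)
  then show "nat k \<in> Q_set \<I> N (R - real d)" unfolding Q_set_iff using kk by blast
qed

text \<open>No endpoint lies between the two positions, so they belong to the same piece of the
  partition.\<close>

lemma Q_set_same_value:
  assumes i: "i \<in> Q_set \<I> N R" and k: "k \<in> {1..N}" "\<bar>real i - real k\<bar> \<le> R" and g: "step_fun g"
  shows "g (real i / real N) = g (real k / real N)"
proof -
  let ?x = "real i / real N" and ?y = "real k / real N"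
  have N: "real N > 0" using k by auto
  have "i \<le> N" using i by (simp add: Q_set_iff)
  then have "?x \<in> {0..1}" using N by auto
  then obtain J where J: "J \<in> \<I>" "?x \<in> J" using I_union by blast
  have e: "\<bar>real i - real N * x\<bar> > R" if "x \<in> endpoints \<I>" for x using i that by (simp add: Q_set_iff)
  have xb: "Inf J \<le> ?x" "?x \<le> Sup J" using interval_bounds(2)[OF J(1)] J(2) by auto
  have "Inf J \<in> endpoints \<I>" "Sup J \<in> endpoints \<I>" using J(1) by (auto simp: endpoints_def)
  then have eb: "\<bar>real i - real N * Inf J\<bar> > R" "\<bar>real i - real N * Sup J\<bar> > R" using e by auto
  have b: "real N * Inf J \<le> real i" "real i \<le> real N * Sup J" using xb N by (auto simp: field_simps)
  have "real N * Inf J < real k" "real k < real N * Sup J" using b eb k(2) by linarith+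
  then have "?y \<in> {Inf J<..<Sup J}" using N by (auto simp: field_simps)
  then have "?y \<in> J" using interval_bounds(1)[OF J(1)] by blast
  then show ?thesis using g J unfolding step_fun_def by blast
qed

lemma card_non_Q_set:
  assumes "0 \<le> R"
  shows "real (card ({1..N} - Q_set \<I> N R)) \<le> real (card (endpoints \<I>)) * (2 * R + 1)"
proof -
  have "{1..N} - Q_set \<I> N R \<subseteq> (\<Union>x\<in>endpoints \<I>. {i. \<bar>real i - real N * x\<bar> \<le> R})"
    by (auto simp: Q_set_iff not_less)
  then have "card ({1..N} - Q_set \<I> N R) \<le> card (\<Union>x\<in>endpoints \<I>. {i::nat. \<bar>real i - real N * x\<bar> \<le> R})"
    by (intro card_mono) (auto simp: finite_endpoints card_nat_near(1)[OF assms])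
  also have "\<dots> \<le> (\<Sum>x\<in>endpoints \<I>. card {i::nat. \<bar>real i - real N * x\<bar> \<le> R})"
    by (rule card_UN_le[OF finite_endpoints])
  finally have "real (card ({1..N} - Q_set \<I> N R)) \<le> (\<Sum>x\<in>endpoints \<I>. real (card {i::nat. \<bar>real i - real N * x\<bar> \<le> R}))"
    by (simp only: of_nat_le_iff flip: of_nat_sum)
  also have "\<dots> \<le> (\<Sum>x\<in>endpoints \<I>. 2 * R + 1)" by (intro sum_mono card_nat_near(2)[OF assms])
  finally show ?thesis by simp
qed

lemma grid01: "j \<in> {1..N} \<Longrightarrow> real j / real N \<in> {0..1}"
  by auto

end

text \<open>The \<open>+ 1\<close> in the denominator permits \<open>a = 0\<close>.\<close>

lemma scaled_epsilon_le:
  fixes a \<epsilon> :: real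
  assumes "0 \<le> a" "0 < \<epsilon>"
  shows "0 < \<epsilon> / (2 * (a + 1))" "a * (\<epsilon> / (2 * (a + 1))) \<le> \<epsilon> / 2"
proof -
  show "0 < \<epsilon> / (2 * (a + 1))" using assms by simp
  have "a * (\<epsilon> / (2 * (a + 1))) = (a * \<epsilon>) / (2 * (a + 1))" by simp
  also have "\<dots> \<le> ((a + 1) * \<epsilon>) / (2 * (a + 1))"
    using assms by (intro divide_right_mono mult_right_mono) auto
  also have "\<dots> = \<epsilon> / 2"
    using assms unfolding mult.commute[of 2] by (intro nonzero_mult_divide_mult_cancel_left) linarith
  finally show "a * (\<epsilon> / (2 * (a + 1))) \<le> \<epsilon> / 2" .
qed

lemma norm_sum_diff_le_card:
  fixes h g :: "'b \<Rightarrow> complex"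
  assumes "finite V" "\<And>j. j \<in> V \<Longrightarrow> j \<notin> Bd \<Longrightarrow> norm (h j - g j) \<le> e"
    and "\<And>j. j \<in> V \<Longrightarrow> norm (h j - g j) \<le> E" "0 \<le> e" "0 \<le> E" "real (card (V \<inter> Bd)) \<le> b"
  shows "norm ((\<Sum>j\<in>V. h j) - (\<Sum>j\<in>V. g j)) \<le> real (card V) * e + b * E"
proof -
  have "norm ((\<Sum>j\<in>V. h j) - (\<Sum>j\<in>V. g j)) \<le> (\<Sum>j\<in>V. e + (if j \<in> Bd then E else 0))"
    unfolding sum_subtractf[symmetric]
  proof (rule sum_norm_le)
    fix j assume "j \<in> V"
    then show "norm (h j - g j) \<le> e + (if j \<in> Bd then E else 0)"
      using assms(2)[of j] assms(3)[of j] assms(4) by auto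
  qed
  also have "\<dots> = real (card V) * e + (\<Sum>j\<in>V. if j \<in> Bd then E else 0)"
    by (simp add: sum.distrib)
  also have "(\<Sum>j\<in>V. if j \<in> Bd then E else 0) = (\<Sum>j\<in>V \<inter> Bd. E)"
    using assms(1) by (intro sum.inter_restrict[symmetric])
  also have "\<dots> = real (card (V \<inter> Bd)) * E" by simp
  also have "\<dots> \<le> b * E" using assms by (intro mult_right_mono)
  finally show ?thesis by simp
qed

text \<open>An abstract form of the scaled path sums. In the inner sum \<open>l\<close> stays within
  \<open>L\<close> of \<open>j\<close>, so it is an average over \<open>j\<close>. If
  \<open>i\<close> and \<open>j\<close> are more than \<open>3 * L + 1\<close> apart, then
  \<open>k\<close> and \<open>l\<close>, each within \<open>L\<close> of its partner, are still more
  than \<open>L + 1\<close> apart, which exceeds \<open>K\<close> in the application; so both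
  entries are covered by the covariance assumption.\<close>

locale toeplitz_recursion = step_kernel +
  fixes K :: real and cov :: "nat \<Rightarrow> nat \<Rightarrow> nat \<Rightarrow> nat \<Rightarrow> nat \<Rightarrow> complex"
    and P :: "nat \<Rightarrow> nat \<Rightarrow> nat \<Rightarrow> nat \<Rightarrow> complex" and C :: real
  assumes K0: "0 \<le> K" and C0: "0 \<le> C"
    and P_0: "\<And>N i k. i \<in> {1..N} \<Longrightarrow> k \<in> {1..N} \<Longrightarrow> P N 0 i k = (if i = k then 1 else 0)"
    and P_Suc: "\<And>N m i k. i \<in> {1..N} \<Longrightarrow> k \<in> {1..N} \<Longrightarrow> P N (Suc m) i k =
      (\<Sum>c<m. \<Sum>k'\<in>{1..N}. ((\<Sum>j\<in>{1..N}. \<Sum>l\<in>{1..N}. cov N i j l k' * P N c j l) / of_nat N) * P N (m - 1 - c) k' k)"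
    and cov_0: "\<And>N i j l k. i \<in> {1..N} \<Longrightarrow> j \<in> {1..N} \<Longrightarrow> l \<in> {1..N} \<Longrightarrow> k \<in> {1..N} \<Longrightarrow>
      int i - int k \<notin> freqs L \<or> int j - int l \<notin> freqs L \<Longrightarrow> cov N i j l k = 0"
    and norm_cov: "\<And>N i j l k. i \<in> {1..N} \<Longrightarrow> j \<in> {1..N} \<Longrightarrow> l \<in> {1..N} \<Longrightarrow> k \<in> {1..N} \<Longrightarrow>
      norm (cov N i j l k) \<le> C"
    and cov_eq: "\<And>N i j l k. i \<in> Q_set \<I> N K \<Longrightarrow> j \<in> Q_set \<I> N K \<Longrightarrow> l \<in> Q_set \<I> N K \<Longrightarrow> k \<in> Q_set \<I> N K \<Longrightarrow>
      int i - int k \<in> freqs L \<Longrightarrow> int j - int l \<in> freqs L \<Longrightarrow> \<bar>int i - int j\<bar> > 3 * int L + 1 \<Longrightarrow>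
      cov N i j l k = sc (int i - int k) (int l - int j) (real i / real N) (real j / real N)"
begin

definition H :: "nat \<Rightarrow> nat \<Rightarrow> nat \<Rightarrow> nat \<Rightarrow> complex" where
  "H N c i k' = (\<Sum>j\<in>{1..N}. \<Sum>l\<in>{1..N}. cov N i j l k' * P N c j l) / of_nat N"

lemma card_near: "card {k\<in>{1..N}. int i - int k \<in> freqs L} \<le> card (freqs L)"
proof -
  have "card ((\<lambda>k. int i - int k) ` {k\<in>{1..N}. int i - int k \<in> freqs L}) = card {k\<in>{1..N}. int i - int k \<in> freqs L}"
    by (intro card_image) (auto simp: inj_on_def)
  moreover have "card ((\<lambda>k. int i - int k) ` {k\<in>{1..N}. int i - int k \<in> freqs L}) \<le> card (freqs L)"
    by (intro card_mono) auto
  ultimately show ?thesis by simp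
qed

lemma norm_band_sum_le:
  fixes F :: "nat \<Rightarrow> complex"
  assumes "\<And>k. k \<in> {1..N} \<Longrightarrow> int i - int k \<notin> freqs L \<Longrightarrow> F k = 0"
    and "\<And>k. k \<in> {1..N} \<Longrightarrow> norm (F k) \<le> b" "0 \<le> b"
  shows "norm (\<Sum>k\<in>{1..N}. F k) \<le> real (card (freqs L)) * b"
proof -
  have "(\<Sum>k\<in>{1..N}. F k) = (\<Sum>k\<in>{k\<in>{1..N}. int i - int k \<in> freqs L}. F k)"
    using assms(1) by (intro sum.mono_neutral_right) auto
  also have "norm \<dots> \<le> (\<Sum>k\<in>{k\<in>{1..N}. int i - int k \<in> freqs L}. b)"
    using assms(2) by (intro sum_norm_le) auto
  also have "\<dots> = real (card {k\<in>{1..N}. int i - int k \<in> freqs L}) * b" by simp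
  also have "\<dots> \<le> real (card (freqs L)) * b"
    using assms(3) card_near by (intro mult_right_mono) auto
  finally show ?thesis .
qed

text \<open>Away from the ends of the range every offset in \<open>freqs L\<close> is attained, so
  the sum can run over offsets.\<close>

lemma band_sum_eq:
  fixes F :: "nat \<Rightarrow> complex"
  assumes "\<And>k. k \<in> {1..N} \<Longrightarrow> int i - int k \<notin> freqs L \<Longrightarrow> F k = 0" and i: "i \<in> Q_set \<I> N R" "real L \<le> R"
  shows "(\<Sum>k\<in>{1..N}. F k) = (\<Sum>q\<in>freqs L. F (nat (int i - q)))"
proof -
  have s: "int (nat (int i - q)) = int i - q" "nat (int i - q) \<in> {1..N}" if "q \<in> freqs L" for q
  proof -
    have iq: "\<bar>int i - (int i - q)\<bar> \<le> int L" using that by (auto simp: freqs_def)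
    show "int (nat (int i - q)) = int i - q" "nat (int i - q) \<in> {1..N}"
      using Q_set_shift(2,3)[OF i(1) iq i(2)] by auto
  qed
  have "(\<Sum>k\<in>{1..N}. F k) = (\<Sum>k\<in>{k\<in>{1..N}. int i - int k \<in> freqs L}. F k)"
    using assms(1) by (intro sum.mono_neutral_right) auto
  also have "\<dots> = (\<Sum>q\<in>freqs L. F (nat (int i - q)))"
    by (rule sum.reindex_bij_witness[of _ "\<lambda>q. nat (int i - q)" "\<lambda>k. int i - int k"]) (use s in auto)
  finally show ?thesis .
qed

text \<open>The bound is uniform in \<open>N\<close> because the sums over \<open>l\<close> and
  \<open>k'\<close> have at most \<open>card (freqs L)\<close> nonzero terms and the sum over
  \<open>j\<close> is divided by \<open>N\<close>.\<close>

lemma P_bounded: "\<exists>B\<ge>0. \<forall>N i k. i \<in> {1..N} \<longrightarrow> k \<in> {1..N} \<longrightarrow> norm (P N m i k) \<le> B"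
proof (induction m rule: less_induct)
  case (less m)
  show ?case
  proof (cases m)
    case 0
    then show ?thesis using P_0 by (intro exI[of _ 1]) auto
  next
    case (Suc m')
    have "\<forall>c. \<exists>B. c < m \<longrightarrow> 0 \<le> B \<and> (\<forall>N i k. i \<in> {1..N} \<longrightarrow> k \<in> {1..N} \<longrightarrow> norm (P N c i k) \<le> B)"
      using less.IH by blast
    then obtain b where b: "\<And>c. c < m \<Longrightarrow> 0 \<le> b c"
      "\<And>c N i k. c < m \<Longrightarrow> i \<in> {1..N} \<Longrightarrow> k \<in> {1..N} \<Longrightarrow> norm (P N c i k) \<le> b c" by metis
    let ?n = "real (card (freqs L))"
    define B where "B = (\<Sum>c<m'. ?n * ((?n * (C * b c)) * b (m' - 1 - c)))"
    have "norm (P N m i k) \<le> B" if ik: "i \<in> {1..N}" "k \<in> {1..N}" for N i k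
    proof -
      have N: "N > 0" using ik by auto
      have Hb: "norm (H N c i k') \<le> ?n * (C * b c)" if c: "c < m" and k': "k' \<in> {1..N}" for c k'
      proof -
        have "norm (\<Sum>j\<in>{1..N}. \<Sum>l\<in>{1..N}. cov N i j l k' * P N c j l) \<le> (\<Sum>j\<in>{1..N}. ?n * (C * b c))"
        proof (rule sum_norm_le)
          fix j assume j: "j \<in> {1..N}"
          show "norm (\<Sum>l\<in>{1..N}. cov N i j l k' * P N c j l) \<le> ?n * (C * b c)"
          proof (rule norm_band_sum_le[of _ j])
            fix l assume l: "l \<in> {1..N}"
            show "int j - int l \<notin> freqs L \<Longrightarrow> cov N i j l k' * P N c j l = 0"
              using cov_0[OF ik(1) j l k'] by simp
            show "norm (cov N i j l k' * P N c j l) \<le> C * b c"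
              unfolding norm_mult by (intro mult_mono norm_cov b C0) (use ik j l k' c in auto)
          qed (use C0 b c in auto)
        qed
        also have "\<dots> = real N * (?n * (C * b c))" by simp
        finally show ?thesis using N by (simp add: H_def norm_divide divide_le_eq mult.commute)
      qed
      have Hz: "H N c i k' = 0" if "k' \<in> {1..N}" "int i - int k' \<notin> freqs L" for c k'
        unfolding H_def using cov_0[OF ik(1) _ _ that(1)] that(2) by simp
      have "norm (P N m i k) \<le> (\<Sum>c<m'. norm (\<Sum>k'\<in>{1..N}. H N c i k' * P N (m' - 1 - c) k' k))"
        unfolding Suc P_Suc[OF ik] H_def[symmetric] by (rule norm_sum)
      also have "\<dots> \<le> B" unfolding B_def
      proof (rule sum_mono)
        fix c assume "c \<in> {..<m'}"
        then have c: "c < m" "m' - 1 - c < m" using Suc by auto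
        show "norm (\<Sum>k'\<in>{1..N}. H N c i k' * P N (m' - 1 - c) k' k) \<le> ?n * ((?n * (C * b c)) * b (m' - 1 - c))"
        proof (rule norm_band_sum_le[of _ i])
          fix k' assume k': "k' \<in> {1..N}"
          show "int i - int k' \<notin> freqs L \<Longrightarrow> H N c i k' * P N (m' - 1 - c) k' k = 0" using Hz[OF k'] by simp
          show "norm (H N c i k' * P N (m' - 1 - c) k' k) \<le> (?n * (C * b c)) * b (m' - 1 - c)"
            unfolding norm_mult using C0 b(1)[OF c(1)] b(1)[OF c(2)] by (intro mult_mono Hb b(2) k' ik c) auto
        qed (use C0 b(1)[OF c(1)] b(1)[OF c(2)] in auto)
      qed
      finally show ?thesis .
    qed
    moreover have "0 \<le> B" unfolding B_def
      using C0 b Suc by (intro sum_nonneg mult_nonneg_nonneg) auto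
    ultimately show ?thesis by blast
  qed
qed

text \<open>The radius may depend on \<open>m\<close> but neither on \<open>\<epsilon>\<close> nor
  on \<open>N\<close>, so only boundedly many rows are excluded. Convergence is uniform in the
  remaining rows and in all columns.\<close>

definition P_converges :: "nat \<Rightarrow> bool" where
  "P_converges m \<longleftrightarrow> (\<exists>R\<ge>0. \<forall>\<epsilon>>0. eventually (\<lambda>N. \<forall>i\<in>Q_set \<I> N R. \<forall>k\<in>{1..N}.
     norm (P N m i k - dcoef m (int i - int k) (real i / real N)) \<le> \<epsilon>) sequentially)"

definition H_converges :: "nat \<Rightarrow> bool" where
  "H_converges c \<longleftrightarrow> (\<exists>R\<ge>0. \<forall>\<epsilon>>0. eventually (\<lambda>N. \<forall>i\<in>Q_set \<I> N R. \<forall>q\<in>freqs L.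
     norm (H N c i (nat (int i - q)) - eta (dcoef c) q (real i / real N)) \<le> \<epsilon>) sequentially)"

text \<open>For all but boundedly many \<open>j\<close> the covariances are given by
  \<open>sc\<close> and the path sums are close to \<open>dcoef\<close>. The average over
  \<open>j\<close> is thus a Riemann sum for \<open>eta\<close>, and the exceptional terms are
  bounded and vanish after division by \<open>N\<close>.\<close>

lemma H_converges_if_P_converges:
  assumes "P_converges c"
  shows "H_converges c"
proof -
  obtain R0 where R0: "0 \<le> R0" "\<And>\<epsilon>. \<epsilon> > 0 \<Longrightarrow> eventually (\<lambda>N. \<forall>i\<in>Q_set \<I> N R0. \<forall>k\<in>{1..N}.
     norm (P N c i k - dcoef c (int i - int k) (real i / real N)) \<le> \<epsilon>) sequentially"
    using assms unfolding P_converges_def by auto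
  obtain B where B: "0 \<le> B" "\<And>N i k. i \<in> {1..N} \<Longrightarrow> k \<in> {1..N} \<Longrightarrow> norm (P N c i k) \<le> B"
    using P_bounded[of c] by blast
  \<comment> \<open>Large enough that an index in \<open>Q_set \<I> N R\<close> meets the
    requirements with \<open>K\<close> and with \<open>R0\<close>, and that its shifts by at most
    \<open>L\<close> still meet the one with \<open>K\<close>.\<close>
  define R where "R = R0 + K + real L"
  have R: "0 \<le> R" "R0 \<le> R" "K \<le> R - real L" "real L \<le> R" "K \<le> R" using R0 K0 by (auto simp: R_def)
  let ?n = "real (card (freqs L))"
  define E where "E = ?n * (C * B) + integrand_bound c"
  define b where "b = real (card (endpoints \<I>)) * (2 * R + 1) + (2 * (3 * real L + 1) + 1)"
  have E0: "0 \<le> E" using C0 B integrand_bound_nonneg by (simp add: E_def)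
  have "eventually (\<lambda>N. \<forall>i\<in>Q_set \<I> N R. \<forall>q\<in>freqs L.
     norm (H N c i (nat (int i - q)) - eta (dcoef c) q (real i / real N)) \<le> \<epsilon>) sequentially" if e: "\<epsilon> > 0" for \<epsilon>
  proof -
    define e' where "e' = \<epsilon> / (2 * (?n * sc_bound + 1))"
    have n0: "0 \<le> ?n * sc_bound" using sc_bound_nonneg by simp
    have e': "e' > 0" "?n * (sc_bound * e') \<le> \<epsilon> / 2"
      using scaled_epsilon_le[OF n0 e] unfolding e'_def by (simp_all only: mult.assoc)
    have "eventually (\<lambda>N. (b * E + 2 * real (card \<I>) * integrand_bound c) / real N \<le> \<epsilon> / 2) sequentially"
      by (rule eventually_divide_le) (use e in simp)
    from eventually_conj[OF R0(2)[OF e'(1)] eventually_conj[OF this eventually_ge_at_top[of 1]]]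
    have "eventually (\<lambda>N. (\<forall>i\<in>Q_set \<I> N R0. \<forall>k\<in>{1..N}.
        norm (P N c i k - dcoef c (int i - int k) (real i / real N)) \<le> e') \<and>
        (b * E + 2 * real (card \<I>) * integrand_bound c) / real N \<le> \<epsilon> / 2 \<and> 1 \<le> N) sequentially" .
    then show ?thesis
    proof (rule eventually_mono, elim conjE, intro ballI)
      fix N i q
      assume close: "\<forall>i\<in>Q_set \<I> N R0. \<forall>k\<in>{1..N}. norm (P N c i k - dcoef c (int i - int k) (real i / real N)) \<le> e'"
        and small: "(b * E + 2 * real (card \<I>) * integrand_bound c) / real N \<le> \<epsilon> / 2" and N: "1 \<le> N"
        and i: "i \<in> Q_set \<I> N R" and q: "q \<in> freqs L"
      let ?k = "nat (int i - q)" and ?x = "real i / real N"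
      have iq: "\<bar>int i - (int i - q)\<bar> \<le> int L" using q by (auto simp: freqs_def)
      note sh = Q_set_shift[OF i iq R(4)]
      have iV: "i \<in> {1..N}" using i by (simp add: Q_set_iff)
      have x01: "?x \<in> {0..1}" by (rule grid01[OF iV])
      have kQ: "?k \<in> Q_set \<I> N K" and iQ: "i \<in> Q_set \<I> N K"
        using Q_set_antimono[OF R(3) sh(1)] Q_set_antimono[OF R(5) i] by auto
      define h where "h j = (\<Sum>l\<in>{1..N}. cov N i j l ?k * P N c j l)" for j
      define g where "g y = eta_integrand c q ?x y" for y
      \<comment> \<open>The exceptional \<open>j\<close> are near an endpoint of the partition or
        near \<open>i\<close>, where the entry approaches the diagonal.\<close>
      define Bd where "Bd = ({1..N} - Q_set \<I> N R) \<union> {j. \<bar>real j - real i\<bar> \<le> 3 * real L + 1}"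
      have hz: "cov N i j l ?k * P N c j l = 0" if "j \<in> {1..N}" "l \<in> {1..N}" "int j - int l \<notin> freqs L" for j l
        using cov_0[OF iV that(1,2) sh(3)] that(3) by simp
      have near: "norm (h j - g (real j / real N)) \<le> ?n * (sc_bound * e')" if j: "j \<in> {1..N}" "j \<notin> Bd" for j
      proof -
        have jQ: "j \<in> Q_set \<I> N R" and far: "\<bar>int i - int j\<bar> > 3 * int L + 1"
          using j by (auto simp: Bd_def)
        have jK: "j \<in> Q_set \<I> N K" "j \<in> Q_set \<I> N R0"
          using Q_set_antimono[OF R(5) jQ] Q_set_antimono[OF R(2) jQ] by auto
        have "h j = (\<Sum>r\<in>freqs L. cov N i j (nat (int j - r)) ?k * P N c j (nat (int j - r)))"
          unfolding h_def by (rule band_sum_eq[OF _ jQ R(4)]) (use hz j in auto)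
        also have "\<dots> = (\<Sum>r\<in>freqs L. sc q (-r) ?x (real j / real N) * P N c j (nat (int j - r)))"
        proof (intro sum.cong refl arg_cong2[where f = times])
          fix r assume r: "r \<in> freqs L"
          have jr: "\<bar>int j - (int j - r)\<bar> \<le> int L" using r by (auto simp: freqs_def)
          note shj = Q_set_shift[OF jQ jr R(4)]
          define l where "l = nat (int j - r)"
          have d: "int i - int ?k = q" "int j - int l = r" "int l - int j = -r"
            unfolding l_def sh(2) shj(2) by simp_all
          have "cov N i j l ?k = sc (int i - int ?k) (int l - int j) ?x (real j / real N)"
          proof (rule cov_eq[OF iQ jK(1) _ kQ])
            show "l \<in> Q_set \<I> N K" unfolding l_def by (rule Q_set_antimono[OF R(3) shj(1)])
          qed (use q r far in \<open>simp_all only: d\<close>)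
          then show "cov N i j (nat (int j - r)) ?k = sc q (-r) ?x (real j / real N)"
            by (simp only: d l_def[symmetric])
        qed
        finally have "h j - g (real j / real N) = (\<Sum>r\<in>freqs L. sc q (-r) ?x (real j / real N) *
            (P N c j (nat (int j - r)) - dcoef c r (real j / real N)))"
          by (simp add: g_def eta_integrand_def sum_subtractf right_diff_distrib)
        also have "norm \<dots> \<le> (\<Sum>r\<in>freqs L. sc_bound * e')"
        proof (rule sum_norm_le, unfold norm_mult, rule mult_mono)
          fix r assume r: "r \<in> freqs L"
          have jr: "\<bar>int j - (int j - r)\<bar> \<le> int L" using r by (auto simp: freqs_def)
          note shj = Q_set_shift[OF jQ jr R(4)]
          show "norm (sc q (-r) ?x (real j / real N)) \<le> sc_bound" by (rule norm_sc_le[OF x01 grid01[OF j(1)]])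
          show "norm (P N c j (nat (int j - r)) - dcoef c r (real j / real N)) \<le> e'"
            using bspec[OF bspec[OF close jK(2)] shj(3)] unfolding shj(2) by simp
        qed (auto simp: sc_bound_nonneg)
        finally show ?thesis by simp
      qed
      have all: "norm (h j - g (real j / real N)) \<le> E" if j: "j \<in> {1..N}" for j
      proof -
        have "norm (h j) \<le> ?n * (C * B)" unfolding h_def
        proof (rule norm_band_sum_le[of _ j])
          fix l assume l: "l \<in> {1..N}"
          show "norm (cov N i j l ?k * P N c j l) \<le> C * B"
            unfolding norm_mult by (intro mult_mono norm_cov B iV j l sh(3) C0) auto
        qed (use hz j C0 B in auto)
        moreover have "norm (g (real j / real N)) \<le> integrand_bound c"
          unfolding g_def by (rule norm_eta_integrand_le[OF x01 grid01[OF j]])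
        ultimately show ?thesis using norm_triangle_ineq4[of "h j" "g (real j / real N)"] by (simp add: E_def)
      qed
      have cb: "real (card ({1..N} \<inter> Bd)) \<le> b"
      proof -
        have "0 \<le> 3 * real L + 1" by simp
        note cn = card_nat_near[OF this, of "real i"]
        have "card ({1..N} \<inter> Bd) \<le> card (({1..N} - Q_set \<I> N R) \<union> {j. \<bar>real j - real i\<bar> \<le> 3 * real L + 1})"
          unfolding Bd_def by (rule card_mono) (use cn in auto)
        also have "\<dots> \<le> card ({1..N} - Q_set \<I> N R) + card {j::nat. \<bar>real j - real i\<bar> \<le> 3 * real L + 1}"
          by (rule card_Un_le)
        finally show ?thesis using card_non_Q_set[OF R(1), of N] cn(2) unfolding b_def by linarith
      qed
      have "norm ((\<Sum>j\<in>{1..N}. h j) - (\<Sum>j\<in>{1..N}. g (real j / real N))) \<le> real (card {1..N}) * (?n * (sc_bound * e')) + b * E"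
        using sc_bound_nonneg e'(1) E0 by (intro norm_sum_diff_le_card[of _ Bd] near all cb) auto
      then have "norm ((\<Sum>j\<in>{1..N}. h j) / of_nat N - (\<Sum>j\<in>{1..N}. g (real j / real N)) / of_nat N) \<le> ?n * (sc_bound * e') + b * E / real N"
        using N by (simp add: diff_divide_distrib[symmetric] norm_divide field_simps)
      moreover have "norm ((\<Sum>j\<in>{1..N}. g (real j / real N)) / of_nat N - eta (dcoef c) q ?x) \<le> 2 * real (card \<I>) * integrand_bound c / real N"
        unfolding eta_eq g_def using x01 N
        by (intro riemann_sum_step_fun step_fun_eta_integrand norm_eta_integrand_le) auto
      moreover have "H N c i ?k = (\<Sum>j\<in>{1..N}. h j) / of_nat N" by (simp add: H_def h_def)
      moreover have "norm (A - G) \<le> u \<Longrightarrow> norm (G - Z) \<le> v \<Longrightarrow> norm (A - Z) \<le> u + v" for A G Z :: complex and u v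
        using norm_triangle_ineq[of "A - G" "G - Z"] by simp
      ultimately have "norm (H N c i ?k - eta (dcoef c) q ?x) \<le>
          (?n * (sc_bound * e') + b * E / real N) + 2 * real (card \<I>) * integrand_bound c / real N" by metis
      then show "norm (H N c i ?k - eta (dcoef c) q ?x) \<le> \<epsilon>"
        using e'(2) small unfolding add_divide_distrib by linarith
    qed
  qed
  then show ?thesis unfolding H_converges_def using R(1) by blast
qed

end

lemma tendsto_if_eventually_norm_le:
  fixes f :: "nat \<Rightarrow> complex"
  assumes "\<And>\<epsilon>. \<epsilon> > 0 \<Longrightarrow> eventually (\<lambda>N. norm (f N - l) \<le> \<epsilon>) sequentially"
  shows "f \<longlonglongrightarrow> l"
proof (rule tendstoI)
  fix e :: real assume "e > 0"
  then have "eventually (\<lambda>N. norm (f N - l) \<le> e / 2) sequentially" by (intro assms) simp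
  then show "eventually (\<lambda>N. dist (f N) l < e) sequentially"
    by (rule eventually_mono) (use \<open>e > 0\<close> in \<open>simp add: dist_norm\<close>)
qed

lemma norm_diff_trans:
  fixes a b c :: complex
  assumes "norm (a - b) \<le> u" "norm (b - c) \<le> v"
  shows "norm (a - c) \<le> u + v"
  using norm_triangle_ineq[of "a - b" "b - c"] assms by simp

lemma norm_mult_diff_le:
  fixes h p e d :: complex
  assumes "norm (h - e) \<le> \<epsilon>" "norm (p - d) \<le> \<epsilon>" "norm p \<le> b" "norm e \<le> eb"
  shows "norm (h * p - e * d) \<le> (b + eb) * \<epsilon>"
proof -
  have "h * p - e * d = (h - e) * p + e * (p - d)" by (simp add: algebra_simps)
  then have "norm (h * p - e * d) \<le> norm (h - e) * norm p + norm e * norm (p - d)"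
    by (metis norm_mult norm_triangle_ineq)
  also have "\<dots> \<le> \<epsilon> * b + eb * \<epsilon>"
    using assms order_trans[OF norm_ge_zero assms(1)] order_trans[OF norm_ge_zero assms(4)]
    by (intro add_mono mult_mono) auto
  finally show ?thesis by (simp add: algebra_simps)
qed

context step_kernel
begin

definition eta_bound :: "nat \<Rightarrow> real" where
  "eta_bound c = (\<Sum>J\<in>\<I>. wt J) * integrand_bound c"

lemma eta_bound_nonneg: "0 \<le> eta_bound c"
  unfolding eta_bound_def using wt_nonneg integrand_bound_nonneg by (intro mult_nonneg_nonneg sum_nonneg) auto

lemma norm_eta_le_bound: "x \<in> {0..1} \<Longrightarrow> norm (eta (dcoef c) q x) \<le> eta_bound c"
  unfolding eta_bound_def by (rule norm_eta_le)

end

context toeplitz_recursion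
begin

text \<open>Each term of the recursion is a product of a converging average \<open>H\<close> and a
  shorter path sum. Only the offsets in \<open>freqs L\<close> contribute, so finitely many product
  estimates add up.\<close>

lemma P_converges_all: "P_converges m"
proof (induction m rule: less_induct)
  case (less m)
  show ?case
  proof (cases m)
    case 0
    have "norm (P N 0 i k - dcoef 0 (int i - int k) (real i / real N)) \<le> \<epsilon>"
      if "i \<in> Q_set \<I> N 0" "k \<in> {1..N}" "\<epsilon> > 0" for N i k \<epsilon>
      using P_0[of i N k] that by (simp add: Q_set_iff)
    then show ?thesis unfolding 0 P_converges_def by (intro exI[of _ 0]) (auto intro!: always_eventually)
  next
    case (Suc m')
    define CP where "CP c R \<longleftrightarrow> (\<forall>\<epsilon>>0. eventually (\<lambda>N. \<forall>i\<in>Q_set \<I> N R. \<forall>k\<in>{1..N}.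
        norm (P N c i k - dcoef c (int i - int k) (real i / real N)) \<le> \<epsilon>) sequentially)" for c R
    define CH where "CH c R \<longleftrightarrow> (\<forall>\<epsilon>>0. eventually (\<lambda>N. \<forall>i\<in>Q_set \<I> N R. \<forall>q\<in>freqs L.
        norm (H N c i (nat (int i - q)) - eta (dcoef c) q (real i / real N)) \<le> \<epsilon>) sequentially)" for c R
    have "\<forall>c\<in>{..<m}. \<exists>R. 0 \<le> R \<and> CP c R"
      using less.IH unfolding P_converges_def CP_def by simp
    from bchoice[OF this] obtain RP where RP': "\<forall>c\<in>{..<m}. 0 \<le> RP c \<and> CP c (RP c)" ..
    have "\<forall>c\<in>{..<m}. \<exists>R. 0 \<le> R \<and> CH c R"
      using H_converges_if_P_converges[OF less.IH] unfolding H_converges_def CH_def by simp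
    from bchoice[OF this] obtain RH where RH': "\<forall>c\<in>{..<m}. 0 \<le> RH c \<and> CH c (RH c)" ..
    have RP: "0 \<le> RP c" "\<epsilon> > 0 \<Longrightarrow> eventually (\<lambda>N. \<forall>i\<in>Q_set \<I> N (RP c). \<forall>k\<in>{1..N}.
        norm (P N c i k - dcoef c (int i - int k) (real i / real N)) \<le> \<epsilon>) sequentially" if "c < m" for c \<epsilon>
      using RP' that unfolding CP_def by simp_all
    have RH: "0 \<le> RH c" "\<epsilon> > 0 \<Longrightarrow> eventually (\<lambda>N. \<forall>i\<in>Q_set \<I> N (RH c). \<forall>q\<in>freqs L.
        norm (H N c i (nat (int i - q)) - eta (dcoef c) q (real i / real N)) \<le> \<epsilon>) sequentially" if "c < m" for c \<epsilon>
      using RH' that unfolding CH_def by simp_all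
    obtain b where b: "\<And>c. 0 \<le> b c" "\<And>c N i k. i \<in> {1..N} \<Longrightarrow> k \<in> {1..N} \<Longrightarrow> norm (P N c i k) \<le> b c"
      using P_bounded by metis
    \<comment> \<open>The sum dominates all radii of shorter path lengths at once; the extra
      \<open>L\<close> absorbs the shift from \<open>i\<close> to
      \<open>nat (int i - q)\<close>.\<close>
    define R where "R = (\<Sum>c<m. RP c + RH c) + real L"
    have RcS: "RP c + RH c \<le> (\<Sum>c<m. RP c + RH c)" if "c < m" for c
      using that RP(1) RH(1) by (intro member_le_sum[where f = "\<lambda>c. RP c + RH c"]) auto
    have R: "0 \<le> R" "real L \<le> R" "\<And>c. c < m \<Longrightarrow> RP c \<le> R - real L" "\<And>c. c < m \<Longrightarrow> RH c \<le> R"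
    proof -
      have "0 \<le> (\<Sum>c<m. RP c + RH c)" using RP(1) RH(1) by (intro sum_nonneg) auto
      then show "0 \<le> R" "real L \<le> R" unfolding R_def by auto
      show "RP c \<le> R - real L" "RH c \<le> R" if "c < m" for c
        using RcS[OF that] RP(1)[OF that] RH(1)[OF that] unfolding R_def by auto
    qed
    let ?n = "real (card (freqs L))"
    define Mb where "Mb = (\<Sum>c<m'. ?n * (b (m' - 1 - c) + eta_bound c))"
    have Mb0: "0 \<le> Mb" unfolding Mb_def using b(1) eta_bound_nonneg by (intro sum_nonneg mult_nonneg_nonneg add_nonneg_nonneg) auto
    have "eventually (\<lambda>N. \<forall>i\<in>Q_set \<I> N R. \<forall>k\<in>{1..N}.
        norm (P N m i k - dcoef m (int i - int k) (real i / real N)) \<le> \<epsilon>) sequentially" if e: "\<epsilon> > 0" for \<epsilon>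
    proof -
      define e' where "e' = \<epsilon> / (2 * (Mb + 1))"
      have e': "e' > 0" "Mb * e' \<le> \<epsilon> / 2" unfolding e'_def using scaled_epsilon_le[OF Mb0 e] by auto
      have "eventually (\<lambda>N. \<forall>c\<in>{..<m}. (\<forall>i\<in>Q_set \<I> N (RP c). \<forall>k\<in>{1..N}.
          norm (P N c i k - dcoef c (int i - int k) (real i / real N)) \<le> e') \<and>
          (\<forall>i\<in>Q_set \<I> N (RH c). \<forall>q\<in>freqs L.
          norm (H N c i (nat (int i - q)) - eta (dcoef c) q (real i / real N)) \<le> e')) sequentially"
        by (intro eventually_ball_finite ballI eventually_conj RP(2) RH(2) e'(1)) auto
      then show ?thesis
      proof (rule eventually_mono, intro ballI)
        fix N i k
        assume ev: "\<forall>c\<in>{..<m}. (\<forall>i\<in>Q_set \<I> N (RP c). \<forall>k\<in>{1..N}.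
          norm (P N c i k - dcoef c (int i - int k) (real i / real N)) \<le> e') \<and>
          (\<forall>i\<in>Q_set \<I> N (RH c). \<forall>q\<in>freqs L.
          norm (H N c i (nat (int i - q)) - eta (dcoef c) q (real i / real N)) \<le> e')"
          and i: "i \<in> Q_set \<I> N R" and k: "k \<in> {1..N}"
        let ?x = "real i / real N"
        have iV: "i \<in> {1..N}" using i by (simp add: Q_set_iff)
        have Hz: "H N c i k' = 0" if "k' \<in> {1..N}" "int i - int k' \<notin> freqs L" for c k'
          unfolding H_def using cov_0[OF iV _ _ that(1)] that(2) by simp
        have "P N m i k = (\<Sum>c<m'. \<Sum>k'\<in>{1..N}. H N c i k' * P N (m' - 1 - c) k' k)"
          unfolding Suc P_Suc[OF iV k] H_def[symmetric] ..
        also have "\<dots> = (\<Sum>c<m'. \<Sum>q\<in>freqs L. H N c i (nat (int i - q)) * P N (m' - 1 - c) (nat (int i - q)) k)"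
          by (intro sum.cong refl band_sum_eq[OF _ i R(2)]) (simp add: Hz)
        finally have eq: "P N m i k - dcoef m (int i - int k) ?x = (\<Sum>c<m'. \<Sum>q\<in>freqs L.
            H N c i (nat (int i - q)) * P N (m' - 1 - c) (nat (int i - q)) k -
            eta (dcoef c) q ?x * dcoef (m' - 1 - c) (int i - int k - q) ?x)"
          unfolding Suc dcoef.simps(2) by (simp only: sum_subtractf)
        have "norm (P N m i k - dcoef m (int i - int k) ?x) \<le>
            (\<Sum>c<m'. \<Sum>q\<in>freqs L. (b (m' - 1 - c) + eta_bound c) * e')"
          unfolding eq
        proof (intro sum_norm_le)
          fix c q assume c: "c \<in> {..<m'}" and q: "q \<in> freqs L"
          then have cm: "c \<in> {..<m}" "m' - 1 - c \<in> {..<m}" "c < m" "m' - 1 - c < m" using Suc by auto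
          let ?k = "nat (int i - q)" and ?c = "m' - 1 - c"
          have iq: "\<bar>int i - (int i - q)\<bar> \<le> int L" using q by (auto simp: freqs_def)
          note sh = Q_set_shift[OF i iq R(2)]
          have near: "\<bar>real i - real ?k\<bar> \<le> R"
          proof -
            have "\<bar>int i - int ?k\<bar> \<le> int L" using iq unfolding sh(2) .
            then show ?thesis using R(2) by linarith
          qed
          have kQ: "?k \<in> Q_set \<I> N (RP ?c)" by (rule Q_set_antimono[OF R(3)[OF cm(4)] sh(1)])
          have iQ: "i \<in> Q_set \<I> N (RH c)" by (rule Q_set_antimono[OF R(4)[OF cm(3)] i])
          have "norm (P N ?c ?k k - dcoef ?c (int ?k - int k) (real ?k / real N)) \<le> e'"
            using ev cm(2) kQ k by blast
          also have "dcoef ?c (int ?k - int k) (real ?k / real N) = dcoef ?c (int i - int k - q) ?x"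
            using Q_set_same_value[OF i sh(3) near step_fun_dcoef] unfolding sh(2)
            by (simp add: algebra_simps)
          finally have p: "norm (P N ?c ?k k - dcoef ?c (int i - int k - q) ?x) \<le> e'" .
          have h: "norm (H N c i ?k - eta (dcoef c) q ?x) \<le> e'" using ev cm(1) iQ q by blast
          show "norm (H N c i ?k * P N ?c ?k k - eta (dcoef c) q ?x * dcoef ?c (int i - int k - q) ?x)
              \<le> (b ?c + eta_bound c) * e'"
            by (rule norm_mult_diff_le[OF h p b(2)[OF sh(3) k] norm_eta_le_bound[OF grid01[OF iV]]])
        qed
        also have "\<dots> = Mb * e'" unfolding Mb_def sum_distrib_right sum_constant by (simp only: mult.assoc)
        finally show "norm (P N m i k - dcoef m (int i - int k) ?x) \<le> \<epsilon>" using e'(2) e by linarith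
      qed
    qed
    then show ?thesis unfolding P_converges_def using R(1) by blast
  qed
qed

text \<open>On the diagonal the distance is \<open>0\<close>, so the trace is a Riemann sum of
  \<open>dcoef m 0\<close> up to boundedly many bounded terms.\<close>

lemma trace_P_tendsto: "(\<lambda>N. (\<Sum>i\<in>{1..N}. P N m i i) / of_nat N) \<longlonglongrightarrow> step_mean (dcoef m 0)"
proof (rule tendsto_if_eventually_norm_le)
  fix \<epsilon> :: real assume e: "\<epsilon> > 0"
  obtain R where R: "0 \<le> R" "\<And>\<epsilon>. \<epsilon> > 0 \<Longrightarrow> eventually (\<lambda>N. \<forall>i\<in>Q_set \<I> N R. \<forall>k\<in>{1..N}.
     norm (P N m i k - dcoef m (int i - int k) (real i / real N)) \<le> \<epsilon>) sequentially"
    using P_converges_all[of m] unfolding P_converges_def by auto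
  obtain B where B: "0 \<le> B" "\<And>N i k. i \<in> {1..N} \<Longrightarrow> k \<in> {1..N} \<Longrightarrow> norm (P N m i k) \<le> B"
    using P_bounded[of m] by blast
  define b where "b = real (card (endpoints \<I>)) * (2 * R + 1)"
  define E where "E = B + dcoef_bound m"
  have "eventually (\<lambda>N. (b * E + 2 * real (card \<I>) * dcoef_bound m) / real N \<le> \<epsilon> / 2) sequentially"
    by (rule eventually_divide_le) (use e in simp)
  from eventually_conj[OF R(2)[OF half_gt_zero[OF e]] eventually_conj[OF this eventually_ge_at_top[of 1]]]
  show "eventually (\<lambda>N. norm ((\<Sum>i\<in>{1..N}. P N m i i) / of_nat N - step_mean (dcoef m 0)) \<le> \<epsilon>) sequentially"
  proof (rule eventually_mono, elim conjE)
    fix N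
    assume close: "\<forall>i\<in>Q_set \<I> N R. \<forall>k\<in>{1..N}. norm (P N m i k - dcoef m (int i - int k) (real i / real N)) \<le> \<epsilon> / 2"
      and small: "(b * E + 2 * real (card \<I>) * dcoef_bound m) / real N \<le> \<epsilon> / 2" and N: "1 \<le> N"
    let ?g = "\<lambda>i. dcoef m 0 (real i / real N)"
    have "norm ((\<Sum>i\<in>{1..N}. P N m i i) - (\<Sum>i\<in>{1..N}. ?g i)) \<le> real (card {1..N}) * (\<epsilon> / 2) + b * E"
    proof (rule norm_sum_diff_le_card[of _ "{1..N} - Q_set \<I> N R"])
      fix i assume i: "i \<in> {1..N}"
      show "norm (P N m i i - ?g i) \<le> E"
        using norm_triangle_ineq4[of "P N m i i" "?g i"] B(2)[OF i i] norm_dcoef_le[OF grid01[OF i], of m 0]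
        by (simp add: E_def)
      assume "i \<notin> {1..N} - Q_set \<I> N R"
      then show "norm (P N m i i - ?g i) \<le> \<epsilon> / 2" using close i by fastforce
    next
      have "{1..N} \<inter> ({1..N} - Q_set \<I> N R) = {1..N} - Q_set \<I> N R" by auto
      then show "real (card ({1..N} \<inter> ({1..N} - Q_set \<I> N R))) \<le> b"
        using card_non_Q_set[OF R(1), of N] by (simp add: b_def)
    qed (use e B dcoef_bound_nonneg in \<open>auto simp: E_def\<close>)
    then have 1: "norm ((\<Sum>i\<in>{1..N}. P N m i i) / of_nat N - (\<Sum>i\<in>{1..N}. ?g i) / of_nat N) \<le> \<epsilon> / 2 + b * E / real N"
      using N by (simp add: diff_divide_distrib[symmetric] norm_divide field_simps)
    have 2: "norm ((\<Sum>i\<in>{1..N}. ?g i) / of_nat N - step_mean (dcoef m 0)) \<le> 2 * real (card \<I>) * dcoef_bound m / real N"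
      using N by (intro riemann_sum_step_fun step_fun_dcoef norm_dcoef_le) auto
    show "norm ((\<Sum>i\<in>{1..N}. P N m i i) / of_nat N - step_mean (dcoef m 0)) \<le> \<epsilon>"
      using norm_diff_trans[OF 1 2] small unfolding add_divide_distrib by linarith
  qed
qed

end

section \<open>Convergence of the recursion of the color matrix\<close>

lemma sum_color_points:
  fixes F :: "color \<Rightarrow> complex"
  shows "(\<Sum>k<N\<^sup>2. F (color_point N k)) = (\<Sum>u<N. \<Sum>v<N. F (real u / real N, cis (2 * pi * real v / real N)))"
proof -
  have "(\<Sum>k<N\<^sup>2. F (color_point N k)) =
      (\<Sum>(u, v)\<in>{..<N} \<times> {..<N}. F (real u / real N, cis (2 * pi * real v / real N)))"
  proof (rule sum.reindex_bij_witness[of _ "\<lambda>(u, v). u * N + v" "\<lambda>k. (k div N, k mod N)"])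
    fix k assume k: "k \<in> {..<N\<^sup>2}"
    then have "N > 0" by (cases "N = 0") auto
    then show "(k div N, k mod N) \<in> {..<N} \<times> {..<N}"
      using k by (auto simp: power2_eq_square less_mult_imp_div_less)
    show "(case (k div N, k mod N) of (u, v) \<Rightarrow> u * N + v) = k" by simp
    show "(case (k div N, k mod N) of (u, v) \<Rightarrow> F (real u / real N, cis (2 * pi * real v / real N))) = F (color_point N k)"
      by (simp add: color_point_def)
  next
    fix z assume "z \<in> {..<N} \<times> {..<N}"
    then obtain u v where z: "z = (u, v)" "u < N" "v < N" by auto
    have "u * N + v < Suc u * N" using z by simp
    also have "\<dots> \<le> N * N" using z by (intro mult_le_mono1) simp
    finally show "(case z of (u, v) \<Rightarrow> u * N + v) \<in> {..<N\<^sup>2}" by (simp add: z power2_eq_square)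
    show "((case z of (u, v) \<Rightarrow> u * N + v) div N, (case z of (u, v) \<Rightarrow> u * N + v) mod N) = z"
      using z by simp
  qed
  then show ?thesis by (simp add: sum.cartesian_product)
qed

lemma color_point_in:
  assumes "k < N\<^sup>2"
  shows "fst (color_point N k) \<in> {0..1}" "norm (snd (color_point N k)) = 1" "color_point N k \<in> color_space"
proof -
  have N: "N > 0" using assms by (cases "N = 0") auto
  have "k div N < N" using assms by (auto simp: power2_eq_square less_mult_imp_div_less)
  then have "real (k div N) / real N \<in> {0..1}" using N by auto
  then show "fst (color_point N k) \<in> {0..1}" "norm (snd (color_point N k)) = 1" "color_point N k \<in> color_space"
    by (auto simp: color_point_def color_space_def)
qed

lemma sum_powi_unit:
  assumes N: "int N > \<bar>k\<bar>"
  shows "(\<Sum>v<N. cis (2 * pi * real v / real N) powi k) = (if k = 0 then of_nat N else 0)"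
proof -
  have "int N dvd k \<longleftrightarrow> k = 0"
    using zdvd_imp_le[of "int N" "\<bar>k\<bar>"] N by auto
  then show ?thesis using N by (subst sum_roots_of_unity) auto
qed

lemma nc_bound_mono: "0 \<le> c \<Longrightarrow> c \<le> c' \<Longrightarrow> nc_bound c m \<le> nc_bound c' m"
proof (induction m rule: less_induct)
  case (less m)
  show ?case
  proof (cases m)
    case (Suc m')
    show ?thesis unfolding Suc nc_bound.simps
      using less Suc by (intro sum_mono mult_mono less.IH mult_nonneg_nonneg nc_bound_nonneg) auto
  qed simp
qed

text \<open>The pairs \<open>(k, m - 1 - k)\<close> are distinct points of the square
  \<open>{..<M} \<times> {..<M}\<close>, so a Cauchy product is below the product of partial
  sums.\<close>

lemma sum_triangle_le:
  fixes T :: "nat \<Rightarrow> nat \<Rightarrow> real"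
  assumes "\<And>k l. 0 \<le> T k l"
  shows "(\<Sum>m<M. \<Sum>k<m. T k (m - 1 - k)) \<le> (\<Sum>k<M. \<Sum>l<M. T k l)"
proof (cases M)
  case (Suc M')
  have "(\<Sum>m<M. \<Sum>k<m. T k (m - 1 - k)) = (\<Sum>m<M'. \<Sum>k\<le>m. T k (m - k))"
    unfolding Suc sum.lessThan_Suc_shift[where g = "\<lambda>m. \<Sum>k<m. T k (m - 1 - k)"]
    by (simp add: lessThan_Suc_atMost del: sum.lessThan_Suc)
  also have "\<dots> = (\<Sum>(k, l)\<in>{(k, l). k + l < M'}. T k l)"
    by (rule sum.triangle_reindex[symmetric])
  also have "\<dots> \<le> (\<Sum>(k, l)\<in>{..<M} \<times> {..<M}. T k l)"
    by (rule sum_mono2) (use assms Suc in auto)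
  also have "\<dots> = (\<Sum>k<M. \<Sum>l<M. T k l)" by (rule sum.cartesian_product[symmetric])
  finally show ?thesis .
qed simp

text \<open>The generating function of the bound satisfies a quadratic recursion, and its partial sums stay
  below \<open>2\<close> at every point \<open>z\<close> with \<open>c z\<^sup>2 \<le> 1 / 4\<close>.\<close>

lemma nc_bound_le:
  assumes c: "c > 0"
  shows "nc_bound c m \<le> 2 * (2 * sqrt c) ^ m"
proof -
  \<comment> \<open>With \<open>c * z\<^sup>2 = 1 / 4\<close> the recursion for the partial sums is
    governed by the map \<open>1 + t\<^sup>2 / 4\<close>, whose only fixed point is
    \<open>2\<close>.\<close>
  define z where "z = 1 / (2 * sqrt c)"
  have z: "z > 0" "c * (z * z) = 1 / 4"
    using c by (auto simp: z_def field_simps)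
  define S where "S M = (\<Sum>m<M. nc_bound c m * z ^ m)" for M
  have term0: "0 \<le> nc_bound c m * z ^ m" for m using c z by (simp add: nc_bound_nonneg)
  have S0: "0 \<le> S M" for M unfolding S_def by (intro sum_nonneg term0)
  have mono: "S M \<le> S M'" if "M \<le> M'" for M M'
    unfolding S_def using that term0 by (intro sum_mono2) auto
  have rec: "S (Suc M) \<le> 1 + 1 / 4 * (S M * S M)" for M
  proof -
    have "S (Suc M) = 1 + (\<Sum>m<M. nc_bound c (Suc m) * z ^ Suc m)"
      unfolding S_def by (subst sum.lessThan_Suc_shift) simp
    also have "(\<Sum>m<M. nc_bound c (Suc m) * z ^ Suc m) =
        (\<Sum>m<M. \<Sum>k<m. 1 / 4 * ((nc_bound c k * z ^ k) * (nc_bound c (m - 1 - k) * z ^ (m - 1 - k))))"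
    proof (intro sum.cong refl)
      fix m assume "m \<in> {..<M}"
      have "c * nc_bound c k * nc_bound c (m - 1 - k) * z ^ Suc m =
          1 / 4 * ((nc_bound c k * z ^ k) * (nc_bound c (m - 1 - k) * z ^ (m - 1 - k)))" if k: "k < m" for k
      proof -
        have "Suc m = Suc (Suc (k + (m - 1 - k)))" using k by simp
        then have "z ^ Suc m = (z * z) * (z ^ k * z ^ (m - 1 - k))" by (metis mult.assoc power_Suc power_add)
        then have "c * nc_bound c k * nc_bound c (m - 1 - k) * z ^ Suc m =
            (c * (z * z)) * ((nc_bound c k * z ^ k) * (nc_bound c (m - 1 - k) * z ^ (m - 1 - k)))"
          by (simp only: ac_simps)
        then show ?thesis unfolding z(2) .
      qed
      then show "nc_bound c (Suc m) * z ^ Suc m =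
          (\<Sum>k<m. 1 / 4 * ((nc_bound c k * z ^ k) * (nc_bound c (m - 1 - k) * z ^ (m - 1 - k))))"
        unfolding nc_bound.simps sum_distrib_right by (intro sum.cong refl) simp
    qed
    also have "\<dots> \<le> (\<Sum>k<M. \<Sum>l<M. 1 / 4 * ((nc_bound c k * z ^ k) * (nc_bound c l * z ^ l)))"
      by (intro sum_triangle_le mult_nonneg_nonneg[OF _ mult_nonneg_nonneg[OF term0 term0]]) simp
    also have "\<dots> = 1 / 4 * (S M * S M)"
      unfolding S_def by (subst sum_product) (simp only: sum_distrib_left)
    finally show ?thesis by simp
  qed
  have S2: "S M \<le> 2" for M
  proof (induction M)
    case (Suc M)
    have "S M * S M \<le> 2 * 2" using Suc S0 by (intro mult_mono) auto
    then show ?case using rec[of M] by simp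
  qed (simp add: S_def)
  have "nc_bound c m * z ^ m \<le> S (Suc m)"
    unfolding S_def using term0 by (intro member_le_sum) auto
  then have "nc_bound c m * z ^ m \<le> 2" using S2[of "Suc m"] by linarith
  then have "nc_bound c m \<le> 2 / z ^ m" using z(1) by (simp add: pos_le_divide_eq)
  also have "\<dots> = 2 * (2 * sqrt c) ^ m" by (simp add: z_def power_divide)
  finally show ?thesis .
qed

section \<open>Functions on the color space with coefficients \<open>dcoef\<close>\<close>

context step_kernel
begin

definition s_bound :: real where
  "s_bound = real (card (freqs L)) * (real (card (freqs L)) * sc_bound)"

lemma s_bound_nonneg: "0 \<le> s_bound"
  by (simp add: s_bound_def sc_bound_nonneg)

lemma abs_s_le:
  assumes "x \<in> {0..1}" "y \<in> {0..1}" "norm \<xi> = 1" "norm \<eta> = 1"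
  shows "\<bar>s (x, \<xi>) (y, \<eta>)\<bar> \<le> s_bound"
proof -
  have "\<bar>s (x, \<xi>) (y, \<eta>)\<bar> = norm (\<Sum>i\<in>freqs L. \<Sum>j\<in>freqs L. sc i j x y * \<xi> powi i * \<eta> powi j)"
    unfolding s_expansion[OF assms, symmetric] by simp
  also have "\<dots> \<le> (\<Sum>i\<in>freqs L. \<Sum>j\<in>freqs L. sc_bound)"
    by (intro sum_norm_le) (simp add: norm_mult norm_power_int assms(3,4) norm_sc_le[OF assms(1,2)])
  finally show ?thesis by (simp add: s_bound_def)
qed

lemma abs_s_color_point_le: "k < N\<^sup>2 \<Longrightarrow> j < N\<^sup>2 \<Longrightarrow> \<bar>s (color_point N k) (color_point N j)\<bar> \<le> s_bound"
  using abs_s_le[OF color_point_in(1)[of k N] color_point_in(1)[of j N] color_point_in(2)[of k N] color_point_in(2)[of j N]]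
  by simp

definition Dsym :: "nat \<Rightarrow> color \<Rightarrow> complex" where
  "Dsym m c = (\<Sum>p\<in>freqs (L * m). dcoef m p (fst c) * snd c powi p)"

text \<open>The integral operator with kernel \<open>s\<close> applied to \<open>Dsym c\<close>,
  written through its Fourier coefficients.\<close>

definition Gsym :: "nat \<Rightarrow> color \<Rightarrow> complex" where
  "Gsym c z = (\<Sum>q\<in>freqs L. eta (dcoef c) q (fst z) * snd z powi q)"

lemma Dsym_0: "Dsym 0 c = 1"
  by (simp add: Dsym_def freqs_def)

text \<open>The recursion of \<open>dcoef\<close> convolves coefficients, so for the trigonometric
  polynomials it is a pointwise product. This is the passage from the Toeplitz recursion to the one
  on colors.\<close>

lemma Dsym_Suc:
  assumes x: "fst z \<in> {0..1}" and xi: "norm (snd z) = 1"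
  shows "Dsym (Suc m) z = (\<Sum>c<m. Gsym c z * Dsym (m - 1 - c) z)"
proof -
  obtain x \<xi> where z: "z = (x, \<xi>)" by (cases z)
  have x: "x \<in> {0..1}" and xi: "norm \<xi> = 1" "\<xi> \<noteq> 0" using x xi by (auto simp: z)
  let ?F = "freqs (L * Suc m)"
  have inner: "(\<Sum>p\<in>?F. dcoef c' (p - q) x * \<xi> powi p) = \<xi> powi q * Dsym c' z"
    if c': "c' < m" and q: "q \<in> freqs L" for c' q
  proof -
    have "L * c' + L \<le> L * Suc m" using mult_le_mono2[of "Suc c'" "Suc m" L] c' by simp
    then have i: "int (L * c') + int L \<le> int (L * Suc m)" by (simp only: of_nat_add[symmetric] of_nat_le_iff)
    have "(\<Sum>p\<in>?F. dcoef c' (p - q) x * \<xi> powi p) = (\<Sum>p\<in>(\<lambda>r. r + q) ` freqs (L * c'). dcoef c' (p - q) x * \<xi> powi p)"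
    proof (rule sum.mono_neutral_right)
      show "(\<lambda>r. r + q) ` freqs (L * c') \<subseteq> ?F" using q i unfolding freqs_def by auto
      show "\<forall>p\<in>?F - (\<lambda>r. r + q) ` freqs (L * c'). dcoef c' (p - q) x * \<xi> powi p = 0"
      proof
        fix p assume "p \<in> ?F - (\<lambda>r. r + q) ` freqs (L * c')"
        then have "p - q \<notin> freqs (L * c')" by force
        then show "dcoef c' (p - q) x * \<xi> powi p = 0" using dcoef_eq_0[OF x] by simp
      qed
    qed simp
    also have "\<dots> = (\<Sum>r\<in>freqs (L * c'). dcoef c' r x * \<xi> powi (r + q))"
      by (subst sum.reindex) (auto simp: inj_on_def)
    also have "\<dots> = \<xi> powi q * Dsym c' z"
      using xi by (simp add: Dsym_def z power_int_add sum_distrib_left ac_simps)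
    finally show ?thesis .
  qed
  have "Dsym (Suc m) z = (\<Sum>p\<in>?F. \<Sum>c<m. \<Sum>q\<in>freqs L. eta (dcoef c) q x * (dcoef (m - 1 - c) (p - q) x * \<xi> powi p))"
    unfolding Dsym_def dcoef.simps(2) z by (simp add: sum_distrib_right mult.assoc)
  also have "\<dots> = (\<Sum>c<m. \<Sum>p\<in>?F. \<Sum>q\<in>freqs L. eta (dcoef c) q x * (dcoef (m - 1 - c) (p - q) x * \<xi> powi p))"
    by (rule sum.swap)
  also have "\<dots> = (\<Sum>c<m. \<Sum>q\<in>freqs L. \<Sum>p\<in>?F. eta (dcoef c) q x * (dcoef (m - 1 - c) (p - q) x * \<xi> powi p))"
    by (rule sum.cong[OF refl], rule sum.swap)
  also have "\<dots> = (\<Sum>c<m. \<Sum>q\<in>freqs L. eta (dcoef c) q x * (\<xi> powi q * Dsym (m - 1 - c) z))"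
  proof (intro sum.cong refl)
    fix c q assume c: "c \<in> {..<m}" and q: "q \<in> freqs L"
    then have "m - 1 - c < m" by auto
    from inner[OF this q] show "(\<Sum>p\<in>?F. eta (dcoef c) q x * (dcoef (m - 1 - c) (p - q) x * \<xi> powi p)) =
        eta (dcoef c) q x * (\<xi> powi q * Dsym (m - 1 - c) z)"
      unfolding sum_distrib_left[symmetric] by (rule arg_cong)
  qed
  also have "\<dots> = (\<Sum>c<m. Gsym c z * Dsym (m - 1 - c) z)"
    by (simp add: Gsym_def z sum_distrib_right mult.assoc)
  finally show ?thesis .
qed

lemma norm_Gsym_le:
  assumes "fst z \<in> {0..1}" "norm (snd z) = 1"
  shows "norm (Gsym c z) \<le> real (card (freqs L)) * eta_bound c"
proof -
  have "norm (Gsym c z) \<le> (\<Sum>p\<in>freqs L. eta_bound c)"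
    unfolding Gsym_def using norm_eta_le_bound[OF assms(1)]
    by (intro sum_norm_le) (simp add: norm_mult norm_power_int assms)
  then show ?thesis by simp
qed

text \<open>The sum over the circle is exact: all frequencies that occur have absolute value at most
  \<open>L + L * c < N\<close>. Only the sum over the interval remains as a Riemann sum.\<close>

lemma sum_s_Dsym:
  assumes z: "fst z \<in> {0..1}" "norm (snd z) = 1" and N: "N > L + L * c"
  shows "(\<Sum>j<N\<^sup>2. of_real (s z (color_point N j)) * Dsym c (color_point N j)) / of_nat (N\<^sup>2) =
    (\<Sum>q\<in>freqs L. ((\<Sum>u<N. eta_integrand c q (fst z) (real u / real N)) / of_nat N) * snd z powi q)"
proof -
  obtain x \<xi> where zz: "z = (x, \<xi>)" by (cases z)
  have x: "x \<in> {0..1}" and xi: "norm \<xi> = 1" using z by (auto simp: zz)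
  have N0: "N > 0" using N by simp
  define w where "w v = cis (2 * pi * real v / real N)" for v
  have orth: "(\<Sum>v<N. w v powi t * w v powi r) = (if t = - r then of_nat N else 0)"
    if "t \<in> freqs L" "r \<in> freqs (L * c)" for t r
  proof -
    have "\<bar>t + r\<bar> \<le> int L + int (L * c)" using that by (auto simp: freqs_def)
    also have "\<dots> < int N" using N by (simp only: of_nat_add[symmetric] of_nat_less_iff)
    finally have "(\<Sum>v<N. w v powi (t + r)) = (if t + r = 0 then of_nat N else 0)"
      unfolding w_def by (rule sum_powi_unit)
    moreover have "(\<Sum>v<N. w v powi t * w v powi r) = (\<Sum>v<N. w v powi (t + r))"
      by (intro sum.cong refl) (simp add: w_def power_int_add)
    moreover have "t + r = 0 \<longleftrightarrow> t = - r" by auto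
    ultimately show ?thesis by simp
  qed
  have one: "(\<Sum>v<N. of_real (s z (y, w v)) * Dsym c (y, w v)) = of_nat N * (\<Sum>q\<in>freqs L. eta_integrand c q x y * \<xi> powi q)"
    if y: "y \<in> {0..1}" for y
  proof -
    have "(\<Sum>v<N. of_real (s z (y, w v)) * Dsym c (y, w v)) =
        (\<Sum>v<N. \<Sum>q\<in>freqs L. \<Sum>t\<in>freqs L. \<Sum>r\<in>freqs (L * c).
          (sc q t x y * \<xi> powi q * dcoef c r y) * (w v powi t * w v powi r))"
    proof (intro sum.cong refl)
      fix v
      have wv: "norm (w v) = 1" by (simp add: w_def)
      show "of_real (s z (y, w v)) * Dsym c (y, w v) = (\<Sum>q\<in>freqs L. \<Sum>t\<in>freqs L. \<Sum>r\<in>freqs (L * c).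
          (sc q t x y * \<xi> powi q * dcoef c r y) * (w v powi t * w v powi r))"
        unfolding zz s_expansion[OF x y xi wv] Dsym_def fst_conv snd_conv
        unfolding sum_distrib_right unfolding sum_distrib_left
        by (intro sum.cong refl) (simp only: ac_simps)
    qed
    also have "\<dots> = (\<Sum>q\<in>freqs L. \<Sum>v<N. \<Sum>t\<in>freqs L. \<Sum>r\<in>freqs (L * c).
          (sc q t x y * \<xi> powi q * dcoef c r y) * (w v powi t * w v powi r))"
      by (rule sum.swap)
    also have "\<dots> = (\<Sum>q\<in>freqs L. \<Sum>t\<in>freqs L. \<Sum>v<N. \<Sum>r\<in>freqs (L * c).
          (sc q t x y * \<xi> powi q * dcoef c r y) * (w v powi t * w v powi r))"
      by (rule sum.cong[OF refl], rule sum.swap)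
    also have "\<dots> = (\<Sum>q\<in>freqs L. \<Sum>t\<in>freqs L. \<Sum>r\<in>freqs (L * c). \<Sum>v<N.
          (sc q t x y * \<xi> powi q * dcoef c r y) * (w v powi t * w v powi r))"
      by (rule sum.cong[OF refl], rule sum.cong[OF refl], rule sum.swap)
    also have "\<dots> = (\<Sum>q\<in>freqs L. \<Sum>t\<in>freqs L. \<Sum>r\<in>freqs (L * c).
          (sc q t x y * \<xi> powi q * dcoef c r y) * (if t = - r then of_nat N else 0))"
      by (intro sum.cong refl) (simp only: orth flip: sum_distrib_left)
    also have "\<dots> = (\<Sum>q\<in>freqs L. of_nat N * (eta_integrand c q x y * \<xi> powi q))"
    proof (intro sum.cong refl)
      fix q
      have "(\<Sum>t\<in>freqs L. \<Sum>r\<in>freqs (L * c). (sc q t x y * \<xi> powi q * dcoef c r y) * (if t = - r then of_nat N else 0)) =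
          (\<Sum>t\<in>freqs L. \<Sum>r\<in>freqs (L * c). if r = - t then (sc q t x y * \<xi> powi q * dcoef c (- t) y) * of_nat N else 0)"
        by (intro sum.cong refl) auto
      \<comment> \<open>If \<open>- t\<close> is outside \<open>freqs (L * c)\<close>, as happens
        for \<open>c = 0\<close>, the inner sum is empty and the coefficient on the right is zero
        too.\<close>
      also have "\<dots> = (\<Sum>t\<in>freqs L. (sc q t x y * \<xi> powi q * dcoef c (- t) y) * of_nat N)"
        using dcoef_eq_0[OF y, of _ c] by (intro sum.cong refl) (simp add: sum.delta)
      also have "\<dots> = (\<Sum>r\<in>freqs L. (sc q (- r) x y * \<xi> powi q * dcoef c r y) * of_nat N)"
        by (rule sum.reindex_bij_witness[of _ uminus uminus]) (auto simp: freqs_def)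
      also have "\<dots> = of_nat N * (eta_integrand c q x y * \<xi> powi q)"
        by (simp add: eta_integrand_def sum_distrib_left sum_distrib_right ac_simps)
      finally show "(\<Sum>t\<in>freqs L. \<Sum>r\<in>freqs (L * c). (sc q t x y * \<xi> powi q * dcoef c r y) * (if t = - r then of_nat N else 0)) =
          of_nat N * (eta_integrand c q x y * \<xi> powi q)" .
    qed
    finally show ?thesis by (simp add: sum_distrib_left)
  qed
  have "(\<Sum>j<N\<^sup>2. of_real (s z (color_point N j)) * Dsym c (color_point N j)) =
      (\<Sum>u<N. \<Sum>v<N. of_real (s z (real u / real N, w v)) * Dsym c (real u / real N, w v))"
    unfolding w_def by (rule sum_color_points)
  also have "\<dots> = (\<Sum>u<N. of_nat N * (\<Sum>q\<in>freqs L. eta_integrand c q x (real u / real N) * \<xi> powi q))"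
    by (intro sum.cong refl one) auto
  also have "\<dots> = of_nat N * (\<Sum>q\<in>freqs L. (\<Sum>u<N. eta_integrand c q x (real u / real N)) * \<xi> powi q)"
    unfolding sum_distrib_left[symmetric] sum_distrib_right by (subst sum.swap) (rule refl)
  finally have eq: "(\<Sum>j<N\<^sup>2. of_real (s z (color_point N j)) * Dsym c (color_point N j)) =
      of_nat N * (\<Sum>q\<in>freqs L. (\<Sum>u<N. eta_integrand c q x (real u / real N)) * \<xi> powi q)" .
  have "of_nat N * X / of_nat (N\<^sup>2) = X / of_nat N" for X :: complex
    using N0 by (simp add: power2_eq_square)
  then show ?thesis unfolding eq by (simp only: zz fst_conv snd_conv sum_divide_distrib[of _ "freqs L"]) simp
qed

end

lemma norm_average_le:
  fixes f :: "nat \<Rightarrow> complex"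
  assumes "0 < n" "\<And>j. j < n \<Longrightarrow> norm (f j) \<le> B"
  shows "norm ((\<Sum>j<n. f j) / of_nat n) \<le> B"
proof -
  have "norm (\<Sum>j<n. f j) \<le> (\<Sum>j<n. B)" by (rule sum_norm_le) (simp add: assms(2))
  then show ?thesis using assms(1) by (simp add: norm_divide divide_le_eq mult.commute)
qed

lemma norm_average_diff_le:
  fixes f g :: "nat \<Rightarrow> complex"
  assumes "0 < n" "\<And>j. j < n \<Longrightarrow> norm (f j - g j) \<le> B"
  shows "norm ((\<Sum>j<n. f j) / of_nat n - (\<Sum>j<n. g j) / of_nat n) \<le> B"
  unfolding diff_divide_distrib[symmetric] sum_subtractf[symmetric] by (rule norm_average_le[OF assms])

lemma less_square_pos: "k < N\<^sup>2 \<Longrightarrow> 0 < (N::nat)\<^sup>2"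
  by (rule le_less_trans[OF le0])

text \<open>\<open>a N m k\<close> stands for the scaled path sum from \<open>k\<close> to itself.
  The factor \<open>2\<close> for \<open>k = j\<close> is the doubled variance of diagonal
  entries.\<close>

locale color_recursion = step_kernel +
  fixes a :: "nat \<Rightarrow> nat \<Rightarrow> nat \<Rightarrow> complex"
  assumes a_0: "\<And>N k. k < N\<^sup>2 \<Longrightarrow> a N 0 k = 1"
    and a_Suc: "\<And>N m k. k < N\<^sup>2 \<Longrightarrow> a N (Suc m) k =
      (\<Sum>c<m. ((\<Sum>j<N\<^sup>2. (if k = j then 2 else 1) * of_real (s (color_point N k) (color_point N j)) * a N c j) / of_nat (N\<^sup>2)) *
        a N (m - 1 - c) k)"
begin

definition h :: "nat \<Rightarrow> nat \<Rightarrow> nat \<Rightarrow> complex" where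
  "h N c k = (\<Sum>j<N\<^sup>2. (if k = j then 2 else 1) * of_real (s (color_point N k) (color_point N j)) * a N c j) / of_nat (N\<^sup>2)"

lemma norm_h_le:
  assumes k: "k < N\<^sup>2" and B: "\<And>j. j < N\<^sup>2 \<Longrightarrow> norm (a N c j) \<le> B" and B0: "0 \<le> B"
  shows "norm (h N c k) \<le> 2 * s_bound * B"
  unfolding h_def
proof (rule norm_average_le[OF less_square_pos[OF k]])
    fix j assume j: "j < N\<^sup>2"
    have "norm (if k = j then 2 else 1 :: complex) \<le> 2" by simp
    then show "norm ((if k = j then 2 else 1) * of_real (s (color_point N k) (color_point N j)) * a N c j) \<le> 2 * s_bound * B"
      unfolding norm_mult norm_of_real using j s_bound_nonneg
      by (intro mult_mono B abs_s_color_point_le k) auto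
qed

lemma norm_a_le: "k < N\<^sup>2 \<Longrightarrow> norm (a N m k) \<le> nc_bound (2 * s_bound) m"
proof (induction m arbitrary: k rule: less_induct)
  case (less m)
  show ?case
  proof (cases m)
    case 0
    then show ?thesis using a_0[OF less.prems] by simp
  next
    case (Suc m')
    have s2: "0 \<le> 2 * s_bound" using s_bound_nonneg by simp
    have "norm (a N (Suc m') k) \<le> (\<Sum>c<m'. norm (h N c k) * norm (a N (m' - 1 - c) k))"
      unfolding a_Suc[OF less.prems] h_def[symmetric] norm_mult[symmetric] by (rule norm_sum)
    also have "\<dots> \<le> (\<Sum>c<m'. 2 * s_bound * nc_bound (2 * s_bound) c * nc_bound (2 * s_bound) (m' - 1 - c))"
      using Suc s2 by (intro sum_mono mult_mono norm_h_le less.IH less.prems nc_bound_nonneg mult_nonneg_nonneg) auto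
    finally show ?thesis unfolding Suc by simp
  qed
qed

text \<open>The convergence is uniform in the color points, which is what allows it to pass through
  the average in the recursion.\<close>

lemma a_tendsto_Dsym:
  "\<epsilon> > 0 \<Longrightarrow> eventually (\<lambda>N. \<forall>k<N\<^sup>2. norm (a N m k - Dsym m (color_point N k)) \<le> \<epsilon>) sequentially"
proof (induction m arbitrary: \<epsilon> rule: less_induct)
  case (less m)
  show ?case
  proof (cases m)
    case 0
    then show ?thesis using a_0 less.prems by (simp add: Dsym_0)
  next
    case (Suc m')
    define b where "b c = nc_bound (2 * s_bound) c" for c
    have b0: "0 \<le> b c" for c unfolding b_def using s_bound_nonneg by (intro nc_bound_nonneg) simp
    have b: "norm (a N c k) \<le> b c" if "k < N\<^sup>2" for N c k unfolding b_def by (rule norm_a_le[OF that])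
    let ?n = "real (card (freqs L))"
    define g where "g c = ?n * eta_bound c" for c
    have g0: "0 \<le> g c" for c unfolding g_def using eta_bound_nonneg by simp
    define E where "E c = s_bound * b c + ?n * (2 * real (card \<I>) * integrand_bound c)" for c
    define Mb where "Mb = (\<Sum>c<m'. (s_bound + 2) * (b (m' - 1 - c) + g c))"
    have Mb0: "0 \<le> Mb" unfolding Mb_def using b0 g0 s_bound_nonneg by (intro sum_nonneg mult_nonneg_nonneg add_nonneg_nonneg) auto
    define e' where "e' = \<epsilon> / (2 * (Mb + 1))"
    have e': "e' > 0" "Mb * e' \<le> \<epsilon> / 2" unfolding e'_def using scaled_epsilon_le[OF Mb0 less.prems] by auto
    have "eventually (\<lambda>N. (\<forall>c\<in>{..<m}. \<forall>k<N\<^sup>2. norm (a N c k - Dsym c (color_point N k)) \<le> e') \<and>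
        (\<forall>c\<in>{..<m}. E c / real N \<le> e' \<and> L + L * c < N)) sequentially"
      by (intro eventually_conj eventually_ball_finite ballI less.IH eventually_divide_le e'(1) eventually_gt_at_top) auto
    then show ?thesis
    proof (rule eventually_mono, elim conjE, intro allI impI)
      fix N k
      assume close: "\<forall>c\<in>{..<m}. \<forall>k<N\<^sup>2. norm (a N c k - Dsym c (color_point N k)) \<le> e'"
        and small: "\<forall>c\<in>{..<m}. E c / real N \<le> e' \<and> L + L * c < N" and k: "k < N\<^sup>2"
      have N: "N > 0" using k by (cases "N = 0") auto
      let ?z = "color_point N k"
      note z = color_point_in(1,2)[OF k]
      have hG: "norm (h N c k - Gsym c ?z) \<le> (s_bound + 2) * e'" if c: "c < m" for c
      proof -
        let ?s = "\<lambda>j. complex_of_real (s ?z (color_point N j))"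
        \<comment> \<open>\<open>?h1\<close> drops the doubled diagonal, \<open>?h2\<close> replaces
          \<open>a\<close> by its limit, and passing to \<open>Gsym\<close> replaces Riemann sums by
          \<open>step_mean\<close>.\<close>
        let ?h1 = "(\<Sum>j<N\<^sup>2. ?s j * a N c j) / of_nat (N\<^sup>2)"
        let ?h2 = "(\<Sum>j<N\<^sup>2. ?s j * Dsym c (color_point N j)) / of_nat (N\<^sup>2)"
        have "(\<Sum>j<N\<^sup>2. (if k = j then 2 else 1) * ?s j * a N c j) =
            (\<Sum>j<N\<^sup>2. ?s j * a N c j + (if k = j then ?s j * a N c j else 0))"
          by (intro sum.cong) auto
        also have "\<dots> = (\<Sum>j<N\<^sup>2. ?s j * a N c j) + ?s k * a N c k"
          using k by (simp add: sum.distrib)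
        finally have "h N c k - ?h1 = ?s k * a N c k / of_nat (N\<^sup>2)"
          by (simp add: h_def add_divide_distrib)
        moreover have "norm (?s k * a N c k / of_nat (N\<^sup>2)) \<le> s_bound * b c / real N"
        proof -
          have "norm (?s k * a N c k / of_nat (N\<^sup>2)) = \<bar>s ?z ?z\<bar> * norm (a N c k) / real (N\<^sup>2)"
            by (simp add: norm_divide norm_mult norm_power)
          also have "\<dots> \<le> s_bound * b c / real (N\<^sup>2)"
            by (intro divide_right_mono mult_mono abs_s_color_point_le b k s_bound_nonneg) auto
          \<comment> \<open>The order \<open>1 / N\<^sup>2\<close> is weakened so that this error
            and the one of the Riemann sum share the constant \<open>E c\<close>.\<close>
          also have "\<dots> \<le> s_bound * b c / real N"
            using N b0[of c] s_bound_nonneg by (intro divide_left_mono) (auto simp: power2_eq_square)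
          finally show ?thesis .
        qed
        ultimately have 1: "norm (h N c k - ?h1) \<le> s_bound * b c / real N" by simp
        have 2: "norm (?h1 - ?h2) \<le> s_bound * e'"
        proof (rule norm_average_diff_le[OF less_square_pos[OF k]])
          fix j assume j: "j < N\<^sup>2"
          then have "norm (a N c j - Dsym c (color_point N j)) \<le> e'" using close c by auto
          then show "norm (?s j * a N c j - ?s j * Dsym c (color_point N j)) \<le> s_bound * e'"
            unfolding right_diff_distrib[symmetric] norm_mult norm_of_real using j s_bound_nonneg
            by (intro mult_mono abs_s_color_point_le k) auto
        qed
        have h2: "?h2 = (\<Sum>q\<in>freqs L. ((\<Sum>u<N. eta_integrand c q (fst ?z) (real u / real N)) / of_nat N) * snd ?z powi q)"
          using small c by (intro sum_s_Dsym[OF z]) auto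
        have 3: "norm (?h2 - Gsym c ?z) \<le> ?n * (2 * real (card \<I>) * integrand_bound c) / real N"
        proof -
          have eq: "?h2 - Gsym c ?z = (\<Sum>q\<in>freqs L. ((\<Sum>u<N. eta_integrand c q (fst ?z) (real u / real N)) / of_nat N - eta (dcoef c) q (fst ?z)) * snd ?z powi q)"
            unfolding h2 Gsym_def by (simp only: sum_subtractf left_diff_distrib)
          have "norm (?h2 - Gsym c ?z) \<le> (\<Sum>q\<in>freqs L. 2 * real (card \<I>) * integrand_bound c / real N)"
            unfolding eq
          proof (rule sum_norm_le)
            fix q
            have "norm ((\<Sum>u<N. eta_integrand c q (fst ?z) (real u / real N)) / of_nat N - eta (dcoef c) q (fst ?z)) \<le> 2 * real (card \<I>) * integrand_bound c / real N"
              unfolding eta_eq using N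
              by (intro riemann_sum_step_fun step_fun_eta_integrand norm_eta_integrand_le z(1)) auto
            then show "norm (((\<Sum>u<N. eta_integrand c q (fst ?z) (real u / real N)) / of_nat N - eta (dcoef c) q (fst ?z)) * snd ?z powi q) \<le> 2 * real (card \<I>) * integrand_bound c / real N"
              by (simp add: norm_mult norm_power_int z(2))
          qed
          then show ?thesis unfolding sum_constant times_divide_eq_right .
        qed
        have "E c / real N \<le> e'" using small c by simp
        then have "s_bound * b c / real N + ?n * (2 * real (card \<I>) * integrand_bound c) / real N \<le> e'"
          by (simp add: E_def add_divide_distrib)
        then have "norm (h N c k - Gsym c ?z) \<le> s_bound * e' + e'"
          using norm_diff_trans[OF norm_diff_trans[OF 1 2] 3] by linarith
        also have "\<dots> \<le> (s_bound + 2) * e'" using e'(1) by (simp add: algebra_simps)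
        finally show ?thesis .
      qed
      have aD: "norm (a N c k - Dsym c ?z) \<le> (s_bound + 2) * e'" if "c < m" for c
      proof -
        have "norm (a N c k - Dsym c ?z) \<le> 1 * e'" using close that k by simp
        also have "\<dots> \<le> (s_bound + 2) * e'" using e'(1) s_bound_nonneg by (intro mult_right_mono) auto
        finally show ?thesis .
      qed
      have eq: "a N m k - Dsym m ?z = (\<Sum>c<m'. h N c k * a N (m' - 1 - c) k - Gsym c ?z * Dsym (m' - 1 - c) ?z)"
        unfolding Suc a_Suc[OF k] Dsym_Suc[OF z] h_def[symmetric] by (simp only: sum_subtractf)
      have "norm (a N m k - Dsym m ?z) \<le> (\<Sum>c<m'. (b (m' - 1 - c) + g c) * ((s_bound + 2) * e'))"
        unfolding eq using Suc
        by (intro sum_norm_le norm_mult_diff_le hG aD b k) (auto simp: g_def intro: norm_Gsym_le[OF z])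
      also have "\<dots> = Mb * e'" unfolding Mb_def sum_distrib_right by (intro sum.cong refl) (simp only: ac_simps)
      finally show "norm (a N m k - Dsym m ?z) \<le> \<epsilon>" using e'(2) less.prems by linarith
    qed
  qed
qed

text \<open>For \<open>N > L * m\<close> averaging over the roots of unity extracts exactly the
  frequency \<open>0\<close>.\<close>

lemma sum_Dsym:
  assumes N: "N > L * m"
  shows "(\<Sum>k<N\<^sup>2. Dsym m (color_point N k)) / of_nat (N\<^sup>2) = (\<Sum>u<N. dcoef m 0 (real u / real N)) / of_nat N"
proof -
  have "(\<Sum>k<N\<^sup>2. Dsym m (color_point N k)) =
      (\<Sum>u<N. \<Sum>v<N. Dsym m (real u / real N, cis (2 * pi * real v / real N)))"
    by (rule sum_color_points)
  also have "\<dots> = (\<Sum>u<N. \<Sum>v<N. \<Sum>p\<in>freqs (L * m). dcoef m p (real u / real N) * cis (2 * pi * real v / real N) powi p)"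
    unfolding Dsym_def fst_conv snd_conv ..
  also have "\<dots> = (\<Sum>u<N. \<Sum>p\<in>freqs (L * m). \<Sum>v<N. dcoef m p (real u / real N) * cis (2 * pi * real v / real N) powi p)"
    by (rule sum.cong[OF refl], rule sum.swap)
  also have "\<dots> = (\<Sum>u<N. \<Sum>p\<in>freqs (L * m). dcoef m p (real u / real N) * (if p = 0 then of_nat N else 0))"
  proof (rule sum.cong[OF refl], rule sum.cong[OF refl])
    fix u p assume "p \<in> freqs (L * m)"
    then have "\<bar>p\<bar> \<le> int (L * m)" by (auto simp: freqs_def)
    also have "\<dots> < int N" using N by (simp only: of_nat_less_iff)
    finally show "(\<Sum>v<N. dcoef m p (real u / real N) * cis (2 * pi * real v / real N) powi p) =
        dcoef m p (real u / real N) * (if p = 0 then of_nat N else 0)"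
      unfolding sum_distrib_left[symmetric] by (subst sum_powi_unit) auto
  qed
  also have "\<dots> = (\<Sum>u<N. dcoef m 0 (real u / real N) * of_nat N)"
  proof (intro sum.cong refl)
    fix u
    have "(\<Sum>p\<in>freqs (L * m). dcoef m p (real u / real N) * (if p = 0 then of_nat N else 0)) =
        (\<Sum>p\<in>freqs (L * m). if p = 0 then dcoef m 0 (real u / real N) * of_nat N else 0)"
      by (intro sum.cong) auto
    then show "(\<Sum>p\<in>freqs (L * m). dcoef m p (real u / real N) * (if p = 0 then of_nat N else 0)) = dcoef m 0 (real u / real N) * of_nat N"
      by (simp add: freqs_def)
  qed
  finally show ?thesis using N by (simp add: power2_eq_square flip: sum_distrib_right)
qed

lemma trace_a_tendsto: "(\<lambda>N. (\<Sum>k<N\<^sup>2. a N m k) / of_nat (N\<^sup>2)) \<longlonglongrightarrow> step_mean (dcoef m 0)"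
proof (rule tendsto_if_eventually_norm_le)
  fix \<epsilon> :: real assume e: "\<epsilon> > 0"
  have "eventually (\<lambda>N. 2 * real (card \<I>) * dcoef_bound m / real N \<le> \<epsilon> / 2) sequentially"
    by (rule eventually_divide_le) (use e in simp)
  from eventually_conj[OF a_tendsto_Dsym[OF half_gt_zero[OF e], of m] eventually_conj[OF this eventually_gt_at_top[of "L * m"]]]
  show "eventually (\<lambda>N. norm ((\<Sum>k<N\<^sup>2. a N m k) / of_nat (N\<^sup>2) - step_mean (dcoef m 0)) \<le> \<epsilon>) sequentially"
  proof (rule eventually_mono, elim conjE)
    fix N
    assume close: "\<forall>k<N\<^sup>2. norm (a N m k - Dsym m (color_point N k)) \<le> \<epsilon> / 2"
      and small: "2 * real (card \<I>) * dcoef_bound m / real N \<le> \<epsilon> / 2" and N: "L * m < N"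
    have N0: "N \<ge> 1" using N by simp
    have "norm ((\<Sum>k<N\<^sup>2. a N m k) / of_nat (N\<^sup>2) - (\<Sum>k<N\<^sup>2. Dsym m (color_point N k)) / of_nat (N\<^sup>2)) \<le> \<epsilon> / 2"
      using N0 close by (intro norm_average_diff_le) auto
    then have 1: "norm ((\<Sum>k<N\<^sup>2. a N m k) / of_nat (N\<^sup>2) - (\<Sum>u<N. dcoef m 0 (real u / real N)) / of_nat N) \<le> \<epsilon> / 2"
      unfolding sum_Dsym[OF N] .
    have 2: "norm ((\<Sum>u<N. dcoef m 0 (real u / real N)) / of_nat N - step_mean (dcoef m 0)) \<le> 2 * real (card \<I>) * dcoef_bound m / real N"
      using N0 by (intro riemann_sum_step_fun step_fun_dcoef norm_dcoef_le) auto
    show "norm ((\<Sum>k<N\<^sup>2. a N m k) / of_nat (N\<^sup>2) - step_mean (dcoef m 0)) \<le> \<epsilon>"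
      using norm_diff_trans[OF 1 2] small by linarith
  qed
qed

text \<open>The bound on the moments comes from the color side, where the finite approximations are
  bounded by Catalan-type numbers uniformly in \<open>N\<close>.\<close>

lemma abs_Re_step_mean_le:
  obtains C where "C \<ge> 1" "\<And>m. \<bar>Re (step_mean (dcoef m 0))\<bar> \<le> 2 * C ^ m"
proof
  \<comment> \<open>The \<open>+ 1\<close> ensures that \<open>?c\<close> is positive and that
    \<open>C\<close> is at least \<open>1\<close>, also if \<open>s_bound\<close> is small.\<close>
  let ?c = "2 * s_bound + 1"
  have c: "?c > 0" "0 \<le> 2 * s_bound" using s_bound_nonneg by auto
  have "1 \<le> sqrt ?c" using s_bound_nonneg by (intro real_sqrt_ge_one) simp
  then show "1 \<le> 2 * sqrt ?c" by linarith
  fix m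
  have "norm (step_mean (dcoef m 0)) \<le> 2 * (2 * sqrt ?c) ^ m"
  proof (rule tendsto_upperbound[OF tendsto_norm[OF trace_a_tendsto]])
    have "norm ((\<Sum>k<N\<^sup>2. a N m k) / of_nat (N\<^sup>2)) \<le> 2 * (2 * sqrt ?c) ^ m" if N: "N \<ge> 1" for N
    proof (rule norm_average_le)
      fix k assume "k < N\<^sup>2"
      then have "norm (a N m k) \<le> nc_bound (2 * s_bound) m" by (rule norm_a_le)
      also have "\<dots> \<le> nc_bound ?c m" by (rule nc_bound_mono) (use c in auto)
      also have "\<dots> \<le> 2 * (2 * sqrt ?c) ^ m" by (rule nc_bound_le[OF c(1)])
      finally show "norm (a N m k) \<le> 2 * (2 * sqrt ?c) ^ m" .
    qed (use N in simp)
    then show "eventually (\<lambda>N. norm ((\<Sum>k<N\<^sup>2. a N m k) / of_nat (N\<^sup>2)) \<le> 2 * (2 * sqrt ?c) ^ m) sequentially"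
      by (rule eventually_sequentiallyI)
  qed simp
  then show "\<bar>Re (step_mean (dcoef m 0))\<bar> \<le> 2 * (2 * sqrt ?c) ^ m" by (rule order_trans[OF abs_Re_le_cmod])
qed

end

section \<open>The color matrix as a band ensemble\<close>

abbreviation std_normal :: "real measure" where
  "std_normal \<equiv> density lborel (\<lambda>x. ennreal (std_normal_density x))"

lemma integrable_prod_moments:
  fixes Z :: "nat \<Rightarrow> 'a \<Rightarrow> complex"
  assumes M: "finite_measure M" and S: "finite S"
    and Z: "\<And>a. a \<in> S \<Longrightarrow> Z a \<in> borel_measurable M" "\<And>a k. a \<in> S \<Longrightarrow> integrable M (\<lambda>\<omega>. norm (Z a \<omega>) ^ k)"
  shows "integrable M (\<lambda>\<omega>. \<Prod>a\<in>S. Z a \<omega>)"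
proof (rule Bochner_Integration.integrable_bound)
  interpret finite_measure M by (rule M)
  show "integrable M (\<lambda>\<omega>. 1 + (\<Sum>a\<in>S. norm (Z a \<omega>) ^ card S))"
    using Z by (intro Bochner_Integration.integrable_add Bochner_Integration.integrable_sum) auto
  show "(\<lambda>\<omega>. \<Prod>a\<in>S. Z a \<omega>) \<in> borel_measurable M"
    using Z by (intro borel_measurable_prod) auto
  have "norm (\<Prod>a\<in>S. Z a \<omega>) \<le> 1 + (\<Sum>a\<in>S. norm (Z a \<omega>) ^ card S)" for \<omega>
    unfolding prod_norm[symmetric] by (rule prod_le_one_plus_sum_power[OF S]) simp
  then have "norm (\<Prod>a\<in>S. Z a \<omega>) \<le> norm (1 + (\<Sum>a\<in>S. norm (Z a \<omega>) ^ card S))" for \<omega>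
    by (rule order_trans) simp
  then show "AE \<omega> in M. norm (\<Prod>a\<in>S. Z a \<omega>) \<le> norm (1 + (\<Sum>a\<in>S. norm (Z a \<omega>) ^ card S))"
    by simp
qed

lemma prob_space_std_normal: "prob_space std_normal"
  by (rule prob_space_normal_density) simp

interpretation noise: prob_space noise_measure
  unfolding noise_measure_def by (intro prob_space_PiM prob_space_std_normal)

lemma distr_noise: "e \<in> noise_index \<Longrightarrow> distr noise_measure std_normal (\<lambda>Y. Y e) = std_normal"
  unfolding noise_measure_def by (rule distr_PiM_component) (rule prob_space_std_normal)

lemma measurable_noise_std: "e \<in> noise_index \<Longrightarrow> (\<lambda>Y. Y e) \<in> measurable noise_measure std_normal"
  unfolding noise_measure_def by (rule measurable_component_singleton)

lemma measurable_noise: "e \<in> noise_index \<Longrightarrow> (\<lambda>Y. Y e) \<in> borel_measurable noise_measure"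
  using measurable_noise_std[of e] by simp

lemma integral_noise:
  fixes g :: "real \<Rightarrow> real"
  assumes e: "e \<in> noise_index" and g: "g \<in> borel_measurable borel"
  shows "(LINT Y|noise_measure. g (Y e)) = (LINT x|lborel. std_normal_density x * g x)"
proof -
  have "(LINT Y|noise_measure. g (Y e)) = (LINT x|distr noise_measure std_normal (\<lambda>Y. Y e). g x)"
    using measurable_noise_std[OF e] g by (intro integral_distr[symmetric]) auto
  also have "\<dots> = (LINT x|std_normal. g x)" by (simp add: distr_noise[OF e])
  also have "\<dots> = (LINT x|lborel. std_normal_density x * g x)"
    using g by (subst integral_density) auto
  finally show ?thesis .
qed

lemma integrable_noise:
  fixes g :: "real \<Rightarrow> real"
  assumes e: "e \<in> noise_index" and g: "g \<in> borel_measurable borel"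
    and int: "integrable lborel (\<lambda>x. std_normal_density x * g x)"
  shows "integrable noise_measure (\<lambda>Y. g (Y e))"
proof -
  have "integrable std_normal g"
    using g int by (subst integrable_density) auto
  then have "integrable (distr noise_measure std_normal (\<lambda>Y. Y e)) g" by (simp add: distr_noise[OF e])
  then show ?thesis using measurable_noise_std[OF e] g by (subst (asm) integrable_distr_eq) auto
qed

lemma indep_noise: "noise_index \<noteq> {} \<Longrightarrow> noise.indep_vars (\<lambda>_. std_normal) (\<lambda>e Y. Y e) noise_index"
proof (subst noise.indep_vars_iff_distr_eq_PiM')
  have "distr noise_measure (Pi\<^sub>M noise_index (\<lambda>_. std_normal)) (\<lambda>x. \<lambda>i\<in>noise_index. x i) =
      distr noise_measure noise_measure (\<lambda>x. x)"
    by (rule distr_cong) (auto simp: noise_measure_def space_PiM PiE_restrict)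
  also have "\<dots> = noise_measure" by simp
  also have "\<dots> = (\<Pi>\<^sub>M i\<in>noise_index. distr noise_measure std_normal (\<lambda>x. x i))"
    unfolding noise_measure_def[of, symmetric]
    by (subst (1) noise_measure_def) (rule PiM_cong, simp_all add: distr_noise)
  finally show "distr noise_measure (Pi\<^sub>M noise_index (\<lambda>_. std_normal)) (\<lambda>x. \<lambda>i\<in>noise_index. x i) =
      (\<Pi>\<^sub>M i\<in>noise_index. distr noise_measure std_normal (\<lambda>x. x i))" .
qed (use measurable_noise in auto)

text \<open>Edges of the same block may share a Gaussian variable, so independence is used between
  the blocks \<open>e\<close> S\<open>and\<close>e \<open>T\<close> of variables and not between
  single factors.\<close>

lemma noise_factor:
  fixes w :: "nat \<Rightarrow> real" and e :: "nat \<Rightarrow> color set"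
  assumes fin: "finite S" "finite T" and e: "\<And>a. a \<in> S \<union> T \<Longrightarrow> e a \<in> noise_index"
    and disj: "\<And>a b. a \<in> S \<Longrightarrow> b \<in> T \<Longrightarrow> e a \<noteq> e b"
  shows "(LINT Y|noise_measure. (\<Prod>a\<in>S \<union> T. complex_of_real (w a * Y (e a)))) =
    (LINT Y|noise_measure. (\<Prod>a\<in>S. complex_of_real (w a * Y (e a)))) *
    (LINT Y|noise_measure. (\<Prod>a\<in>T. complex_of_real (w a * Y (e a))))"
proof (cases "S \<union> T = {}")
  case False
  define F where "F U Y = (\<Prod>a\<in>U. complex_of_real (w a * Y (e a)))" for U and Y :: "color set \<Rightarrow> real"
  have "noise_index \<noteq> {}" using False e by blast
  note ind = noise.indep_var_restrict[OF indep_noise[OF this], of "e ` S" "e ` T"]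
  have "e ` S \<inter> e ` T = {}" "e ` S \<subseteq> noise_index" "e ` T \<subseteq> noise_index" using e disj by auto
  note ind = ind[OF this]
  have F_meas: "F U \<in> borel_measurable (Pi\<^sub>M (e ` U) (\<lambda>_. std_normal))" for U
  proof -
    have "(\<lambda>Y. Y (e a)) \<in> borel_measurable (Pi\<^sub>M (e ` U) (\<lambda>_. std_normal))" if "a \<in> U" for a
      using measurable_component_singleton[of "e a" "e ` U" "\<lambda>_. std_normal"] that by simp
    then show ?thesis unfolding F_def[abs_def] by (intro borel_measurable_prod) measurable
  qed
  have comp: "F U \<circ> (\<lambda>Y. \<lambda>i\<in>e ` U. Y i) = F U" for U
    by (auto simp: F_def fun_eq_iff intro!: prod.cong)
  have F_ind: "noise.indep_var borel (F S) borel (F T)"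
    using noise.indep_var_compose[OF ind F_meas F_meas] unfolding comp .
  have F_int: "integrable noise_measure (F U)" if "finite U" "U \<subseteq> S \<union> T" for U
    unfolding F_def[abs_def]
  proof (rule integrable_prod_moments[OF noise.finite_measure_axioms that(1)])
    fix a k assume "a \<in> U"
    then have a: "e a \<in> noise_index" using that e by auto
    show "(\<lambda>Y. complex_of_real (w a * Y (e a))) \<in> borel_measurable noise_measure"
      using measurable_noise[OF a] by measurable
    have "integrable noise_measure (\<lambda>Y. \<bar>w a\<bar> ^ k * \<bar>Y (e a)\<bar> ^ k)"
      by (intro integrable_mult_right integrable_noise[OF a, of "\<lambda>x. \<bar>x\<bar> ^ k"] integrable_std_normal_moment_abs) measurable
    then show "integrable noise_measure (\<lambda>Y. norm (complex_of_real (w a * Y (e a))) ^ k)"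
      by (simp add: norm_mult abs_mult power_mult_distrib)
  qed
  have "S \<inter> T = {}" using disj by auto
  then have "F (S \<union> T) Y = F S Y * F T Y" for Y
    unfolding F_def using fin by (rule prod.union_disjoint[rotated 2])
  then show ?thesis
    using noise.indep_var_lebesgue_integral[OF F_ind F_int F_int] fin unfolding F_def by simp
qed (simp add: noise.prob_space)

lemma inj_color_point: "i < N\<^sup>2 \<Longrightarrow> j < N\<^sup>2 \<Longrightarrow> color_point N i = color_point N j \<longleftrightarrow> i = j"
proof -
  assume ij: "i < N\<^sup>2" "j < N\<^sup>2"
  then have "N \<ge> 1" by (cases "N = 0") auto
  from bij_betw_imp_inj_on[OF bij_betw_color_point[OF this]] ij show ?thesis
    by (auto dest: inj_onD)
qed

lemma color_pair_in_noise_index: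
  assumes "i < N\<^sup>2" "j < N\<^sup>2"
  shows "{color_point N i, color_point N j} \<in> noise_index"
proof -
  have N: "N \<ge> 1" using assms(1) by (cases "N = 0") auto
  have "color_point N k \<in> all_color_points" if "k < N\<^sup>2" for k
    using bij_betwE[OF bij_betw_color_point[OF N]] that N unfolding all_color_points_def by auto
  then show ?thesis using assms by (auto simp: noise_index_def card_insert_if)
qed

lemma color_pair_eq_iff:
  assumes "i < N\<^sup>2" "j < N\<^sup>2" "k < N\<^sup>2" "l < N\<^sup>2"
  shows "{color_point N i, color_point N j} = {color_point N k, color_point N l} \<longleftrightarrow>
    i = k \<and> j = l \<or> i = l \<and> j = k"
  unfolding doubleton_eq_iff using assms by (simp add: inj_color_point)

section \<open>Entries of the color matrix\<close>

context step_kernel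
begin

definition color_weight :: "nat \<Rightarrow> nat \<Rightarrow> nat \<Rightarrow> real" where
  "color_weight N i j = (if i = j then sqrt 2 else 1) * sqrt (s (color_point N i) (color_point N j))"

definition color_entry :: "nat \<Rightarrow> nat \<Rightarrow> nat \<Rightarrow> (color set \<Rightarrow> real) \<Rightarrow> complex" where
  "color_entry N i j Y = of_real (color_weight N i j * Y {color_point N i, color_point N j})"

definition color_moment :: "nat \<Rightarrow> real" where
  "color_moment k = sqrt (2 * s_bound) ^ k * (LINT x|lborel. std_normal_density x * \<bar>x\<bar> ^ k)"

lemma color_weight_sym: "i < N\<^sup>2 \<Longrightarrow> j < N\<^sup>2 \<Longrightarrow> color_weight N i j = color_weight N j i"
  using s_sym[OF color_point_in(3) color_point_in(3), of i N j N] by (simp add: color_weight_def)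

lemma color_weight_square:
  assumes "i < N\<^sup>2" "j < N\<^sup>2"
  shows "color_weight N i j * color_weight N i j = (if i = j then 2 else 1) * s (color_point N i) (color_point N j)"
  using s_nonneg[OF color_point_in(3)[OF assms(1)] color_point_in(3)[OF assms(2)]]
  by (auto simp: color_weight_def power_mult_distrib simp flip: power2_eq_square)

lemma abs_color_weight_le:
  assumes ij: "i < N\<^sup>2" "j < N\<^sup>2"
  shows "\<bar>color_weight N i j\<bar> \<le> sqrt (2 * s_bound)"
proof (rule real_le_rsqrt)
  have "\<bar>color_weight N i j\<bar>\<^sup>2 = (if i = j then 2 else 1) * s (color_point N i) (color_point N j)"
    using color_weight_square[OF ij] by (simp add: power2_eq_square)
  also have "\<dots> \<le> 2 * s_bound"
    using abs_s_color_point_le[OF ij] s_bound_nonneg by auto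
  finally show "\<bar>color_weight N i j\<bar>\<^sup>2 \<le> 2 * s_bound" .
qed

lemma color_entry_sym: "i < N\<^sup>2 \<Longrightarrow> j < N\<^sup>2 \<Longrightarrow> color_entry N j i Y = color_entry N i j Y"
  using color_weight_sym[of i N j] by (simp add: color_entry_def insert_commute)

lemma integral_color_entry_square:
  assumes ij: "i < N\<^sup>2" "j < N\<^sup>2"
  shows "(LINT Y|noise_measure. color_entry N i j Y * color_entry N j i Y) =
    (if i = j then 2 else 1) * of_real (s (color_point N i) (color_point N j))"
proof -
  let ?e = "{color_point N i, color_point N j}"
  have "(LINT Y|noise_measure. color_entry N i j Y * color_entry N j i Y) =
      (LINT Y|noise_measure. complex_of_real (color_weight N i j * color_weight N i j * (Y ?e) ^ 2))"
    unfolding color_entry_sym[OF ij] by (simp add: color_entry_def power2_eq_square ac_simps)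
  also have "\<dots> = of_real (color_weight N i j * color_weight N i j * (LINT Y|noise_measure. (Y ?e) ^ 2))"
    by (simp only: integral_complex_of_real integral_mult_right_zero)
  also have "(LINT Y|noise_measure. (Y ?e) ^ 2) = 1"
    using integral_noise[OF color_pair_in_noise_index[OF ij], of "\<lambda>x. x ^ 2"] integral_std_normal_moment_even[of 1] by simp
  finally show ?thesis unfolding color_weight_square[OF ij] by simp
qed

text \<open>Two entries share a Gaussian variable exactly if their unordered index pairs agree, so
  equality serves as the neighbour relation, with degree \<open>1\<close>.\<close>

lemma band_ensemble_color:
  assumes N: "N \<ge> 1"
  shows "band_ensemble {..<N\<^sup>2} (=) 1 noise_measure (color_entry N) color_moment"
proof (intro band_ensemble.intro band_ensemble_axioms.intro noise.prob_space_axioms)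
  show "band_set {..<N\<^sup>2} (=) 1"
  proof
    have "(0::nat) < N\<^sup>2" using N by simp
    then show "{..<N\<^sup>2} \<noteq> {}" by blast
    have "{w \<in> {..<N\<^sup>2}. v = w} \<subseteq> {v}" for v by auto
    then show "card {w \<in> {..<N\<^sup>2}. v = w} \<le> 1" for v using card_mono[of "{v}"] by fastforce
  qed auto
next
  fix i j assume "i \<in> {..<N\<^sup>2}" "j \<in> {..<N\<^sup>2}"
  then have ij: "i < N\<^sup>2" "j < N\<^sup>2" by auto
  let ?e = "{color_point N i, color_point N j}"
  note e = color_pair_in_noise_index[OF ij]
  show "color_entry N i j \<in> borel_measurable noise_measure"
    unfolding color_entry_def[abs_def] using measurable_noise[OF e] by measurable
  have eq: "norm (color_entry N i j Y) ^ k = \<bar>color_weight N i j\<bar> ^ k * \<bar>Y ?e\<bar> ^ k" for Y k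
    by (simp add: color_entry_def norm_mult abs_mult power_mult_distrib)
  show "integrable noise_measure (\<lambda>Y. norm (color_entry N i j Y) ^ k)" for k
    unfolding eq
    by (intro integrable_mult_right integrable_noise[OF e, of "\<lambda>x. \<bar>x\<bar> ^ k"] integrable_std_normal_moment_abs) measurable
  have "(LINT Y|noise_measure. norm (color_entry N i j Y) ^ k) =
      \<bar>color_weight N i j\<bar> ^ k * (LINT x|lborel. std_normal_density x * \<bar>x\<bar> ^ k)" for k
    unfolding eq using integral_noise[OF e, of "\<lambda>x. \<bar>x\<bar> ^ k"] by simp
  also have "\<dots> k \<le> color_moment k" for k
    unfolding color_moment_def using abs_color_weight_le[OF ij]
    by (intro mult_right_mono power_mono Bochner_Integration.integral_nonneg) auto
  finally show "(LINT Y|noise_measure. norm (color_entry N i j Y) ^ k) \<le> color_moment k" for k .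
  have "(LINT Y|noise_measure. color_entry N i j Y) = of_real (color_weight N i j * (LINT Y|noise_measure. Y ?e))"
    unfolding color_entry_def by (simp only: integral_complex_of_real integral_mult_right_zero)
  also have "(LINT Y|noise_measure. Y ?e) = 0"
    using integral_noise[OF e, of "\<lambda>x. x"] integral_std_normal_moment_odd[of 0] by simp
  finally show "(LINT Y|noise_measure. color_entry N i j Y) = 0" by simp
next
  fix \<phi> :: "nat \<Rightarrow> nat" and S T :: "nat set"
  assume fin: "finite S" "finite T" and lab: "\<forall>a\<in>S \<union> T. \<phi> a \<in> {..<N\<^sup>2} \<and> \<phi> (Suc a) \<in> {..<N\<^sup>2}"
    and far: "\<forall>a\<in>S. \<forall>b\<in>T. \<not> (\<phi> a = \<phi> b \<and> \<phi> (Suc a) = \<phi> (Suc b) \<or> \<phi> a = \<phi> (Suc b) \<and> \<phi> (Suc a) = \<phi> b)"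
  show "(LINT Y|noise_measure. (\<Prod>a\<in>S \<union> T. color_entry N (\<phi> a) (\<phi> (Suc a)) Y)) =
      (LINT Y|noise_measure. (\<Prod>a\<in>S. color_entry N (\<phi> a) (\<phi> (Suc a)) Y)) *
      (LINT Y|noise_measure. (\<Prod>a\<in>T. color_entry N (\<phi> a) (\<phi> (Suc a)) Y))"
    unfolding color_entry_def
  proof (rule noise_factor[OF fin])
    show "{color_point N (\<phi> a), color_point N (\<phi> (Suc a))} \<in> noise_index" if "a \<in> S \<union> T" for a
      using lab that by (intro color_pair_in_noise_index) auto
    show "{color_point N (\<phi> a), color_point N (\<phi> (Suc a))} \<noteq> {color_point N (\<phi> b), color_point N (\<phi> (Suc b))}"
      if "a \<in> S" "b \<in> T" for a b
      using far lab that by (subst color_pair_eq_iff) auto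
  qed
qed

definition color_path_sum :: "nat \<Rightarrow> nat \<Rightarrow> nat \<Rightarrow> nat \<Rightarrow> complex" where
  "color_path_sum N = band_ensemble.path_sum {..<N\<^sup>2} (=) noise_measure (color_entry N)"

text \<open>A nonzero covariance forces \<open>l = j\<close> and \<open>k' = i\<close>. By induction
  only path sums from a point to itself survive, and the recursion closes on functions of one color
  point.\<close>

lemma color_path_sum_recursion:
  assumes k: "k < N\<^sup>2"
  shows "color_path_sum N 0 k k = 1"
    and "i < N\<^sup>2 \<Longrightarrow> i \<noteq> k \<Longrightarrow> color_path_sum N m i k = 0"
    and "color_path_sum N (Suc m) k k = (\<Sum>c<m. (\<Sum>j<N\<^sup>2. (if k = j then 2 else 1) *
      of_real (s (color_point N k) (color_point N j)) * color_path_sum N c j j) * color_path_sum N (m - 1 - c) k k)"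
proof -
  have "N \<ge> 1" using k by (cases "N = 0") auto
  then interpret band_ensemble "{..<N\<^sup>2}" "(=)" 1 noise_measure "color_entry N" color_moment
    by (rule band_ensemble_color)
  show "color_path_sum N 0 k k = 1" using k by (simp add: color_path_sum_def path_sum_0)
  let ?s = "\<lambda>i j. (if i = j then 2 else 1) * complex_of_real (s (color_point N i) (color_point N j))"
  have cov: "cov i j l k = (if k = i then if l = j then ?s i j else 0 else 0)"
    if "i < N\<^sup>2" "j < N\<^sup>2" for i j l k
    using integral_color_entry_square[OF that] by (simp add: cov_def)
  have rec: "path_sum (Suc m) i k = (\<Sum>c<m. (\<Sum>j<N\<^sup>2. ?s i j * path_sum c j j) * path_sum (m - 1 - c) i k)"
    if i: "i < N\<^sup>2" and k: "k < N\<^sup>2" for m i k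
  proof -
    have "(\<Sum>j<N\<^sup>2. \<Sum>l<N\<^sup>2. \<Sum>k'<N\<^sup>2. cov i j l k' * path_sum c j l * path_sum (m - 1 - c) k' k) =
        (\<Sum>j<N\<^sup>2. ?s i j * path_sum c j j * path_sum (m - 1 - c) i k)" for c
    proof (rule sum.cong[OF refl])
      fix j assume j: "j \<in> {..<N\<^sup>2}"
      have "(\<Sum>k'<N\<^sup>2. cov i j l k' * path_sum c j l * path_sum (m - 1 - c) k' k) =
          (\<Sum>k'<N\<^sup>2. if k' = i then (if l = j then ?s i j else 0) * path_sum c j l * path_sum (m - 1 - c) k' k else 0)" for l
        using i j by (intro sum.cong[OF refl]) (simp add: cov)
      then have "(\<Sum>k'<N\<^sup>2. cov i j l k' * path_sum c j l * path_sum (m - 1 - c) k' k) =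
          (if l = j then ?s i j * path_sum c j l * path_sum (m - 1 - c) i k else 0)" for l
        using i by (simp add: sum.delta)
      then show "(\<Sum>l<N\<^sup>2. \<Sum>k'<N\<^sup>2. cov i j l k' * path_sum c j l * path_sum (m - 1 - c) k' k) =
          ?s i j * path_sum c j j * path_sum (m - 1 - c) i k"
        using j by (simp add: sum.delta)
    qed
    then show ?thesis using i k by (simp only: path_sum_Suc lessThan_iff sum_distrib_right)
  qed
  show "color_path_sum N (Suc m) k k = (\<Sum>c<m. (\<Sum>j<N\<^sup>2. ?s k j * color_path_sum N c j j) * color_path_sum N (m - 1 - c) k k)"
    unfolding color_path_sum_def by (rule rec[OF k k])
  assume i: "i < N\<^sup>2" "i \<noteq> k"
  show "color_path_sum N m i k = 0"
    unfolding color_path_sum_def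
  proof (induction m rule: less_induct)
    case (less m)
    show ?case
    proof (cases m)
      case 0
      then show ?thesis using i by (simp add: path_sum_0)
    next
      case (Suc m')
      then show ?thesis using less i k by (simp add: rec)
    qed
  qed
qed

text \<open>The matrix has size \<open>N\<^sup>2\<close>, so each of the \<open>m\<close> entries
  carries the factor \<open>1 / N\<close>.\<close>

definition color_coef :: "nat \<Rightarrow> nat \<Rightarrow> nat \<Rightarrow> complex" where
  "color_coef N m k = color_path_sum N m k k / of_nat N ^ m"

lemma color_recursion_color: "color_recursion s sc \<I> L color_coef"
proof (intro color_recursion.intro step_kernel_axioms color_recursion_axioms.intro)
  fix N m k :: nat assume k: "k < N\<^sup>2"
  then have N: "N > 0" by (cases "N = 0") auto
  show "color_coef N 0 k = 1" by (simp add: color_coef_def color_path_sum_recursion(1)[OF k])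
  let ?s = "\<lambda>i j. (if i = j then 2 else 1) * complex_of_real (s (color_point N i) (color_point N j))"
  have "(\<Sum>j<N\<^sup>2. ?s k j * color_coef N c j) / of_nat (N\<^sup>2) * color_coef N (m - 1 - c) k =
      (\<Sum>j<N\<^sup>2. ?s k j * color_path_sum N c j j) * color_path_sum N (m - 1 - c) k k / of_nat N ^ Suc m"
    if c: "c < m" for c
  proof -
    have "of_nat N ^ Suc m = of_nat N ^ c * complex_of_nat (N\<^sup>2) * of_nat N ^ (m - 1 - c)"
    proof -
      have m: "Suc m = c + 2 + (m - 1 - c)" using c by simp
      show ?thesis by (subst m) (simp only: power_add of_nat_power)
    qed
    moreover have "(\<Sum>j<N\<^sup>2. ?s k j * color_coef N c j) = (\<Sum>j<N\<^sup>2. ?s k j * color_path_sum N c j j) / of_nat N ^ c"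
      by (simp add: color_coef_def sum_divide_distrib)
    ultimately show ?thesis by (simp add: color_coef_def)
  qed
  then show "color_coef N (Suc m) k = (\<Sum>c<m. (\<Sum>j<N\<^sup>2. ?s k j * color_coef N c j) / of_nat (N\<^sup>2) * color_coef N (m - 1 - c) k)"
    unfolding color_coef_def[of N "Suc m"] color_path_sum_recursion(3)[OF k] sum_divide_distrib by simp
qed

lemma spectral_moments_color:
  "spectral_moments (\<lambda>N. noise_measure) (\<lambda>N Y. map_mat complex_of_real ((1 / real N) \<cdot>\<^sub>m color_matrix s N Y))
     (\<lambda>N. N\<^sup>2) (\<lambda>m. Re (step_mean (dcoef m 0)))"
proof (rule spectral_moments_band_matrices[where V = "\<lambda>N. {..<N\<^sup>2}" and nb = "\<lambda>N. (=)" and D = 1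
      and X = color_entry and B = color_moment and f = "\<lambda>N i. i"])
  fix N :: nat assume N: "N \<ge> 1"
  show "band_matrix {..<N\<^sup>2} (=) 1 noise_measure (color_entry N) color_moment
      (\<lambda>Y. map_mat complex_of_real ((1 / real N) \<cdot>\<^sub>m color_matrix s N Y)) (\<lambda>i. i) (N\<^sup>2)"
  proof (intro band_matrix.intro band_ensemble_color[OF N] band_matrix_axioms.intro)
    show "map_mat complex_of_real ((1 / real N) \<cdot>\<^sub>m color_matrix s N Y) =
        Matrix.mat (N\<^sup>2) (N\<^sup>2) (\<lambda>(i, j). color_entry N i j Y / complex_of_real (sqrt (real (N\<^sup>2))))" for Y
      by (rule eq_matI) (auto simp: color_matrix_def color_entry_def color_weight_def)
    show "color_entry N j i Y = cnj (color_entry N i j Y)" if "i \<in> {..<N\<^sup>2}" "j \<in> {..<N\<^sup>2}" for i j Y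
    proof -
      have "color_entry N j i Y = color_entry N i j Y" using that by (intro color_entry_sym) auto
      also have "\<dots> = cnj (color_entry N i j Y)" by (simp add: color_entry_def)
      finally show ?thesis .
    qed
  qed (simp add: bij_betw_def)
next
  show "filterlim (\<lambda>N::nat. N\<^sup>2) at_top sequentially"
    by (rule filterlim_at_top_mono[OF filterlim_ident]) (simp add: power2_nat_le_imp_le power2_eq_square)
next
  fix m
  interpret color_recursion s sc \<I> L color_coef by (rule color_recursion_color)
  have "band_ensemble.path_mean {..<N\<^sup>2} (=) noise_measure (color_entry N) m = (\<Sum>k<N\<^sup>2. color_coef N m k) / of_nat (N\<^sup>2)"
    if N: "N \<ge> 1" for N
    using N by (simp add: band_ensemble.path_mean_def[OF band_ensemble_color[OF N]] color_coef_def color_path_sum_def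
        mult.commute flip: sum_divide_distrib)
  then have "eventually (\<lambda>N. (\<Sum>k<N\<^sup>2. color_coef N m k) / of_nat (N\<^sup>2) =
      band_ensemble.path_mean {..<N\<^sup>2} (=) noise_measure (color_entry N) m) sequentially"
    by (intro eventually_sequentiallyI[of 1]) simp
  from Lim_transform_eventually[OF trace_a_tendsto this]
  show "(\<lambda>N. band_ensemble.path_mean {..<N\<^sup>2} (=) noise_measure (color_entry N) m) \<longlonglongrightarrow> step_mean (dcoef m 0)" .
qed

end

section \<open>The model as a band ensemble\<close>

lemma (in prob_space) indep_var_of_indep_set:
  assumes indep: "indep_set (sets A) (sets B)" and sp: "space A = space M" "space B = space M"
    and f: "f \<in> measurable A A'" and g: "g \<in> measurable B B'"
  shows "indep_var A' f B' g"
proof -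
  note ev = indep_setD_ev1[OF indep] indep_setD_ev2[OF indep]
  have fA: "f -` S \<inter> space M \<in> sets A" if "S \<in> sets A'" for S
    using measurable_sets[OF f that] by (simp add: sp)
  have gB: "g -` S \<inter> space M \<in> sets B" if "S \<in> sets B'" for S
    using measurable_sets[OF g that] by (simp add: sp)
  have "f \<in> measurable M A'" "g \<in> measurable M B'"
    using fA gB ev measurable_space[OF f] measurable_space[OF g] by (auto simp: sp intro!: measurableI)
  moreover have sub: "sigma_sets (space M) {f -` S \<inter> space M |S. S \<in> sets A'} \<subseteq> sets A"
      "sigma_sets (space M) {g -` S \<inter> space M |S. S \<in> sets B'} \<subseteq> sets B"
    using fA gB sets.sigma_sets_subset[of "{f -` S \<inter> space M |S. S \<in> sets A'}" A]
      sets.sigma_sets_subset[of "{g -` S \<inter> space M |S. S \<in> sets B'}" B] unfolding sp by blast+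
  ultimately show ?thesis
    unfolding indep_var_eq using ev
    by (intro conjI indep_setI indep_setD[OF indep]) (blast+)
qed

text \<open>The generated sigma-field as a measure object, so that measurability with respect to it
  can be stated.\<close>

definition generated_measure ::
  "'a measure \<Rightarrow> (nat \<Rightarrow> nat \<Rightarrow> 'a \<Rightarrow> complex) \<Rightarrow> (nat \<times> nat) set \<Rightarrow> 'a measure" where
  "generated_measure M Y A = sigma (space M) {Y i j -` S \<inter> space M | i j S. (i, j) \<in> A \<and> S \<in> sets borel}"

lemma space_generated_measure [simp]: "space (generated_measure M Y A) = space M"
  by (simp add: generated_measure_def space_measure_of_conv)

lemma sets_generated_measure: "sets (generated_measure M Y A) = generated_sigma M Y A"
  unfolding generated_measure_def generated_sigma_def by (rule sets_measure_of) auto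

lemma measurable_generated_measure: "(i, j) \<in> A \<Longrightarrow> Y i j \<in> borel_measurable (generated_measure M Y A)"
  by (rule measurableI) (auto simp: sets_generated_measure generated_sigma_def intro!: sigma_sets.Basic)

definition nearby :: "nat \<Rightarrow> nat \<Rightarrow> nat \<Rightarrow> bool" where
  "nearby L i k \<longleftrightarrow> int i - int k \<in> freqs L"

lemma band_set_nearby: "N \<ge> 1 \<Longrightarrow> band_set {1..N} (nearby L) (2 * L + 1)"
proof
  fix i
  have "card {k \<in> {1..N}. nearby L i k} = card ((\<lambda>k. int i - int k) ` {k \<in> {1..N}. nearby L i k})"
    by (intro card_image[symmetric]) (auto simp: inj_on_def)
  also have "\<dots> \<le> card (freqs L)"
    by (intro card_mono) (auto simp: nearby_def freqs_def)
  also have "\<dots> = 2 * L + 1" by (simp add: freqs_def)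
  finally show "card {k \<in> {1..N}. nearby L i k} \<le> 2 * L + 1" .
qed (auto simp: nearby_def freqs_def)

text \<open>Independence is assumed for entries on or above the diagonal, which means for sorted
  index pairs. If sorted pairs are close, the unsorted ones are close in parallel or
  antiparallel.\<close>

lemma abs_diff_min_max_le:
  fixes a b c d K :: real
  assumes "\<bar>min a b - min c d\<bar> \<le> K" "\<bar>max a b - max c d\<bar> \<le> K"
  shows "\<bar>a - c\<bar> \<le> K \<and> \<bar>b - d\<bar> \<le> K \<or> \<bar>a - d\<bar> \<le> K \<and> \<bar>b - c\<bar> \<le> K"
proof (cases "a \<le> b"; cases "c \<le> d")
  assume "a \<le> b" "c \<le> d" then show ?thesis using assms by (simp add: min_absorb1 max_absorb2)
next
  assume "a \<le> b" "\<not> c \<le> d" then show ?thesis using assms by (simp add: min_absorb1 min_absorb2 max_absorb1 max_absorb2)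
next
  assume "\<not> a \<le> b" "c \<le> d" then show ?thesis using assms by (simp add: min_absorb1 min_absorb2 max_absorb1 max_absorb2)
next
  assume "\<not> a \<le> b" "\<not> c \<le> d" then show ?thesis using assms by (simp add: min_absorb2 max_absorb1)
qed

section \<open>Moments, independence and covariances of the model\<close>

locale band_model = step_kernel s sc \<I> L
  for s :: "color \<Rightarrow> color \<Rightarrow> real" and sc :: "int \<Rightarrow> int \<Rightarrow> real \<Rightarrow> real \<Rightarrow> complex" and \<I> L +
  fixes K :: real and M :: "nat \<Rightarrow> 'a measure" and X :: "nat \<Rightarrow> nat \<Rightarrow> nat \<Rightarrow> 'a \<Rightarrow> complex"
  assumes K: "0 < K" and L: "L = nat \<lfloor>K\<rfloor>"
    and M: "\<And>N. N \<ge> 1 \<Longrightarrow> prob_space (M N)"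
    and meas: "\<And>N i j. N \<ge> 1 \<Longrightarrow> i \<in> {1..N} \<Longrightarrow> j \<in> {1..N} \<Longrightarrow> X N i j \<in> borel_measurable (M N)"
    and herm: "\<And>N i j \<omega>. N \<ge> 1 \<Longrightarrow> i \<in> {1..N} \<Longrightarrow> j \<in> {1..N} \<Longrightarrow> \<omega> \<in> space (M N) \<Longrightarrow> X N j i \<omega> = cnj (X N i j \<omega>)"
    and mean: "\<And>N i j. N \<ge> 1 \<Longrightarrow> i \<in> {1..N} \<Longrightarrow> j \<in> {1..N} \<Longrightarrow> (LINT \<omega>|M N. X N i j \<omega>) = 0"
    and moments: "\<And>k. k \<ge> 1 \<Longrightarrow> (SUP N\<in>{1..}. SUP i\<in>{1..N}. SUP j\<in>{1..N}.
        \<integral>\<^sup>+ \<omega>. ennreal (norm (X N i j \<omega>) ^ k) \<partial>M N) < \<infinity>"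
    and indep: "\<And>N A B. N \<ge> 1 \<Longrightarrow> A \<noteq> {} \<Longrightarrow> B \<noteq> {} \<Longrightarrow>
           A \<subseteq> {(i, j). i \<in> {1..N} \<and> j \<in> {1..N} \<and> i \<le> j} \<Longrightarrow>
           B \<subseteq> {(i, j). i \<in> {1..N} \<and> j \<in> {1..N} \<and> i \<le> j} \<Longrightarrow>
           (\<forall>(i, j)\<in>A. \<forall>(k, l)\<in>B. max \<bar>real i - real k\<bar> \<bar>real j - real l\<bar> > K) \<Longrightarrow>
           prob_space.indep_set (M N) (generated_sigma (M N) (X N) A) (generated_sigma (M N) (X N) B)"
    and covariance: "\<And>N i j k l. N \<ge> 1 \<Longrightarrow> i \<in> Q_set \<I> N K \<Longrightarrow> j \<in> Q_set \<I> N K \<Longrightarrow>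
           k \<in> Q_set \<I> N K \<Longrightarrow> l \<in> Q_set \<I> N K \<Longrightarrow> min (real j - real i) (real l - real k) > K \<Longrightarrow>
           (LINT \<omega>|M N. X N i j \<omega> * cnj (X N k l \<omega>)) =
             sc (int i - int k) (int l - int j) (real i / real N) (real j / real N)"
begin

lemma in_freqs_iff: "m \<in> freqs L \<longleftrightarrow> \<bar>real_of_int m\<bar> \<le> K"
proof -
  have "m \<in> freqs L \<longleftrightarrow> \<bar>m\<bar> \<le> \<lfloor>K\<rfloor>" using K by (auto simp: freqs_def L)
  then show ?thesis by (simp add: le_floor_iff)
qed

lemma nearby_iff: "nearby L i k \<longleftrightarrow> \<bar>real i - real k\<bar> \<le> K"
  by (simp add: nearby_def in_freqs_iff)

text \<open>The supremum is assumed finite only for \<open>k \<ge> 1\<close>; the value at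
  \<open>0\<close> is the total mass.\<close>

definition model_moment :: "nat \<Rightarrow> real" where
  "model_moment k = (if k = 0 then 1 else enn2real (SUP N\<in>{1..}. SUP i\<in>{1..N}. SUP j\<in>{1..N}.
     \<integral>\<^sup>+ \<omega>. ennreal (norm (X N i j \<omega>) ^ k) \<partial>M N))"

lemma moment_bound:
  assumes N: "N \<ge> 1" and ij: "i \<in> {1..N}" "j \<in> {1..N}"
  shows "integrable (M N) (\<lambda>\<omega>. norm (X N i j \<omega>) ^ k)"
    and "(LINT \<omega>|M N. norm (X N i j \<omega>) ^ k) \<le> model_moment k"
proof -
  interpret prob_space "M N" by (rule M[OF N])
  have "integrable (M N) (\<lambda>\<omega>. norm (X N i j \<omega>) ^ k) \<and> (LINT \<omega>|M N. norm (X N i j \<omega>) ^ k) \<le> model_moment k"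
  proof (cases "k = 0")
    case True
    then show ?thesis by (simp add: model_moment_def prob_space)
  next
    case False
    let ?n = "\<lambda>N i j. \<integral>\<^sup>+ \<omega>. ennreal (norm (X N i j \<omega>) ^ k) \<partial>M N"
    let ?B = "SUP N\<in>{1..}. SUP i\<in>{1..N}. SUP j\<in>{1..N}. ?n N i j"
    have fin: "?B < \<infinity>" using moments[of k] False by simp
    have "?n N i j \<le> (SUP j\<in>{1..N}. ?n N i j)" using ij by (intro SUP_upper)
    also have "\<dots> \<le> (SUP i\<in>{1..N}. SUP j\<in>{1..N}. ?n N i j)"
      using ij by (intro SUP_upper[where f = "\<lambda>i. SUP j\<in>{1..N}. ?n N i j"])
    also have "\<dots> \<le> ?B"
      using N by (intro SUP_upper[where f = "\<lambda>N. SUP i\<in>{1..N}. SUP j\<in>{1..N}. ?n N i j"]) simp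
    finally have le: "?n N i j \<le> ?B" .
    have m: "(\<lambda>\<omega>. norm (X N i j \<omega>) ^ k) \<in> borel_measurable (M N)"
      using meas[OF N ij] by measurable
    have "integrable (M N) (\<lambda>\<omega>. norm (X N i j \<omega>) ^ k)"
      using m le_less_trans[OF le fin] by (intro integrableI_bounded) auto
    moreover have "(LINT \<omega>|M N. norm (X N i j \<omega>) ^ k) = enn2real (?n N i j)"
      using m by (intro integral_eq_nn_integral) auto
    ultimately show ?thesis
      using enn2real_mono[OF le fin[unfolded infinity_ennreal_def]] False by (simp add: model_moment_def)
  qed
  then show "integrable (M N) (\<lambda>\<omega>. norm (X N i j \<omega>) ^ k)"
    "(LINT \<omega>|M N. norm (X N i j \<omega>) ^ k) \<le> model_moment k" by auto
qed

definition upper_pair :: "(nat \<Rightarrow> nat) \<Rightarrow> nat \<Rightarrow> nat \<times> nat" where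
  "upper_pair \<phi> a = (min (\<phi> a) (\<phi> (Suc a)), max (\<phi> a) (\<phi> (Suc a)))"

text \<open>An entry below the diagonal is the conjugate of the one generating the
  sigma-field.\<close>

lemma measurable_entry_generated:
  assumes N: "N \<ge> 1" and "\<phi> a \<in> {1..N}" "\<phi> (Suc a) \<in> {1..N}" "upper_pair \<phi> a \<in> A"
  shows "X N (\<phi> a) (\<phi> (Suc a)) \<in> borel_measurable (generated_measure (M N) (X N) A)"
proof (cases "\<phi> a \<le> \<phi> (Suc a)")
  case True
  then show ?thesis using assms(4) by (intro measurable_generated_measure) (simp add: upper_pair_def)
next
  case False
  have "X N (\<phi> (Suc a)) (\<phi> a) \<in> borel_measurable (generated_measure (M N) (X N) A)"
    using assms(4) False by (intro measurable_generated_measure) (simp add: upper_pair_def)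
  then have "(\<lambda>\<omega>. cnj (X N (\<phi> (Suc a)) (\<phi> a) \<omega>)) \<in> borel_measurable (generated_measure (M N) (X N) A)"
    by (rule measurable_compose) (intro borel_measurable_continuous_onI continuous_intros)
  moreover have "X N (\<phi> a) (\<phi> (Suc a)) \<omega> = cnj (X N (\<phi> (Suc a)) (\<phi> a) \<omega>)" if "\<omega> \<in> space (M N)" for \<omega>
    using herm[OF N assms(3,2) that] .
  ultimately show ?thesis by (subst measurable_cong) auto
qed

text \<open>The factorization rule follows from independence of the sigma-fields of the two sets of
  sorted index pairs, once every edge is identified with an entry on or above the diagonal.\<close>

lemma band_ensemble_model:
  assumes N: "N \<ge> 1"
  shows "band_ensemble {1..N} (nearby L) (2 * L + 1) (M N) (X N) model_moment"
proof (intro band_ensemble.intro band_ensemble_axioms.intro band_set_nearby M meas moment_bound mean N)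
  interpret prob_space "M N" by (rule M[OF N])
  fix \<phi> :: "nat \<Rightarrow> nat" and S T :: "nat set"
  assume fin: "finite S" "finite T" and lab: "\<forall>a\<in>S \<union> T. \<phi> a \<in> {1..N} \<and> \<phi> (Suc a) \<in> {1..N}"
    and far: "\<forall>a\<in>S. \<forall>b\<in>T. \<not> (nearby L (\<phi> a) (\<phi> b) \<and> nearby L (\<phi> (Suc a)) (\<phi> (Suc b)) \<or>
      nearby L (\<phi> a) (\<phi> (Suc b)) \<and> nearby L (\<phi> (Suc a)) (\<phi> b))"
  define F where "F U \<omega> = (\<Prod>a\<in>U. X N (\<phi> a) (\<phi> (Suc a)) \<omega>)" for U \<omega>
  have "(LINT \<omega>|M N. F (S \<union> T) \<omega>) = (LINT \<omega>|M N. F S \<omega>) * (LINT \<omega>|M N. F T \<omega>)"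
  proof (cases "S = {} \<or> T = {}")
    case True
    then show ?thesis by (auto simp: F_def prob_space)
  next
    case False
    let ?G = "\<lambda>U. generated_measure (M N) (X N) (upper_pair \<phi> ` U)"
    have up: "upper_pair \<phi> ` U \<subseteq> {(i, j). i \<in> {1..N} \<and> j \<in> {1..N} \<and> i \<le> j}" if "U \<subseteq> S \<union> T" for U
      using lab that unfolding upper_pair_def min_def max_def by fastforce
    have "indep_set (generated_sigma (M N) (X N) (upper_pair \<phi> ` S)) (generated_sigma (M N) (X N) (upper_pair \<phi> ` T))"
    proof (rule indep[OF N])
      show "\<forall>(i, j)\<in>upper_pair \<phi> ` S. \<forall>(k, l)\<in>upper_pair \<phi> ` T. max \<bar>real i - real k\<bar> \<bar>real j - real l\<bar> > K"
      proof -
        have "max \<bar>real (min (\<phi> a) (\<phi> (Suc a))) - real (min (\<phi> b) (\<phi> (Suc b)))\<bar>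
            \<bar>real (max (\<phi> a) (\<phi> (Suc a))) - real (max (\<phi> b) (\<phi> (Suc b)))\<bar> > K" if "a \<in> S" "b \<in> T" for a b
        proof (rule ccontr)
          assume "\<not> ?thesis"
          then have "\<bar>min (real (\<phi> a)) (real (\<phi> (Suc a))) - min (real (\<phi> b)) (real (\<phi> (Suc b)))\<bar> \<le> K \<and>
              \<bar>max (real (\<phi> a)) (real (\<phi> (Suc a))) - max (real (\<phi> b)) (real (\<phi> (Suc b)))\<bar> \<le> K"
            unfolding of_nat_min of_nat_max not_less max.bounded_iff .
          note abs_diff_min_max_le[OF conjunct1[OF this] conjunct2[OF this]]
          moreover have "\<not> (nearby L (\<phi> a) (\<phi> b) \<and> nearby L (\<phi> (Suc a)) (\<phi> (Suc b)) \<or>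
            nearby L (\<phi> a) (\<phi> (Suc b)) \<and> nearby L (\<phi> (Suc a)) (\<phi> b))"
            by (rule bspec[OF bspec[OF far that(1)] that(2)])
          ultimately show False unfolding nearby_iff by (rule notE[rotated])
        qed
        then show ?thesis unfolding upper_pair_def by blast
      qed
    qed (use False up in auto)
    then have ind: "indep_set (sets (?G S)) (sets (?G T))" unfolding sets_generated_measure .
    have F_meas: "F U \<in> borel_measurable (?G U)" if "U \<subseteq> S \<union> T" for U
      unfolding F_def[abs_def] using lab that
      by (intro borel_measurable_prod measurable_entry_generated[OF N]) auto
    have ind: "indep_var borel (F S) borel (F T)"
      by (rule indep_var_of_indep_set[OF ind]) (auto intro!: F_meas)
    have F_int: "integrable (M N) (F U)" if "finite U" "U \<subseteq> S \<union> T" for U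
      unfolding F_def[abs_def] using lab that
      by (intro integrable_prod_moments finite_measure_axioms moment_bound[OF N] meas[OF N]) auto
    \<comment> \<open>An edge is close to itself, so a common edge would contradict the distance
      assumption.\<close>
    have "S \<inter> T = {}"
    proof -
      have False if a: "a \<in> S" "a \<in> T" for a
        using bspec[OF bspec[OF far a(1)] a(2)] K unfolding nearby_iff by simp
      then show ?thesis by blast
    qed
    then have "F (S \<union> T) \<omega> = F S \<omega> * F T \<omega>" for \<omega>
      unfolding F_def using fin by (intro prod.union_disjoint)
    then show ?thesis using indep_var_lebesgue_integral[OF ind F_int F_int] fin by simp
  qed
  then show "(LINT \<omega>|M N. (\<Prod>a\<in>S \<union> T. X N (\<phi> a) (\<phi> (Suc a)) \<omega>)) =
      (LINT \<omega>|M N. (\<Prod>a\<in>S. X N (\<phi> a) (\<phi> (Suc a)) \<omega>)) * (LINT \<omega>|M N. (\<Prod>a\<in>T. X N (\<phi> a) (\<phi> (Suc a)) \<omega>))"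
    unfolding F_def .
qed

definition model_cov :: "nat \<Rightarrow> nat \<Rightarrow> nat \<Rightarrow> nat \<Rightarrow> nat \<Rightarrow> complex" where
  "model_cov N = band_ensemble.cov (nearby L) (M N) (X N)"

definition model_path :: "nat \<Rightarrow> nat \<Rightarrow> nat \<Rightarrow> nat \<Rightarrow> complex" where
  "model_path N m i k = band_ensemble.path_sum {1..N} (nearby L) (M N) (X N) m i k / of_real (sqrt (real N) ^ m)"

text \<open>Hermitian symmetry turns \<open>X l k\<close> into the conjugate of
  \<open>X k l\<close>, which is the assumed covariance if both entries lie above the
  diagonal.\<close>

lemma model_cov_eq:
  assumes Q: "i \<in> Q_set \<I> N K" "j \<in> Q_set \<I> N K" "l \<in> Q_set \<I> N K" "k \<in> Q_set \<I> N K"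
    and near: "int i - int k \<in> freqs L" "int j - int l \<in> freqs L" and far: "\<bar>int i - int j\<bar> > 3 * int L + 1"
  shows "model_cov N i j l k = sc (int i - int k) (int l - int j) (real i / real N) (real j / real N)"
proof -
  have in1: "i \<in> {1..N}" "j \<in> {1..N}" "l \<in> {1..N}" "k \<in> {1..N}" using Q by (auto simp: Q_set_def)
  then have N: "N \<ge> 1" by auto
  interpret band_ensemble "{1..N}" "nearby L" "2 * L + 1" "M N" "X N" model_moment
    by (rule band_ensemble_model[OF N])
  have LK: "real L \<le> K" "K < real L + 1" using K unfolding L by linarith+
  have d: "\<bar>int i - int k\<bar> \<le> int L" "\<bar>int j - int l\<bar> \<le> int L" using near by (auto simp: freqs_def)
  have u: "real i / real N \<in> {0..1}" "real j / real N \<in> {0..1}" using in1 by auto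
  have "model_cov N i j l k = (LINT \<omega>|M N. X N i j \<omega> * X N l k \<omega>)"
    using near by (simp add: model_cov_def cov_def nearby_def)
  also have "\<dots> = sc (int i - int k) (int l - int j) (real i / real N) (real j / real N)"
  proof (cases "i < j")
    case True
    have "real j - real i > K" "real l - real k > K" using True far d LK by linarith+
    then have "(LINT \<omega>|M N. X N i j \<omega> * cnj (X N k l \<omega>)) =
        sc (int i - int k) (int l - int j) (real i / real N) (real j / real N)"
      using covariance[OF N Q(1,2,4,3)] by simp
    moreover have "(LINT \<omega>|M N. X N i j \<omega> * X N l k \<omega>) = (LINT \<omega>|M N. X N i j \<omega> * cnj (X N k l \<omega>))"
      by (rule Bochner_Integration.integral_cong[OF refl]) (simp only: herm[OF N in1(4,3)])
    ultimately show ?thesis by simp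
  next
    \<comment> \<open>Below the diagonal the assumption applies to the transposed entries in
      exchanged roles. This transposes the coefficient and moves its arguments within their pieces,
      and \<open>sc_sym\<close> restores the claimed form.\<close>
    case False
    have g: "real i - real j > K" "real k - real l > K" using False far d LK by linarith+
    then have c: "(LINT \<omega>|M N. X N l k \<omega> * cnj (X N j i \<omega>)) =
        sc (int l - int j) (int i - int k) (real l / real N) (real k / real N)"
      using covariance[OF N Q(3,4,2,1)] by simp
    have "(LINT \<omega>|M N. X N i j \<omega> * X N l k \<omega>) = (LINT \<omega>|M N. X N l k \<omega> * cnj (X N j i \<omega>))"
      by (rule Bochner_Integration.integral_cong[OF refl]) (simp only: herm[OF N in1(2,1)] mult.commute)
    also have "\<dots> = sc (int l - int j) (int i - int k) (real j / real N) (real i / real N)"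
    proof -
      have n: "\<bar>real j - real l\<bar> \<le> K" "\<bar>real i - real k\<bar> \<le> K" using d LK by linarith+
      have u': "real k / real N \<in> {0..1}" using in1 by auto
      show ?thesis unfolding c
        using Q_set_same_value[OF Q(2) in1(3) n(1) step_fun_sc_left[OF u'], of "int l - int j" "int i - int k"]
          Q_set_same_value[OF Q(1) in1(4) n(2) step_fun_sc_right[OF u(2)], of "int l - int j" "int i - int k"]
        by simp
    qed
    also have "\<dots> = sc (int i - int k) (int l - int j) (real i / real N) (real j / real N)"
      by (rule sc_sym[OF u(2,1)])
    finally show ?thesis .
  qed
  finally show ?thesis .
qed

lemma toeplitz_recursion_model:
  "toeplitz_recursion s sc \<I> L K model_cov model_path (moment_const model_moment 2)"
proof (intro toeplitz_recursion.intro step_kernel_axioms toeplitz_recursion_axioms.intro model_cov_eq)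
  show "0 \<le> K" using K by simp
  interpret band_ensemble "{1..1::nat}" "nearby L" "2 * L + 1" "M 1" "X 1" model_moment
    by (rule band_ensemble_model) simp
  show "0 \<le> moment_const model_moment 2"
    by (rule order_trans[OF norm_ge_zero norm_cov_le[of 1 1 1 1]]) simp_all
next
  fix N i j l k :: nat assume ijlk: "i \<in> {1..N}" "j \<in> {1..N}" "l \<in> {1..N}" "k \<in> {1..N}"
  then have N: "N \<ge> 1" by auto
  interpret band_ensemble "{1..N}" "nearby L" "2 * L + 1" "M N" "X N" model_moment
    by (rule band_ensemble_model[OF N])
  show "norm (model_cov N i j l k) \<le> moment_const model_moment 2"
    unfolding model_cov_def by (rule norm_cov_le[OF ijlk])
  show "int i - int k \<notin> freqs L \<or> int j - int l \<notin> freqs L \<Longrightarrow> model_cov N i j l k = 0"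
    by (auto simp: model_cov_def cov_def nearby_def)
next
  fix N m i k :: nat assume ik: "i \<in> {1..N}" "k \<in> {1..N}"
  then have N: "N \<ge> 1" by auto
  interpret band_ensemble "{1..N}" "nearby L" "2 * L + 1" "M N" "X N" model_moment
    by (rule band_ensemble_model[OF N])
  show "model_path N 0 i k = (if i = k then 1 else 0)"
    unfolding model_path_def path_sum_0[OF ik(1)] by simp
  define r where "r = complex_of_real (sqrt (real N))"
  have r: "r \<noteq> 0" "of_nat N = r * r" using N by (simp_all add: r_def flip: of_real_mult)
  have mp: "model_path N c j l = path_sum c j l / r ^ c" for c j l by (simp add: model_path_def r_def)
  have "(\<Sum>j\<in>{1..N}. \<Sum>l\<in>{1..N}. \<Sum>k'\<in>{1..N}. cov i j l k' * path_sum c j l * path_sum (m - 1 - c) k' k) / r ^ Suc m =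
      (\<Sum>k'\<in>{1..N}. (\<Sum>j\<in>{1..N}. \<Sum>l\<in>{1..N}. model_cov N i j l k' * model_path N c j l) / of_nat N * model_path N (m - 1 - c) k' k)"
    if c: "c < m" for c
  proof -
    \<comment> \<open>The paired edges take two of the \<open>Suc m\<close> factors
      \<open>r\<close>, and these give the \<open>1 / N\<close> of the average over
      \<open>j\<close>.\<close>
    have e: "Suc m = c + 2 + (m - 1 - c)" using c by simp
    have pw: "r ^ Suc m = r ^ c * (r * r) * r ^ (m - 1 - c)"
      by (subst e) (simp only: power_add power2_eq_square)
    have "(\<Sum>j\<in>{1..N}. \<Sum>l\<in>{1..N}. \<Sum>k'\<in>{1..N}. cov i j l k' * path_sum c j l * path_sum (m - 1 - c) k' k) =
        (\<Sum>j\<in>{1..N}. \<Sum>k'\<in>{1..N}. \<Sum>l\<in>{1..N}. cov i j l k' * path_sum c j l * path_sum (m - 1 - c) k' k)"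
      by (rule sum.cong[OF refl]) (rule sum.swap)
    also have "\<dots> = (\<Sum>k'\<in>{1..N}. \<Sum>j\<in>{1..N}. \<Sum>l\<in>{1..N}. cov i j l k' * path_sum c j l * path_sum (m - 1 - c) k' k)"
      by (rule sum.swap)
    finally have sw: "(\<Sum>j\<in>{1..N}. \<Sum>l\<in>{1..N}. \<Sum>k'\<in>{1..N}. cov i j l k' * path_sum c j l * path_sum (m - 1 - c) k' k) =
        (\<Sum>k'\<in>{1..N}. \<Sum>j\<in>{1..N}. \<Sum>l\<in>{1..N}. cov i j l k' * path_sum c j l * path_sum (m - 1 - c) k' k)" .
    show ?thesis
      unfolding sw sum_divide_distrib sum_distrib_right mp model_cov_def pw r(2)
      by (simp only: times_divide_eq_right times_divide_eq_left divide_divide_eq_left mult.assoc)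
  qed
  then show "model_path N (Suc m) i k = (\<Sum>c<m. \<Sum>k'\<in>{1..N}. (\<Sum>j\<in>{1..N}. \<Sum>l\<in>{1..N}.
      model_cov N i j l k' * model_path N c j l) / of_nat N * model_path N (m - 1 - c) k' k)"
    unfolding mp[of "Suc m"] path_sum_Suc[OF ik] sum_divide_distrib[of _ "{..<m}"] by simp
qed

lemma spectral_moments_model:
  "spectral_moments M (\<lambda>N \<omega>. complex_of_real (1 / sqrt (real N)) \<cdot>\<^sub>m model_matrix X N \<omega>)
     (\<lambda>N. N) (\<lambda>m. Re (step_mean (dcoef m 0)))"
proof (rule spectral_moments_band_matrices[where V = "\<lambda>N. {1..N}" and nb = "\<lambda>N. nearby L" and D = "2 * L + 1"
      and X = X and B = model_moment and f = "\<lambda>N. Suc"])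
  fix N :: nat assume N: "N \<ge> 1"
  show "band_matrix {1..N} (nearby L) (2 * L + 1) (M N) (X N) model_moment
      (\<lambda>\<omega>. complex_of_real (1 / sqrt (real N)) \<cdot>\<^sub>m model_matrix X N \<omega>) Suc N"
  proof (intro band_matrix.intro band_ensemble_model[OF N] band_matrix_axioms.intro herm[OF N])
    show "bij_betw Suc {..<N} {1..N}"
      by (simp add: bij_betw_def image_Suc_lessThan)
    show "complex_of_real (1 / sqrt (real N)) \<cdot>\<^sub>m model_matrix X N \<omega> =
        Matrix.mat N N (\<lambda>(i, j). X N (Suc i) (Suc j) \<omega> / complex_of_real (sqrt (real N)))" for \<omega>
      by (rule eq_matI) (auto simp: model_matrix_def)
  qed
next
  show "filterlim (\<lambda>N::nat. N) at_top sequentially" by (rule filterlim_ident)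
next
  fix m
  interpret toeplitz_recursion s sc \<I> L K model_cov model_path "moment_const model_moment 2"
    by (rule toeplitz_recursion_model)
  have "band_ensemble.path_mean {1..N} (nearby L) (M N) (X N) m = (\<Sum>i\<in>{1..N}. model_path N m i i) / of_nat N"
    if N: "N \<ge> 1" for N
    unfolding band_ensemble.path_mean_def[OF band_ensemble_model[OF N]] model_path_def
    by (simp add: mult.commute flip: sum_divide_distrib)
  then have "eventually (\<lambda>N. (\<Sum>i\<in>{1..N}. model_path N m i i) / of_nat N =
      band_ensemble.path_mean {1..N} (nearby L) (M N) (X N) m) sequentially"
    by (intro eventually_sequentiallyI[of 1]) simp
  from Lim_transform_eventually[OF trace_P_tendsto this]
  show "(\<lambda>N. band_ensemble.path_mean {1..N} (nearby L) (M N) (X N) m) \<longlonglongrightarrow> step_mean (dcoef m 0)" .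
qed

end

theorem theorem2p5:
  fixes s :: "color \<Rightarrow> color \<Rightarrow> real"
    and sc :: "int \<Rightarrow> int \<Rightarrow> real \<Rightarrow> real \<Rightarrow> complex"
    and \<I> :: "real set set"
    and M :: "nat \<Rightarrow> 'a measure"
    and X :: "nat \<Rightarrow> nat \<Rightarrow> nat \<Rightarrow> 'a \<Rightarrow> complex"
  assumes "kernel_assumption s sc \<I>"
    and "model_assumption sc \<I> M X"
  shows "weakly_in_probability M
           (\<lambda>N \<omega>. empirical_distribution
              (complex_of_real (1 / sqrt (real N)) \<cdot>\<^sub>m model_matrix X N \<omega>))
           (kernel_measure s)"
proof -
  note model = assms(2)[unfolded model_assumption_def]
  obtain K :: real where K: "K > 0" and KN: "\<forall>N\<ge>1.
        (\<forall>i j. real_of_int (max \<bar>i\<bar> \<bar>j\<bar>) > K \<longrightarrow> (\<forall>x\<in>{0..1}. \<forall>y\<in>{0..1}. sc i j x y = 0)) \<and>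
        (\<forall>A B. A \<noteq> {} \<and> B \<noteq> {} \<and>
           A \<subseteq> {(i, j). i \<in> {1..N} \<and> j \<in> {1..N} \<and> i \<le> j} \<and>
           B \<subseteq> {(i, j). i \<in> {1..N} \<and> j \<in> {1..N} \<and> i \<le> j} \<and>
           (\<forall>(i, j)\<in>A. \<forall>(k, l)\<in>B. max \<bar>real i - real k\<bar> \<bar>real j - real l\<bar> > K) \<longrightarrow>
           prob_space.indep_set (M N) (generated_sigma (M N) (X N) A)
             (generated_sigma (M N) (X N) B)) \<and>
        (\<forall>i\<in>Q_set \<I> N K. \<forall>j\<in>Q_set \<I> N K. \<forall>k\<in>Q_set \<I> N K. \<forall>l\<in>Q_set \<I> N K.
           min (real j - real i) (real l - real k) > K \<longrightarrow>
           (LINT \<omega>|M N. X N i j \<omega> * cnj (X N k l \<omega>)) =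
             sc (int i - int k) (int l - int j) (real i / real N) (real j / real N))"
    using conjunct2[OF conjunct2[OF conjunct2[OF model]]] by (elim exE conjE)
  define L where "L = nat \<lfloor>K\<rfloor>"
  have band: "sc i j x y = 0" if "x \<in> {0..1}" "y \<in> {0..1}" "i \<notin> freqs L \<or> j \<notin> freqs L" for i j x y
  proof -
    have "\<bar>i\<bar> > \<lfloor>K\<rfloor> \<or> \<bar>j\<bar> > \<lfloor>K\<rfloor>" using that(3) K by (auto simp: L_def freqs_def)
    then have "max \<bar>i\<bar> \<bar>j\<bar> > \<lfloor>K\<rfloor>" by linarith
    then have "real_of_int (max \<bar>i\<bar> \<bar>j\<bar>) > K" by (simp only: floor_less_iff)
    \<comment> \<open>The band condition does not involve the matrix size, so it is read off at
      \<open>N = 1\<close>.\<close>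
    then show ?thesis using KN[THEN spec, of 1, simplified, THEN conjunct1] that by simp
  qed
  interpret band_model s sc \<I> L K M X
  proof (intro band_model.intro band_model_axioms.intro step_kernel.intro assms(1) band K L_def)
    show "prob_space (M N)" if "N \<ge> 1" for N :: nat
      by (rule conjunct1[OF conjunct1[OF model, rule_format, OF that]])
    fix N i j :: nat assume N: "N \<ge> 1" and ij: "i \<in> {1..N}" "j \<in> {1..N}"
    note * = conjunct2[OF conjunct1[OF model, rule_format, OF N], rule_format, OF ij]
    show "X N i j \<in> borel_measurable (M N)" by (rule conjunct1[OF *])
    show "X N j i \<omega> = cnj (X N i j \<omega>)" if "\<omega> \<in> space (M N)" for \<omega>
      by (rule conjunct2[OF *, rule_format, OF that])
    show "(LINT \<omega>|M N. X N i j \<omega>) = 0"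
      by (rule conjunct1[OF conjunct2[OF model], rule_format, OF N ij])
  next
    show "(SUP N\<in>{1..}. SUP i\<in>{1..N}. SUP j\<in>{1..N}. \<integral>\<^sup>+ \<omega>. ennreal (norm (X N i j \<omega>) ^ k) \<partial>M N) < \<infinity>"
      if "k \<ge> 1" for k :: nat
      by (rule conjunct1[OF conjunct2[OF conjunct2[OF model]], rule_format, OF that])
  next
    fix N :: nat and A B assume N: "N \<ge> 1" and AB: "A \<noteq> {}" "B \<noteq> {}"
      "A \<subseteq> {(i, j). i \<in> {1..N} \<and> j \<in> {1..N} \<and> i \<le> j}" "B \<subseteq> {(i, j). i \<in> {1..N} \<and> j \<in> {1..N} \<and> i \<le> j}"
      "\<forall>(i, j)\<in>A. \<forall>(k, l)\<in>B. max \<bar>real i - real k\<bar> \<bar>real j - real l\<bar> > K"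
    show "prob_space.indep_set (M N) (generated_sigma (M N) (X N) A) (generated_sigma (M N) (X N) B)"
      by (rule KN[THEN spec, THEN mp, OF N, THEN conjunct2, THEN conjunct1, THEN spec, THEN spec, THEN mp]) (intro conjI AB)
  next
    fix N i j k l :: nat assume N: "N \<ge> 1" and Q: "i \<in> Q_set \<I> N K" "j \<in> Q_set \<I> N K" "k \<in> Q_set \<I> N K" "l \<in> Q_set \<I> N K"
      and far: "min (real j - real i) (real l - real k) > K"
    show "(LINT \<omega>|M N. X N i j \<omega> * cnj (X N k l \<omega>)) =
        sc (int i - int k) (int l - int j) (real i / real N) (real j / real N)"
      by (rule KN[THEN spec, THEN mp, OF N, THEN conjunct2, THEN conjunct2, THEN bspec, OF Q(1), THEN bspec, OF Q(2),
          THEN bspec, OF Q(3), THEN bspec, OF Q(4), THEN mp, OF far])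
  qed
  \<comment> \<open>The growth bound is proved with color matrices but concerns only
    \<open>dcoef\<close>, which both families share.\<close>
  obtain C where C: "C \<ge> 1" "\<And>m. \<bar>Re (step_mean (dcoef m 0))\<bar> \<le> 2 * C ^ m"
    by (rule color_recursion.abs_Re_step_mean_le[OF color_recursion_color]) (rule that)
  show ?thesis
    unfolding kernel_measure_def
    by (rule common_weak_limit[OF spectral_moments_model spectral_moments_color C(2,1)])
qed

end
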